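(* Let $N$ be a finite dimensional irreducible $\mathfrak{L}^0$-module such that the irreducible highest weight $\mathfrak L$-module $V(N)$ is integrable. Let $I$ be a (co-finite) ideal of $A(m)$ with $\mathfrak L^0(I)\cdot N=0$, generated by polynomials $P_i(t_i^{m_i})=\prod_{j=1}^{q_i}(t_i^{m_i}-a_{ij}^{m_i})^{b_{ij}}$, $1\le i\le n$, where $q_i,b_{ij}$ are positive integers, the $a_{ij}$ are non-zero complex numbers, and $a_{ij}^{m_i}\ne a_{ij'}^{m_i}$ for $j\neq j'$. Let $I'$ be the ideal of $A(m)$ generated by $P_i'(t_i^{m_i})=\prod_{j=1}^{q_i}(t_i^{m_i}-a_{ij}^{m_i})$, $1\le i\le n$. Then $\mathfrak L(I')\cdot V(N)=0$.
   Context: Everything is over $\mathbb{C}$. Let $\mathfrak g$ be a finite dimensional simple Lie algebra with a non-degenerate symmetric invariant bilinear form $(\cdot|\cdot)$. Let $n\ge 1$ and let $\sigma_0,\dots,\sigma_n$ be commuting automorphisms of $\mathfrak g$ of finite orders $m_0,\dots,m_n$; let $\xi_i$ be a primitive $m_i$-th root of unity. For $(k_0,k)\in\mathbb Z\times\mathbb Z^n$ put $\mathfrak g(\bar k_0,\bar k)=\{X\in\mathfrak g:\sigma_iX=\xi_i^{k_i}X,\ 0\le i\le n\}$ (depending only on $k_i$ mod $m_i$). Write $t^k=t_1^{k_1}\cdots t_n^{k_n}$, $\Gamma=m_1\mathbb Z\oplus\cdots\oplus m_n\mathbb Z$, $A(m)=\mathbb C[t_1^{\pm m_1},\dots,t_n^{\pm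 m_n}]$. Standing assumption: $LT=\bigoplus_{(k_0,k)\in\mathbb Z^{n+1}}\mathfrak g(\bar k_0,\bar k)t_0^{k_0}t^k$ is a Lie torus, meaning: (1) $\mathfrak g(\bar0,\bar0)$ is a simple Lie algebra; (2) as a $\mathfrak g(\bar0,\bar0)$-module each $\mathfrak g(\bar k_0,\bar k)=U(\bar k_0,\bar k)\oplus V(\bar k_0,\bar k)$ with $U$ trivial and $V$ either zero or irreducible with highest weight equal to the highest root, or the highest short root if the root system of $\mathfrak g(\bar 0,\bar 0)$ is not simply laced, or twice the highest short root if it is of type $B_l$. Let $\mathfrak h(0)$ be a Cartan subalgebra of $\mathfrak g(\bar0,\bar0)$, and $\mathfrak g(\bar k_0,\bar k,\alpha)$ the $\alpha$-weight space of $\mathfrak g(\bar k_0,\bar k)$ under $\mathfrak h(0)$, $\alpha\in\mathfrak h(0)^*$. Positivity of nonzero $\mathfrak h(0)$-weights $\alpha$ of $\mathfrak g$ is with respect to a fixed set of simple roots $\alpha_1,\dots,\alpha_d$ of $\mathfrak g(\bar0,\bar0)$. The Lie algebra $\mathfrak L=LT\oplus (\mathbb CK\otimes A(m))\oplus\mathbb Cd_0$ has brackets, for $X\in\mathfrak g(\bar k_0,\bar k)$, $Y\in\mathfrak g(\bar l_0,\bar l)$ and $X(k_0,k)=X\otimes t_0^{k_0}t^k$: $[X(k_0,k),Y(l_0,l)]=[X,Y](k_0+l_0,k+l)+(X|Y)\,\delta_{k_0+l_0,0}\,k_0\,K\otimes t^{k+l}$ (note that $(X|Y)\neq0$ forces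 $k+l\in\Gamma$ and $m_0\mid k_0+l_0$); $K\otimes A(m)$ is central; $[d_0,X(k_0,k)]=k_0X(k_0,k)$. Identify $K=K\otimes1$. Let $\tilde{\mathfrak h}(0)=\mathfrak h(0)\oplus\mathbb CK\oplus\mathbb Cd_0$ and let $\delta\in\tilde{\mathfrak h}(0)^*$ vanish on $\mathfrak h(0)$ and $K$ with $\delta(d_0)=1$. The root spaces of $\mathfrak L$ are $\mathfrak L_{\alpha+k_0\delta}=\bigoplus_{k}\mathfrak g(\bar k_0,\bar k,\alpha)t_0^{k_0}t^k$ if $\alpha+k_0\delta\ne0$, and $\mathfrak L_0=\bigoplus_k\mathfrak g(\bar0,\bar k,0)t^k\oplus K\otimes A(m)\oplus\mathbb Cd_0$. A root $\alpha+k_0\delta$ is positive if $k_0>0$, or $k_0=0$ and $\alpha>0$; negative if $k_0<0$, or $k_0=0$ and $\alpha<0$; it is real if $\alpha\neq0$. Let $\mathfrak L^{\pm}$ be the sum of the root spaces for positive/negative roots, and $\mathfrak L^0=\mathfrak L_0$. For a finite dimensional irreducible $\mathfrak L^0$-module $N$, let $\mathfrak L^+$ act on $N$ by $0$, let $M(N)=U(\mathfrak L)\otimes_{U(\mathfrak L^+\oplus\mathfrak L^0)}N$, and let $V(N)$ be its unique irreducible quotient. An $\mathfrak L$-module is a weight module if it is the direct sum of its $\tilde{\mathfrak h}(0)$-weight spaces and these are finite dimensional; a weight module is integrable if every real root vector (element of $\mathfrak L_{\alpha+k_0\delta}$ with $\alpha\ne0$) acts locally nilpotently. For an ideal $J$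 of $A(m)$ put $\mathfrak L^0(J)=\sum_{k\in\mathbb Z^n}\mathfrak g(\bar0,\bar k,0)t^kJ+K\otimes J$ and $\mathfrak L(J)=\sum_{k_0\in\mathbb Z,k\in\mathbb Z^n}\mathfrak g(\bar k_0,\bar k)t_0^{k_0}t^kJ+K\otimes J$. *)

theory Defs
  imports "HOL-Analysis.Analysis" "HOL-Library.Poly_Mapping"
begin

section \<open>Complex Lie algebras\<close>

text \<open>Lie algebras are subspaces of an additive group carrying a scalar multiplication \<open>sc\<close> and
  a bracket \<open>br\<close>; the span, subspace, dependence etc. of the library are taken with
  respect to \<open>sc\<close>.\<close>

definition lie_algebra :: "(complex \<Rightarrow> 'g::ab_group_add \<Rightarrow> 'g) \<Rightarrow> ('g \<Rightarrow> 'g \<Rightarrow> 'g) \<Rightarrow> bool" where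
  "lie_algebra sc br \<longleftrightarrow> vector_space sc \<and>
     (\<forall>x. Vector_Spaces.linear sc sc (br x)) \<and>
     (\<forall>y. Vector_Spaces.linear sc sc (\<lambda>x. br x y)) \<and>
     (\<forall>x. br x x = 0) \<and>
     (\<forall>x y z. br x (br y z) + br y (br z x) + br z (br x y) = 0)"

definition fin_dim :: "(complex \<Rightarrow> 'g::ab_group_add \<Rightarrow> 'g) \<Rightarrow> 'g set \<Rightarrow> bool" where
  "fin_dim sc W \<longleftrightarrow> (\<exists>B. finite B \<and> module.span sc B = W)"

definition lie_subalgebra ::
    "(complex \<Rightarrow> 'g::ab_group_add \<Rightarrow> 'g) \<Rightarrow> ('g \<Rightarrow> 'g \<Rightarrow> 'g) \<Rightarrow> 'g set \<Rightarrow> bool" where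
  "lie_subalgebra sc br S \<longleftrightarrow> module.subspace sc S \<and> (\<forall>x\<in>S. \<forall>y\<in>S. br x y \<in> S)"

definition lie_ideal ::
    "(complex \<Rightarrow> 'g::ab_group_add \<Rightarrow> 'g) \<Rightarrow> ('g \<Rightarrow> 'g \<Rightarrow> 'g) \<Rightarrow> 'g set \<Rightarrow> 'g set \<Rightarrow> bool" where
  "lie_ideal sc br S J \<longleftrightarrow> module.subspace sc J \<and> J \<subseteq> S \<and> (\<forall>x\<in>S. \<forall>y\<in>J. br x y \<in> J)"

definition simple_lie ::
    "(complex \<Rightarrow> 'g::ab_group_add \<Rightarrow> 'g) \<Rightarrow> ('g \<Rightarrow> 'g \<Rightarrow> 'g) \<Rightarrow> 'g set \<Rightarrow> bool" where
  "simple_lie sc br S \<longleftrightarrow> lie_subalgebra sc br S \<and> (\<exists>x\<in>S. \<exists>y\<in>S. br x y \<noteq> 0) \<and>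
     (\<forall>J. lie_ideal sc br S J \<longrightarrow> J = {0} \<or> J = S)"

definition lie_automorphism ::
    "(complex \<Rightarrow> 'g::ab_group_add \<Rightarrow> 'g) \<Rightarrow> ('g \<Rightarrow> 'g \<Rightarrow> 'g) \<Rightarrow> ('g \<Rightarrow> 'g) \<Rightarrow> bool" where
  "lie_automorphism sc br s \<longleftrightarrow> bij s \<and> Vector_Spaces.linear sc sc s \<and>
     (\<forall>x y. s (br x y) = br (s x) (s y))"

definition nondeg_invariant_form ::
    "(complex \<Rightarrow> 'g::ab_group_add \<Rightarrow> 'g) \<Rightarrow> ('g \<Rightarrow> 'g \<Rightarrow> 'g) \<Rightarrow> ('g \<Rightarrow> 'g \<Rightarrow> complex) \<Rightarrow> bool" where
  "nondeg_invariant_form sc br F \<longleftrightarrow>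
     (\<forall>x. Vector_Spaces.linear sc (*) (F x)) \<and>
     (\<forall>x y. F x y = F y x) \<and>
     (\<forall>x y z. F (br x y) z = F x (br y z)) \<and>
     (\<forall>x. (\<forall>y. F x y = 0) \<longrightarrow> x = 0)"

definition trace_on :: "(complex \<Rightarrow> 'g::ab_group_add \<Rightarrow> 'g) \<Rightarrow> 'g set \<Rightarrow> ('g \<Rightarrow> 'g) \<Rightarrow> complex" where
  "trace_on sc S f =
     (let B = (SOME B. \<not> module.dependent sc B \<and> module.span sc B = S)
      in \<Sum>b\<in>B. module.representation sc B (f b) b)"

definition killing ::
    "(complex \<Rightarrow> 'g::ab_group_add \<Rightarrow> 'g) \<Rightarrow> ('g \<Rightarrow> 'g \<Rightarrow> 'g) \<Rightarrow> 'g set \<Rightarrow> 'g \<Rightarrow> 'g \<Rightarrow> complex" where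
  "killing sc br S x y = trace_on sc S (\<lambda>z. br x (br y z))"

text \<open>A Cartan subalgebra of a (semi)simple complex Lie algebra \<open>S\<close>: a maximal abelian
  subalgebra consisting of elements whose adjoint action on \<open>S\<close> is diagonalizable.\<close>

definition cartan_subalgebra ::
    "(complex \<Rightarrow> 'g::ab_group_add \<Rightarrow> 'g) \<Rightarrow> ('g \<Rightarrow> 'g \<Rightarrow> 'g) \<Rightarrow> 'g set \<Rightarrow> 'g set \<Rightarrow> bool" where
  "cartan_subalgebra sc br S H \<longleftrightarrow> lie_subalgebra sc br H \<and> H \<subseteq> S \<and>
     (\<forall>h\<in>H. \<forall>h'\<in>H. br h h' = 0) \<and>
     (\<forall>x\<in>S. (\<forall>h\<in>H. br h x = 0) \<longrightarrow> x \<in> H) \<and>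
     (\<forall>h\<in>H. module.span sc {x \<in> S. \<exists>c. br h x = sc c x} = S)"


section \<open>Roots\<close>

text \<open>The dual of a subspace \<open>H\<close>: functionals are extended by \<open>0\<close> outside \<open>H\<close>, so that equality of
  functions is equality in the dual space and \<open>\<lambda>_. 0\<close> is its zero.\<close>

definition dual :: "(complex \<Rightarrow> 'g::ab_group_add \<Rightarrow> 'g) \<Rightarrow> 'g set \<Rightarrow> ('g \<Rightarrow> complex) set" where
  "dual sc H = {\<alpha>. (\<forall>x\<in>H. \<forall>y\<in>H. \<alpha> (x + y) = \<alpha> x + \<alpha> y) \<and> (\<forall>c. \<forall>x\<in>H. \<alpha> (sc c x) = c * \<alpha> x) \<and>
                   (\<forall>x. x \<notin> H \<longrightarrow> \<alpha> x = 0)}"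

definition wt_space ::
    "(complex \<Rightarrow> 'g::ab_group_add \<Rightarrow> 'g) \<Rightarrow> ('g \<Rightarrow> 'g \<Rightarrow> 'g) \<Rightarrow> 'g set \<Rightarrow> 'g set \<Rightarrow> ('g \<Rightarrow> complex) \<Rightarrow> 'g set" where
  "wt_space sc br H W \<alpha> = {x \<in> W. \<forall>h\<in>H. br h x = sc (\<alpha> h) x}"

definition roots ::
    "(complex \<Rightarrow> 'g::ab_group_add \<Rightarrow> 'g) \<Rightarrow> ('g \<Rightarrow> 'g \<Rightarrow> 'g) \<Rightarrow> 'g set \<Rightarrow> 'g set \<Rightarrow> ('g \<Rightarrow> complex) set" where
  "roots sc br S H = {\<alpha> \<in> dual sc H. \<alpha> \<noteq> (\<lambda>_. 0) \<and> wt_space sc br H S \<alpha> \<noteq> {0}}"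

definition nonneg_comb :: "('g \<Rightarrow> complex) set \<Rightarrow> ('g \<Rightarrow> complex) \<Rightarrow> bool" where
  "nonneg_comb B \<alpha> \<longleftrightarrow> (\<exists>n::('g \<Rightarrow> complex) \<Rightarrow> nat. \<forall>h. \<alpha> h = (\<Sum>\<beta>\<in>B. of_nat (n \<beta>) * \<beta> h))"

definition positive_wt :: "('g \<Rightarrow> complex) set \<Rightarrow> ('g \<Rightarrow> complex) \<Rightarrow> bool" where
  "positive_wt B \<alpha> \<longleftrightarrow> \<alpha> \<noteq> (\<lambda>_. 0) \<and> nonneg_comb B \<alpha>"

definition simple_roots :: "('g \<Rightarrow> complex) set \<Rightarrow> ('g \<Rightarrow> complex) set \<Rightarrow> bool" where
  "simple_roots \<Delta> B \<longleftrightarrow> finite B \<and> B \<subseteq> \<Delta> \<and>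
     (\<forall>c. (\<forall>h. (\<Sum>\<beta>\<in>B. c \<beta> * \<beta> h) = (0::complex)) \<longrightarrow> (\<forall>\<beta>\<in>B. c \<beta> = 0)) \<and>
     (\<forall>\<alpha>\<in>\<Delta>. nonneg_comb B \<alpha> \<or> nonneg_comb B (\<lambda>h. - \<alpha> h))"

text \<open>The form on the dual of \<open>H\<close> induced by the Killing form of \<open>S\<close>; on roots its values
  are real.\<close>

definition dual_vec ::
    "(complex \<Rightarrow> 'g::ab_group_add \<Rightarrow> 'g) \<Rightarrow> ('g \<Rightarrow> 'g \<Rightarrow> 'g) \<Rightarrow> 'g set \<Rightarrow> 'g set \<Rightarrow> ('g \<Rightarrow> complex) \<Rightarrow> 'g" where
  "dual_vec sc br S H \<alpha> = (THE t. t \<in> H \<and> (\<forall>h\<in>H. killing sc br S t h = \<alpha> h))"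

definition root_ip ::
    "(complex \<Rightarrow> 'g::ab_group_add \<Rightarrow> 'g) \<Rightarrow> ('g \<Rightarrow> 'g \<Rightarrow> 'g) \<Rightarrow> 'g set \<Rightarrow> 'g set \<Rightarrow>
     ('g \<Rightarrow> complex) \<Rightarrow> ('g \<Rightarrow> complex) \<Rightarrow> real" where
  "root_ip sc br S H \<alpha> \<beta> = Re (killing sc br S (dual_vec sc br S H \<alpha>) (dual_vec sc br S H \<beta>))"

text \<open>Short roots are those of minimal length (in particular all roots if there is only one length).\<close>

definition short_roots ::
    "(complex \<Rightarrow> 'g::ab_group_add \<Rightarrow> 'g) \<Rightarrow> ('g \<Rightarrow> 'g \<Rightarrow> 'g) \<Rightarrow> 'g set \<Rightarrow> 'g set \<Rightarrow> ('g \<Rightarrow> complex) set" where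
  "short_roots sc br S H = {\<alpha> \<in> roots sc br S H.
     \<forall>\<beta>\<in>roots sc br S H. root_ip sc br S H \<alpha> \<alpha> \<le> root_ip sc br S H \<beta> \<beta>}"

definition simply_laced ::
    "(complex \<Rightarrow> 'g::ab_group_add \<Rightarrow> 'g) \<Rightarrow> ('g \<Rightarrow> 'g \<Rightarrow> 'g) \<Rightarrow> 'g set \<Rightarrow> 'g set \<Rightarrow> bool" where
  "simply_laced sc br S H \<longleftrightarrow>
     (\<forall>\<alpha>\<in>roots sc br S H. \<forall>\<beta>\<in>roots sc br S H. root_ip sc br S H \<alpha> \<alpha> = root_ip sc br S H \<beta> \<beta>)"

definition cartan_matrix_B :: "nat \<Rightarrow> nat \<Rightarrow> nat \<Rightarrow> real" where
  "cartan_matrix_B l i j =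
     (if i = j then 2 else if i + 1 = j \<and> j + 1 = l then -2
      else if i + 1 = j \<or> j + 1 = i then -1 else 0)"

text \<open>Type \<open>B\<^sub>l\<close>, with \<open>l \<ge> 1\<close> and the convention \<open>B\<^sub>1 = A\<^sub>1\<close>. The short simple root is the last one.\<close>

definition type_B ::
    "(complex \<Rightarrow> 'g::ab_group_add \<Rightarrow> 'g) \<Rightarrow> ('g \<Rightarrow> 'g \<Rightarrow> 'g) \<Rightarrow> 'g set \<Rightarrow> 'g set \<Rightarrow> ('g \<Rightarrow> complex) set \<Rightarrow> bool" where
  "type_B sc br S H B \<longleftrightarrow> (\<exists>l \<beta>. l \<ge> 1 \<and> bij_betw \<beta> {..<l} B \<and>
     (\<forall>i<l. \<forall>j<l. 2 * root_ip sc br S H (\<beta> i) (\<beta> j) / root_ip sc br S H (\<beta> j) (\<beta> j)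
                    = cartan_matrix_B l i j))"

definition is_highest :: "('g \<Rightarrow> complex) set \<Rightarrow> ('g \<Rightarrow> complex) set \<Rightarrow> ('g \<Rightarrow> complex) \<Rightarrow> bool" where
  "is_highest B A \<theta> \<longleftrightarrow> \<theta> \<in> A \<and> (\<forall>\<alpha>\<in>A. nonneg_comb B (\<lambda>h. \<theta> h - \<alpha> h))"


section \<open>Modules\<close>

text \<open>Modules are records with an explicit carrier, since quotients are formed as sets of cosets.\<close>

record ('l, 'v) lie_mod =
  mcar :: "'v set"
  madd :: "'v \<Rightarrow> 'v \<Rightarrow> 'v"
  mzero :: 'v
  mscale :: "complex \<Rightarrow> 'v \<Rightarrow> 'v"
  mact :: "'l \<Rightarrow> 'v \<Rightarrow> 'v"

definition complex_space :: "('l, 'v) lie_mod \<Rightarrow> bool" where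
  "complex_space M \<longleftrightarrow>
     mzero M \<in> mcar M \<and>
     (\<forall>u\<in>mcar M. \<forall>v\<in>mcar M. madd M u v \<in> mcar M \<and> madd M u v = madd M v u) \<and>
     (\<forall>u\<in>mcar M. \<forall>v\<in>mcar M. \<forall>w\<in>mcar M. madd M (madd M u v) w = madd M u (madd M v w)) \<and>
     (\<forall>v\<in>mcar M. madd M (mzero M) v = v \<and> (\<exists>u\<in>mcar M. madd M u v = mzero M)) \<and>
     (\<forall>c. \<forall>v\<in>mcar M. mscale M c v \<in> mcar M) \<and>
     (\<forall>c. \<forall>u\<in>mcar M. \<forall>v\<in>mcar M. mscale M c (madd M u v) = madd M (mscale M c u) (mscale M c v)) \<and>
     (\<forall>c d. \<forall>v\<in>mcar M. mscale M (c + d) v = madd M (mscale M c v) (mscale M d v)) \<and>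
     (\<forall>c d. \<forall>v\<in>mcar M. mscale M (c * d) v = mscale M c (mscale M d v)) \<and>
     (\<forall>v\<in>mcar M. mscale M 1 v = v)"

definition lie_module ::
    "(complex \<Rightarrow> 'l::ab_group_add \<Rightarrow> 'l) \<Rightarrow> ('l \<Rightarrow> 'l \<Rightarrow> 'l) \<Rightarrow> 'l set \<Rightarrow> ('l, 'v) lie_mod \<Rightarrow> bool" where
  "lie_module sc br L M \<longleftrightarrow> complex_space M \<and>
     (\<forall>x\<in>L. \<forall>v\<in>mcar M. mact M x v \<in> mcar M) \<and>
     (\<forall>x\<in>L. \<forall>u\<in>mcar M. \<forall>v\<in>mcar M. mact M x (madd M u v) = madd M (mact M x u) (mact M x v)) \<and>
     (\<forall>x\<in>L. \<forall>c. \<forall>v\<in>mcar M. mact M x (mscale M c v) = mscale M c (mact M x v)) \<and>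
     (\<forall>x\<in>L. \<forall>y\<in>L. \<forall>v\<in>mcar M. mact M (x + y) v = madd M (mact M x v) (mact M y v)) \<and>
     (\<forall>c. \<forall>x\<in>L. \<forall>v\<in>mcar M. mact M (sc c x) v = mscale M c (mact M x v)) \<and>
     (\<forall>x\<in>L. \<forall>y\<in>L. \<forall>v\<in>mcar M.
        madd M (mact M (br x y) v) (mact M y (mact M x v)) = mact M x (mact M y v))"

definition msubspace :: "('l, 'v) lie_mod \<Rightarrow> 'v set \<Rightarrow> bool" where
  "msubspace M S \<longleftrightarrow> S \<subseteq> mcar M \<and> mzero M \<in> S \<and> (\<forall>u\<in>S. \<forall>v\<in>S. madd M u v \<in> S) \<and>
     (\<forall>c. \<forall>v\<in>S. mscale M c v \<in> S)"

definition mspan :: "('l, 'v) lie_mod \<Rightarrow> 'v set \<Rightarrow> 'v set" where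
  "mspan M B = \<Inter>{S. msubspace M S \<and> B \<subseteq> S}"

definition mfin_dim :: "('l, 'v) lie_mod \<Rightarrow> 'v set \<Rightarrow> bool" where
  "mfin_dim M S \<longleftrightarrow> (\<exists>B. finite B \<and> B \<subseteq> S \<and> mspan M B = S)"

definition submodule :: "'l set \<Rightarrow> ('l, 'v) lie_mod \<Rightarrow> 'v set \<Rightarrow> bool" where
  "submodule L M S \<longleftrightarrow> msubspace M S \<and> (\<forall>x\<in>L. \<forall>v\<in>S. mact M x v \<in> S)"

definition irreducible_module :: "'l set \<Rightarrow> ('l, 'v) lie_mod \<Rightarrow> bool" where
  "irreducible_module L M \<longleftrightarrow> mcar M \<noteq> {mzero M} \<and>
     (\<forall>S. submodule L M S \<longrightarrow> S = {mzero M} \<or> S = mcar M)"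

definition quotient_module :: "('l, 'v) lie_mod \<Rightarrow> 'v set \<Rightarrow> ('l, 'v set) lie_mod" where
  "quotient_module M S = \<lparr>
     mcar = (\<lambda>v. {madd M v s | s. s \<in> S}) ` mcar M,
     madd = (\<lambda>X Y. {madd M x y | x y. x \<in> X \<and> y \<in> Y}),
     mzero = S,
     mscale = (\<lambda>c X. {madd M (mscale M c x) s | x s. x \<in> X \<and> s \<in> S}),
     mact = (\<lambda>l X. {madd M (mact M l x) s | x s. x \<in> X \<and> s \<in> S})\<rparr>"

definition irreducible_quotient :: "'l set \<Rightarrow> ('l, 'v) lie_mod \<Rightarrow> ('l, 'v set) lie_mod \<Rightarrow> bool" where
  "irreducible_quotient L M V \<longleftrightarrow>
     (\<exists>S. submodule L M S \<and> V = quotient_module M S \<and> irreducible_module L V)"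

definition adjoint_module ::
    "(complex \<Rightarrow> 'g::ab_group_add \<Rightarrow> 'g) \<Rightarrow> ('g \<Rightarrow> 'g \<Rightarrow> 'g) \<Rightarrow> 'g set \<Rightarrow> ('g, 'g) lie_mod" where
  "adjoint_module sc br W = \<lparr>mcar = W, madd = (+), mzero = 0, mscale = sc, mact = br\<rparr>"


section \<open>Enveloping algebras and induced modules\<close>

definition pscale :: "(complex \<Rightarrow> 'b::zero \<Rightarrow> 'b) \<Rightarrow> complex \<Rightarrow> ('a \<Rightarrow>\<^sub>0 'b) \<Rightarrow> ('a \<Rightarrow>\<^sub>0 'b)" where
  "pscale sc c f = Poly_Mapping.map (sc c) f"

text \<open>\<open>U(L)\<close> is the free associative algebra on the set \<open>L\<close> (words in \<open>L\<close> with complex coefficients)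
  modulo the two-sided ideal making the map from \<open>L\<close> linear with \<open>xy - yx = [x,y]\<close>; its elements are
  cosets.\<close>

type_synonym 'l free_alg = "'l list \<Rightarrow>\<^sub>0 complex"

definition free_alg :: "'l set \<Rightarrow> 'l free_alg set" where
  "free_alg L = {a. \<forall>w\<in>Poly_Mapping.keys a. set w \<subseteq> L}"

definition fmul :: "'l free_alg \<Rightarrow> 'l free_alg \<Rightarrow> 'l free_alg" where
  "fmul a b = (\<Sum>u\<in>Poly_Mapping.keys a. \<Sum>v\<in>Poly_Mapping.keys b.
     Poly_Mapping.single (u @ v) (Poly_Mapping.lookup a u * Poly_Mapping.lookup b v))"

abbreviation word :: "'l list \<Rightarrow> 'l free_alg" where
  "word w \<equiv> Poly_Mapping.single w 1"

definition env_relations ::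
    "(complex \<Rightarrow> 'l::ab_group_add \<Rightarrow> 'l) \<Rightarrow> ('l \<Rightarrow> 'l \<Rightarrow> 'l) \<Rightarrow> 'l set \<Rightarrow> 'l free_alg set" where
  "env_relations sc br L =
     {word [x + y] - word [x] - word [y] | x y. x \<in> L \<and> y \<in> L} \<union>
     {word [sc c x] - pscale (*) c (word [x]) | c x. x \<in> L} \<union>
     {word [x, y] - word [y, x] - word [br x y] | x y. x \<in> L \<and> y \<in> L}"

definition free_alg_ideal :: "'l set \<Rightarrow> 'l free_alg set \<Rightarrow> bool" where
  "free_alg_ideal L J \<longleftrightarrow> module.subspace (pscale (*)) J \<and> J \<subseteq> free_alg L \<and>
     (\<forall>a\<in>free_alg L. \<forall>j\<in>J. fmul a j \<in> J \<and> fmul j a \<in> J)"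

definition env_ideal ::
    "(complex \<Rightarrow> 'l::ab_group_add \<Rightarrow> 'l) \<Rightarrow> ('l \<Rightarrow> 'l \<Rightarrow> 'l) \<Rightarrow> 'l set \<Rightarrow> 'l free_alg set" where
  "env_ideal sc br L = \<Inter>{J. free_alg_ideal L J \<and> env_relations sc br L \<subseteq> J}"

definition env_class ::
    "(complex \<Rightarrow> 'l::ab_group_add \<Rightarrow> 'l) \<Rightarrow> ('l \<Rightarrow> 'l \<Rightarrow> 'l) \<Rightarrow> 'l set \<Rightarrow> 'l free_alg \<Rightarrow> 'l free_alg set" where
  "env_class sc br L a = {a + j | j. j \<in> env_ideal sc br L}"

definition env_alg ::
    "(complex \<Rightarrow> 'l::ab_group_add \<Rightarrow> 'l) \<Rightarrow> ('l \<Rightarrow> 'l \<Rightarrow> 'l) \<Rightarrow> 'l set \<Rightarrow> 'l free_alg set set" where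
  "env_alg sc br L = env_class sc br L ` free_alg L"

definition env_add :: "'l free_alg set \<Rightarrow> 'l free_alg set \<Rightarrow> 'l free_alg set" where
  "env_add X Y = {x + y | x y. x \<in> X \<and> y \<in> Y}"

definition env_scale ::
    "(complex \<Rightarrow> 'l::ab_group_add \<Rightarrow> 'l) \<Rightarrow> ('l \<Rightarrow> 'l \<Rightarrow> 'l) \<Rightarrow> 'l set \<Rightarrow>
     complex \<Rightarrow> 'l free_alg set \<Rightarrow> 'l free_alg set" where
  "env_scale sc br L c X = {pscale (*) c x + j | x j. x \<in> X \<and> j \<in> env_ideal sc br L}"

definition env_mul ::
    "(complex \<Rightarrow> 'l::ab_group_add \<Rightarrow> 'l) \<Rightarrow> ('l \<Rightarrow> 'l \<Rightarrow> 'l) \<Rightarrow> 'l set \<Rightarrow>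
     'l free_alg set \<Rightarrow> 'l free_alg set \<Rightarrow> 'l free_alg set" where
  "env_mul sc br L X Y = {fmul x y + j | x y j. x \<in> X \<and> y \<in> Y \<and> j \<in> env_ideal sc br L}"

text \<open>For a subalgebra \<open>B\<close> of \<open>L\<close> and a \<open>B\<close>-module \<open>N\<close>, the module induced by \<open>N\<close> is the tensor product
  of \<open>U(L)\<close> and \<open>N\<close> over \<open>U(B)\<close>: the free vector space on pairs \<open>(u, n)\<close> modulo bilinearity and
  \<open>(u b, n) = (u, b n)\<close>, where it suffices to let \<open>b\<close> run through the monomials \<open>b\<^sub>1 \<dots> b\<^sub>r\<close>
  spanning \<open>U(B)\<close>.\<close>

type_synonym ('l, 'w) tensor_free = "('l free_alg set \<times> 'w) \<Rightarrow>\<^sub>0 complex"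

abbreviation pair :: "'l free_alg set \<Rightarrow> 'w \<Rightarrow> ('l, 'w) tensor_free" where
  "pair u n \<equiv> Poly_Mapping.single (u, n) 1"

definition tensor_free_module ::
    "(complex \<Rightarrow> 'l::ab_group_add \<Rightarrow> 'l) \<Rightarrow> ('l \<Rightarrow> 'l \<Rightarrow> 'l) \<Rightarrow> 'l set \<Rightarrow> ('l, 'w) lie_mod \<Rightarrow>
     ('l, ('l, 'w) tensor_free) lie_mod" where
  "tensor_free_module sc br L N = \<lparr>
     mcar = {f. Poly_Mapping.keys f \<subseteq> env_alg sc br L \<times> mcar N},
     madd = (+), mzero = 0, mscale = pscale (*),
     mact = (\<lambda>x f. \<Sum>(u, n)\<in>Poly_Mapping.keys f.
       Poly_Mapping.single (env_mul sc br L (env_class sc br L (word [x])) u, n)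
         (Poly_Mapping.lookup f (u, n)))\<rparr>"

definition tensor_relations ::
    "(complex \<Rightarrow> 'l::ab_group_add \<Rightarrow> 'l) \<Rightarrow> ('l \<Rightarrow> 'l \<Rightarrow> 'l) \<Rightarrow> 'l set \<Rightarrow> 'l set \<Rightarrow> ('l, 'w) lie_mod \<Rightarrow>
     ('l, 'w) tensor_free set" where
  "tensor_relations sc br L B N =
     {pair (env_add u u') n - pair u n - pair u' n
        | u u' n. u \<in> env_alg sc br L \<and> u' \<in> env_alg sc br L \<and> n \<in> mcar N} \<union>
     {pair u (madd N n n') - pair u n - pair u n'
        | u n n'. u \<in> env_alg sc br L \<and> n \<in> mcar N \<and> n' \<in> mcar N} \<union>
     {pair (env_scale sc br L c u) n - pscale (*) c (pair u n)
        | c u n. u \<in> env_alg sc br L \<and> n \<in> mcar N} \<union>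
     {pair u (mscale N c n) - pscale (*) c (pair u n)
        | c u n. u \<in> env_alg sc br L \<and> n \<in> mcar N} \<union>
     {pair (env_mul sc br L u (env_class sc br L (word bs))) n - pair u (foldr (mact N) bs n)
        | u bs n. u \<in> env_alg sc br L \<and> set bs \<subseteq> B \<and> n \<in> mcar N}"

definition induced_module ::
    "(complex \<Rightarrow> 'l::ab_group_add \<Rightarrow> 'l) \<Rightarrow> ('l \<Rightarrow> 'l \<Rightarrow> 'l) \<Rightarrow> 'l set \<Rightarrow> 'l set \<Rightarrow> ('l, 'w) lie_mod \<Rightarrow>
     ('l, ('l, 'w) tensor_free set) lie_mod" where
  "induced_module sc br L B N =
     quotient_module (tensor_free_module sc br L N)
       (module.span (pscale (*)) (tensor_relations sc br L B N))"


section \<open>Multiloop algebras and Lie tori\<close>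

text \<open>The indices \<open>0, \<dots>, n\<close> of the automorphisms are the elements of \<open>'n option\<close>, where \<open>None\<close> stands
  for \<open>0\<close> and \<open>'n\<close> for \<open>{1..n}\<close>; thus \<open>n\<close> is the cardinality of \<open>'n\<close>.\<close>

record ('g, 'n) multiloop =
  scal :: "complex \<Rightarrow> 'g \<Rightarrow> 'g"
  brac :: "'g \<Rightarrow> 'g \<Rightarrow> 'g"
  form :: "'g \<Rightarrow> 'g \<Rightarrow> complex"
  aut :: "'n option \<Rightarrow> 'g \<Rightarrow> 'g"
  ord :: "'n option \<Rightarrow> nat"
  rootu :: "'n option \<Rightarrow> complex"
  csub :: "'g set"
  simples :: "('g \<Rightarrow> complex) set"

definition multidegree :: "int \<Rightarrow> int^'n \<Rightarrow> 'n option \<Rightarrow> int" where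
  "multidegree k0 k i = (case i of None \<Rightarrow> k0 | Some j \<Rightarrow> k $ j)"

definition gspace :: "('g, 'n) multiloop \<Rightarrow> int \<Rightarrow> int^'n \<Rightarrow> 'g set" where
  "gspace D k0 k = {X. \<forall>i. aut D i X = scal D (rootu D i powi multidegree k0 k i) X}"

abbreviation g00 :: "('g, 'n::finite) multiloop \<Rightarrow> 'g set" where
  "g00 D \<equiv> gspace D 0 0"

definition gspace_wt ::
    "('g::ab_group_add, 'n) multiloop \<Rightarrow> int \<Rightarrow> int^'n \<Rightarrow> ('g \<Rightarrow> complex) \<Rightarrow> 'g set" where
  "gspace_wt D k0 k \<alpha> = wt_space (scal D) (brac D) (csub D) (gspace D k0 k) \<alpha>"

definition multiloop_data :: "('g::ab_group_add, 'n::finite) multiloop \<Rightarrow> bool" where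
  "multiloop_data D \<longleftrightarrow>
     lie_algebra (scal D) (brac D) \<and>
     fin_dim (scal D) UNIV \<and>
     simple_lie (scal D) (brac D) UNIV \<and>
     nondeg_invariant_form (scal D) (brac D) (form D) \<and>
     (\<forall>i. lie_automorphism (scal D) (brac D) (aut D i)) \<and>
     (\<forall>i j. aut D i \<circ> aut D j = aut D j \<circ> aut D i) \<and>
     (\<forall>i. ord D i > 0 \<and> aut D i ^^ ord D i = id \<and> (\<forall>r. 0 < r \<and> r < ord D i \<longrightarrow> aut D i ^^ r \<noteq> id)) \<and>
     (\<forall>i. rootu D i ^ ord D i = 1 \<and> (\<forall>r. 0 < r \<and> r < ord D i \<longrightarrow> rootu D i ^ r \<noteq> 1))"

definition g00_roots :: "('g::ab_group_add, 'n::finite) multiloop \<Rightarrow> ('g \<Rightarrow> complex) set" where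
  "g00_roots D = roots (scal D) (brac D) (g00 D) (csub D)"

definition has_highest_weight ::
    "('g::ab_group_add, 'n::finite) multiloop \<Rightarrow> 'g set \<Rightarrow> ('g \<Rightarrow> complex) \<Rightarrow> bool" where
  "has_highest_weight D V lam \<longleftrightarrow> (\<exists>v\<in>V. v \<noteq> 0 \<and> (\<forall>h\<in>csub D. brac D h v = scal D (lam h) v) \<and>
     (\<forall>\<alpha>\<in>g00_roots D. positive_wt (simples D) \<alpha> \<longrightarrow> (\<forall>x\<in>gspace_wt D 0 0 \<alpha>. brac D x v = 0)))"

definition torus_weights :: "('g::ab_group_add, 'n::finite) multiloop \<Rightarrow> ('g \<Rightarrow> complex) set" where
  "torus_weights D =
     (let sh = short_roots (scal D) (brac D) (g00 D) (csub D) in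
      {\<theta>. is_highest (simples D) (g00_roots D) \<theta>} \<union>
      {\<theta>. \<not> simply_laced (scal D) (brac D) (g00 D) (csub D) \<and> is_highest (simples D) sh \<theta>} \<union>
      {(\<lambda>h. 2 * \<theta> h) | \<theta>. type_B (scal D) (brac D) (g00 D) (csub D) (simples D) \<and>
                          is_highest (simples D) sh \<theta>})"

definition lie_torus :: "('g::ab_group_add, 'n::finite) multiloop \<Rightarrow> bool" where
  "lie_torus D \<longleftrightarrow> multiloop_data D \<and>
     simple_lie (scal D) (brac D) (g00 D) \<and>
     cartan_subalgebra (scal D) (brac D) (g00 D) (csub D) \<and>
     simple_roots (g00_roots D) (simples D) \<and>
     (\<forall>k0 k. \<exists>U V.
        submodule (g00 D) (adjoint_module (scal D) (brac D) (gspace D k0 k)) U \<and>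
        submodule (g00 D) (adjoint_module (scal D) (brac D) (gspace D k0 k)) V \<and>
        U \<inter> V = {0} \<and> {u + v | u v. u \<in> U \<and> v \<in> V} = gspace D k0 k \<and>
        (\<forall>x\<in>g00 D. \<forall>u\<in>U. brac D x u = 0) \<and>
        (V = {0} \<or>
         irreducible_module (g00 D) (adjoint_module (scal D) (brac D) V) \<and>
         (\<exists>lam\<in>torus_weights D. has_highest_weight D V lam)))"


section \<open>The toroidal algebra\<close>

text \<open>An element \<open>(x, f, c)\<close> is the sum of the terms \<open>x(k\<^sub>0,k) t\<^sub>0\<^bsup>k\<^sub>0\<^esup> t\<^bsup>k\<^esup>\<close>, of \<open>K \<otimes> f\<close> and of \<open>c d\<^sub>0\<close>.
  Laurent polynomials are finitely supported functions on exponents, multiplied by the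
  library's convolution product.\<close>

type_synonym 'n laurent = "(int^'n) \<Rightarrow>\<^sub>0 complex"
type_synonym ('g, 'n) toroidal = "((int \<times> (int^'n)) \<Rightarrow>\<^sub>0 'g) \<times> 'n laurent \<times> complex"

definition tscale :: "('g::ab_group_add, 'n::finite) multiloop \<Rightarrow> complex \<Rightarrow> ('g, 'n) toroidal \<Rightarrow> ('g, 'n) toroidal" where
  "tscale D c = (\<lambda>(x, f, d). (pscale (scal D) c x, pscale (*) c f, c * d))"

abbreviation loop_elt :: "'g::ab_group_add \<Rightarrow> int \<Rightarrow> int^'n \<Rightarrow> ('g, 'n::finite) toroidal" where
  "loop_elt X k0 k \<equiv> (Poly_Mapping.single (k0, k) X, 0, 0)"

abbreviation K_elt :: "'n laurent \<Rightarrow> ('g::ab_group_add, 'n::finite) toroidal" where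
  "K_elt f \<equiv> (0, f, 0)"

abbreviation d0_elt :: "('g::ab_group_add, 'n::finite) toroidal" where
  "d0_elt \<equiv> (0, 0, 1)"

definition degree_deriv ::
    "('g::ab_group_add, 'n::finite) multiloop \<Rightarrow> ((int \<times> (int^'n)) \<Rightarrow>\<^sub>0 'g) \<Rightarrow> ((int \<times> (int^'n)) \<Rightarrow>\<^sub>0 'g)" where
  "degree_deriv D x = (\<Sum>p\<in>Poly_Mapping.keys x.
     Poly_Mapping.single p (scal D (of_int (fst p)) (Poly_Mapping.lookup x p)))"

definition tbracket ::
    "('g::ab_group_add, 'n::finite) multiloop \<Rightarrow> ('g, 'n) toroidal \<Rightarrow> ('g, 'n) toroidal \<Rightarrow> ('g, 'n) toroidal" where
  "tbracket D = (\<lambda>(x, f, c) (y, g, d).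
     ((\<Sum>p\<in>Poly_Mapping.keys x. \<Sum>q\<in>Poly_Mapping.keys y.
         Poly_Mapping.single (p + q) (brac D (Poly_Mapping.lookup x p) (Poly_Mapping.lookup y q)))
        + pscale (scal D) c (degree_deriv D y) - pscale (scal D) d (degree_deriv D x),
      (\<Sum>p\<in>Poly_Mapping.keys x. \<Sum>q\<in>Poly_Mapping.keys y.
         if fst p + fst q = 0
         then Poly_Mapping.single (snd p + snd q)
                (of_int (fst p) * form D (Poly_Mapping.lookup x p) (Poly_Mapping.lookup y q))
         else 0),
      0))"

definition Am :: "('g, 'n::finite) multiloop \<Rightarrow> 'n laurent set" where
  "Am D = {f. \<forall>k\<in>Poly_Mapping.keys f. \<forall>i. int (ord D (Some i)) dvd k $ i}"

definition Lalg :: "('g::ab_group_add, 'n::finite) multiloop \<Rightarrow> ('g, 'n) toroidal set" where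
  "Lalg D = module.span (tscale D)
     ({loop_elt X k0 k | X k0 k. X \<in> gspace D k0 k} \<union> {K_elt f | f. f \<in> Am D} \<union> {d0_elt})"

definition root_space ::
    "('g::ab_group_add, 'n::finite) multiloop \<Rightarrow> ('g \<Rightarrow> complex) \<Rightarrow> int \<Rightarrow> ('g, 'n) toroidal set" where
  "root_space D \<alpha> k0 = module.span (tscale D)
     ({loop_elt X k0 k | X k. X \<in> gspace_wt D k0 k \<alpha>} \<union>
      (if \<alpha> = (\<lambda>_. 0) \<and> k0 = 0 then {K_elt f | f. f \<in> Am D} \<union> {d0_elt} else {}))"

definition Lzero :: "('g::ab_group_add, 'n::finite) multiloop \<Rightarrow> ('g, 'n) toroidal set" where
  "Lzero D = root_space D (\<lambda>_. 0) 0"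

definition Lplus :: "('g::ab_group_add, 'n::finite) multiloop \<Rightarrow> ('g, 'n) toroidal set" where
  "Lplus D = module.span (tscale D)
     (\<Union>{root_space D \<alpha> k0 | \<alpha> k0. \<alpha> \<in> dual (scal D) (csub D) \<and>
           (k0 > 0 \<or> k0 = 0 \<and> positive_wt (simples D) \<alpha>)})"

definition Lborel :: "('g::ab_group_add, 'n::finite) multiloop \<Rightarrow> ('g, 'n) toroidal set" where
  "Lborel D = {x + y | x y. x \<in> Lplus D \<and> y \<in> Lzero D}"

definition extend_by_zero ::
    "('g::ab_group_add, 'n::finite) multiloop \<Rightarrow> (('g, 'n) toroidal, 'w) lie_mod \<Rightarrow> (('g, 'n) toroidal, 'w) lie_mod" where
  "extend_by_zero D N = N\<lparr>mact := (\<lambda>b. mact N (THE y. y \<in> Lzero D \<and> b - y \<in> Lplus D))\<rparr>"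

definition MN ::
    "('g::ab_group_add, 'n::finite) multiloop \<Rightarrow> (('g, 'n) toroidal, 'w) lie_mod \<Rightarrow>
     (('g, 'n) toroidal, (('g, 'n) toroidal, 'w) tensor_free set) lie_mod" where
  "MN D N = induced_module (tscale D) (tbracket D) (Lalg D) (Lborel D) (extend_by_zero D N)"

definition htilde :: "('g::ab_group_add, 'n::finite) multiloop \<Rightarrow> ('g, 'n) toroidal set" where
  "htilde D = {(Poly_Mapping.single 0 h, Poly_Mapping.single 0 c, d) | h c d. h \<in> csub D}"

definition mweight_space :: "'l set \<Rightarrow> ('l, 'v) lie_mod \<Rightarrow> ('l \<Rightarrow> complex) \<Rightarrow> 'v set" where
  "mweight_space H M lam = {v \<in> mcar M. \<forall>h\<in>H. mact M h v = mscale M (lam h) v}"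

text \<open>Weight spaces for distinct weights are always independent, so the sum below is direct.\<close>

definition weight_module ::
    "('g::ab_group_add, 'n::finite) multiloop \<Rightarrow> (('g, 'n) toroidal, 'v) lie_mod \<Rightarrow> bool" where
  "weight_module D M \<longleftrightarrow>
     (\<forall>lam\<in>dual (tscale D) (htilde D). mfin_dim M (mweight_space (htilde D) M lam)) \<and>
     mspan M (\<Union>lam\<in>dual (tscale D) (htilde D). mweight_space (htilde D) M lam) = mcar M"

definition integrable_module ::
    "('g::ab_group_add, 'n::finite) multiloop \<Rightarrow> (('g, 'n) toroidal, 'v) lie_mod \<Rightarrow> bool" where
  "integrable_module D M \<longleftrightarrow> weight_module D M \<and>
     (\<forall>\<alpha>\<in>dual (scal D) (csub D). \<forall>k0. \<alpha> \<noteq> (\<lambda>_. 0) \<longrightarrow>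
        (\<forall>x\<in>root_space D \<alpha> k0. \<forall>v\<in>mcar M. \<exists>r. (mact M x ^^ r) v = mzero M))"


section \<open>Ideals\<close>

definition ideal_of :: "'a::comm_ring_1 set \<Rightarrow> 'a set \<Rightarrow> bool" where
  "ideal_of A J \<longleftrightarrow> J \<subseteq> A \<and> 0 \<in> J \<and> (\<forall>x\<in>J. \<forall>y\<in>J. x + y \<in> J) \<and> (\<forall>a\<in>A. \<forall>x\<in>J. a * x \<in> J)"

definition ideal_generated :: "'a::comm_ring_1 set \<Rightarrow> 'a set \<Rightarrow> 'a set" where
  "ideal_generated A G = \<Inter>{J. ideal_of A J \<and> G \<subseteq> J}"

text \<open>\<open>\<Prod>\<^sub>j (t\<^sub>i\<^bsup>m\<^sub>i\<^esup> - a\<^sub>j\<^bsup>m\<^sub>i\<^esup>)\<^bsup>b\<^sub>j\<^esup>\<close>, \<open>1 \<le> j \<le> q\<close>.\<close>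

definition laurent_prod ::
    "('g, 'n::finite) multiloop \<Rightarrow> 'n \<Rightarrow> nat \<Rightarrow> (nat \<Rightarrow> complex) \<Rightarrow> (nat \<Rightarrow> nat) \<Rightarrow> 'n laurent" where
  "laurent_prod D i q a b = (\<Prod>j\<in>{1..q}.
     (Poly_Mapping.single (axis i (int (ord D (Some i)))) 1
       - Poly_Mapping.single 0 (a j ^ ord D (Some i))) ^ b j)"

text \<open>\<open>X \<otimes> t\<^sub>0\<^bsup>k\<^sub>0\<^esup> t\<^bsup>k\<^esup> f\<close>\<close>

definition loop_mult ::
    "('g::ab_group_add, 'n::finite) multiloop \<Rightarrow> 'g \<Rightarrow> int \<Rightarrow> int^'n \<Rightarrow> 'n laurent \<Rightarrow> ('g, 'n) toroidal" where
  "loop_mult D X k0 k f =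
     (\<Sum>s\<in>Poly_Mapping.keys f. loop_elt (scal D (Poly_Mapping.lookup f s) X) k0 (k + s))"

definition Lzero_ideal ::
    "('g::ab_group_add, 'n::finite) multiloop \<Rightarrow> 'n laurent set \<Rightarrow> ('g, 'n) toroidal set" where
  "Lzero_ideal D J = module.span (tscale D)
     ({loop_mult D X 0 k f | X k f. X \<in> gspace_wt D 0 k (\<lambda>_. 0) \<and> f \<in> J} \<union> {K_elt f | f. f \<in> J})"

definition Lalg_ideal ::
    "('g::ab_group_add, 'n::finite) multiloop \<Rightarrow> 'n laurent set \<Rightarrow> ('g, 'n) toroidal set" where
  "Lalg_ideal D J = module.span (tscale D)
     ({loop_mult D X k0 k f | X k0 k f. X \<in> gspace D k0 k \<and> f \<in> J} \<union> {K_elt f | f. f \<in> J})"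

end

theory Submission
  imports Defs "HOL-Computational_Algebra.Fundamental_Theorem_Algebra"
begin

text \<open>For \<open>f \<in> A(m)\<close> consider the operators \<open>X t\<^sub>0\<^bsup>k\<^sub>0\<^esup> t\<^bsup>k\<^esup> f\<close> and \<open>K t\<^bsup>\<gamma>\<^esup> f\<close> on \<open>V(N)\<close>. The polynomials
  \<open>f\<close> for which all of them vanish form an ideal, and it suffices to test the operators from \<open>L\<^sup>0\<close> on the
  top \<open>N\<close>: if those vanish, the vectors \<open>(X t\<^sub>0\<^bsup>k\<^sub>0\<^esup> t\<^bsup>k\<^esup> f) n\<close> generate a submodule with all weights strictly
  below those of \<open>N\<close>, which is therefore zero.

  The point is that this ideal is radical. Suppose \<open>f\<^sup>2\<close> kills \<open>V(N)\<close>. Let \<open>x\<close> be a positive real root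
  vector, \<open>y\<close> an opposite one multiplied by \<open>f\<close>, and \<open>h = [x,y]\<close>. Then \<open>h\<close> commutes with \<open>y\<close>, since
  \<open>[y,h]\<close> contains \<open>f\<^sup>2\<close>, and so \<open>x\<^sup>r y\<^sup>r n = r! h\<^sup>r n\<close> for \<open>n \<in> N\<close>. By integrability \<open>y\<close>, hence
  \<open>h\<close>, is nilpotent. The operators \<open>h\<close> commute, so they have a common kernel in \<open>N\<close>; as \<open>g\<close> is generated by
  its nonzero weight vectors, they span all the operators from \<open>L\<^sup>0\<close> containing \<open>f\<close>, whose common
  kernel is an \<open>L\<^sup>0\<close>-submodule and thus \<open>N\<close>. Hence \<open>f\<close> kills \<open>V(N)\<close>. Finally
  a power of \<open>P\<^sub>i'\<close> is a multiple of \<open>P\<^sub>i\<close>.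

  The Lie torus axioms enter through the dichotomy that every nonzero weight of \<open>g\<close> is positive or
  negative.\<close>

section \<open>Linear algebra\<close>

text \<open>The top is the image of \<open>N\<close> in \<open>V(N)\<close>, nonzero because it
  generates. In place of a basis of the enveloping algebra stands a closure argument: what lowering
  operators produce from a set is stable under the raising ones as soon as these send the set itself
  into the closure. The operator h = [x,y] is the sum of a loop term and a central term; changing
  the t_0-degree of x by a multiple of m_0 alters only the coefficient of the central term, which
  separates the two. The dichotomy of weights is checked on each irreducible summand of a graded
  piece of g over g(0,0). If its highest weight is a root, its weights are weights of g(0,0) by
  saturation. If it is twice a short root in type B, reflections preserve the sum of the absolute
  values of the orthogonal coordinates, which is therefore at most 2; the coefficients with respect
  to the simple roots are partial sums of these coordinates, and the bound keeps them from taking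
  both signs. The compatibility of the form with the grading is read off from the existence of an
  irreducible quotient: without it the induced module would be zero.\<close>

no_notation vector_scalar_mult (infixl "*s" 70)

locale complex_vector_space = vector_space scale
  for scale :: "complex \<Rightarrow> 'b::ab_group_add \<Rightarrow> 'b" (infixr "*s" 75)
begin

abbreviation endo :: "('b \<Rightarrow> 'b) \<Rightarrow> bool" where
  "endo \<equiv> Vector_Spaces.linear scale scale"

lemma endo_iff: "endo T \<longleftrightarrow> (\<forall>x y. T (x + y) = T x + T y) \<and> (\<forall>c x. T (c *s x) = c *s T x)"
  using vector_space_axioms by (simp add: Vector_Spaces.linear_iff)

lemma endo_add: "endo T \<Longrightarrow> T (x + y) = T x + T y"
  and endo_scale: "endo T \<Longrightarrow> T (c *s x) = c *s T x"
  by (simp_all add: endo_iff)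

lemma endo_zero: "endo T \<Longrightarrow> T 0 = 0"
  using endo_scale[of T 0 0] by simp

lemma endo_diff: "endo T \<Longrightarrow> T (x - y) = T x - T y"
  by (metis add_diff_cancel diff_add_cancel endo_add)

lemma endo_neg: "endo T \<Longrightarrow> T (- x) = - T x"
  by (metis diff_0 endo_diff endo_zero)

lemma endo_sum: "endo T \<Longrightarrow> T (sum f A) = (\<Sum>a\<in>A. T (f a))"
  by (induction A rule: infinite_finite_induct) (auto simp: endo_zero endo_add)

lemma endo_funpow: "endo T \<Longrightarrow> endo (T ^^ n)"
  by (induction n) (auto simp: endo_iff)

lemma endo_span:
  assumes "endo T" "subspace W" "\<And>x. x \<in> S \<Longrightarrow> T x \<in> W" "x \<in> span S"
  shows "T x \<in> W"
  using assms(4)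
proof (induction rule: span_induct_alt)
  case base then show ?case using assms(1,2) by (simp add: endo_zero subspace_0)
next
  case (step c x y)
  then show ?case using assms by (simp add: endo_add endo_scale subspace_add subspace_scale)
qed

section \<open>Joint eigenspaces of families of operators\<close>

definition joint_eigenspace :: "'i set \<Rightarrow> ('i \<Rightarrow> 'b \<Rightarrow> 'b) \<Rightarrow> ('i \<Rightarrow> complex) \<Rightarrow> 'b set" where
  "joint_eigenspace I T ev = {x. \<forall>i\<in>I. T i x = ev i *s x}"

lemma subspace_joint_eigenspace:
  "(\<And>i. i \<in> I \<Longrightarrow> endo (T i)) \<Longrightarrow> subspace (joint_eigenspace I T ev)"
  by (auto simp: subspace_def joint_eigenspace_def endo_zero endo_add endo_scale
      scale_right_distrib scale_left_commute)

text \<open>Induction on the set of components. For an operator \<open>T i\<close> that separates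
  \<open>a\<close> from \<open>m\<close>, the operator \<open>T i - ev m i\<close> removes the
  component of \<open>m\<close> and multiplies that of \<open>a\<close> by a nonzero number. With
  \<open>W = {0}\<close> this is the linear independence of eigenvectors for different eigenvalue
  functions.\<close>

lemma eigen_components_in_invariant:
  assumes "finite A" and W: "subspace W"
    and lin: "\<And>i. i \<in> I \<Longrightarrow> endo (T i)"
    and inv: "\<And>i x. i \<in> I \<Longrightarrow> x \<in> W \<Longrightarrow> T i x \<in> W"
    and eig: "\<And>a. a \<in> A \<Longrightarrow> x a \<in> joint_eigenspace I T (ev a)"
    and dist: "\<And>a b. a \<in> A \<Longrightarrow> b \<in> A \<Longrightarrow> a \<noteq> b \<Longrightarrow> \<exists>i\<in>I. ev a i \<noteq> ev b i"
    and sum: "(\<Sum>a\<in>A. x a) \<in> W"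
  shows "\<forall>a\<in>A. x a \<in> W"
  using assms(1) eig dist sum
proof (induction A arbitrary: x rule: finite_induct)
  case empty then show ?case by simp
next
  case (insert m A)
  have "x a \<in> W" if a: "a \<in> A" for a
  proof -
    obtain i where i: "i \<in> I" "ev a i \<noteq> ev m i"
      using insert.prems(2)[of a m] a insert.hyps by auto
    let ?y = "\<lambda>b. (ev b i - ev m i) *s x b"
    have e: "T i (x b) = ev b i *s x b" if "b \<in> insert m A" for b
      using insert.prems(1)[OF that] i by (simp add: joint_eigenspace_def)
    have "T i (sum x (insert m A)) - ev m i *s sum x (insert m A) \<in> W"
      using insert.prems(3) i inv W by (simp add: subspace_diff subspace_scale)
    also have "T i (sum x (insert m A)) - ev m i *s sum x (insert m A) = (\<Sum>b\<in>insert m A. ?y b)"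
      using e by (simp add: endo_sum[OF lin[OF i(1)]] scale_sum_right scale_left_diff_distrib
          sum_subtractf del: sum.insert)
    also have "\<dots> = sum ?y A" using insert.hyps by simp
    finally have s: "sum ?y A \<in> W" .
    have "?y a \<in> W"
    proof (rule insert.IH[rule_format, OF _ _ s a])
      show "?y b \<in> joint_eigenspace I T (ev b)" if "b \<in> A" for b
        using insert.prems(1)[of b] that lin by (simp add: subspace_scale subspace_joint_eigenspace)
    qed (use insert.prems(2) in auto)
    from subspace_scale[OF W this, of "inverse (ev a i - ev m i)"] i show ?thesis by simp
  qed
  moreover have "x m \<in> W"
  proof -
    have "x m = sum x (insert m A) - sum x A" using insert.hyps by simp
    then show ?thesis using insert.prems(3) calculation W by (simp add: subspace_diff subspace_sum)
  qed
  ultimately show ?case by simp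
qed

lemma differ_on:
  fixes a b :: "'i \<Rightarrow> complex"
  assumes "\<And>i. i \<notin> I \<Longrightarrow> a i = 0" "\<And>i. i \<notin> I \<Longrightarrow> b i = 0" "a \<noteq> b"
  shows "\<exists>i\<in>I. a i \<noteq> b i"
proof (rule ccontr)
  assume "\<not> ?thesis"
  then have "a i = b i" for i using assms(1,2)[of i] by (cases "i \<in> I") auto
  with assms(3) show False by blast
qed

text \<open>Eigenvalue functions are normalised to vanish outside \<open>I\<close>, so that distinct ones differ on \<open>I\<close>.\<close>

lemma eigen_decomposition:
  assumes S: "\<And>x. x \<in> S \<Longrightarrow> \<exists>ev. (\<forall>i. i \<notin> I \<longrightarrow> ev i = 0) \<and> x \<in> joint_eigenspace I T ev"
    and lin: "\<And>i. i \<in> I \<Longrightarrow> endo (T i)"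
    and z: "z \<in> span S"
  obtains A x where "finite A" "z = sum x A"
    "\<And>a i. a \<in> A \<Longrightarrow> i \<notin> I \<Longrightarrow> a i = 0"
    "\<And>a. a \<in> A \<Longrightarrow> x a \<in> joint_eigenspace I T a"
    "\<And>a. a \<in> A \<Longrightarrow> x a \<in> span (S \<inter> joint_eigenspace I T a)"
proof -
  obtain t r where t: "finite t" "t \<subseteq> S" "z = (\<Sum>v\<in>t. r v *s v)"
    using z by (auto simp: span_explicit)
  obtain f where f: "\<And>v. v \<in> t \<Longrightarrow> (\<forall>i. i \<notin> I \<longrightarrow> f v i = 0) \<and> v \<in> joint_eigenspace I T (f v)"
    using S t(2) by (metis subsetD)
  define x where "x a = (\<Sum>v\<in>{v\<in>t. f v = a}. r v *s v)" for a
  have sp: "x a \<in> span (S \<inter> joint_eigenspace I T a)" for a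
    unfolding x_def using f t(2) by (intro span_sum span_scale span_base) auto
  have "x a \<in> joint_eigenspace I T a" for a
    using sp[of a] subspace_joint_eigenspace[of I T a, OF lin] span_minimal[of "S \<inter> joint_eigenspace I T a"]
    by blast
  moreover have "z = sum x (f ` t)"
    unfolding t(3) x_def by (rule sum.image_gen[OF t(1)])
  ultimately show thesis using that[of "f ` t" x] t(1) f sp by auto
qed

text \<open>By \<open>eigen_components_in_invariant\<close> the components of \<open>z\<close>
  cannot leave a stable subspace. This is how eigenvectors are found inside a subspace of which only
  stability is known.\<close>

lemma eigen_vectors_in_invariant:
  assumes S: "\<And>x. x \<in> S \<Longrightarrow> \<exists>ev. (\<forall>i. i \<notin> I \<longrightarrow> ev i = 0) \<and> x \<in> joint_eigenspace I T ev"
    and lin: "\<And>i. i \<in> I \<Longrightarrow> endo (T i)"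
    and W: "subspace W" and inv: "\<And>i x. i \<in> I \<Longrightarrow> x \<in> W \<Longrightarrow> T i x \<in> W"
    and z: "z \<in> span S" "z \<in> W"
  shows "z \<in> span {w \<in> W. \<exists>ev. (\<forall>i. i \<notin> I \<longrightarrow> ev i = 0) \<and> w \<in> joint_eigenspace I T ev
                            \<and> w \<in> span (S \<inter> joint_eigenspace I T ev)}"
proof -
  obtain A x where A: "finite A" "z = sum x A" "\<And>a i. a \<in> A \<Longrightarrow> i \<notin> I \<Longrightarrow> a i = 0"
    "\<And>a. a \<in> A \<Longrightarrow> x a \<in> joint_eigenspace I T a" "\<And>a. a \<in> A \<Longrightarrow> x a \<in> span (S \<inter> joint_eigenspace I T a)"
    using eigen_decomposition[OF S lin z(1)] by metis
  have "\<forall>a\<in>A. x a \<in> W"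
    by (rule eigen_components_in_invariant[OF A(1) W lin inv A(4) differ_on[OF A(3) A(3)]])
      (use z A(2) in auto)
  then show ?thesis unfolding A(2) using A by (intro span_sum span_base) blast
qed

text \<open>Uniqueness of the decomposition: \<open>z\<close>, being an eigenvector for
  \<open>t\<close>, coincides with its own component for \<open>t\<close>, and that component is
  built from elements of \<open>S\<close> in the same eigenspace.\<close>

lemma eigen_vector_span:
  assumes S: "\<And>x. x \<in> S \<Longrightarrow> \<exists>ev. (\<forall>i. i \<notin> I \<longrightarrow> ev i = 0) \<and> x \<in> joint_eigenspace I T ev"
    and lin: "\<And>i. i \<in> I \<Longrightarrow> endo (T i)"
    and z: "z \<in> span S" "z \<in> joint_eigenspace I T t" and t0: "\<And>i. i \<notin> I \<Longrightarrow> t i = 0"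
  shows "z \<in> span (S \<inter> joint_eigenspace I T t)"
proof -
  obtain A x where A: "finite A" "z = sum x A" "\<And>a i. a \<in> A \<Longrightarrow> i \<notin> I \<Longrightarrow> a i = 0"
    "\<And>a. a \<in> A \<Longrightarrow> x a \<in> joint_eigenspace I T a" "\<And>a. a \<in> A \<Longrightarrow> x a \<in> span (S \<inter> joint_eigenspace I T a)"
    using eigen_decomposition[OF S lin z(1)] by metis
  \<comment> \<open>The difference of two decompositions of \<open>z\<close>. Since \<open>t\<close>
    need not occur in \<open>A\<close>, both are extended by zero.\<close>
  let ?x = "\<lambda>a. (if a \<in> A then x a else 0) - (if a = t then z else 0)"
  have "(\<Sum>a\<in>insert t A. if a \<in> A then x a else 0) = sum x A"
    using A(1) by (intro sum.mono_neutral_cong_right) auto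
  moreover have "(\<Sum>a\<in>insert t A. if a = t then z else 0) = z"
    using A(1) by (subst sum.delta) auto
  ultimately have s0: "sum ?x (insert t A) \<in> {0}"
    using A(2) by (simp add: sum_subtractf del: sum.insert)
  have E: "?x a \<in> joint_eigenspace I T a" if "a \<in> insert t A" for a
    using z(2) A(4) subspace_joint_eigenspace[of I T a, OF lin] that
    by (auto intro!: subspace_neg subspace_diff subspace_0)
  have "\<forall>a\<in>insert t A. ?x a \<in> {0}"
  proof (rule eigen_components_in_invariant[OF _ subspace_single_0 lin _ E _ s0])
    show "\<exists>i\<in>I. a i \<noteq> b i" if "a \<in> insert t A" "b \<in> insert t A" "a \<noteq> b" for a b
      using that A(3) t0 by (intro differ_on) auto
  qed (use A(1) lin in \<open>auto simp: endo_zero\<close>)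
  then have "z = (if t \<in> A then x t else 0)" by auto
  then show ?thesis using A(5) by (auto simp: span_zero)
qed

text \<open>The trace in a given basis, free of the choice made in \<open>trace_on\<close>. It is
  the trace of an operator only if this maps \<open>B\<close> into \<open>span B\<close>, since
  \<open>representation\<close> vanishes outside the span.\<close>

definition btrace :: "'b set \<Rightarrow> ('b \<Rightarrow> 'b) \<Rightarrow> complex" where
  "btrace B f = (\<Sum>b\<in>B. representation B (f b) b)"

lemma representation_endo:
  assumes B: "independent B" "finite B" and f: "endo f" "\<And>b. b \<in> B \<Longrightarrow> f b \<in> span B" and v: "v \<in> span B"
  shows "representation B (f v) b = (\<Sum>c\<in>B. representation B v c * representation B (f c) b)"
proof -
  have "f v = f (\<Sum>c\<in>B. representation B v c *s c)"
    using sum_representation_eq[OF B(1) v B(2) order_refl] by simp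
  also have "\<dots> = (\<Sum>c\<in>B. representation B v c *s f c)"
    by (simp add: endo_sum[OF f(1)] endo_scale[OF f(1)])
  finally have "representation B (f v) b = representation B (\<Sum>c\<in>B. representation B v c *s f c) b"
    by simp
  also have "\<dots> = (\<Sum>c\<in>B. representation B (representation B v c *s f c) b)"
    using f(2) by (subst representation_sum[OF B(1)]) (auto intro: span_scale)
  also have "\<dots> = (\<Sum>c\<in>B. representation B v c * representation B (f c) b)"
    using f(2) by (intro sum.cong refl) (simp add: representation_scale[OF B(1)])
  finally show ?thesis .
qed

text \<open>Both sides are one double sum of products of matrix entries, summed in the two possible
  orders.\<close>

lemma btrace_comp_commute:
  assumes B: "independent B" "finite B" and f: "endo f" "\<And>b. b \<in> B \<Longrightarrow> f b \<in> span B"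
    and g: "endo g" "\<And>b. b \<in> B \<Longrightarrow> g b \<in> span B"
  shows "btrace B (\<lambda>x. f (g x)) = btrace B (\<lambda>x. g (f x))"
proof -
  have "btrace B (\<lambda>x. f (g x)) = (\<Sum>b\<in>B. \<Sum>c\<in>B. representation B (g b) c * representation B (f c) b)"
    unfolding btrace_def by (intro sum.cong refl representation_endo[OF B f] g)
  also have "\<dots> = (\<Sum>c\<in>B. \<Sum>b\<in>B. representation B (f c) b * representation B (g b) c)"
    by (subst sum.swap) (simp add: mult.commute)
  also have "\<dots> = btrace B (\<lambda>x. g (f x))"
    unfolding btrace_def by (intro sum.cong refl representation_endo[OF B g, symmetric] f)
  finally show ?thesis .
qed

text \<open>Both traces equal the double sum of the coefficients of \<open>f c\<close> in
  \<open>B\<close> times those of \<open>b\<close> in \<open>C\<close>. This makes the value of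
  \<open>trace_on\<close> independent of the basis chosen there.\<close>

lemma btrace_basis_change:
  assumes B: "independent B" "finite B" and C: "independent C" "finite C" and BC: "span B = span C"
    and f: "endo f" "\<And>b. b \<in> span B \<Longrightarrow> f b \<in> span B"
  shows "btrace B f = btrace C f"
proof -
  have fB: "f b \<in> span B" if "b \<in> B" for b using f(2) span_base that by blast
  have fC: "f c \<in> span B" if "c \<in> C" for c using f(2) span_base that BC by blast
  have "btrace B f = (\<Sum>b\<in>B. \<Sum>c\<in>C. representation C b c * representation B (f c) b)"
    unfolding btrace_def
  proof (intro sum.cong refl)
    fix b assume b: "b \<in> B"
    have "f b = f (\<Sum>c\<in>C. representation C b c *s c)"
      using sum_representation_eq[OF C(1) _ C(2) order_refl, of b] b BC span_base by force
    also have "\<dots> = (\<Sum>c\<in>C. representation C b c *s f c)"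
      by (simp add: endo_sum[OF f(1)] endo_scale[OF f(1)])
    finally have "representation B (f b) b = representation B (\<Sum>c\<in>C. representation C b c *s f c) b"
      by simp
    also have "\<dots> = (\<Sum>c\<in>C. representation C b c * representation B (f c) b)"
      using fC by (subst representation_sum[OF B(1)]) (auto intro: span_scale simp: representation_scale[OF B(1)])
    finally show "representation B (f b) b = (\<Sum>c\<in>C. representation C b c * representation B (f c) b)" .
  qed
  also have "\<dots> = (\<Sum>c\<in>C. \<Sum>b\<in>B. representation B (f c) b * representation C b c)"
    by (subst sum.swap) (simp add: mult.commute)
  also have "\<dots> = btrace C f"
    unfolding btrace_def
  proof (intro sum.cong refl)
    fix c assume c: "c \<in> C"
    have "f c = (\<Sum>b\<in>B. representation B (f c) b *s b)"
      using sum_representation_eq[OF B(1) fC[OF c] B(2) order_refl] by simp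
    then have "representation C (f c) c = representation C (\<Sum>b\<in>B. representation B (f c) b *s b) c"
      by simp
    also have "\<dots> = (\<Sum>b\<in>B. representation B (f c) b * representation C b c)"
      using BC span_base[of _ B]
      by (subst representation_sum[OF C(1)]) (auto intro: span_scale simp: representation_scale[OF C(1)])
    finally show "(\<Sum>b\<in>B. representation B (f c) b * representation C b c) = representation C (f c) c"
      by simp
  qed
  finally show ?thesis .
qed

lemma btrace_add:
  assumes "independent B" "\<And>b. b \<in> B \<Longrightarrow> f b \<in> span B" "\<And>b. b \<in> B \<Longrightarrow> g b \<in> span B"
  shows "btrace B (\<lambda>x. f x + g x) = btrace B f + btrace B g"
  by (simp add: btrace_def representation_add assms sum.distrib)

lemma btrace_diff:
  assumes "independent B" "\<And>b. b \<in> B \<Longrightarrow> f b \<in> span B" "\<And>b. b \<in> B \<Longrightarrow> g b \<in> span B"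
  shows "btrace B (\<lambda>x. f x - g x) = btrace B f - btrace B g"
  by (simp add: btrace_def representation_diff assms sum_subtractf)

lemma btrace_scale:
  assumes "independent B" "\<And>b. b \<in> B \<Longrightarrow> f b \<in> span B"
  shows "btrace B (\<lambda>x. c *s f x) = c * btrace B f"
  by (simp add: btrace_def representation_scale assms sum_distrib_left)

lemma btrace_diagonal:
  assumes "independent B" "\<And>b. b \<in> B \<Longrightarrow> f b = d b *s b"
  shows "btrace B f = sum d B"
  unfolding btrace_def
  by (intro sum.cong refl) (simp add: assms representation_scale representation_basis span_base)

text \<open>The ambient space may have infinite dimension, where \<open>dim\<close> carries no
  information; the finite set \<open>B\<close> around \<open>W2\<close> keeps all bases
  finite.\<close>

lemma subspace_eq_of_dim_le:
  assumes W: "subspace W1" "W1 \<subseteq> W2" and B: "finite B" "W2 \<subseteq> span B" and d: "dim W2 \<le> dim W1"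
  shows "W1 = W2"
proof -
  obtain C1 where C1: "C1 \<subseteq> W1" "independent C1" "W1 \<subseteq> span C1" "card C1 = dim W1"
    using basis_exists by blast
  obtain C2 where C2: "C1 \<subseteq> C2" "C2 \<subseteq> W2" "independent C2" "W2 \<subseteq> span C2"
    using maximal_independent_subset_extend[of C1 W2] C1 W(2) by (metis order_trans)
  have fin: "finite C2" using independent_span_bound[OF B(1) C2(3)] C2(2) B(2) by auto
  have "card C2 = dim W2" using basis_card_eq_dim C2 by blast
  then have "C1 = C2" using C1(4) C2(1) d fin by (metis card_seteq)
  then show ?thesis using C2(4) C1(1) W span_minimal[of C1 W1] by auto
qed

text \<open>A nonzero stable subspace of least dimension is killed by every \<open>f\<close>: the
  kernel of \<open>f\<close> in it is nonzero by nilpotency and stable by commutativity, hence is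
  the whole of it. Minimality of the dimension copes with infinite families
  \<open>F\<close>.\<close>

lemma commuting_nilpotents_common_kernel:
  assumes N: "subspace N" "N \<subseteq> span B" "finite B" "n0 \<in> N" "n0 \<noteq> 0"
    and lin: "\<And>f. f \<in> F \<Longrightarrow> endo f"
    and inv: "\<And>f n. f \<in> F \<Longrightarrow> n \<in> N \<Longrightarrow> f n \<in> N"
    and comm: "\<And>f g n. f \<in> F \<Longrightarrow> g \<in> F \<Longrightarrow> n \<in> N \<Longrightarrow> f (g n) = g (f n)"
    and nil: "\<And>f n. f \<in> F \<Longrightarrow> n \<in> N \<Longrightarrow> \<exists>r. (f ^^ r) n = 0"
  shows "\<exists>n\<in>N. n \<noteq> 0 \<and> (\<forall>f\<in>F. f n = 0)"
proof -
  define P where "P W \<longleftrightarrow> subspace W \<and> W \<subseteq> N \<and> (\<exists>x\<in>W. x \<noteq> 0) \<and> (\<forall>f\<in>F. \<forall>x\<in>W. f x \<in> W)" for W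
  have "P N" unfolding P_def using N inv by blast
  then obtain W where W: "P W" "\<And>W'. P W' \<Longrightarrow> dim W \<le> dim W'"
    using ex_has_least_nat[of P N dim] by blast
  have "f x = 0" if f: "f \<in> F" and x: "x \<in> W" for f x
  proof -
    let ?K = "{x \<in> W. f x = 0}"
    have "subspace ?K" using W(1) lin[OF f]
      by (auto simp: P_def subspace_def endo_zero endo_add endo_scale)
    moreover have "\<exists>y\<in>?K. y \<noteq> 0"
    proof -
      obtain w where w: "w \<in> W" "w \<noteq> 0" using W(1) P_def by auto
      have inW: "(f ^^ k) w \<in> W" for k using w W(1) f by (induction k) (auto simp: P_def)
      obtain r where r: "(f ^^ r) w = 0" using nil[OF f, of w] w W(1) P_def by blast
      \<comment> \<open>The last nonzero vector among w, f w, f (f w), ... lies in the kernel of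
        f.\<close>
      define m where "m = (LEAST m. (f ^^ m) w = 0)"
      have m: "(f ^^ m) w = 0" unfolding m_def using r by (rule LeastI)
      have "m \<noteq> 0" using m w(2) by (metis funpow_0)
      then obtain l where l: "m = Suc l" using not0_implies_Suc by blast
      have "(f ^^ l) w \<noteq> 0" using not_less_Least[of l "\<lambda>m. (f ^^ m) w = 0"] l m_def by auto
      then show ?thesis using m l inW by auto
    qed
    moreover have "g y \<in> ?K" if "g \<in> F" "y \<in> ?K" for g y
      using that f comm[OF f that(1), of y] W(1) endo_zero[OF lin[OF that(1)]] by (auto simp: P_def)
    ultimately have "P ?K" using W(1) by (auto simp: P_def)
    then have "dim W \<le> dim ?K" using W(2) by blast
    then have "?K = W"
      using \<open>subspace ?K\<close> N W(1) by (intro subspace_eq_of_dim_le[of _ _ B]) (auto simp: P_def)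
    then show ?thesis using x by blast
  qed
  then show ?thesis using W(1) unfolding P_def by blast
qed

text \<open>The substitute for the space U(n^-) T. The parameter \<open>act\<close> allows elements
  of a Lie algebra to act through the bracket, and sets of operators to act through the
  identity.\<close>

definition lowering_closure :: "('l \<Rightarrow> 'b \<Rightarrow> 'b) \<Rightarrow> 'l set \<Rightarrow> 'b set \<Rightarrow> 'b set" where
  "lowering_closure act Nm T = \<Inter>{W. subspace W \<and> T \<subseteq> W \<and> (\<forall>y\<in>Nm. \<forall>v\<in>W. act y v \<in> W)}"

lemma subspace_lowering_closure: "subspace (lowering_closure act Nm T)"
  unfolding lowering_closure_def by (rule subspace_Inter) auto

lemma lowering_closure_base: "x \<in> T \<Longrightarrow> x \<in> lowering_closure act Nm T"
  unfolding lowering_closure_def by auto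

lemma lowering_closure_act:
  "y \<in> Nm \<Longrightarrow> v \<in> lowering_closure act Nm T \<Longrightarrow> act y v \<in> lowering_closure act Nm T"
  unfolding lowering_closure_def by auto

lemma lowering_closure_minimal:
  "subspace W \<Longrightarrow> T \<subseteq> W \<Longrightarrow> (\<And>y v. y \<in> Nm \<Longrightarrow> v \<in> W \<Longrightarrow> act y v \<in> W) \<Longrightarrow> lowering_closure act Nm T \<subseteq> W"
  unfolding lowering_closure_def by (rule Inter_lower) auto

text \<open>The substitute for the triangular decomposition of the enveloping algebra.\<close>

lemma lowering_closure_stable:
  assumes lin: "\<And>x. x \<in> Nm \<union> Bp \<Longrightarrow> endo (act x)"
    and base: "\<And>x t. x \<in> Bp \<Longrightarrow> t \<in> T \<Longrightarrow> act x t \<in> lowering_closure act Nm T"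
    and comm: "\<And>x y v. x \<in> Bp \<Longrightarrow> y \<in> Nm \<Longrightarrow> v \<in> lowering_closure act Nm T \<Longrightarrow>
      act x (act y v) - act y (act x v) \<in> span {act z v | z. z \<in> Nm \<union> Bp}"
    and x: "x \<in> Bp" and v: "v \<in> lowering_closure act Nm T"
  shows "act x v \<in> lowering_closure act Nm T"
proof -
  let ?M = "lowering_closure act Nm T"
  let ?Q = "{v \<in> ?M. \<forall>x\<in>Bp. act x v \<in> ?M}"
  note sM = subspace_lowering_closure[of act Nm T]
  have "?M \<subseteq> ?Q"
  proof (rule lowering_closure_minimal)
    show "subspace ?Q" using sM lin
      by (auto simp: subspace_def endo_zero endo_add endo_scale)
    show "T \<subseteq> ?Q" using base lowering_closure_base by blast
    fix y v assume y: "y \<in> Nm" and v: "v \<in> ?Q"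
    have "act x (act y v) \<in> ?M" if x: "x \<in> Bp" for x
    proof -
      \<comment> \<open>The commutator applied to \<open>v\<close> is a combination of lowering and
        raising operators applied to the same \<open>v\<close>, and for \<open>v\<close> in
        \<open>?Q\<close> both kinds stay in \<open>?M\<close>.\<close>
      have "{act z v | z. z \<in> Nm \<union> Bp} \<subseteq> ?M" using v lowering_closure_act by fastforce
      then have "span {act z v | z. z \<in> Nm \<union> Bp} \<subseteq> ?M" using span_minimal sM by blast
      then have "act x (act y v) - act y (act x v) \<in> ?M" using comm[OF x y, of v] v by blast
      moreover have "act y (act x v) \<in> ?M" using v x by (intro lowering_closure_act[OF y]) simp
      ultimately have "act x (act y v) - act y (act x v) + act y (act x v) \<in> ?M"
        by (rule subspace_add[OF sM])
      then show ?thesis by simp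
    qed
    then show "act y v \<in> ?Q" using v lowering_closure_act[OF y] by simp
  qed
  then show ?thesis using x v by blast
qed

end

subsection \<open>Eigenvalues and dual bases\<close>

definition poly_endo :: "(complex \<Rightarrow> 'v \<Rightarrow> 'v) \<Rightarrow> ('v \<Rightarrow> 'v) \<Rightarrow> complex poly \<Rightarrow> 'v \<Rightarrow> ('v::ab_group_add)" where
  "poly_endo s T p x = (\<Sum>i\<le>degree p. s (coeff p i) ((T ^^ i) x))"

context
  fixes s :: "complex \<Rightarrow> 'v \<Rightarrow> ('v::ab_group_add)"
  assumes vs: "vector_space s"
begin

interpretation complex_vector_space s
  using vs by (simp add: complex_vector_space_def)

lemma poly_endo_eq: "degree p \<le> n \<Longrightarrow> poly_endo s T p x = (\<Sum>i\<le>n. s (coeff p i) ((T ^^ i) x))"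
  unfolding poly_endo_def by (rule sum.mono_neutral_left) (auto simp: coeff_eq_0)

text \<open>The coefficients of the product are those of \<open>q\<close> shifted by one minus
  \<open>r\<close> times those of \<open>q\<close>.\<close>

lemma poly_endo_root:
  assumes T: "endo T"
  shows "poly_endo s T ([:- r, 1:] * q) x = poly_endo s T q (T x - s r x)"
proof -
  have d: "degree ([:- r, 1:] * q) \<le> Suc (degree q)"
    using degree_mult_le[of "[:- r, 1:]" q] by simp
  have c: "coeff ([:- r, 1:] * q) i = (if i = 0 then 0 else coeff q (i - 1)) - r * coeff q i" for i
    by (cases i) auto
  have "poly_endo s T ([:- r, 1:] * q) x =
      (\<Sum>i\<le>Suc (degree q). s (if i = 0 then 0 else coeff q (i - 1)) ((T ^^ i) x))
      - (\<Sum>i\<le>Suc (degree q). s (r * coeff q i) ((T ^^ i) x))"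
    by (simp only: poly_endo_eq[OF d] c scale_left_diff_distrib sum_subtractf)
  also have "(\<Sum>i\<le>Suc (degree q). s (if i = 0 then 0 else coeff q (i - 1)) ((T ^^ i) x))
      = (\<Sum>i\<le>degree q. s (coeff q i) ((T ^^ Suc i) x))"
    by (subst sum.atMost_Suc_shift) simp
  also have "(\<Sum>i\<le>Suc (degree q). s (r * coeff q i) ((T ^^ i) x))
      = (\<Sum>i\<le>degree q. s (r * coeff q i) ((T ^^ i) x))"
    by (simp add: coeff_eq_0)
  finally show ?thesis
    unfolding poly_endo_def sum_subtractf[symmetric]
    by (simp add: endo_diff[OF endo_funpow[OF T]] endo_scale[OF endo_funpow[OF T]]
        scale_right_diff_distrib funpow_swap1 mult.commute)
qed

text \<open>Induction on the degree. For a root r of p, either T x = r x, or T x - r x is a nonzero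
  vector killed by the cofactor.\<close>

lemma eigenvector_of_poly:
  assumes T: "endo T"
  shows "p \<noteq> 0 \<Longrightarrow> x \<noteq> 0 \<Longrightarrow> poly_endo s T p x = 0 \<Longrightarrow> \<exists>l y. y \<noteq> 0 \<and> T y = s l y"
proof (induction "degree p" arbitrary: p x)
  case 0
  then have "s (coeff p 0) x = 0" by (simp add: poly_endo_def)
  moreover have "coeff p 0 \<noteq> 0" using 0 by (metis leading_coeff_neq_0)
  ultimately show ?case using 0 by simp
next
  case (Suc n)
  then have "\<not> constant (poly p)" by (simp add: constant_degree)
  then obtain r where "poly p r = 0" using fundamental_theorem_of_algebra by blast
  then obtain q where q: "p = [:- r, 1:] * q" using poly_eq_0_iff_dvd by (metis dvdE)
  have q0: "q \<noteq> 0" using q Suc.prems by auto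
  have dq: "n = degree q" using Suc.hyps(2) q0 unfolding q by (subst (asm) degree_mult_eq) auto
  show ?case
  proof (cases "T x - s r x = 0")
    case True
    then show ?thesis using Suc.prems(2) by (intro exI[of _ r] exI[of _ x]) simp
  next
    case False
    show ?thesis
      using Suc.hyps(1)[OF dq q0 False] Suc.prems(3) unfolding q poly_endo_root[OF T] by blast
  qed
qed

text \<open>More iterates of x than the size of a spanning set are linearly dependent, and the
  relation is a polynomial in T that kills x.\<close>

lemma eigenvector_exists:
  assumes B: "finite B" "span B = UNIV" and T: "endo T" and x: "(x::'v) \<noteq> 0"
  shows "\<exists>l y. y \<noteq> 0 \<and> T y = s l y"
proof -
  let ?n = "card B"
  have "\<exists>c. (\<exists>i\<le>?n. c i \<noteq> 0) \<and> (\<Sum>i\<le>?n. s (c i) ((T ^^ i) x)) = 0"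
  proof (cases "inj_on (\<lambda>i. (T ^^ i) x) {..?n}")
    case True
    let ?S = "(\<lambda>i. (T ^^ i) x) ` {..?n}"
    have "card ?S = Suc ?n" using card_image[OF True] by simp
    then have "dependent ?S"
      using independent_span_bound[OF B(1), of ?S] B(2) by auto
    then obtain u where u: "\<exists>v\<in>?S. u v \<noteq> 0" "(\<Sum>v\<in>?S. s (u v) v) = 0"
      using dependent_finite[of ?S] by auto
    then have "(\<Sum>i\<le>?n. s (u ((T ^^ i) x)) ((T ^^ i) x)) = 0"
      by (simp add: sum.reindex[OF True])
    with u(1) show ?thesis by (intro exI[of _ "\<lambda>i. u ((T ^^ i) x)"]) auto
  next
    \<comment> \<open>Coinciding iterates need their own relation, because \<open>dependent\<close>
      is a property of the set of vectors and does not see repetitions.\<close>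
    case False
    then obtain i j where ij: "i \<le> ?n" "j \<le> ?n" "i \<noteq> j" "(T ^^ i) x = (T ^^ j) x"
      by (auto simp: inj_on_def)
    let ?c = "\<lambda>k. (if k = i then 1 else 0) - (if k = j then 1 else (0::complex))"
    have "(\<Sum>k\<le>?n. s (?c k) ((T ^^ k) x)) = (\<Sum>k\<le>?n. if k = i then (T ^^ i) x else 0)
        - (\<Sum>k\<le>?n. if k = j then (T ^^ j) x else 0)"
      unfolding sum_subtractf[symmetric] by (intro sum.cong) (auto simp: scale_left_diff_distrib)
    also have "\<dots> = 0" using ij by (simp add: sum.delta)
    finally show ?thesis using ij by (intro exI[of _ ?c]) auto
  qed
  then obtain c i where c: "i \<le> ?n" "c i \<noteq> 0" "(\<Sum>i\<le>?n. s (c i) ((T ^^ i) x)) = 0" by blast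
  define p where "p = Poly (map c [0..<Suc ?n])"
  have cp: "coeff p k = (if k \<le> ?n then c k else 0)" for k
    by (auto simp: p_def nth_default_def nth_append simp del: upt_Suc)
  have "p \<noteq> 0" using c(1,2) cp[of i] by auto
  moreover have "degree p \<le> ?n" by (rule degree_le) (simp add: cp)
  then have "poly_endo s T p x = 0" using c(3) by (simp add: poly_endo_eq cp)
  ultimately show ?thesis using eigenvector_of_poly[OF T] x by blast
qed

text \<open>Induction on the number of functionals: the vectors dual to the old ones are corrected
  by a vector on which the old functionals vanish and the new one does not. Linearity and
  independence are considered on \<open>H\<close> only, as for elements of
  \<open>dual\<close>.\<close>

lemma dual_basis_exists:
  assumes "finite B" and H: "subspace H"
    and add: "\<And>f x y. f \<in> B \<Longrightarrow> x \<in> H \<Longrightarrow> y \<in> H \<Longrightarrow> f (x + y) = f x + f y"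
    and scl: "\<And>f c x. f \<in> B \<Longrightarrow> x \<in> H \<Longrightarrow> f (s c x) = c * f x"
    and ind: "\<And>c. (\<And>h. h \<in> H \<Longrightarrow> (\<Sum>f\<in>B. c f * f h) = 0) \<Longrightarrow> \<forall>f\<in>B. c f = (0::complex)"
  shows "\<exists>h\<in>H. \<forall>f\<in>B. f h = t f"
  using assms(1) add scl ind
proof (induction B arbitrary: t rule: finite_induct)
  case empty
  then show ?case using H subspace_0 by blast
next
  case (insert g B)
  have IH: "\<exists>h\<in>H. \<forall>f\<in>B. f h = t f" for t
  proof (rule insert.IH)
    fix c assume c: "\<And>h. h \<in> H \<Longrightarrow> (\<Sum>f\<in>B. c f * f h) = 0"
    have "\<forall>f\<in>insert g B. (if f = g then 0 else c f) = 0"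
    proof (rule insert.prems(3))
      fix h assume "h \<in> H"
      show "(\<Sum>f\<in>insert g B. (if f = g then 0 else c f) * f h) = 0"
        proof -
        have "(\<Sum>f\<in>B. (if f = g then 0 else c f) * f h) = (\<Sum>f\<in>B. c f * f h)"
          using insert.hyps by (intro sum.cong) auto
        then show ?thesis using c[OF \<open>h \<in> H\<close>] insert.hyps by simp
      qed
    qed
    then show "\<forall>f\<in>B. c f = 0" using insert.hyps by (metis insertCI)
  qed (use insert.prems in auto)
  obtain u where u: "\<And>b. b \<in> B \<Longrightarrow> u b \<in> H \<and> (\<forall>f\<in>B. f (u b) = (if f = b then 1 else 0))"
    using IH[of "\<lambda>f. if f = b then 1 else 0" for b] by metis
  note fadd = insert.prems(1) and fscl = insert.prems(2)
  have sumH: "(\<Sum>b\<in>B. s (b h) (u b)) \<in> H" for h using u H by (intro subspace_sum) (auto intro: subspace_scale)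
  have fsum: "f (\<Sum>b\<in>A. s (b h) (u b)) = (\<Sum>b\<in>A. b h * f (u b))"
    if f: "f \<in> insert g B" and A: "finite A" "A \<subseteq> B" for f h A
    using A
  proof (induction A rule: finite_induct)
    case empty
    then show ?case using insert.prems(2)[OF f, of 0 0] H subspace_0 by simp
  next
    case (insert b A)
    have "(\<Sum>b\<in>A. s (b h) (u b)) \<in> H" using u H insert.prems by (intro subspace_sum) (auto intro: subspace_scale)
    then show ?case
      using insert u[of b] fadd[OF f] fscl[OF f] H by (simp add: subspace_scale)
  qed
  have "\<exists>k\<in>H. (\<forall>f\<in>B. f k = 0) \<and> g k \<noteq> 0"
  proof (rule ccontr)
    assume no: "\<not> ?thesis"
    \<comment> \<open>If \<open>g\<close> vanished on the common kernel of \<open>B\<close> in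
      \<open>H\<close>, then subtracting from h its combination of the dual vectors
      \<open>u b\<close> would give g h = \<Sum>b. b h * g (u b), a relation between
      \<open>g\<close> and \<open>B\<close>.\<close>
    let ?c = "\<lambda>f. if f = g then -1 else g (u f)"
    have "\<forall>f\<in>insert g B. ?c f = 0"
    proof (rule insert.prems(3))
      fix h assume h: "h \<in> H"
      let ?k = "h + s (-1) (\<Sum>b\<in>B. s (b h) (u b))"
      have k: "?k \<in> H" using h sumH H by (simp add: subspace_diff)
      have fk: "f ?k = f h - (\<Sum>b\<in>B. b h * f (u b))" if "f \<in> insert g B" for f
        using insert.prems(1)[OF that h, of "s (-1) (\<Sum>b\<in>B. s (b h) (u b))"] sumH[of h] H
          insert.prems(2)[OF that sumH, of "-1" h] fsum[OF that insert.hyps(1) order_refl, of h]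
        by (simp add: subspace_neg)
      have "f ?k = 0" if "f \<in> B" for f
      proof -
        have "(\<Sum>b\<in>B. b h * f (u b)) = (\<Sum>b\<in>B. if b = f then f h else 0)"
          by (intro sum.cong refl) (simp add: u that)
        then show ?thesis using fk[of f] that insert.hyps by (simp add: sum.delta)
      qed
      then have "g ?k = 0" using no k by blast
      then have "g h = (\<Sum>b\<in>B. b h * g (u b))" using fk[of g] by simp
      moreover have "(\<Sum>f\<in>B. ?c f * f h) = (\<Sum>b\<in>B. b h * g (u b))"
        using insert.hyps by (intro sum.cong) auto
      ultimately show "(\<Sum>f\<in>insert g B. ?c f * f h) = 0" using insert.hyps by simp
    qed
    then show False by auto
  qed
  then obtain k where k: "k \<in> H" "\<And>f. f \<in> B \<Longrightarrow> f k = 0" "g k \<noteq> 0" by blast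
  obtain h where h: "h \<in> H" "\<And>f. f \<in> B \<Longrightarrow> f h = t f" using IH by blast
  let ?r = "(t g - g h) / g k"
  have "h + s ?r k \<in> H" using h k H by (simp add: subspace_add subspace_scale)
  moreover have e: "f (h + s ?r k) = f h + ?r * f k" if "f \<in> insert g B" for f
    using insert.prems(1)[OF that h(1), of "s ?r k"] insert.prems(2)[OF that k(1)] k(1) H
    by (simp add: subspace_scale)
  have "\<forall>f\<in>insert g B. f (h + s ?r k) = t f"
  proof
    fix f assume f: "f \<in> insert g B"
    show "f (h + s ?r k) = t f" unfolding e[OF f] using f h(2) k(2,3) by (cases "f = g") auto
  qed
  ultimately show ?case by blast
qed

end

section \<open>Lie tori\<close>

locale lie_torus_data =
  fixes D :: "('g::ab_group_add, 'n::finite) multiloop"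
  assumes torus: "lie_torus D"
begin

abbreviation sc :: "complex \<Rightarrow> 'g \<Rightarrow> 'g" where "sc \<equiv> scal D"
abbreviation br :: "'g \<Rightarrow> 'g \<Rightarrow> 'g" where "br \<equiv> brac D"
abbreviation H :: "'g set" where "H \<equiv> csub D"
abbreviation G :: "'g set" where "G \<equiv> g00 D"
abbreviation zero_wt :: "'g \<Rightarrow> complex" where "zero_wt \<equiv> \<lambda>_. 0"
abbreviation dualH :: "('g \<Rightarrow> complex) set" where "dualH \<equiv> dual sc H"

section \<open>The axioms unpacked\<close>

lemma data: "multiloop_data D" and simpleG: "simple_lie sc br G" and cartan: "cartan_subalgebra sc br G H"
  and simples: "simple_roots (g00_roots D) (simples D)"
  using torus by (auto simp: lie_torus_def)

lemma lie: "lie_algebra sc br" and findim: "fin_dim sc UNIV" and simpleg: "simple_lie sc br UNIV"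
  and formD: "nondeg_invariant_form sc br (form D)"
  and autD: "lie_automorphism sc br (aut D i)"
  and aut_comm: "aut D i (aut D j x) = aut D j (aut D i x)"
  and ord_pos: "ord D i > 0"
  and aut_ord: "aut D i ^^ ord D i = id"
  and root_ord: "rootu D i ^ ord D i = 1"
  and root_prim: "0 < r \<Longrightarrow> r < ord D i \<Longrightarrow> rootu D i ^ r \<noteq> 1"
  using data by (auto simp: multiloop_data_def fun_eq_iff)

sublocale complex_vector_space "scal D"
  using lie by (simp add: lie_algebra_def complex_vector_space_def)

lemma br_endo: "endo (br x)" and br_endo_left: "endo (\<lambda>x. br x y)"
  and br_self [simp]: "br x x = 0"
  using lie by (auto simp: lie_algebra_def)

lemmas br_add = endo_add[OF br_endo] and br_add_left = endo_add[OF br_endo_left]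
  and br_scale = endo_scale[OF br_endo] and br_scale_left = endo_scale[OF br_endo_left]
  and br_zero [simp] = endo_zero[OF br_endo] and br_zero_left [simp] = endo_zero[OF br_endo_left]
  and br_diff = endo_diff[OF br_endo] and br_diff_left = endo_diff[OF br_endo_left]
  and br_neg = endo_neg[OF br_endo] and br_neg_left = endo_neg[OF br_endo_left]

lemma br_skew: "br y x = - br x y"
proof -
  have "br (x + y) (x + y) = br x x + br y x + (br x y + br y y)"
    by (simp only: br_add br_add_left)
  then have "br x y + br y x = 0" by (simp add: add.commute)
  then show ?thesis by (metis add.inverse_unique)
qed

lemma jacobi: "br x (br y z) = br (br x y) z + br y (br x z)"
proof -
  have "br x (br y z) + br y (br z x) + br z (br x y) = 0"
    using lie by (auto simp: lie_algebra_def)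
  moreover have "br y (br z x) = - br y (br x z)" by (simp add: br_skew[of z x] br_neg)
  moreover have "br z (br x y) = - br (br x y) z" by (rule br_skew)
  ultimately show ?thesis by (simp add: algebra_simps)
qed

section \<open>The grading by eigenvalues of the automorphisms\<close>

lemma rootu_nonzero: "rootu D i \<noteq> 0"
  using root_ord[of i] ord_pos[of i] by (metis power_eq_0_iff zero_neq_one zero_power)

lemma rootu_powi_eq_1_iff: "rootu D i powi a = 1 \<longleftrightarrow> int (ord D i) dvd a"
proof -
  let ?m = "int (ord D i)"
  have m: "rootu D i powi ?m = 1" using root_ord[of i] by simp
  have "rootu D i powi a = rootu D i powi (?m * (a div ?m) + a mod ?m)" by simp
  also have "\<dots> = rootu D i powi (?m * (a div ?m)) * rootu D i powi (a mod ?m)"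
    by (rule power_int_add) (simp add: rootu_nonzero)
  also have "\<dots> = rootu D i powi (a mod ?m)" unfolding power_int_mult m by simp
  also have "\<dots> = rootu D i ^ nat (a mod ?m)"
    using ord_pos[of i] by (simp add: power_int_def)
  finally have e: "rootu D i powi a = rootu D i ^ nat (a mod ?m)" .
  show ?thesis
  proof
    assume "rootu D i powi a = 1"
    then have "rootu D i ^ nat (a mod ?m) = 1" using e by simp
    moreover have "nat (a mod ?m) < ord D i" using ord_pos[of i] by (simp add: nat_less_iff)
    ultimately have "\<not> nat (a mod ?m) > 0" using root_prim by blast
    then have "a mod ?m = 0" using ord_pos[of i] pos_mod_sign[of ?m a] by linarith
    then show "?m dvd a" by presburger
  next
    assume "?m dvd a" then show "rootu D i powi a = 1" using e by simp
  qed
qed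

lemma rootu_powi_cong: "rootu D i powi a = rootu D i powi b \<longleftrightarrow> int (ord D i) dvd a - b"
proof -
  have "rootu D i powi a = rootu D i powi b * rootu D i powi (a - b)"
    using rootu_nonzero[of i] by (simp flip: power_int_add)
  then show ?thesis
    using rootu_powi_eq_1_iff[of i "a - b"] rootu_nonzero[of i] by (auto simp: power_int_eq_0_iff)
qed

lemma aut_endo: "endo (aut D i)" and aut_br: "aut D i (br x y) = br (aut D i x) (aut D i y)"
  using autD[of i] by (auto simp: lie_automorphism_def)

text \<open>The eigenvalue of the automorphism \<open>i\<close> in degree (k0, k). It is
  multiplicative in the degree, which makes the graded pieces compatible with the bracket.\<close>

abbreviation charm :: "int \<Rightarrow> int^'n \<Rightarrow> 'n option \<Rightarrow> complex" where
  "charm k0 k \<equiv> \<lambda>i. rootu D i powi multidegree k0 k i"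

lemma multidegree_add: "multidegree (k0 + l0) (k + l) i = multidegree k0 k i + multidegree l0 l i"
  by (cases i) (auto simp: multidegree_def)

lemma charm_add: "charm (k0 + l0) (k + l) i = charm k0 k i * charm l0 l i"
  using rootu_nonzero by (simp add: multidegree_add power_int_add)

lemma gspaceI: "(\<And>i. aut D i X = sc (charm k0 k i) X) \<Longrightarrow> X \<in> gspace D k0 k"
  and gspaceD: "X \<in> gspace D k0 k \<Longrightarrow> aut D i X = sc (charm k0 k i) X"
  by (auto simp: gspace_def)

lemma subspace_gspace: "subspace (gspace D k0 k)"
  unfolding gspace_def subspace_def using aut_endo
  by (auto simp: endo_zero endo_add endo_scale scale_right_distrib scale_left_commute)

lemma br_gspace: "X \<in> gspace D k0 k \<Longrightarrow> Y \<in> gspace D l0 l \<Longrightarrow> br X Y \<in> gspace D (k0 + l0) (k + l)"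
  by (rule gspaceI) (simp add: aut_br gspaceD br_scale br_scale_left charm_add mult.commute)

lemma gspace_periodic:
  assumes "int (ord D None) dvd k0 - l0" "\<And>i. int (ord D (Some i)) dvd k $ i - l $ i"
  shows "gspace D k0 k = gspace D l0 l"
proof -
  have "charm k0 k i = charm l0 l i" for i
    using assms by (cases i) (auto simp: rootu_powi_cong multidegree_def)
  then show ?thesis by (simp add: gspace_def)
qed

section \<open>Weight spaces of the Cartan subalgebra\<close>

abbreviation wtv :: "('g \<Rightarrow> complex) \<Rightarrow> 'g set" where
  "wtv \<alpha> \<equiv> joint_eigenspace H br \<alpha>"

lemma wtvD: "x \<in> wtv \<alpha> \<Longrightarrow> h \<in> H \<Longrightarrow> br h x = sc (\<alpha> h) x"
  by (simp add: joint_eigenspace_def)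

lemma wt_space_eq: "wt_space sc br H W \<alpha> = W \<inter> wtv \<alpha>"
  by (auto simp: wt_space_def joint_eigenspace_def)

lemma gspace_wt_eq: "gspace_wt D k0 k \<alpha> = gspace D k0 k \<inter> wtv \<alpha>"
  by (simp add: gspace_wt_def wt_space_eq)

lemma subspace_wtv: "subspace (wtv \<alpha>)"
  by (rule subspace_joint_eigenspace[OF br_endo])

lemma br_wtv: "X \<in> wtv \<alpha> \<Longrightarrow> Y \<in> wtv \<beta> \<Longrightarrow> br X Y \<in> wtv (\<lambda>h. \<alpha> h + \<beta> h)"
  by (simp add: joint_eigenspace_def jacobi br_scale br_scale_left scale_left_distrib)

lemma br_gspace_wt: "X \<in> gspace_wt D k0 k \<alpha> \<Longrightarrow> Y \<in> gspace_wt D l0 l \<beta> \<Longrightarrow>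
    br X Y \<in> gspace_wt D (k0 + l0) (k + l) (\<lambda>h. \<alpha> h + \<beta> h)"
  by (simp add: gspace_wt_eq br_gspace br_wtv)

lemma dual_zero: "zero_wt \<in> dualH"
  and dual_add: "\<alpha> \<in> dualH \<Longrightarrow> \<beta> \<in> dualH \<Longrightarrow> (\<lambda>h. \<alpha> h + \<beta> h) \<in> dualH"
  and dual_neg: "\<alpha> \<in> dualH \<Longrightarrow> (\<lambda>h. - \<alpha> h) \<in> dualH"
  and dual_mult: "\<alpha> \<in> dualH \<Longrightarrow> (\<lambda>h. c * \<alpha> h) \<in> dualH"
  and dual_outside: "\<alpha> \<in> dualH \<Longrightarrow> h \<notin> H \<Longrightarrow> \<alpha> h = 0"
  by (auto simp: dual_def algebra_simps)

lemma H_sub: "H \<subseteq> G" and H_subspace: "subspace H"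
  and H_abelian: "h \<in> H \<Longrightarrow> h' \<in> H \<Longrightarrow> br h h' = 0"
  and H_max: "x \<in> G \<Longrightarrow> (\<And>h. h \<in> H \<Longrightarrow> br h x = 0) \<Longrightarrow> x \<in> H"
  and H_diag: "h \<in> H \<Longrightarrow> span {x \<in> G. \<exists>c. br h x = sc c x} = G"
  using cartan by (auto simp: cartan_subalgebra_def lie_subalgebra_def)

lemma subspace_G: "subspace G" by (rule subspace_gspace)

lemma G_br: "x \<in> G \<Longrightarrow> y \<in> G \<Longrightarrow> br x y \<in> G"
  using br_gspace[of x 0 0 y 0 0] by simp

lemma finite_basis:
  assumes "subspace W"
  obtains B where "finite B" "independent B" "span B = W"
proof -
  obtain B0 where B0: "finite B0" "span B0 = UNIV" using findim by (auto simp: fin_dim_def)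
  obtain B where B: "B \<subseteq> W" "independent B" "W \<subseteq> span B" using maximal_independent_subset by blast
  have "finite B" using independent_span_bound[OF B0(1) B(2)] B0(2) by auto
  moreover have "span B = W" using B span_minimal[OF B(1) assms] by auto
  ultimately show thesis using that B(2) by blast
qed

lemma finite_basis_within:
  assumes "subspace W" "W \<subseteq> span S" "S \<subseteq> W"
  obtains B where "finite B" "independent B" "span B = W" "B \<subseteq> S"
proof -
  obtain B0 where B0: "finite B0" "span B0 = UNIV" using findim by (auto simp: fin_dim_def)
  obtain B where B: "B \<subseteq> S" "independent B" "S \<subseteq> span B" using maximal_independent_subset by blast
  have "finite B" using independent_span_bound[OF B0(1) B(2)] B0(2) by auto
  moreover have "span B = W"
    using B assms span_minimal[of B W] span_minimal[of S "span B"] by (auto simp: subspace_span)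
  ultimately show thesis using that B by blast
qed

text \<open>Simultaneous diagonalisation, one element of \<open>H\<close> at a time: a joint
  eigenspace for \<open>E\<close> is stable under the next \<open>h\<close> because \<open>H\<close>
  is abelian, so it decomposes further into eigenvectors of \<open>h\<close>.\<close>

lemma finite_eigen_H:
  assumes "finite E" "E \<subseteq> H" "x \<in> G"
  shows "x \<in> span {y \<in> G. \<exists>ev. y \<in> joint_eigenspace E br ev}"
  using assms
proof (induction E arbitrary: x rule: finite_induct)
  case empty
  then show ?case by (intro span_base) (auto simp: joint_eigenspace_def)
next
  case (insert h E)
  have "y \<in> span {y \<in> G. \<exists>ev. y \<in> joint_eigenspace (insert h E) br ev}"
    if y: "y \<in> G" "y \<in> joint_eigenspace E br ev" for y ev
  proof -
    let ?W = "{y \<in> G. y \<in> joint_eigenspace E br ev}"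
    have W: "subspace ?W"
      using subspace_inter[OF subspace_G subspace_joint_eigenspace[of E br ev, OF br_endo]]
      by (simp add: Int_def)
    have inv: "br h w \<in> ?W" if "w \<in> ?W" for w
    proof -
      have "br e (br h w) = br h (br e w)" if "e \<in> E" for e
        using jacobi[of e h w] H_abelian[of e h] insert.prems that by auto
      then show ?thesis
        using that insert.prems H_sub G_br by (auto simp: joint_eigenspace_def br_scale)
    qed
    have "y \<in> span {w \<in> ?W. \<exists>ev. (\<forall>i. i \<notin> {h} \<longrightarrow> ev i = 0) \<and> w \<in> joint_eigenspace {h} br ev \<and>
        w \<in> span ({x \<in> G. \<exists>c. br h x = sc c x} \<inter> joint_eigenspace {h} br ev)}"
    proof (rule eigen_vectors_in_invariant[OF _ br_endo W])
      fix x assume "x \<in> {x \<in> G. \<exists>c. br h x = sc c x}"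
      then obtain c where "br h x = sc c x" by blast
      then show "\<exists>ev. (\<forall>i. i \<notin> {h} \<longrightarrow> ev i = 0) \<and> x \<in> joint_eigenspace {h} br ev"
        by (intro exI[of _ "\<lambda>i. if i = h then c else 0"]) (auto simp: joint_eigenspace_def)
    next
      show "y \<in> span {x \<in> G. \<exists>c. br h x = sc c x}" using H_diag insert.prems y by auto
    qed (use y inv in auto)
    then show ?thesis
    proof (rule span_mono[THEN subsetD, rotated], intro subsetI)
      fix w assume "w \<in> {w \<in> ?W. \<exists>ev. (\<forall>i. i \<notin> {h} \<longrightarrow> ev i = 0) \<and> w \<in> joint_eigenspace {h} br ev \<and>
        w \<in> span ({x \<in> G. \<exists>c. br h x = sc c x} \<inter> joint_eigenspace {h} br ev)}"
      then obtain ev' where w: "w \<in> G" "w \<in> joint_eigenspace E br ev" "br h w = sc (ev' h) w"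
        by (auto simp: joint_eigenspace_def)
      then have "w \<in> joint_eigenspace (insert h E) br (ev(h := ev' h))"
        using insert.hyps by (auto simp: joint_eigenspace_def)
      then show "w \<in> {y \<in> G. \<exists>ev. y \<in> joint_eigenspace (insert h E) br ev}" using w by blast
    qed
  qed
  then have "{y \<in> G. \<exists>ev. y \<in> joint_eigenspace E br ev}
      \<subseteq> span {y \<in> G. \<exists>ev. y \<in> joint_eigenspace (insert h E) br ev}" by blast
  then show ?case using insert.IH insert.prems span_minimal subspace_span by blast
qed

text \<open>The elements of \<open>H\<close> that have \<open>y\<close> as an eigenvector form a
  subspace, and the eigenvalue is linear on it. The zero vector has no definite eigenvalue and is
  assigned the weight zero.\<close>

lemma eigen_weight:
  assumes E: "span E = H" and y: "y \<in> joint_eigenspace E br ev"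
  shows "\<exists>\<alpha>\<in>dualH. y \<in> wtv \<alpha>"
proof (cases "y = 0")
  case True
  then show ?thesis using dual_zero by (intro bexI[of _ zero_wt]) (auto simp: joint_eigenspace_def)
next
  case False
  define \<alpha> where "\<alpha> h = (if h \<in> H then (THE c. br h y = sc c y) else 0)" for h
  have "\<exists>c. br h y = sc c y" if "h \<in> H" for h
  proof -
    have "subspace {h. \<exists>c. br h y = sc c y}"
    proof (rule subspaceI)
      show "0 \<in> {h. \<exists>c. br h y = sc c y}" by (auto intro: exI[of _ 0])
      show "u + v \<in> {h. \<exists>c. br h y = sc c y}"
        if "u \<in> {h. \<exists>c. br h y = sc c y}" "v \<in> {h. \<exists>c. br h y = sc c y}" for u v
        using that by (auto simp: br_add_left simp flip: scale_left_distrib)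
      show "sc c u \<in> {h. \<exists>c. br h y = sc c y}" if "u \<in> {h. \<exists>c. br h y = sc c y}" for c u
        using that by (auto simp: br_scale_left)
    qed
    moreover have "E \<subseteq> {h. \<exists>c. br h y = sc c y}" using y by (auto simp: joint_eigenspace_def)
    ultimately show ?thesis using that E span_minimal by blast
  qed
  then have a: "br h y = sc (\<alpha> h) y" if h: "h \<in> H" for h
  proof -
    obtain c where c: "br h y = sc c y" using \<open>\<And>h. h \<in> H \<Longrightarrow> \<exists>c. br h y = sc c y\<close> h by blast
    then have "(THE c. br h y = sc c y) = c" using False by (intro the_equality) auto
    then show ?thesis using c h by (simp add: \<alpha>_def)
  qed
  have "\<alpha> \<in> dualH" unfolding dual_def
  proof (intro CollectI conjI ballI allI impI)
    fix x z assume h: "x \<in> H" "z \<in> H"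
    have "sc (\<alpha> (x + z)) y = sc (\<alpha> x + \<alpha> z) y"
      using a[of x] a[of z] a[of "x + z"] h H_subspace
      by (simp add: subspace_add br_add_left scale_left_distrib)
    then show "\<alpha> (x + z) = \<alpha> x + \<alpha> z" using False by simp
  next
    fix c x assume h: "x \<in> H"
    have "sc (\<alpha> (sc c x)) y = br (sc c x) y" using a[of "sc c x"] h H_subspace by (simp add: subspace_scale)
    also have "\<dots> = sc (c * \<alpha> x) y" using a[OF h] by (simp add: br_scale_left)
    finally show "\<alpha> (sc c x) = c * \<alpha> x" using False by simp
  qed (simp add: \<alpha>_def)
  then show ?thesis using a by (auto simp: joint_eigenspace_def)
qed

abbreviation wvecs :: "'g set \<Rightarrow> 'g set" where
  "wvecs W \<equiv> {x \<in> W. \<exists>\<alpha>\<in>dualH. x \<in> wtv \<alpha>}"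

lemma G_weights: "G \<subseteq> span (wvecs G)"
proof
  fix x assume x: "x \<in> G"
  obtain E where E: "finite E" "span E = H" using finite_basis[OF H_subspace] by metis
  have "E \<subseteq> H" using E(2) span_base by blast
  then have "x \<in> span {y \<in> G. \<exists>ev. y \<in> joint_eigenspace E br ev}" using finite_eigen_H E x by blast
  moreover have "{y \<in> G. \<exists>ev. y \<in> joint_eigenspace E br ev} \<subseteq> wvecs G"
    using eigen_weight[OF E(2)] by blast
  ultimately show "x \<in> span (wvecs G)" using span_mono by blast
qed

section \<open>Weight decomposition of the graded pieces\<close>

lemma submodule_subspace: "submodule G (adjoint_module sc br W) U \<Longrightarrow>
    subspace U \<and> U \<subseteq> W \<and> (\<forall>x\<in>G. \<forall>u\<in>U. br x u \<in> U)"
  by (auto simp: submodule_def msubspace_def adjoint_module_def subspace_def)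

lemma subspace_submodule: "subspace U \<Longrightarrow> U \<subseteq> W \<Longrightarrow> (\<And>x u. x \<in> G \<Longrightarrow> u \<in> U \<Longrightarrow> br x u \<in> U) \<Longrightarrow>
    submodule G (adjoint_module sc br W) U"
  by (auto simp: submodule_def msubspace_def adjoint_module_def subspace_def)

text \<open>The nontrivial summand of a graded piece, with irreducibility expressed by subspaces of
  g instead of module records. That it is nonzero is part of
  \<open>has_highest_weight\<close>.\<close>

definition constituent :: "'g set \<Rightarrow> ('g \<Rightarrow> complex) \<Rightarrow> bool" where
  "constituent V lam \<longleftrightarrow> subspace V \<and> (\<forall>x\<in>G. \<forall>u\<in>V. br x u \<in> V) \<and>
     (\<forall>S. subspace S \<longrightarrow> S \<subseteq> V \<longrightarrow> (\<forall>x\<in>G. \<forall>u\<in>S. br x u \<in> S) \<longrightarrow> S = {0} \<or> S = V) \<and>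
     lam \<in> torus_weights D \<and> has_highest_weight D V lam"

lemma gspace_constituent:
  obtains U V where "subspace U" "subspace V" "U \<subseteq> gspace D k0 k" "V \<subseteq> gspace D k0 k"
    "\<And>x. x \<in> gspace D k0 k \<Longrightarrow> \<exists>u\<in>U. \<exists>v\<in>V. x = u + v"
    "\<And>x u. x \<in> G \<Longrightarrow> u \<in> U \<Longrightarrow> br x u = 0" "V = {0} \<or> (\<exists>lam. constituent V lam)"
proof -
  obtain U V where UV0: "submodule G (adjoint_module sc br (gspace D k0 k)) U \<and>
    submodule G (adjoint_module sc br (gspace D k0 k)) V \<and>
    U \<inter> V = {0} \<and> {u + v | u v. u \<in> U \<and> v \<in> V} = gspace D k0 k \<and>
    (\<forall>x\<in>G. \<forall>u\<in>U. br x u = 0) \<and>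
    (V = {0} \<or> irreducible_module G (adjoint_module sc br V) \<and>
      (\<exists>lam\<in>torus_weights D. has_highest_weight D V lam))"
    using torus[unfolded lie_torus_def, THEN conjunct2, THEN conjunct2, THEN conjunct2, THEN conjunct2,
        THEN spec, THEN spec, of k0 k] by (elim exE) (rule that)
  have UV: "submodule G (adjoint_module sc br (gspace D k0 k)) U"
    "submodule G (adjoint_module sc br (gspace D k0 k)) V"
    "{u + v | u v. u \<in> U \<and> v \<in> V} = gspace D k0 k" "\<forall>x\<in>G. \<forall>u\<in>U. br x u = 0"
    "V = {0} \<or> irreducible_module G (adjoint_module sc br V) \<and> (\<exists>lam\<in>torus_weights D. has_highest_weight D V lam)"
    using UV0 by simp_all
  have "\<exists>lam. constituent V lam" if "V \<noteq> {0}"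
  proof -
    from that UV(5) obtain lam where l: "irreducible_module G (adjoint_module sc br V)"
      "lam \<in> torus_weights D" "has_highest_weight D V lam" by blast
    then have "constituent V lam"
      using submodule_subspace[OF UV(2)] subspace_submodule[of _ V]
      by (auto simp: constituent_def irreducible_module_def adjoint_module_def)
    then show ?thesis by blast
  qed
  note nontriv = this
  show thesis
  proof (rule that[of U V])
    show "subspace U" "U \<subseteq> gspace D k0 k" using submodule_subspace[OF UV(1)] by simp_all
    show "subspace V" "V \<subseteq> gspace D k0 k" using submodule_subspace[OF UV(2)] by simp_all
    show "\<exists>u\<in>U. \<exists>v\<in>V. x = u + v" if "x \<in> gspace D k0 k" for x
      using that unfolding UV(3)[symmetric] by auto
    show "br x u = 0" if "x \<in> G" "u \<in> U" for x u using that UV(4) by simp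
    show "V = {0} \<or> (\<exists>lam. constituent V lam)" using nontriv by (cases "V = {0}") simp_all
  qed
qed

lemma roots_dual: "\<alpha> \<in> g00_roots D \<Longrightarrow> \<alpha> \<in> dualH"
  by (simp add: g00_roots_def roots_def)

lemma torus_weights_dual: "lam \<in> torus_weights D \<Longrightarrow> lam \<in> dualH"
  unfolding torus_weights_def Let_def is_highest_def short_roots_def
  using roots_dual dual_mult[of _ 2] by (auto simp: g00_roots_def)

text \<open>The span of the weight vectors is a submodule, because weight vectors of g(0,0) shift
  weights and span g(0,0). It contains the highest weight vector, so irreducibility makes it all of
  \<open>V\<close>.\<close>

lemma constituent_weights: "constituent V lam \<Longrightarrow> V \<subseteq> span (wvecs V)"
proof -
  assume V: "constituent V lam"
  have sV: "subspace V" using V by (simp add: constituent_def)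
  let ?S = "span (wvecs V)"
  have S: "?S \<subseteq> V" using span_minimal[of "wvecs V" V] sV by blast
  obtain v where v: "v \<in> V" "v \<noteq> 0" "v \<in> wtv lam"
    using V by (auto simp: constituent_def has_highest_weight_def joint_eigenspace_def)
  have "lam \<in> dualH" using V torus_weights_dual by (simp add: constituent_def)
  then have "v \<in> ?S" using v by (intro span_base) auto
  moreover have "br x u \<in> ?S" if x: "x \<in> G" and u: "u \<in> ?S" for x u
  proof (rule endo_span[OF br_endo subspace_span _ u])
    fix u assume u: "u \<in> wvecs V"
    then obtain \<beta> where b: "\<beta> \<in> dualH" "u \<in> wtv \<beta>" by blast
    have "x \<in> span (wvecs G)" using x G_weights by blast
    then show "br x u \<in> ?S"
    proof (rule endo_span[OF br_endo_left subspace_span, rotated])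
      fix x assume "x \<in> wvecs G"
      then obtain \<alpha> where a: "\<alpha> \<in> dualH" "x \<in> wtv \<alpha>" "x \<in> G" by blast
      have "br x u \<in> V" using V a u by (auto simp: constituent_def)
      then show "br x u \<in> ?S" using br_wtv[OF a(2) b(2)] dual_add[OF a(1) b(1)] by (intro span_base) blast
    qed
  qed
  ultimately have "?S = V" using V S v unfolding constituent_def by blast
  then show ?thesis by simp
qed

lemma gspace_weights: "gspace D k0 k \<subseteq> span (wvecs (gspace D k0 k))"
proof
  fix x assume x: "x \<in> gspace D k0 k"
  obtain U V where "subspace U" "subspace V" and UV: "U \<subseteq> gspace D k0 k" "V \<subseteq> gspace D k0 k"
    "\<And>x. x \<in> gspace D k0 k \<Longrightarrow> \<exists>u\<in>U. \<exists>v\<in>V. x = u + v"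
    "\<And>x u. x \<in> G \<Longrightarrow> u \<in> U \<Longrightarrow> br x u = 0" "V = {0} \<or> (\<exists>lam. constituent V lam)"
    by (rule gspace_constituent[of k0 k]) blast
  obtain u v where uv: "u \<in> U" "v \<in> V" "x = u + v" using UV(3)[OF x] by blast
  have "u \<in> wtv zero_wt" using UV(4) uv(1) H_sub by (auto simp: joint_eigenspace_def)
  then have "u \<in> wvecs (gspace D k0 k)" using uv UV(1) dual_zero by blast
  moreover have "v \<in> span (wvecs (gspace D k0 k))"
  proof (cases "V = {0}")
    case True then show ?thesis using uv by (simp add: span_zero)
  next
    case False
    then have "v \<in> span (wvecs V)" using UV(5) constituent_weights uv by blast
    moreover have "wvecs V \<subseteq> wvecs (gspace D k0 k)" using UV(2) by blast
    ultimately show ?thesis using span_mono by blast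
  qed
  ultimately show "x \<in> span (wvecs (gspace D k0 k))" unfolding uv(3) by (rule span_add[OF span_base])
qed

text \<open>Averaging over the powers of one automorphism projects onto its eigenspaces.\<close>

lemma aut_eigen_sum:
  "\<exists>p. (\<forall>r. aut D i (p r) = sc (rootu D i ^ r) (p r)) \<and> x = (\<Sum>r<ord D i. p r) \<and>
     (\<forall>r. p r \<in> span (range (\<lambda>j. (aut D i ^^ j) x)))"
proof -
  let ?m = "ord D i" and ?s = "aut D i" and ?z = "rootu D i"
  \<comment> \<open>A discrete Fourier transform over the powers of the automorphism:
    \<open>p r\<close> is the component of \<open>x\<close> with eigenvalue
    \<open>rootu D i ^ r\<close>.\<close>
  define p where "p r = sc (1 / of_nat ?m) (\<Sum>j<?m. sc (?z powi (- int (r * j))) ((?s ^^ j) x))" for r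
  have "?s (p r) = sc (?z ^ r) (p r)" for r
  proof -
    let ?t = "\<lambda>j. sc (?z powi (- int (r * j))) ((?s ^^ j) x)"
    have "?s (?t j) = sc (?z ^ r) (?t (Suc j))" for j
    proof -
      have "?z ^ r * ?z powi (- int (r * Suc j)) = ?z powi (int r + (- int (r * Suc j)))"
        by (subst power_int_add) (simp_all add: rootu_nonzero)
      also have "int r + (- int (r * Suc j)) = - int (r * j)" by simp
      finally show ?thesis by (simp add: endo_scale[OF aut_endo])
    qed
    then have "?s (\<Sum>j<?m. ?t j) = sc (?z ^ r) (\<Sum>j<?m. ?t (Suc j))"
      by (simp only: endo_sum[OF aut_endo] scale_sum_right)
    \<comment> \<open>The shift by one changes only the boundary terms \<open>?t ?m\<close> and
      \<open>?t 0\<close>; they agree because the automorphism and its root of unity both have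
      \<open>?m\<close>-th power one.\<close>
    also have "(\<Sum>j<?m. ?t (Suc j)) = (\<Sum>j<?m. ?t j) + (?t ?m - ?t 0)"
      using sum.lessThan_Suc_shift[of ?t ?m] by (simp add: algebra_simps)
    also have "?t ?m - ?t 0 = 0"
    proof -
      have "?z powi (- int (r * ?m)) = 1" by (simp add: rootu_powi_eq_1_iff)
      then show ?thesis using aut_ord[of i] by simp
    qed
    finally have "?s (\<Sum>j<?m. ?t j) = sc (?z ^ r) (\<Sum>j<?m. ?t j)" by simp
    then show ?thesis unfolding p_def by (simp add: endo_scale[OF aut_endo] mult.commute)
  qed
  moreover have "x = (\<Sum>r<?m. p r)"
  proof -
    \<comment> \<open>Orthogonality of characters: the geometric sum of an \<open>?m\<close>-th root
      of unity other than 1 vanishes.\<close>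
    have c: "(\<Sum>r<?m. ?z powi (- int (r * j))) = (if j = 0 then of_nat ?m else 0)" if "j < ?m" for j
    proof (cases "j = 0")
      case False
      define w where "w = ?z powi (- int j)"
      have w: "?z powi (- int (r * j)) = w ^ r" for r
        unfolding w_def by (simp flip: power_int_mult power_int_of_nat add: mult.commute)
      have "w \<noteq> 1" using False that by (auto simp: w_def rootu_powi_eq_1_iff dest: zdvd_imp_le)
      moreover have "w ^ ?m = 1" using w[of ?m] by (metis rootu_powi_eq_1_iff dvd_minus_iff dvd_triv_left of_nat_mult)
      moreover have "(\<Sum>r<?m. ?z powi (- int (r * j))) = (\<Sum>r<?m. w ^ r)" by (intro sum.cong refl w)
      ultimately show ?thesis using False geometric_sum[of w ?m] by simp
    qed simp
    have "(\<Sum>r<?m. p r) = sc (1 / of_nat ?m) (\<Sum>j<?m. sc (\<Sum>r<?m. ?z powi (- int (r * j))) ((?s ^^ j) x))"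
      unfolding p_def scale_sum_right[symmetric] scale_sum_left by (subst sum.swap) simp
    also have "\<dots> = sc (1 / of_nat ?m) (\<Sum>j<?m. if j = 0 then sc (of_nat ?m) x else 0)"
      by (intro arg_cong[where f = "sc _"] sum.cong) (auto simp: c simp del: of_nat_mult)
    also have "\<dots> = x" using ord_pos[of i] by (simp add: sum.delta)
    finally show ?thesis by simp
  qed
  moreover have "p r \<in> span (range (\<lambda>j. (?s ^^ j) x))" for r
    unfolding p_def by (intro span_scale span_sum span_base) auto
  ultimately show ?thesis by blast
qed

text \<open>Decomposing an eigenvector under one more automorphism keeps the eigenvalues for the
  earlier ones, since the components are combinations of its iterates and the automorphisms
  commute.\<close>

lemma aut_eigen_finite:
  assumes "finite E"
  shows "x \<in> span {y. \<exists>e. \<forall>i\<in>E. aut D i y = sc (rootu D i powi e i) y}"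
  using assms
proof (induction E arbitrary: x rule: finite_induct)
  case empty then show ?case by (intro span_base) simp
next
  case (insert i E)
  let ?T = "{y. \<exists>e. \<forall>j\<in>insert i E. aut D j y = sc (rootu D j powi e j) y}"
  have "y \<in> span ?T" if y: "\<forall>j\<in>E. aut D j y = sc (rootu D j powi e j) y" for y e
  proof -
    obtain p where p: "\<And>r. aut D i (p r) = sc (rootu D i ^ r) (p r)" "y = (\<Sum>r<ord D i. p r)"
      "\<And>r. p r \<in> span (range (\<lambda>j. (aut D i ^^ j) y))" using aut_eigen_sum[of i y] by blast
    have "p r \<in> ?T" for r
    proof -
      have "aut D j (p r) = sc (rootu D j powi e j) (p r)" if j: "j \<in> E" for j
      proof -
        have "subspace {z. aut D j z = sc (rootu D j powi e j) z}" using aut_endo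
          by (auto simp: subspace_def endo_zero endo_add endo_scale scale_right_distrib scale_left_commute)
        moreover have "aut D j ((aut D i ^^ n) y) = sc (rootu D j powi e j) ((aut D i ^^ n) y)" for n
          by (induction n) (use y j in \<open>auto simp: aut_comm[of j i] endo_scale[OF aut_endo]\<close>)
        ultimately have "span (range (\<lambda>n. (aut D i ^^ n) y)) \<subseteq> {z. aut D j z = sc (rootu D j powi e j) z}"
          by (intro span_minimal) auto
        then show ?thesis using p(3) by blast
      qed
      then have "\<forall>j\<in>insert i E. aut D j (p r) = sc (rootu D j powi (e(i := int r)) j) (p r)"
        using insert.hyps p(1)[of r] by auto
      then show ?thesis by blast
    qed
    then show ?thesis unfolding p(2) by (intro span_sum span_base)
  qed
  then have "{y. \<exists>e. \<forall>j\<in>E. aut D j y = sc (rootu D j powi e j) y} \<subseteq> span ?T" by blast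
  then show ?case using insert.IH span_minimal subspace_span by blast
qed

section \<open>Homogeneous weight vectors\<close>

lemma gspaces_span: "x \<in> span (\<Union>k0 k. gspace D k0 k)"
proof -
  have "{y. \<exists>e. \<forall>i\<in>UNIV. aut D i y = sc (rootu D i powi e i) y} \<subseteq> (\<Union>k0 k. gspace D k0 k)"
  proof
    fix y assume "y \<in> {y. \<exists>e. \<forall>i\<in>UNIV. aut D i y = sc (rootu D i powi e i) y}"
    then obtain e where e: "\<And>i. aut D i y = sc (rootu D i powi e i) y" by auto
    have "multidegree (e None) (\<chi> i. e (Some i)) i = e i" for i
      by (cases i) (auto simp: multidegree_def)
    then have "y \<in> gspace D (e None) (\<chi> i. e (Some i))" using e by (auto simp: gspace_def)
    then show "y \<in> (\<Union>k0 k. gspace D k0 k)" by blast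
  qed
  then show ?thesis by (rule span_mono[THEN subsetD]) (rule aut_eigen_finite[OF finite])
qed

abbreviation homogeneous :: "'g set" where
  "homogeneous \<equiv> {x. \<exists>k0 k. \<exists>\<alpha>\<in>dualH. x \<in> gspace_wt D k0 k \<alpha>}"

lemma homogeneous_span: "x \<in> span homogeneous"
proof -
  have "(\<Union>k0 k. gspace D k0 k) \<subseteq> span homogeneous"
  proof clarify
    fix x k0 k assume "x \<in> gspace D k0 k"
    then have "x \<in> span (wvecs (gspace D k0 k))" using gspace_weights by blast
    moreover have "wvecs (gspace D k0 k) \<subseteq> homogeneous" by (auto simp: gspace_wt_eq)
    ultimately show "x \<in> span homogeneous" using span_mono by blast
  qed
  then show ?thesis using gspaces_span[of x] span_minimal subspace_span by blast
qed

lemma homogeneous_endo_span: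
  assumes "subspace W" "\<And>k0 k \<alpha> x. \<alpha> \<in> dualH \<Longrightarrow> x \<in> gspace_wt D k0 k \<alpha> \<Longrightarrow> br x u \<in> W"
  shows "br x u \<in> W"
  using endo_span[OF br_endo_left assms(1) _ homogeneous_span[of x]] assms(2) by blast

text \<open>Degree and weight are treated as the eigenvalues of a single family of operators, so
  that the eigenspace lemmas separate both at once.\<close>

lemma gspace_wt_joint: "gspace_wt D k0 k \<alpha> =
    joint_eigenspace (UNIV <+> H) (case_sum (aut D) br) (case_sum (charm k0 k) \<alpha>)"
  by (simp add: gspace_wt_eq gspace_def joint_eigenspace_def Plus_def ball_Un Int_def)

lemma homogeneous_part:
  assumes S: "S \<subseteq> homogeneous" and z: "z \<in> span S" "z \<in> gspace_wt D k0 k \<alpha>" and a: "\<alpha> \<in> dualH"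
  shows "z \<in> span (S \<inter> gspace_wt D k0 k \<alpha>)"
  unfolding gspace_wt_joint
proof (rule eigen_vector_span[OF _ _ z(1) z(2)[unfolded gspace_wt_joint]])
  fix x assume "x \<in> S"
  then obtain l0 l \<beta> where b: "\<beta> \<in> dualH" "x \<in> gspace_wt D l0 l \<beta>" using S by blast
  have "\<forall>i. i \<notin> UNIV <+> H \<longrightarrow> case_sum (charm l0 l) \<beta> i = 0"
    using dual_outside[OF b(1)] by (auto split: sum.splits)
  then show "\<exists>ev. (\<forall>i. i \<notin> UNIV <+> H \<longrightarrow> ev i = 0) \<and> x \<in> joint_eigenspace (UNIV <+> H) (case_sum (aut D) br) ev"
    using b(2) unfolding gspace_wt_joint by blast
qed (use dual_outside[OF a] br_endo aut_endo in \<open>auto split: sum.splits\<close>)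

lemma weight_part:
  assumes S: "\<And>x. x \<in> S \<Longrightarrow> \<exists>\<beta>\<in>dualH. x \<in> wtv \<beta>" and z: "z \<in> span S" "z \<in> wtv \<alpha>" and a: "\<alpha> \<in> dualH"
  shows "z \<in> span (S \<inter> wtv \<alpha>)"
  by (rule eigen_vector_span[OF _ br_endo z]) (use S dual_outside a in blast)+

lemma wtv_unique:
  assumes "x \<noteq> 0" "x \<in> wtv \<alpha>" "x \<in> wtv \<beta>" "\<alpha> \<in> dualH" "\<beta> \<in> dualH"
  shows "\<alpha> = \<beta>"
proof
  fix h
  show "\<alpha> h = \<beta> h"
  proof (cases "h \<in> H")
    case True
    then have "sc (\<alpha> h) x = sc (\<beta> h) x" using wtvD[OF assms(2)] wtvD[OF assms(3)] by metis
    then show ?thesis using assms(1) by simp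
  qed (simp add: dual_outside[OF assms(4)] dual_outside[OF assms(5)])
qed

lemma gspace_unique:
  assumes "x \<noteq> 0" "x \<in> gspace D k0 k" "x \<in> gspace D l0 l"
  shows "int (ord D None) dvd k0 - l0" "int (ord D (Some i)) dvd k $ i - l $ i"
proof -
  have "sc (charm k0 k j) x = sc (charm l0 l j) x" for j
    by (rule trans[OF gspaceD[OF assms(2), symmetric] gspaceD[OF assms(3)]])
  then have c: "charm k0 k j = charm l0 l j" for j using assms(1) by simp
  then show "int (ord D None) dvd k0 - l0" "int (ord D (Some i)) dvd k $ i - l $ i"
    using c[of None] c[of "Some i"] by (simp_all add: rootu_powi_cong multidegree_def)
qed

lemma G_not_sub_H: "\<not> G \<subseteq> H"
proof
  assume GH: "G \<subseteq> H"
  obtain x y where "x \<in> G" "y \<in> G" "br x y \<noteq> 0" using simpleG by (auto simp: simple_lie_def)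
  then show False using H_abelian[of x y] GH by blast
qed

text \<open>Without roots g(0,0) would have only the weight zero, hence lie in the abelian
  subalgebra \<open>H\<close>, contrary to simplicity.\<close>

lemma root_exists: "\<exists>\<alpha>. \<alpha> \<in> g00_roots D"
proof (rule ccontr)
  assume no: "\<not> ?thesis"
  have "wvecs G \<subseteq> wtv zero_wt"
  proof
    fix x assume "x \<in> wvecs G"
    then obtain \<alpha> where a: "\<alpha> \<in> dualH" "x \<in> wtv \<alpha>" "x \<in> G" by blast
    show "x \<in> wtv zero_wt"
    proof (cases "x = 0 \<or> \<alpha> = zero_wt")
      case True then show ?thesis using a subspace_0[OF subspace_wtv] by auto
    next
      case False
      then have "\<alpha> \<in> g00_roots D"
        using a by (auto simp: g00_roots_def roots_def wt_space_eq)
      then show ?thesis using no by blast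
    qed
  qed
  then have "G \<subseteq> wtv zero_wt" using G_weights span_minimal[OF _ subspace_wtv] by blast
  then have "G \<subseteq> H" using H_max by (force simp: joint_eigenspace_def)
  then show False using G_not_sub_H by blast
qed

lemma rootE:
  assumes "\<alpha> \<in> g00_roots D"
  obtains x where "x \<in> G" "x \<in> wtv \<alpha>" "x \<noteq> 0" "\<alpha> \<in> dualH" "\<alpha> \<noteq> zero_wt"
  using assms subspace_0[OF subspace_inter[OF subspace_G subspace_wtv]]
  unfolding g00_roots_def roots_def wt_space_eq by auto

text \<open>\<open>g\<close> being simple, it is generated by its nonzero weight vectors; hence its zero weight space is
  spanned by brackets of opposite ones. Since \<open>\<sigma>\<^sub>0\<close> has finite order, the first degree may be taken
  positive.\<close>

lemma zero_weight_span:
  assumes z: "z \<in> gspace_wt D 0 k zero_wt"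
  shows "z \<in> span {br X Y | X Y \<alpha> l0 l l'. \<alpha> \<in> dualH \<and> \<alpha> \<noteq> zero_wt \<and> l0 > 0 \<and>
     X \<in> gspace_wt D l0 l \<alpha> \<and> Y \<in> gspace_wt D (- l0) l' (\<lambda>h. - \<alpha> h) \<and> l + l' = k}"
    (is "z \<in> span ?R")
proof -
  \<comment> \<open>\<open>?Q1\<close> consists of the vectors of nonzero weight and
    \<open>?Q2\<close> of the brackets of opposite ones. Their common span turns out to be an ideal
    of g.\<close>
  let ?Q1 = "{X | X \<alpha> k0 k. \<alpha> \<in> dualH \<and> \<alpha> \<noteq> zero_wt \<and> X \<in> gspace_wt D k0 k \<alpha>}"
  let ?Q2 = "{br X Y | X Y \<alpha> k0 k l0 l. \<alpha> \<in> dualH \<and> \<alpha> \<noteq> zero_wt \<and> X \<in> gspace_wt D k0 k \<alpha> \<and>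
     Y \<in> gspace_wt D l0 l (\<lambda>h. - \<alpha> h)}"
  let ?Q = "?Q1 \<union> ?Q2"
  have q1: "br Z X \<in> ?Q" if Z: "\<beta> \<in> dualH" "Z \<in> gspace_wt D l0 l \<beta>" and X: "\<alpha> \<in> dualH" "\<alpha> \<noteq> zero_wt"
    "X \<in> gspace_wt D k0 k \<alpha>" for Z \<beta> l0 l X \<alpha> k0 k
  proof (cases "(\<lambda>h. \<beta> h + \<alpha> h) = zero_wt")
    case True
    then have a: "\<alpha> = (\<lambda>h. - \<beta> h)" by (metis add_eq_0_iff)
    then have "\<beta> \<noteq> zero_wt" using X(2) by auto
    then have "br Z X \<in> ?Q2" using Z X unfolding a by blast
    then show ?thesis by blast
  next
    case False
    then have "br Z X \<in> ?Q1" using br_gspace_wt[OF Z(2) X(3)] dual_add[OF Z(1) X(1)] by blast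
    then show ?thesis by blast
  qed
  have stable: "br Z q \<in> span ?Q" if q: "q \<in> ?Q" and Z: "\<beta> \<in> dualH" "Z \<in> gspace_wt D l0 l \<beta>" for Z q \<beta> l0 l
  proof (cases "q \<in> ?Q1")
    case True
    then show ?thesis using q1[OF Z] span_base[of _ ?Q] by blast
  next
    case False
    then obtain X Y \<alpha> k0 k l0' l' where XY: "q = br X Y" "\<alpha> \<in> dualH" "\<alpha> \<noteq> zero_wt" "X \<in> gspace_wt D k0 k \<alpha>"
      "Y \<in> gspace_wt D l0' l' (\<lambda>h. - \<alpha> h)" using q by blast
    show ?thesis
    proof (cases "\<beta> = zero_wt")
      case True
      \<comment> \<open>An element of weight zero acts as a derivation on the bracket and preserves
        both opposite weights.\<close>
      have "br Z X \<in> gspace_wt D (l0 + k0) (l + k) \<alpha>" "br Z Y \<in> gspace_wt D (l0 + l0') (l + l') (\<lambda>h. - \<alpha> h)"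
        using br_gspace_wt[OF Z(2) XY(4)] br_gspace_wt[OF Z(2) XY(5)] True by simp_all
      then have "br (br Z X) Y \<in> ?Q2" "br X (br Z Y) \<in> ?Q2" using XY by blast+
      then show ?thesis unfolding XY(1) jacobi[of Z X Y] by (intro span_add span_base) blast+
    next
      case False
      have "br X Y \<in> gspace_wt D (k0 + l0') (k + l') zero_wt" using br_gspace_wt[OF XY(4) XY(5)] by simp
      then have "br Z q \<in> gspace_wt D (l0 + (k0 + l0')) (l + (k + l')) \<beta>"
        using br_gspace_wt[OF Z(2)] XY(1) by fastforce
      then have "br Z q \<in> ?Q1" using Z(1) False by blast
      then show ?thesis by (intro span_base) blast
    qed
  qed
  have "br x y \<in> span ?Q" if y: "y \<in> span ?Q" for x y
    by (rule endo_span[OF br_endo subspace_span _ y], rule homogeneous_endo_span[OF subspace_span stable])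
  then have "lie_ideal sc br UNIV (span ?Q)" by (simp add: lie_ideal_def)
  moreover have "span ?Q \<noteq> {0}"
  proof -
    obtain \<alpha> where "\<alpha> \<in> g00_roots D" using root_exists by blast
    then obtain x where x: "x \<in> G" "x \<in> wtv \<alpha>" "x \<noteq> 0" "\<alpha> \<in> dualH" "\<alpha> \<noteq> zero_wt" by (rule rootE)
    then have "x \<in> ?Q1" by (auto simp: gspace_wt_eq)
    then show ?thesis using x(3) span_base[of x ?Q] by blast
  qed
  ultimately have "span ?Q = UNIV" using simpleg by (auto simp: simple_lie_def)
  then have "z \<in> span ?Q" by simp
  moreover have "?Q \<subseteq> homogeneous"
  proof -
    have "br X Y \<in> homogeneous" if "\<alpha> \<in> dualH" "X \<in> gspace_wt D k0 k \<alpha>" "Y \<in> gspace_wt D l0 l (\<lambda>h. - \<alpha> h)"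
      for X Y \<alpha> k0 k l0 l using br_gspace_wt[OF that(2,3)] dual_zero by auto
    then show ?thesis by blast
  qed
  ultimately have "z \<in> span (?Q \<inter> gspace_wt D 0 k zero_wt)"
    by (rule homogeneous_part[OF _ _ z dual_zero, rotated])
  \<comment> \<open>An element of \<open>?Q1\<close> that also has weight zero vanishes, so only
    brackets contribute in degree (0, k).\<close>
  moreover have "?Q \<inter> gspace_wt D 0 k zero_wt \<subseteq> insert 0 ?R"
  proof
    fix q assume q: "q \<in> ?Q \<inter> gspace_wt D 0 k zero_wt"
    show "q \<in> insert 0 ?R"
    proof (cases "q = 0")
      case False
      have "q \<notin> ?Q1"
      proof
        assume "q \<in> ?Q1"
        then obtain \<alpha> where "\<alpha> \<in> dualH" "\<alpha> \<noteq> zero_wt" "q \<in> wtv \<alpha>" by (auto simp: gspace_wt_eq)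
        then show False using wtv_unique[OF False, of \<alpha> zero_wt] q dual_zero by (auto simp: gspace_wt_eq)
      qed
      then obtain X Y \<alpha> k0 kk l0 l' where XY: "q = br X Y" "\<alpha> \<in> dualH" "\<alpha> \<noteq> zero_wt" "X \<in> gspace_wt D k0 kk \<alpha>"
        "Y \<in> gspace_wt D l0 l' (\<lambda>h. - \<alpha> h)" using q by blast
      have g: "br X Y \<in> gspace D (k0 + l0) (kk + l')" "br X Y \<in> gspace D 0 k"
        using br_gspace_wt[OF XY(4,5)] q XY(1) by (simp_all add: gspace_wt_eq)
      have d: "int (ord D None) dvd k0 + l0" "\<And>i. int (ord D (Some i)) dvd kk $ i + l' $ i - k $ i"
        using gspace_unique[OF _ g] False XY(1) by simp_all
      let ?m = "int (ord D None)"
      define t where "t = ?m * (\<bar>k0\<bar> + 1)"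
      define n0 where "n0 = k0 + t"
      have "\<bar>k0\<bar> + 1 \<le> t"
        unfolding t_def using mult_right_mono[of 1 ?m "\<bar>k0\<bar> + 1"] ord_pos[of None] by simp
      then have n0: "n0 > 0" unfolding n0_def by linarith
      have "gspace D k0 kk = gspace D n0 kk" by (rule gspace_periodic) (auto simp: n0_def t_def)
      \<comment> \<open>The degrees of \<open>X\<close> and \<open>Y\<close> add up to (0, k) only
        modulo the orders; that of \<open>Y\<close> is replaced by the exact complement.\<close>
      moreover have "gspace D l0 l' = gspace D (- n0) (k - kk)"
      proof (rule gspace_periodic)
        have e: "l0 - - n0 = (k0 + l0) + ?m * (\<bar>k0\<bar> + 1)" by (simp add: n0_def t_def)
        show "?m dvd l0 - - n0" unfolding e by (rule dvd_add[OF d(1) dvd_triv_left])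
        show "int (ord D (Some i)) dvd l' $ i - (k - kk) $ i" for i using d(2)[of i] by (simp add: algebra_simps)
      qed
      ultimately have "X \<in> gspace_wt D n0 kk \<alpha>" "Y \<in> gspace_wt D (- n0) (k - kk) (\<lambda>h. - \<alpha> h)"
        using XY(4,5) by (simp_all add: gspace_wt_eq)
      moreover have "kk + (k - kk) = k" by simp
      ultimately have "q \<in> ?R" using XY(1-3) n0 by blast
      then show ?thesis by blast
    qed blast
  qed
  ultimately have "z \<in> span (insert 0 ?R)" using span_mono by blast
  then show ?thesis by (simp add: span_insert_0)
qed

subsection \<open>Traces and the Killing form\<close>

lemma weight_basis:
  assumes "subspace W" "W \<subseteq> span (wvecs W)"
  obtains B wt where "finite B" "independent B" "span B = W"
    "\<And>b. b \<in> B \<Longrightarrow> wt b \<in> dualH \<and> b \<in> wtv (wt b) \<and> b \<noteq> 0"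
proof -
  obtain B where B: "finite B" "independent B" "span B = W" "B \<subseteq> wvecs W"
    using finite_basis_within[OF assms] by auto
  have "\<forall>b\<in>B. \<exists>\<alpha>. \<alpha> \<in> dualH \<and> b \<in> wtv \<alpha>" using B(4) by blast
  then obtain wt where "\<forall>b\<in>B. wt b \<in> dualH \<and> b \<in> wtv (wt b)" using bchoice by metis
  moreover have "b \<noteq> 0" if "b \<in> B" for b using B(2) that dependent_zero by blast
  ultimately show thesis using that B by blast
qed

lemma weight_in_basis:
  assumes B: "\<And>b. b \<in> B \<Longrightarrow> wt b \<in> dualH \<and> b \<in> wtv (wt b) \<and> b \<noteq> 0"
    and u: "u \<in> span B" "u \<noteq> 0" "u \<in> wtv \<beta>" "\<beta> \<in> dualH"
  shows "\<exists>b\<in>B. wt b = \<beta>"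
proof -
  have "u \<in> span (B \<inter> wtv \<beta>)" by (rule weight_part[OF _ u(1,3,4)]) (use B in blast)
  then have "B \<inter> wtv \<beta> \<noteq> {}" using u(2) by auto
  then obtain b where b: "b \<in> B" "b \<in> wtv \<beta>" by blast
  then have "wt b = \<beta>" using wtv_unique[of b] B[OF b(1)] u(4) by blast
  then show ?thesis using b(1) by blast
qed

text \<open>On the sum of the weight spaces for \<beta> + n \<alpha>, which is stable under
  \<open>x\<close> and \<open>y\<close>, the commutator of their actions has trace zero. The trace
  of [x,y] there is also the dimension times \<beta>([x,y]) plus an integer times \<alpha>([x,y]),
  and the dimension is nonzero because \<beta> occurs.\<close>

lemma string_trace:
  assumes W: "subspace W" "W \<subseteq> span (wvecs W)"
    and x: "x \<in> wtv \<alpha>" "\<And>w. w \<in> W \<Longrightarrow> br x w \<in> W" and y: "y \<in> wtv (\<lambda>h. - \<alpha> h)" "\<And>w. w \<in> W \<Longrightarrow> br y w \<in> W"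
    and a: "\<alpha> \<in> dualH" and h0: "br x y \<in> H"
    and u: "u \<in> W" "u \<noteq> 0" "u \<in> wtv \<beta>" "\<beta> \<in> dualH"
  shows "\<exists>q::real. \<beta> (br x y) = of_real q * \<alpha> (br x y)"
proof -
  let ?h = "br x y"
  obtain B wt where B: "finite B" "independent B" "span B = W"
    "\<And>b. b \<in> B \<Longrightarrow> wt b \<in> dualH \<and> b \<in> wtv (wt b) \<and> b \<noteq> 0"
    using weight_basis[OF W] by metis
  define B' where "B' = {b \<in> B. \<exists>n::int. \<forall>h. wt b h = \<beta> h + of_int n * \<alpha> h}"
  have B': "finite B'" "independent B'" "B' \<subseteq> B"
    using B(1,2) independent_mono by (auto simp: B'_def)
  have st: "br z b \<in> span B'" if b: "b \<in> B'" and z: "z \<in> wtv \<gamma>" "\<And>w. w \<in> W \<Longrightarrow> br z w \<in> W"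
    "\<gamma> \<in> dualH" "\<And>h. \<gamma> h = of_int e * \<alpha> h" for z b \<gamma> e
  proof -
    have b1: "b \<in> B" "wt b \<in> dualH" "b \<in> wtv (wt b)" using b B' B(4) by blast+
    have "br z b \<in> span B" using z(2) b1(1) B(3) span_base by blast
    then have "br z b \<in> span (B \<inter> wtv (\<lambda>h. \<gamma> h + wt b h))"
      by (intro weight_part[OF _ _ br_wtv[OF z(1) b1(3)] dual_add[OF z(3) b1(2)]]) (use B(4) in blast)+
    moreover have "B \<inter> wtv (\<lambda>h. \<gamma> h + wt b h) \<subseteq> B'"
    proof
      fix c assume c: "c \<in> B \<inter> wtv (\<lambda>h. \<gamma> h + wt b h)"
      then have "wt c = (\<lambda>h. \<gamma> h + wt b h)"
        using wtv_unique[of c "wt c"] B(4)[of c] dual_add[OF z(3) b1(2)] by blast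
      moreover obtain n :: int where "\<forall>h. wt b h = \<beta> h + of_int n * \<alpha> h" using b by (auto simp: B'_def)
      ultimately have "\<forall>h. wt c h = \<beta> h + of_int (n + e) * \<alpha> h" using z(4) by (simp add: algebra_simps)
      then show "c \<in> B'" using c unfolding B'_def by blast
    qed
    ultimately show ?thesis using span_mono by blast
  qed
  have xs: "br x b \<in> span B'" if "b \<in> B'" for b by (rule st[OF that x a, of 1]) simp_all
  have ys: "br y b \<in> span B'" if "b \<in> B'" for b by (rule st[OF that y dual_neg[OF a], of "-1"]) simp_all
  have xss: "br x w \<in> span B'" if "w \<in> span B'" for w by (rule endo_span[OF br_endo subspace_span xs that])
  have yss: "br y w \<in> span B'" if "w \<in> span B'" for w by (rule endo_span[OF br_endo subspace_span ys that])
  have "btrace B' (br ?h) = btrace B' (\<lambda>z. br x (br y z) - br y (br x z))"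
    by (rule arg_cong[where f = "btrace B'"]) (simp add: fun_eq_iff jacobi[of x y])
  also have "\<dots> = 0"
    using btrace_comp_commute[OF B'(2,1) br_endo xs br_endo ys] xss yss xs ys
    by (subst btrace_diff[OF B'(2)]) auto
  finally have "btrace B' (br ?h) = 0" .
  moreover have "btrace B' (br ?h) = (\<Sum>b\<in>B'. wt b ?h)"
    by (rule btrace_diagonal[OF B'(2)]) (use B(4) B'(3) wtvD[OF _ h0] in blast)
  ultimately have s0: "(\<Sum>b\<in>B'. wt b ?h) = 0" by simp
  have "\<forall>b\<in>B'. \<exists>n::int. wt b ?h = \<beta> ?h + of_int n * \<alpha> ?h" by (auto simp: B'_def)
  then obtain n :: "'g \<Rightarrow> int" where n: "\<forall>b\<in>B'. wt b ?h = \<beta> ?h + of_int (n b) * \<alpha> ?h" by metis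
  have "(\<Sum>b\<in>B'. wt b ?h) = of_nat (card B') * \<beta> ?h + of_int (sum n B') * \<alpha> ?h"
    using n by (simp add: sum.distrib sum_distrib_right)
  then have e: "of_nat (card B') * \<beta> ?h = - of_int (sum n B') * \<alpha> ?h"
    using s0 by (simp add: eq_neg_iff_add_eq_0)
  obtain b where "b \<in> B" "wt b = \<beta>" using weight_in_basis[OF B(4) _ u(2-4)] u(1) B(3) by blast
  then have "b \<in> B'" by (auto simp: B'_def intro!: exI[of _ 0])
  then have "card B' \<noteq> 0" using B'(1) by auto
  then have "\<beta> ?h = of_real (- real_of_int (sum n B') / real (card B')) * \<alpha> ?h"
    using e by (simp add: field_simps)
  then show ?thesis by blast
qed

lemma UNIV_weights: "UNIV \<subseteq> span (wvecs UNIV)"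
proof
  fix x :: 'g
  have "homogeneous \<subseteq> wvecs UNIV" by (auto simp: gspace_wt_eq)
  then show "x \<in> span (wvecs UNIV)" using homogeneous_span[of x] span_mono by blast
qed

lemma center_trivial: assumes "\<And>x. br x z = 0" shows "z = 0"
proof -
  let ?Z = "{z. \<forall>x. br x z = 0}"
  have "lie_ideal sc br UNIV ?Z"
    by (auto simp: lie_ideal_def subspace_def br_add br_scale)
  moreover have "?Z \<noteq> UNIV" using simpleg by (auto simp: simple_lie_def)
  ultimately have "?Z = {0}" using simpleg by (auto simp: simple_lie_def)
  then show ?thesis using assms by auto
qed

lemma opposite_bracket_in_H:
  "x \<in> G \<Longrightarrow> y \<in> G \<Longrightarrow> x \<in> wtv \<alpha> \<Longrightarrow> y \<in> wtv (\<lambda>h. - \<alpha> h) \<Longrightarrow> br x y \<in> H"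
  using br_wtv[of x \<alpha> y "\<lambda>h. - \<alpha> h"] by (intro H_max G_br) (auto simp: joint_eigenspace_def)

text \<open>If \<alpha> vanished on [x,y], then by \<open>string_trace\<close> so would every weight
  of g, and [x,y] would be central in g.\<close>

lemma root_on_bracket_nonzero:
  assumes x: "x \<in> G" "x \<in> wtv \<alpha>" and y: "y \<in> G" "y \<in> wtv (\<lambda>h. - \<alpha> h)" and a: "\<alpha> \<in> dualH" and n: "br x y \<noteq> 0"
  shows "\<alpha> (br x y) \<noteq> 0"
proof
  assume a0: "\<alpha> (br x y) = 0"
  have hH: "br x y \<in> H" using x y opposite_bracket_in_H by blast
  have "br (br x y) z = 0" for z
  proof -
    have "subspace {z. br (br x y) z = 0}" by (auto simp: subspace_def br_add br_scale)
    moreover have "wvecs UNIV \<subseteq> {z. br (br x y) z = 0}"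
    proof clarify
      fix u \<beta> assume u: "\<beta> \<in> dualH" "u \<in> wtv \<beta>"
      show "br (br x y) u = 0"
      proof (cases "u = 0")
        case False
        have "\<exists>q::real. \<beta> (br x y) = of_real q * \<alpha> (br x y)"
          by (rule string_trace[OF subspace_UNIV UNIV_weights x(2) _ y(2) _ a hH _ False u(2,1)]) simp_all
        then have "\<beta> (br x y) = 0" using a0 by auto
        then show ?thesis using wtvD[OF u(2) hH] by simp
      qed simp
    qed
    ultimately show ?thesis using UNIV_weights span_minimal by blast
  qed
  then have "br z (br x y) = 0" for z using br_skew[of z "br x y"] by simp
  then show False using center_trivial n by blast
qed

section \<open>Trace forms on stable subspaces\<close>

abbreviation kf :: "'g set \<Rightarrow> 'g \<Rightarrow> 'g \<Rightarrow> complex" where "kf W \<equiv> killing sc br W"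

text \<open>\<open>killing\<close> takes traces over \<open>W\<close> of brackets in g, and these
  behave like a trace form for elements that preserve \<open>W\<close>. It is applied with
  \<open>W\<close> equal to g(0,0) and to g.\<close>

definition stab :: "'g set \<Rightarrow> 'g \<Rightarrow> bool" where "stab W x \<longleftrightarrow> (\<forall>w\<in>W. br x w \<in> W)"

text \<open>The basis chosen inside \<open>trace_on\<close> is finite because g is finite
  dimensional, and \<open>btrace_basis_change\<close> compares it with \<open>B\<close>.\<close>

lemma trace_on_basis:
  assumes B: "finite B" "independent B" "span B = W" and f: "endo f" "\<And>w. w \<in> W \<Longrightarrow> f w \<in> W"
  shows "trace_on sc W f = btrace B f"
proof -
  define C where "C = (SOME B. independent B \<and> span B = W)"
  have C: "independent C \<and> span C = W" unfolding C_def by (rule someI[of _ B]) (use B in blast)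
  obtain B0 where B0: "finite B0" "span B0 = UNIV" using findim by (auto simp: fin_dim_def)
  have "finite C" using independent_span_bound[OF B0(1), of C] C B0(2) by auto
  moreover have "trace_on sc W f = btrace C f" by (simp add: trace_on_def C_def btrace_def Let_def)
  ultimately show ?thesis using btrace_basis_change[of C B f] C B f by auto
qed

lemma comp_endo: "endo f \<Longrightarrow> endo g \<Longrightarrow> endo (\<lambda>x. f (g x))"
  by (simp add: endo_iff)

lemma kf_basis: "finite B \<Longrightarrow> independent B \<Longrightarrow> span B = W \<Longrightarrow> stab W x \<Longrightarrow> stab W y \<Longrightarrow>
    kf W x y = btrace B (\<lambda>z. br x (br y z))"
  unfolding killing_def
  by (rule trace_on_basis[OF _ _ _ comp_endo[OF br_endo br_endo]]) (auto simp: stab_def)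

lemma stab_br: "subspace W \<Longrightarrow> stab W x \<Longrightarrow> stab W y \<Longrightarrow> stab W (br x y)"
proof -
  assume W: "subspace W" "stab W x" "stab W y"
  have "br (br x y) w = br x (br y w) - br y (br x w)" for w using jacobi[of x y w] by simp
  then show ?thesis using W by (auto simp: stab_def intro: subspace_diff)
qed

lemma stab_add: "subspace W \<Longrightarrow> stab W x \<Longrightarrow> stab W y \<Longrightarrow> stab W (x + y)"
  and stab_scale: "subspace W \<Longrightarrow> stab W x \<Longrightarrow> stab W (sc c x)"
  by (auto simp: stab_def br_add_left br_scale_left intro: subspace_add subspace_scale)

context
  fixes W assumes W: "subspace W"
begin

lemma kf_sym: assumes "stab W x" "stab W y" shows "kf W x y = kf W y x"
proof -
  obtain B where B: "finite B" "independent B" "span B = W" using finite_basis[OF W] by metis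
  have "b \<in> B \<Longrightarrow> b \<in> W" for b using B span_base by blast
  then show ?thesis using assms B by (simp add: kf_basis stab_def btrace_comp_commute[OF B(2,1) br_endo _ br_endo])
qed

lemma kf_add: assumes "stab W x" "stab W y" "stab W z" shows "kf W (x + y) z = kf W x z + kf W y z"
proof -
  obtain B where B: "finite B" "independent B" "span B = W" using finite_basis[OF W] by metis
  have "b \<in> B \<Longrightarrow> b \<in> W" for b using B span_base by blast
  then show ?thesis using assms stab_add[OF W] B
    by (simp add: kf_basis[OF B] br_add_left btrace_add[OF B(2)] stab_def)
qed

lemma kf_scale: assumes "stab W x" "stab W z" shows "kf W (sc c x) z = c * kf W x z"
proof -
  obtain B where B: "finite B" "independent B" "span B = W" using finite_basis[OF W] by metis
  have "b \<in> B \<Longrightarrow> b \<in> W" for b using B span_base by blast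
  then show ?thesis using assms stab_scale[OF W] B
    by (simp add: kf_basis[OF B] br_scale_left btrace_scale[OF B(2)] stab_def)
qed

text \<open>The two sides differ by tr(y x z) = tr(x z y), the cyclicity of the trace.\<close>

lemma kf_invariant: assumes s: "stab W x" "stab W y" "stab W z" shows "kf W (br x y) z = kf W x (br y z)"
proof -
  obtain B where B: "finite B" "independent B" "span B = W" using finite_basis[OF W] by metis
  have bW: "b \<in> B \<Longrightarrow> b \<in> W" for b using B span_base by blast
  have "kf W (br x y) z = btrace B (\<lambda>w. br x (br y (br z w)) - br y (br x (br z w)))"
  proof -
    have "br (br x y) (br z w) = br x (br y (br z w)) - br y (br x (br z w))" for w
      using jacobi[of x y "br z w"] by simp
    then show ?thesis using kf_basis[OF B stab_br[OF W s(1,2)] s(3)] by simp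
  qed
  also have "\<dots> = btrace B (\<lambda>w. br x (br y (br z w))) - btrace B (\<lambda>w. br y (br x (br z w)))"
    using s bW B(3) by (intro btrace_diff[OF B(2)]) (auto simp: stab_def)
  also have "btrace B (\<lambda>w. br y (br x (br z w))) = btrace B (\<lambda>w. br x (br z (br y w)))"
    using s bW B(3)
    by (intro btrace_comp_commute[OF B(2,1) br_endo _ comp_endo[OF br_endo br_endo]]) (auto simp: stab_def)
  also have "btrace B (\<lambda>w. br x (br y (br z w))) - btrace B (\<lambda>w. br x (br z (br y w)))
      = btrace B (\<lambda>w. br x (br y (br z w)) - br x (br z (br y w)))"
    using s bW B(3) by (intro btrace_diff[OF B(2), symmetric]) (auto simp: stab_def)
  also have "\<dots> = kf W x (br y z)"
  proof -
    have "br x (br (br y z) w) = br x (br y (br z w)) - br x (br z (br y w))" for w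
      using jacobi[of y z w] by (simp add: br_add)
    then show ?thesis using kf_basis[OF B s(1) stab_br[OF W s(2,3)]] by simp
  qed
  finally show ?thesis .
qed

end

lemma kf_weights:
  assumes W: "subspace W" and B: "finite B" "independent B" "span B = W"
    "\<And>b. b \<in> B \<Longrightarrow> wt b \<in> dualH \<and> b \<in> wtv (wt b) \<and> b \<noteq> 0"
    and h: "h \<in> H" "h' \<in> H" "stab W h" "stab W h'"
  shows "kf W h h' = (\<Sum>b\<in>B. wt b h * wt b h')"
  unfolding kf_basis[OF B(1-3) h(3,4)]
proof (rule btrace_diagonal[OF B(2)])
  fix b assume "b \<in> B"
  then have w: "b \<in> wtv (wt b)" using B(4) by blast
  show "br h (br h' b) = sc (wt b h * wt b h') b"
    by (simp add: wtvD[OF w h(1)] wtvD[OF w h(2)] br_scale mult.commute)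
qed

text \<open>On a weight space the bracket \<open>[x,y]\<close> of opposite root vectors acts by real multiples of one
  nonzero number, so the trace of its square is a positive multiple of a square.\<close>

lemma kf_bracket_nonzero:
  assumes W: "subspace W" "W \<subseteq> span (wvecs W)" "G \<subseteq> W" "\<And>z. z \<in> G \<Longrightarrow> stab W z"
    and x: "x \<in> G" "x \<in> wtv \<alpha>" and y: "y \<in> G" "y \<in> wtv (\<lambda>h. - \<alpha> h)" and a: "\<alpha> \<in> dualH" and n: "br x y \<noteq> 0"
  shows "kf W (br x y) (br x y) \<noteq> 0"
proof -
  let ?h = "br x y"
  have hH: "?h \<in> H" using x y opposite_bracket_in_H by blast
  have a0: "\<alpha> ?h \<noteq> 0" by (rule root_on_bracket_nonzero[OF x y a n])
  obtain B wt where B: "finite B" "independent B" "span B = W"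
    "\<And>b. b \<in> B \<Longrightarrow> wt b \<in> dualH \<and> b \<in> wtv (wt b) \<and> b \<noteq> 0"
    using weight_basis[OF W(1,2)] by metis
  have "\<exists>q::real. wt b ?h = of_real q * \<alpha> ?h" if b: "b \<in> B" for b
    by (rule string_trace[OF W(1,2) x(2) _ y(2) _ a hH])
      (use b B(3,4) span_base[of b B] W(4)[OF x(1)] W(4)[OF y(1)] in \<open>auto simp: stab_def\<close>)
  then obtain q :: "'g \<Rightarrow> real" where q: "\<And>b. b \<in> B \<Longrightarrow> wt b ?h = of_real (q b) * \<alpha> ?h" by metis
  \<comment> \<open>\<alpha> itself is a weight of \<open>W\<close>, with ratio 1, so the sum of the
    squared ratios is at least 1.\<close>
  have "x \<noteq> 0" using n by auto
  then obtain b where b: "b \<in> B" "wt b = \<alpha>" using weight_in_basis[OF B(4) _ _ x(2) a] x(1) W(3) B(3) by blast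
  have "q b = 1" using q[OF b(1)] b(2) a0 by simp
  then have "(\<Sum>b\<in>B. (q b)\<^sup>2) \<ge> 1" using b(1) B(1) member_le_sum[of b B "\<lambda>b. (q b)\<^sup>2"] by simp
  moreover have "kf W ?h ?h = (\<alpha> ?h)\<^sup>2 * of_real (\<Sum>b\<in>B. (q b)\<^sup>2)"
    using W(4) hH H_sub q by (subst kf_weights[OF W(1) B hH hH])
      (auto simp: sum_distrib_left power2_eq_square intro!: sum.cong)
  moreover have "complex_of_real (\<Sum>b\<in>B. (q b)\<^sup>2) \<noteq> 0"
    using \<open>(\<Sum>b\<in>B. (q b)\<^sup>2) \<ge> 1\<close> by (auto simp del: of_real_sum)
  ultimately show ?thesis using a0 by (simp del: of_real_sum)
qed

lemma stab_G: "z \<in> G \<Longrightarrow> stab G z" by (simp add: stab_def G_br)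

text \<open>Otherwise the span of the vectors of nonzero weight would be an ideal of g(0,0), hence
  everything; then \<open>H\<close>, being of weight zero, would vanish, and everything would
  commute with it and lie in it.\<close>

lemma opposite_root_vectors_exist:
  "\<exists>\<alpha> x y. \<alpha> \<in> dualH \<and> \<alpha> \<noteq> zero_wt \<and> x \<in> G \<and> y \<in> G \<and> x \<in> wtv \<alpha> \<and> y \<in> wtv (\<lambda>h. - \<alpha> h) \<and> br x y \<noteq> 0"
proof (rule ccontr)
  assume "\<not> ?thesis"
  then have no: "br x y = 0" if "\<alpha> \<in> dualH" "\<alpha> \<noteq> zero_wt" "x \<in> G" "y \<in> G" "x \<in> wtv \<alpha>" "y \<in> wtv (\<lambda>h. - \<alpha> h)"
    for \<alpha> x y using that by blast
  let ?Q = "{x \<in> G. \<exists>\<alpha>\<in>dualH. \<alpha> \<noteq> zero_wt \<and> x \<in> wtv \<alpha>}"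
  have step: "br z q \<in> span ?Q" if z: "z \<in> wvecs G" and q: "q \<in> ?Q" for z q
  proof -
    obtain \<alpha> \<beta> where ab: "\<beta> \<in> dualH" "z \<in> wtv \<beta>" "\<alpha> \<in> dualH" "\<alpha> \<noteq> zero_wt" "q \<in> wtv \<alpha>" using z q by blast
    have zq: "z \<in> G" "q \<in> G" using z q by auto
    show ?thesis
    proof (cases "(\<lambda>h. \<beta> h + \<alpha> h) = zero_wt")
      case True
      then have a: "\<alpha> = (\<lambda>h. - \<beta> h)" by (metis add_eq_0_iff)
      then have "\<beta> \<noteq> zero_wt" using ab(4) by auto
      then have "br z q = 0" using no[OF ab(1) _ zq ab(2)] ab(5) a by blast
      then show ?thesis by (simp add: span_zero)
    next
      case False
      then have "br z q \<in> ?Q" using br_wtv[OF ab(2,5)] dual_add[OF ab(1,3)] G_br[OF zq] by blast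
      then show ?thesis by (rule span_base)
    qed
  qed
  have "br z q \<in> span ?Q" if z: "z \<in> G" and q: "q \<in> span ?Q" for z q
  proof (rule endo_span[OF br_endo subspace_span _ q])
    fix q assume q: "q \<in> ?Q"
    show "br z q \<in> span ?Q"
    proof (rule endo_span[OF br_endo_left subspace_span])
      show "z \<in> span (wvecs G)" using z G_weights by blast
    qed (rule step[OF _ q])
  qed
  moreover have "span ?Q \<subseteq> G" using span_minimal[of ?Q G] subspace_G by blast
  ultimately have "lie_ideal sc br G (span ?Q)" by (simp add: lie_ideal_def)
  then consider "span ?Q = {0}" | "span ?Q = G" using simpleG by (auto simp: simple_lie_def)
  then show False
  proof cases
    case 1
    obtain \<alpha> where "\<alpha> \<in> g00_roots D" using root_exists by blast
    then obtain x where "x \<in> G" "x \<in> wtv \<alpha>" "x \<noteq> 0" "\<alpha> \<in> dualH" "\<alpha> \<noteq> zero_wt" by (rule rootE)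
    then have "x \<in> ?Q" "x \<noteq> 0" by blast+
    then show False using 1 span_base[of x ?Q] by blast
  next
    case 2
    have H0: "h = 0" if h: "h \<in> H" for h
    proof -
      have hw: "h \<in> wtv zero_wt" using H_abelian h by (auto simp: joint_eigenspace_def)
      have "h \<in> span ?Q" using 2 h H_sub by blast
      then have "h \<in> span (?Q \<inter> wtv zero_wt)" by (intro weight_part[OF _ _ hw dual_zero]) blast+
      moreover have "?Q \<inter> wtv zero_wt \<subseteq> {0}" using wtv_unique dual_zero by blast
      ultimately show ?thesis using span_mono[of _ "{0}"] by (auto simp: span_zero)
    qed
    have "br h x = 0" if "h \<in> H" for h x using H0[OF that] by simp
    then have "G \<subseteq> H" using H_max by blast
    then show False using G_not_sub_H by blast
  qed
qed

text \<open>The role of Cartan's criterion is taken by \<open>kf_bracket_nonzero\<close>: the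
  radical is an ideal, and it is not everything because the form is nonzero on a bracket of opposite
  root vectors.\<close>

lemma kf_G_nondegenerate: assumes "x \<in> G" "x \<noteq> 0" shows "\<exists>y\<in>G. kf G x y \<noteq> 0"
proof (rule ccontr)
  assume no: "\<not> ?thesis"
  let ?R = "{x \<in> G. \<forall>y\<in>G. kf G x y = 0}"
  note st = stab_G
  have "lie_ideal sc br G ?R" unfolding lie_ideal_def
  proof (intro conjI ballI)
    have z: "kf G 0 y = 0" if "y \<in> G" for y
      using kf_scale[OF subspace_G, of 0 y 0] that st subspace_0[OF subspace_G] by simp
    show "subspace ?R" using subspace_G st z
      by (auto simp: subspace_def kf_add[OF subspace_G] kf_scale[OF subspace_G])
    fix z r assume z: "z \<in> G" and r: "r \<in> ?R"
    have "kf G (br z r) y = 0" if y: "y \<in> G" for y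
    proof -
      have "br z r = sc (-1) (br r z)" using br_skew[of z r] by simp
      then have "kf G (br z r) y = - kf G (br r z) y"
        using kf_scale[OF subspace_G, of "br r z" y "-1"] z r y st G_br by simp
      also have "kf G (br r z) y = 0" using kf_invariant[OF subspace_G, of r z y] z r y st G_br by simp
      finally show ?thesis by simp
    qed
    then show "br z r \<in> ?R" using z r G_br by blast
  qed blast
  moreover have "?R \<noteq> {0}" using assms no by blast
  ultimately have RG: "?R = G" using simpleG by (auto simp: simple_lie_def)
  obtain \<alpha> u v where uv: "\<alpha> \<in> dualH" "u \<in> G" "v \<in> G" "u \<in> wtv \<alpha>" "v \<in> wtv (\<lambda>h. - \<alpha> h)" "br u v \<noteq> 0"
    using opposite_root_vectors_exist by blast
  have "kf G (br u v) (br u v) \<noteq> 0"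
    by (rule kf_bracket_nonzero[OF subspace_G G_weights order_refl st uv(2,4,3,5,1,6)])
  moreover have "br u v \<in> G" using uv G_br by blast
  ultimately show False using RG by blast
qed

lemma dual_uminus: "\<alpha> \<in> dualH \<Longrightarrow> x \<in> H \<Longrightarrow> \<alpha> (- x) = - \<alpha> x"
proof -
  assume a: "\<alpha> \<in> dualH" "x \<in> H"
  have "\<alpha> (sc (-1) x) = -1 * \<alpha> x" using a unfolding dual_def by blast
  then show ?thesis by simp
qed

subsection \<open>Root strings\<close>

text \<open>An sl_2-triple with h = [e,f]: the relations [h,e] = 2e and [h,f] = -2f follow from the
  weights and \<alpha>(h) = 2.\<close>

definition triple :: "('g \<Rightarrow> complex) \<Rightarrow> 'g \<Rightarrow> 'g \<Rightarrow> bool" where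
  "triple \<alpha> e f \<longleftrightarrow> \<alpha> \<in> dualH \<and> e \<in> G \<and> f \<in> G \<and> e \<in> wtv \<alpha> \<and> f \<in> wtv (\<lambda>h. - \<alpha> h) \<and> \<alpha> (br e f) = 2"

lemma triple_H: "triple \<alpha> e f \<Longrightarrow> br e f \<in> H"
  unfolding triple_def using opposite_bracket_in_H by blast

lemma triple_flip: assumes "triple \<alpha> e f" shows "triple (\<lambda>h. - \<alpha> h) f e"
proof -
  have "br f e = - br e f" by (rule br_skew)
  then show ?thesis
    using assms triple_H[OF assms] dual_uminus[of \<alpha> "br e f"] dual_neg[of \<alpha>] by (simp add: triple_def)
qed

text \<open>Nondegeneracy gives a weight vector y pairing with x, and invariance forces its weight
  to be -\<alpha>. Invariance also shows [x,y] \<noteq> 0, so \<alpha> does not vanish on it and y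
  can be rescaled. The second conjunct makes the coroot [e,f] proportional to the vector dual to
  \<alpha>.\<close>

lemma triple_exists:
  assumes "\<alpha> \<in> g00_roots D"
  shows "\<exists>e f. triple \<alpha> e f \<and> (\<forall>h\<in>H. kf G (br e f) h = \<alpha> h * kf G e f)"
proof -
  note st = stab_G and kG = kf_sym[OF subspace_G] kf_add[OF subspace_G] kf_scale[OF subspace_G] kf_invariant[OF subspace_G]
  obtain x where x: "x \<in> G" "x \<in> wtv \<alpha>" "x \<noteq> 0" "\<alpha> \<in> dualH" "\<alpha> \<noteq> zero_wt" using assms by (rule rootE)
  have "\<exists>y\<in>wvecs G. kf G x y \<noteq> 0"
  proof (rule ccontr)
    assume no: "\<not> ?thesis"
    have s: "kf G x y = kf G y x" if "y \<in> G" for y using kG(1)[OF st st] x that by simp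
    have "kf G 0 x = 0" using kG(3)[OF st st, of 0 x 0] x subspace_0[OF subspace_G] by simp
    then have "subspace {y \<in> G. kf G x y = 0}" using subspace_G st x s
      by (auto simp: subspace_def kG(2,3))
    then have "G \<subseteq> {y \<in> G. kf G x y = 0}" using no G_weights span_minimal[of "wvecs G" "{y \<in> G. kf G x y = 0}"] by blast
    then show False using kf_G_nondegenerate[OF x(1,3)] by blast
  qed
  then obtain y \<beta> where y: "y \<in> G" "\<beta> \<in> dualH" "y \<in> wtv \<beta>" "kf G x y \<noteq> 0" by blast
  have b: "\<beta> = (\<lambda>h. - \<alpha> h)"
  proof
    fix h
    show "\<beta> h = - \<alpha> h"
    proof (cases "h \<in> H")
      case True
      then have hG: "h \<in> G" using H_sub by blast
      have "kf G (br x h) y = kf G x (br h y)" using kG(4) st x(1) hG y(1) by blast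
      also have "br h y = sc (\<beta> h) y" by (rule wtvD[OF y(3) True])
      also have "br x h = sc (- \<alpha> h) x" using br_skew[of x h] wtvD[OF x(2) True] by simp
      also have "kf G (sc (- \<alpha> h) x) y = - \<alpha> h * kf G x y" by (rule kG(3)[OF st[OF x(1)] st[OF y(1)]])
      also have "kf G x (sc (\<beta> h) y) = kf G (sc (\<beta> h) y) x"
        by (rule kG(1)[OF st[OF x(1)] stab_scale[OF subspace_G st[OF y(1)]]])
      also have "\<dots> = \<beta> h * kf G y x" by (rule kG(3)[OF st[OF y(1)] st[OF x(1)]])
      also have "kf G y x = kf G x y" by (rule kG(1)[OF st[OF y(1)] st[OF x(1)]])
      finally show ?thesis using mult_right_cancel[OF y(4)] by metis
    qed (simp add: dual_outside[OF x(4)] dual_outside[OF y(2)])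
  qed
  have xyH: "br x y \<in> H" using opposite_bracket_in_H x(1,2) y(1,3) b by blast
  have inv: "kf G (br x z) h = \<alpha> h * kf G x z" if h: "h \<in> H" and z: "z \<in> G" "z \<in> wtv (\<lambda>h. - \<alpha> h)" for h z
  proof -
    have hG: "h \<in> G" using H_sub h by blast
    have "br z h = sc (\<alpha> h) z" using br_skew[of z h] wtvD[OF z(2) h] by simp
    moreover have "kf G x (sc (\<alpha> h) z) = \<alpha> h * kf G x z"
      using kG(1)[OF st[OF x(1)] stab_scale[OF subspace_G st[OF z(1)]], of "\<alpha> h"]
        kG(3)[OF st[OF z(1)] st[OF x(1)]] kG(1)[OF st[OF z(1)] st[OF x(1)]] by simp
    ultimately show ?thesis using kG(4)[OF st[OF x(1)] st[OF z(1)] st[OF hG]] by simp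
  qed
  have "br x y \<noteq> 0"
  proof
    assume 0: "br x y = 0"
    obtain h where h: "\<alpha> h \<noteq> 0" using x(5) by blast
    then have "h \<in> H" using dual_outside[OF x(4)] by blast
    then have "kf G 0 h \<noteq> 0" using inv[of h y] y b h 0 by simp
    moreover have "kf G 0 h = 0" using kG(3)[OF st st, of 0 h 0] subspace_0[OF subspace_G] \<open>h \<in> H\<close> H_sub by auto
    ultimately show False by blast
  qed
  then have a0: "\<alpha> (br x y) \<noteq> 0" using root_on_bracket_nonzero[OF x(1,2) y(1) _ x(4)] y(3) b by blast
  let ?f = "sc (2 / \<alpha> (br x y)) y"
  have f: "?f \<in> G" "?f \<in> wtv (\<lambda>h. - \<alpha> h)"
    using y b subspace_scale[OF subspace_G] subspace_scale[OF subspace_wtv] by blast+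
  have "\<alpha> (sc c (br x y)) = c * \<alpha> (br x y)" for c using x(4) xyH unfolding dual_def by blast
  then have "triple \<alpha> x ?f" using x f a0 by (simp add: triple_def br_scale)
  then show ?thesis using inv f by blast
qed

lemma funpow_br_wtv:
  assumes "e \<in> wtv \<alpha>" "u \<in> wtv \<mu>"
  shows "(br e ^^ r) u \<in> wtv (\<lambda>h. \<mu> h + of_nat r * \<alpha> h)"
proof (induction r)
  case (Suc r)
  show ?case using br_wtv[OF assms(1) Suc] by (simp add: algebra_simps)
qed (use assms in simp)

lemma finite_weights: "finite {\<mu> \<in> dualH. \<exists>u. u \<noteq> 0 \<and> u \<in> wtv \<mu>}"
proof -
  obtain B wt where B: "finite B" "independent B" "span B = UNIV"
    "\<And>b. b \<in> B \<Longrightarrow> wt b \<in> dualH \<and> b \<in> wtv (wt b) \<and> b \<noteq> 0"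
    using weight_basis[OF subspace_UNIV UNIV_weights] by metis
  have "{\<mu> \<in> dualH. \<exists>u. u \<noteq> 0 \<and> u \<in> wtv \<mu>} \<subseteq> wt ` B"
    using weight_in_basis[OF B(4)] B(3) by fastforce
  then show ?thesis by (rule finite_subset[OF _ finite_imageI[OF B(1)]])
qed

text \<open>Otherwise the pairwise distinct functions \<mu> + r \<alpha> would all be weights of g,
  which has finitely many.\<close>

lemma root_vector_nilpotent:
  assumes e: "e \<in> wtv \<alpha>" "\<alpha> \<in> dualH" "\<alpha> h \<noteq> 0" and u: "u \<in> wtv \<mu>" "\<mu> \<in> dualH"
  shows "\<exists>r. (br e ^^ r) u = 0"
proof (rule ccontr)
  assume no: "\<not> ?thesis"
  let ?w = "\<lambda>r::nat. (\<lambda>h. \<mu> h + of_nat r * \<alpha> h)"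
  have "range ?w \<subseteq> {\<mu> \<in> dualH. \<exists>u. u \<noteq> 0 \<and> u \<in> wtv \<mu>}"
    using no funpow_br_wtv[OF e(1) u(1)] dual_add[OF u(2) dual_mult[OF e(2)]] by blast
  moreover have "inj ?w" using e(3) by (intro injI) (auto dest!: fun_cong[of _ _ h])
  ultimately show False using finite_weights finite_subset finite_imageD infinite_UNIV_nat by blast
qed

lemma exists_last_nonzero:
  fixes g :: "'g \<Rightarrow> 'g"
  assumes "(g ^^ r) u = (0::'g)" "u \<noteq> 0"
  shows "\<exists>m. (g ^^ m) u \<noteq> 0 \<and> (\<forall>j\<le>m. (g ^^ j) u \<noteq> 0) \<and> (g ^^ Suc m) u = 0"
proof -
  define n where "n = (LEAST n. (g ^^ n) u = 0)"
  have n: "(g ^^ n) u = 0" unfolding n_def using assms(1) by (rule LeastI)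
  have "n \<noteq> 0" using n assms(2) by (intro notI) simp
  then obtain m where m: "n = Suc m" using not0_implies_Suc by blast
  have "(g ^^ j) u \<noteq> 0" if "j \<le> m" for j
    using not_less_Least[of j "\<lambda>n. (g ^^ n) u = 0"] m n_def that by auto
  then show ?thesis using n m by blast
qed

text \<open>Moving e through the factors f collects the values \<mu>(h) - 2i of h = [e,f] for i = 0,
  ..., j, whose sum is the stated factor.\<close>

lemma raise_lower:
  assumes t: "triple \<alpha> e f" and u: "u \<in> wtv \<mu>" "br e u = 0"
  shows "br e ((br f ^^ Suc j) u) = sc (of_nat (Suc j) * (\<mu> (br e f) - of_nat j)) ((br f ^^ j) u)"
proof (induction j)
  case 0
  show ?case using jacobi[of e f u] u wtvD[OF u(1) triple_H[OF t]] by simp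
next
  case (Suc j)
  let ?w = "(br f ^^ Suc j) u"
  have "?w \<in> wtv (\<lambda>h. \<mu> h + of_nat (Suc j) * - \<alpha> h)"
    using t u(1) by (intro funpow_br_wtv) (auto simp: triple_def)
  from wtvD[OF this triple_H[OF t]] have "br (br e f) ?w = sc (\<mu> (br e f) - 2 * of_nat (Suc j)) ?w"
    using t by (simp add: triple_def algebra_simps)
  moreover have "br e ((br f ^^ Suc (Suc j)) u) = br (br e f) ?w + br f (br e ?w)"
    using jacobi[of e f ?w] by simp
  moreover have "br f (br e ?w) = sc (of_nat (Suc j) * (\<mu> (br e f) - of_nat j)) ?w"
    unfolding Suc by (simp add: br_scale)
  ultimately have "br e ((br f ^^ Suc (Suc j)) u)
      = sc (\<mu> (br e f) - 2 * of_nat (Suc j) + of_nat (Suc j) * (\<mu> (br e f) - of_nat j)) ?w"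
    by (simp only: scale_left_distrib)
  also have "\<mu> (br e f) - 2 * of_nat (Suc j) + of_nat (Suc j) * (\<mu> (br e f) - of_nat j)
      = of_nat (Suc (Suc j)) * (\<mu> (br e f) - of_nat (Suc j))" by (simp add: algebra_simps)
  finally show ?case .
qed

definition wts :: "'g set \<Rightarrow> ('g \<Rightarrow> complex) set" where
  "wts V = {\<mu> \<in> dualH. \<exists>v\<in>V. v \<noteq> 0 \<and> v \<in> wtv \<mu>}"

lemma wtsI: "\<mu> \<in> dualH \<Longrightarrow> v \<in> V \<Longrightarrow> v \<noteq> 0 \<Longrightarrow> v \<in> wtv \<mu> \<Longrightarrow> \<mu> \<in> wts V"
  by (auto simp: wts_def)

text \<open>Let u be the last nonzero vector reached by raising v, p steps above it, and n the
  number of steps by which u can be lowered. By \<open>raise_lower\<close> the end of the string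
  forces the value n at u, hence m = n - 2p at \<mu>. For j \<le> m the weight \<mu> - j \<alpha>
  sits at position j + p \<le> n below u.\<close>

lemma string_lower:
  assumes t: "triple \<alpha> e f" and V: "stab V e" "stab V f" and m: "\<mu> \<in> wts V"
  shows "\<exists>m::int. \<mu> (br e f) = of_int m \<and> (\<forall>j::nat. int j \<le> m \<longrightarrow> (\<lambda>h. \<mu> h - of_nat j * \<alpha> h) \<in> wts V)"
proof -
  let ?h = "br e f"
  obtain v where v: "\<mu> \<in> dualH" "v \<in> V" "v \<noteq> 0" "v \<in> wtv \<mu>" using m by (auto simp: wts_def)
  have a: "\<alpha> \<in> dualH" "e \<in> wtv \<alpha>" "f \<in> wtv (\<lambda>h. - \<alpha> h)" "\<alpha> ?h = 2" using t by (auto simp: triple_def)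
  have "\<exists>r. (br e ^^ r) v = 0" using root_vector_nilpotent[OF a(2,1) _ v(4,1), of ?h] a(4) by simp
  then obtain r where "(br e ^^ r) v = 0" by blast
  then obtain p where p: "(br e ^^ p) v \<noteq> 0" "(br e ^^ Suc p) v = 0" using exists_last_nonzero[of r "br e" v] v(3) by blast
  define u where "u = (br e ^^ p) v"
  define \<nu> where "\<nu> = (\<lambda>h. \<mu> h + of_nat p * \<alpha> h)"
  have u: "u \<in> wtv \<nu>" "u \<noteq> 0" "br e u = 0" using funpow_br_wtv[OF a(2) v(4)] p by (simp_all add: u_def \<nu>_def)
  have nd: "\<nu> \<in> dualH" unfolding \<nu>_def by (rule dual_add[OF v(1) dual_mult[OF a(1)]])
  have uV: "u \<in> V" unfolding u_def using V(1) v(2) by (induction p) (auto simp: stab_def)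
  have fV: "(br f ^^ j) u \<in> V" for j using V(2) uV by (induction j) (auto simp: stab_def)
  have "\<exists>r. (br f ^^ r) u = 0"
    using root_vector_nilpotent[OF a(3) dual_neg[OF a(1)] _ u(1) nd, of ?h] a(4) by simp
  then obtain r where "(br f ^^ r) u = 0" by blast
  then obtain n where n: "(br f ^^ n) u \<noteq> 0" "\<And>j. j \<le> n \<Longrightarrow> (br f ^^ j) u \<noteq> 0" "(br f ^^ Suc n) u = 0"
    using exists_last_nonzero[of r "br f" u] u(2) by blast
  have "sc (of_nat (Suc n) * (\<nu> ?h - of_nat n)) ((br f ^^ n) u) = 0"
    using raise_lower[OF t u(1,3), of n] n(3) by simp
  then have "of_nat (Suc n) * (\<nu> ?h - of_nat n) = 0" using n(1) scale_eq_0_iff by blast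
  then have "\<nu> ?h = of_nat n" by (metis eq_iff_diff_eq_0 mult_eq_0_iff of_nat_neq_0)
  then have mh: "\<mu> ?h = of_int (int n - 2 * int p)" using a(4) by (simp add: \<nu>_def algebra_simps)
  have "(\<lambda>h. \<mu> h - of_nat j * \<alpha> h) \<in> wts V" if j: "int j \<le> int n - 2 * int p" for j
  proof (rule wtsI)
    have jn: "j + p \<le> n" using j by linarith
    show "(\<lambda>h. \<mu> h - of_nat j * \<alpha> h) \<in> dualH" using dual_add[OF v(1) dual_mult[OF a(1), of "- of_nat j"]] by simp
    show "(br f ^^ (j + p)) u \<in> V" by (rule fV)
    show "(br f ^^ (j + p)) u \<noteq> 0" by (rule n(2)[OF jn])
    have "(br f ^^ (j + p)) u \<in> wtv (\<lambda>h. \<nu> h + of_nat (j + p) * - \<alpha> h)" by (rule funpow_br_wtv[OF a(3) u(1)])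
    then show "(br f ^^ (j + p)) u \<in> wtv (\<lambda>h. \<mu> h - of_nat j * \<alpha> h)" by (simp add: \<nu>_def algebra_simps)
  qed
  then show ?thesis using mh by blast
qed

text \<open>Strings upwards are strings downwards for the opposite triple. In particular the
  reflected weight \<mu> - m \<alpha> is obtained for either sign of m.\<close>

lemma string_full:
  assumes t: "triple \<alpha> e f" and V: "stab V e" "stab V f" and m: "\<mu> \<in> wts V"
  obtains m :: int where "\<mu> (br e f) = of_int m"
    "\<And>j::nat. int j \<le> m \<Longrightarrow> (\<lambda>h. \<mu> h - of_nat j * \<alpha> h) \<in> wts V"
    "\<And>j::nat. int j \<le> - m \<Longrightarrow> (\<lambda>h. \<mu> h + of_nat j * \<alpha> h) \<in> wts V"
proof -
  obtain m :: int where m1: "\<mu> (br e f) = of_int m" "\<And>j::nat. int j \<le> m \<Longrightarrow> (\<lambda>h. \<mu> h - of_nat j * \<alpha> h) \<in> wts V"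
    using string_lower[OF t V m] by blast
  obtain m' :: int where m2: "\<mu> (br f e) = of_int m'"
    "\<And>j::nat. int j \<le> m' \<Longrightarrow> (\<lambda>h. \<mu> h - of_nat j * - \<alpha> h) \<in> wts V"
    using string_lower[OF triple_flip[OF t] V(2,1) m] by blast
  have "\<mu> (br f e) = - \<mu> (br e f)"
    using br_skew[of f e] dual_uminus[OF _ triple_H[OF t], of \<mu>] m by (simp add: wts_def)
  then have "complex_of_int m' = of_int (- m)" using m1(1) m2(1) by simp
  then have "m' = - m" by (simp only: of_int_eq_iff)
  then show thesis using that[of m] m1 m2(2) by simp
qed

subsection \<open>Positive weights\<close>

abbreviation pos :: "('g \<Rightarrow> complex) \<Rightarrow> bool" where "pos \<equiv> positive_wt (simples D)"
abbreviation nonneg :: "('g \<Rightarrow> complex) \<Rightarrow> bool" where "nonneg \<equiv> nonneg_comb (simples D)"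

lemma simples_dual: "\<beta> \<in> simples D \<Longrightarrow> \<beta> \<in> dualH"
  and simples_root: "\<beta> \<in> simples D \<Longrightarrow> \<beta> \<in> g00_roots D"
  using simples roots_dual by (auto simp: simple_roots_def)

lemma finite_simples: "finite (simples D)"
  and simples_independent: "(\<And>h. (\<Sum>\<beta>\<in>simples D. c \<beta> * \<beta> h) = 0) \<Longrightarrow> \<beta> \<in> simples D \<Longrightarrow> c \<beta> = 0"
  and root_sign: "\<alpha> \<in> g00_roots D \<Longrightarrow> nonneg \<alpha> \<or> nonneg (\<lambda>h. - \<alpha> h)"
  using simples unfolding simple_roots_def by blast+

text \<open>Pairing with \<open>varpi\<close> measures heights.\<close>

definition varpi :: 'g where "varpi = (SOME w. w \<in> H \<and> (\<forall>\<beta>\<in>simples D. \<beta> w = 1))"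

lemma varpi: "varpi \<in> H" "\<And>\<beta>. \<beta> \<in> simples D \<Longrightarrow> \<beta> varpi = 1"
proof -
  have "\<exists>w\<in>H. \<forall>\<beta>\<in>simples D. \<beta> w = 1"
  proof (rule dual_basis_exists[OF vector_space_axioms finite_simples H_subspace])
    fix c assume c: "\<And>h. h \<in> H \<Longrightarrow> (\<Sum>f\<in>simples D. c f * f h) = 0"
    have "(\<Sum>f\<in>simples D. c f * f h) = 0" for h
    proof (cases "h \<in> H")
      case False
      then show ?thesis using dual_outside[OF simples_dual] by (intro sum.neutral) simp
    qed (rule c)
    then show "\<forall>f\<in>simples D. c f = 0" using simples_independent by blast
  qed (use simples_dual in \<open>auto simp: dual_def\<close>)
  then have "\<exists>w. w \<in> H \<and> (\<forall>\<beta>\<in>simples D. \<beta> w = 1)" by blast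
  from someI_ex[OF this] show "varpi \<in> H" "\<And>\<beta>. \<beta> \<in> simples D \<Longrightarrow> \<beta> varpi = 1"
    unfolding varpi_def by blast+
qed

lemma nonneg_height: "nonneg \<alpha> \<Longrightarrow> \<exists>n::nat. \<alpha> varpi = of_nat n \<and> (n = 0 \<longrightarrow> \<alpha> = zero_wt)"
proof -
  assume "nonneg \<alpha>"
  then obtain n :: "('g \<Rightarrow> complex) \<Rightarrow> nat" where n: "\<And>h. \<alpha> h = (\<Sum>\<beta>\<in>simples D. of_nat (n \<beta>) * \<beta> h)"
    by (auto simp: nonneg_comb_def)
  have a: "\<alpha> varpi = of_nat (\<Sum>\<beta>\<in>simples D. n \<beta>)" unfolding n by (simp add: varpi(2))
  have z: "\<alpha> = zero_wt" if "(\<Sum>\<beta>\<in>simples D. n \<beta>) = 0"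
  proof
    fix h show "\<alpha> h = 0" unfolding n using that finite_simples by simp
  qed
  show ?thesis by (rule exI, rule conjI, rule a, rule impI, rule z)
qed

lemma pos_height: "pos \<alpha> \<Longrightarrow> \<exists>n::nat. n > 0 \<and> \<alpha> varpi = of_nat n"
  using nonneg_height[of \<alpha>] by (auto simp: positive_wt_def)

lemma nonneg_add: "nonneg \<alpha> \<Longrightarrow> nonneg \<beta> \<Longrightarrow> nonneg (\<lambda>h. \<alpha> h + \<beta> h)"
proof -
  assume "nonneg \<alpha>" "nonneg \<beta>"
  then obtain n m :: "('g \<Rightarrow> complex) \<Rightarrow> nat" where "\<And>h. \<alpha> h = (\<Sum>\<gamma>\<in>simples D. of_nat (n \<gamma>) * \<gamma> h)"
    "\<And>h. \<beta> h = (\<Sum>\<gamma>\<in>simples D. of_nat (m \<gamma>) * \<gamma> h)" by (auto simp: nonneg_comb_def)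
  then show ?thesis unfolding nonneg_comb_def
    by (intro exI[of _ "\<lambda>\<gamma>. n \<gamma> + m \<gamma>"]) (simp add: sum.distrib distrib_right)
qed

lemma nonneg_antisym: assumes "nonneg (\<lambda>h. \<alpha> h - \<beta> h)" "nonneg (\<lambda>h. \<beta> h - \<alpha> h)" shows "\<alpha> = \<beta>"
proof -
  obtain n m :: nat where nm: "\<alpha> varpi - \<beta> varpi = of_nat n" "\<beta> varpi - \<alpha> varpi = of_nat m"
    "n = 0 \<longrightarrow> (\<lambda>h. \<alpha> h - \<beta> h) = zero_wt"
    using nonneg_height[OF assms(1)] nonneg_height[OF assms(2)] by blast
  have "of_nat (n + m) = (0::complex)" using nm(1,2) by (simp flip: nm(1,2))
  then have "n = 0" by (simp only: of_nat_eq_0_iff)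
  then show ?thesis using nm(3) by (auto simp: fun_eq_iff)
qed

lemma root_pos: "\<alpha> \<in> g00_roots D \<Longrightarrow> pos \<alpha> \<or> pos (\<lambda>h. - \<alpha> h)"
  using root_sign[of \<alpha>] by (auto simp: positive_wt_def g00_roots_def roots_def fun_eq_iff)

lemma weight_of_G_root: "\<mu> \<in> wts G \<Longrightarrow> \<mu> \<noteq> zero_wt \<Longrightarrow> \<mu> \<in> g00_roots D"
  by (auto simp: wts_def g00_roots_def roots_def wt_space_eq)

lemma root_weight_of_G: "\<alpha> \<in> g00_roots D \<Longrightarrow> \<alpha> \<in> wts G"
  by (erule rootE) (auto simp: wts_def)

text \<open>Lowering operators applied to v span a submodule, hence V, and they only subtract
  positive roots from \<open>lam\<close>. The vector v is any one killed by the positive root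
  vectors, since \<open>weight_raise\<close> supposes a second one in order to refute it.\<close>

lemma highest_weight_bound:
  assumes V: "subspace V" "\<And>x u. x \<in> G \<Longrightarrow> u \<in> V \<Longrightarrow> br x u \<in> V"
    and irr: "\<And>S. subspace S \<Longrightarrow> S \<subseteq> V \<Longrightarrow> (\<And>x u. x \<in> G \<Longrightarrow> u \<in> S \<Longrightarrow> br x u \<in> S) \<Longrightarrow> S = {0} \<or> S = V"
    and v: "v \<in> V" "v \<noteq> 0" "v \<in> wtv lam" "lam \<in> dualH"
    and hw: "\<And>\<alpha> x. \<alpha> \<in> g00_roots D \<Longrightarrow> pos \<alpha> \<Longrightarrow> x \<in> G \<Longrightarrow> x \<in> wtv \<alpha> \<Longrightarrow> br x v = 0"
    and m: "\<mu> \<in> wts V"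
  shows "nonneg (\<lambda>h. lam h - \<mu> h)"
proof -
  define Nm where "Nm = {x \<in> G. \<exists>\<alpha>\<in>dualH. pos (\<lambda>h. - \<alpha> h) \<and> x \<in> wtv \<alpha>}"
  define Bp where "Bp = H \<union> {x \<in> G. \<exists>\<alpha>\<in>dualH. pos \<alpha> \<and> x \<in> wtv \<alpha>}"
  define M where "M = lowering_closure br Nm {v}"
  have NB: "Nm \<union> Bp \<subseteq> G" using H_sub by (auto simp: Nm_def Bp_def)
  have "wvecs G \<subseteq> Nm \<union> Bp"
  proof
    fix x assume "x \<in> wvecs G"
    then obtain \<alpha> where a: "\<alpha> \<in> dualH" "x \<in> wtv \<alpha>" "x \<in> G" by blast
    consider "x = 0" | "\<alpha> = zero_wt" | "x \<noteq> 0" "\<alpha> \<noteq> zero_wt" by blast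
    then show "x \<in> Nm \<union> Bp"
    proof cases
      case 1 then show ?thesis using subspace_0[OF H_subspace] by (simp add: Bp_def)
    next
      case 2
      then have "x \<in> H" using a by (intro H_max) (auto simp: joint_eigenspace_def)
      then show ?thesis by (simp add: Bp_def)
    next
      case 3
      then have "\<alpha> \<in> g00_roots D" using a wtsI weight_of_G_root by blast
      then show ?thesis using root_pos a unfolding Nm_def Bp_def by blast
    qed
  qed
  then have G_span: "G \<subseteq> span (Nm \<union> Bp)" using G_weights span_mono by blast
  have sM: "subspace M" unfolding M_def by (rule subspace_lowering_closure)
  have vM: "v \<in> M" unfolding M_def by (intro lowering_closure_base) simp
  have MV: "M \<subseteq> V" unfolding M_def using V v NB by (intro lowering_closure_minimal) auto
  have Bp: "br x w \<in> M" if x: "x \<in> Bp" and w: "w \<in> M" for x w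
    unfolding M_def
  proof (rule lowering_closure_stable[OF br_endo _ _ x w[unfolded M_def]])
    fix x t assume x: "x \<in> Bp" and t: "t \<in> {v}"
    show "br x t \<in> lowering_closure br Nm {v}"
    proof (cases "x \<in> H")
      case True
      then have "br x t = sc (lam x) v" using wtvD[OF v(3)] t by simp
      then show ?thesis using vM sM subspace_scale by (simp add: M_def)
    next
      case False
      then obtain \<alpha> where a: "\<alpha> \<in> dualH" "pos \<alpha>" "x \<in> wtv \<alpha>" "x \<in> G" "x \<noteq> 0"
        using x subspace_0[OF H_subspace] by (auto simp: Bp_def)
      then have "\<alpha> \<in> g00_roots D"
        using wtsI[of \<alpha> x G] weight_of_G_root by (auto simp: positive_wt_def)
      then have "br x t = 0" using hw a t by simp
      then show ?thesis using subspace_0[OF sM] by (simp add: M_def)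
    qed
  next
    fix x y w assume xy: "x \<in> Bp" "y \<in> Nm"
    have "br x y \<in> G" using xy NB G_br by blast
    then have "br x y \<in> span (Nm \<union> Bp)" using G_span by blast
    then have "br (br x y) w \<in> span {br z w | z. z \<in> Nm \<union> Bp}"
      by (rule endo_span[OF br_endo_left subspace_span, rotated]) (blast intro: span_base)
    then show "br x (br y w) - br y (br x w) \<in> span {br z w | z. z \<in> Nm \<union> Bp}"
      using jacobi[of x y w] by simp
  qed
  have "br x w \<in> M" if x: "x \<in> G" and w: "w \<in> M" for x w
  proof (rule endo_span[OF br_endo_left sM])
    show "x \<in> span (Nm \<union> Bp)" using x G_span by blast
    fix z assume "z \<in> Nm \<union> Bp"
    then show "br z w \<in> M" using Bp w lowering_closure_act[of z Nm w br "{v}"] unfolding M_def by blast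
  qed
  then have "M = V" using irr[OF sM MV] vM v(2) by blast
  let ?S = "{u. \<exists>\<mu>\<in>dualH. u \<in> wtv \<mu> \<and> nonneg (\<lambda>h. lam h - \<mu> h)}"
  have "M \<subseteq> span ?S" unfolding M_def
  proof (rule lowering_closure_minimal[OF subspace_span])
    have "nonneg (\<lambda>h. lam h - lam h)" by (auto simp: nonneg_comb_def intro: exI[of _ "\<lambda>_. 0"])
    then have "v \<in> ?S" using v by blast
    then have "v \<in> span ?S" by (rule span_base)
    then show "{v} \<subseteq> span ?S" by simp
    fix y w assume y: "y \<in> Nm" and w: "w \<in> span ?S"
    show "br y w \<in> span ?S"
    proof (rule endo_span[OF br_endo subspace_span _ w])
      fix u assume "u \<in> ?S"
      then obtain \<nu> where u: "\<nu> \<in> dualH" "u \<in> wtv \<nu>" "nonneg (\<lambda>h. lam h - \<nu> h)" by blast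
      obtain \<alpha> where a: "\<alpha> \<in> dualH" "pos (\<lambda>h. - \<alpha> h)" "y \<in> wtv \<alpha>" using y by (auto simp: Nm_def)
      have "nonneg (\<lambda>h. (lam h - \<nu> h) + - \<alpha> h)" using u(3) a(2) by (intro nonneg_add) (auto simp: positive_wt_def)
      then have "nonneg (\<lambda>h. lam h - (\<alpha> h + \<nu> h))" by (simp add: algebra_simps)
      then have "br y u \<in> ?S" using br_wtv[OF a(3) u(2)] dual_add[OF a(1) u(1)] by blast
      then show "br y u \<in> span ?S" by (rule span_base)
    qed
  qed
  moreover obtain u where u: "\<mu> \<in> dualH" "u \<in> V" "u \<noteq> 0" "u \<in> wtv \<mu>" using m by (auto simp: wts_def)
  ultimately have "u \<in> span ?S" using \<open>M = V\<close> by blast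
  then have "u \<in> span (?S \<inter> wtv \<mu>)" by (rule weight_part[rotated, OF _ u(4,1)]) blast
  then have "\<not> ?S \<inter> wtv \<mu> \<subseteq> {0}" using span_mono[of "?S \<inter> wtv \<mu>" "{0}"] u(3) by auto
  then obtain s where s: "s \<in> ?S" "s \<in> wtv \<mu>" "s \<noteq> 0" by blast
  then obtain \<nu> where "\<nu> \<in> dualH" "s \<in> wtv \<nu>" "nonneg (\<lambda>h. lam h - \<nu> h)" by blast
  moreover have "\<nu> = \<mu>" using wtv_unique s calculation u(1) by blast
  ultimately show ?thesis by blast
qed

section \<open>Weights of an irreducible constituent\<close>

context
  fixes V lam
  assumes cV: "constituent V lam"
begin

lemma V_subspace: "subspace V" and V_stable: "x \<in> G \<Longrightarrow> u \<in> V \<Longrightarrow> br x u \<in> V"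
  and V_irr: "\<And>S. subspace S \<Longrightarrow> S \<subseteq> V \<Longrightarrow> (\<And>x u. x \<in> G \<Longrightarrow> u \<in> S \<Longrightarrow> br x u \<in> S) \<Longrightarrow> S = {0} \<or> S = V"
  and lam_torus: "lam \<in> torus_weights D" and V_hw: "has_highest_weight D V lam"
  using cV unfolding constituent_def by auto

lemma lam_dual: "lam \<in> dualH" by (rule torus_weights_dual[OF lam_torus])

lemma V_stab: "x \<in> G \<Longrightarrow> stab V x" by (simp add: stab_def V_stable)

lemma hw_vector:
  obtains v where "v \<in> V" "v \<noteq> 0" "v \<in> wtv lam"
    "\<And>\<alpha> x. \<alpha> \<in> g00_roots D \<Longrightarrow> pos \<alpha> \<Longrightarrow> x \<in> G \<Longrightarrow> x \<in> wtv \<alpha> \<Longrightarrow> br x v = 0"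
  using V_hw unfolding has_highest_weight_def gspace_wt_eq joint_eigenspace_def by auto

lemma lam_weight: "lam \<in> wts V"
  using hw_vector lam_dual wtsI by metis

lemma weight_le: "\<mu> \<in> wts V \<Longrightarrow> nonneg (\<lambda>h. lam h - \<mu> h)"
proof -
  assume m: "\<mu> \<in> wts V"
  obtain v where v: "v \<in> V" "v \<noteq> 0" "v \<in> wtv lam"
    "\<And>\<alpha> x. \<alpha> \<in> g00_roots D \<Longrightarrow> pos \<alpha> \<Longrightarrow> x \<in> G \<Longrightarrow> x \<in> wtv \<alpha> \<Longrightarrow> br x v = 0"
    by (rule hw_vector) blast
  show ?thesis by (rule highest_weight_bound[OF V_subspace V_stable V_irr v(1-3) lam_dual v(4) m])
qed

text \<open>A weight that no positive root raises would belong to another highest weight vector;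
  \<open>highest_weight_bound\<close> in both directions would then identify it with
  \<open>lam\<close>.\<close>

lemma weight_raise:
  assumes m: "\<mu> \<in> wts V" "\<mu> \<noteq> lam"
  shows "\<exists>\<gamma>\<in>g00_roots D. pos \<gamma> \<and> (\<lambda>h. \<mu> h + \<gamma> h) \<in> wts V"
proof (rule ccontr)
  assume no: "\<not> ?thesis"
  obtain u where u: "\<mu> \<in> dualH" "u \<in> V" "u \<noteq> 0" "u \<in> wtv \<mu>" using m by (auto simp: wts_def)
  have k: "br x u = 0" if x: "\<alpha> \<in> g00_roots D" "pos \<alpha>" "x \<in> G" "x \<in> wtv \<alpha>" for \<alpha> x
  proof (rule ccontr)
    assume "br x u \<noteq> 0"
    moreover have "br x u \<in> wtv (\<lambda>h. \<mu> h + \<alpha> h)" using br_wtv[OF x(4) u(4)] by (simp add: add.commute)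
    ultimately have "(\<lambda>h. \<mu> h + \<alpha> h) \<in> wts V"
      using V_stable[OF x(3) u(2)] dual_add[OF u(1) roots_dual[OF x(1)]] wtsI by blast
    then show False using no x by blast
  qed
  have "nonneg (\<lambda>h. \<mu> h - lam h)"
    by (rule highest_weight_bound[OF V_subspace V_stable V_irr u(2-4,1) k lam_weight])
  then show False using nonneg_antisym weight_le[OF m(1)] m(2) by blast
qed

lemma weight_height: "\<mu> \<in> wts V \<Longrightarrow> \<exists>n::nat. lam varpi - \<mu> varpi = of_nat n"
  using nonneg_height[OF weight_le] by blast

text \<open>The weights of \<open>g(0,0)\<close> form a saturated set; a saturated set containing the highest weight
  contains all weights.\<close>

lemma root_constituent_weights:
  assumes l: "lam \<in> g00_roots D" and m: "\<mu> \<in> wts V"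
  shows "\<mu> \<in> wts G"
proof -
  obtain n :: nat where "lam varpi - \<mu> varpi = of_nat n" using weight_height[OF m] by blast
  then show ?thesis using m
  proof (induction n arbitrary: \<mu> rule: less_induct)
    case (less n)
    show ?case
    proof (cases "\<mu> = lam")
      case True then show ?thesis using l root_weight_of_G by blast
    next
      case False
      then obtain \<gamma> where g: "\<gamma> \<in> g00_roots D" "pos \<gamma>" "(\<lambda>h. \<mu> h + \<gamma> h) \<in> wts V"
        using weight_raise less.prems by blast
      obtain p :: nat where p: "p > 0" "\<gamma> varpi = of_nat p" using pos_height g by blast
      obtain e f where t: "triple \<gamma> e f" using triple_exists g by blast
      have efG: "e \<in> G" "f \<in> G" "\<gamma> (br e f) = 2" using t by (auto simp: triple_def)
      \<comment> \<open>The induction runs over the height below \<open>lam\<close>: weights of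
        \<open>V\<close> higher than \<mu> are already weights of \<open>G\<close>.\<close>
      have IH: "\<nu> \<in> wts G" if n: "\<nu> \<in> wts V" "\<nu> varpi = \<mu> varpi + of_nat q" "q > 0" for \<nu> and q :: nat
      proof -
        obtain n' :: nat where n': "lam varpi - \<nu> varpi = of_nat n'" using weight_height[OF n(1)] by blast
        have "complex_of_nat (n' + q) = lam varpi - \<nu> varpi + of_nat q" using n' by simp
        also have "\<dots> = of_nat n" using n(2) less.prems(1) by simp
        finally have "complex_of_nat (n' + q) = of_nat n" .
        then have "n' + q = n" by (simp only: of_nat_eq_iff)
        then show ?thesis using less.IH[of n' \<nu>] n' n by simp
      qed
      obtain m :: int where m: "\<mu> (br e f) = of_int m"
        "\<And>j::nat. int j \<le> m \<Longrightarrow> (\<lambda>h. \<mu> h - of_nat j * \<gamma> h) \<in> wts V"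
        "\<And>j::nat. int j \<le> - m \<Longrightarrow> (\<lambda>h. \<mu> h + of_nat j * \<gamma> h) \<in> wts V"
        by (rule string_full[OF t V_stab[OF efG(1)] V_stab[OF efG(2)] less.prems(2)]) blast
      show ?thesis
      proof (cases "m < 0")
        case True
        \<comment> \<open>The reflection of \<mu> in \<gamma>. It is higher than \<mu>, and its
          \<gamma>-string inside \<open>G\<close> leads back to \<mu>.\<close>
        let ?\<nu> = "\<lambda>h. \<mu> h + of_nat (nat (- m)) * \<gamma> h"
        have "?\<nu> \<in> wts V" using m(3)[of "nat (- m)"] True by simp
        moreover have "?\<nu> varpi = \<mu> varpi + of_nat (nat (- m) * p)" using p(2) by simp
        moreover have "nat (- m) * p > 0" using True p(1) by simp
        ultimately have nG: "?\<nu> \<in> wts G" by (rule IH)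
        obtain m' :: int where m': "?\<nu> (br e f) = of_int m'"
          "\<And>j::nat. int j \<le> m' \<Longrightarrow> (\<lambda>h. ?\<nu> h - of_nat j * \<gamma> h) \<in> wts G"
          by (rule string_full[OF t stab_G[OF efG(1)] stab_G[OF efG(2)] nG]) blast
        have "?\<nu> (br e f) = of_int (- m)" using m(1) efG(3) True by simp
        then have "m' = - m" using m'(1) by (simp only: of_int_eq_iff)
        then show ?thesis using m'(2)[of "nat (- m)"] True by simp
      next
        case False
        \<comment> \<open>The weight \<mu> + \<gamma> takes the positive value m + 2 on the coroot,
          so one step down its string stays among the weights of \<open>G\<close>.\<close>
        have nG: "(\<lambda>h. \<mu> h + \<gamma> h) \<in> wts G" using IH[OF g(3), of p] p by simp
        obtain m' :: int where m': "(\<lambda>h. \<mu> h + \<gamma> h) (br e f) = of_int m'"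
          "\<And>j::nat. int j \<le> m' \<Longrightarrow> (\<lambda>h. (\<lambda>h. \<mu> h + \<gamma> h) h - of_nat j * \<gamma> h) \<in> wts G"
          by (rule string_full[OF t stab_G[OF efG(1)] stab_G[OF efG(2)] nG]) blast
        have "(\<lambda>h. \<mu> h + \<gamma> h) (br e f) = of_int (m + 2)" using m(1) efG(3) by simp
        then have "m' = m + 2" using m'(1) by (simp only: of_int_eq_iff)
        then show ?thesis using m'(2)[of 1] False by simp
      qed
    qed
  qed
qed

end

subsection \<open>The invariant form\<close>

lemma form_endo: "Vector_Spaces.linear sc (*) (form D x)"
  and form_sym: "form D x y = form D y x" and form_inv: "form D (br x y) z = form D x (br y z)"
  and form_nondeg: "(\<And>y. form D x y = 0) \<Longrightarrow> x = 0"
  using formD unfolding nondeg_invariant_form_def by blast+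

lemma form_add: "form D x (y + z) = form D x y + form D x z"
  and form_scale: "form D x (sc c y) = c * form D x y"
  using form_endo[of x] by (simp_all add: Vector_Spaces.linear_iff)

lemma form_add_left: "form D (y + z) x = form D y x + form D z x"
  and form_scale_left: "form D (sc c y) x = c * form D y x"
  using form_add[of x y z] form_scale[of x c y] by (simp_all add: form_sym[of _ x])

lemma form_zero: "form D x 0 = 0" using form_scale[of x 0 0] by simp

lemma kf_UNIV_add: "kf UNIV (x + y) z = kf UNIV x z + kf UNIV y z"
  and kf_UNIV_scale: "kf UNIV (sc c x) z = c * kf UNIV x z"
  and kf_UNIV_sym: "kf UNIV x y = kf UNIV y x"
  and kf_UNIV_inv: "kf UNIV (br x y) z = kf UNIV x (br y z)"
  using kf_add[OF subspace_UNIV] kf_scale[OF subspace_UNIV] kf_sym[OF subspace_UNIV]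
    kf_invariant[OF subspace_UNIV] by (auto simp: stab_def)

lemma kf_UNIV_zero: "kf UNIV 0 x = 0"
proof -
  have "kf UNIV 0 x = kf UNIV (sc 0 0) x" by simp
  also have "\<dots> = 0" unfolding kf_UNIV_scale by simp
  finally show ?thesis .
qed

text \<open>By Schur's lemma the Killing form of \<open>g\<close> is a multiple of the given form.\<close>

lemma killing_multiple: "\<exists>l. \<forall>x y. kf UNIV x y = l * form D x y"
proof -
  obtain B where B: "finite B" "independent B" "span B = UNIV" using finite_basis[OF subspace_UNIV] by metis
  interpret fd: finite_dimensional_vector_space sc B by unfold_locales (use B in auto)
  have extF: "(\<And>b. b \<in> B \<Longrightarrow> form D x b = form D x' b) \<Longrightarrow> x = x'" for x x'
  proof -
    assume e: "\<And>b. b \<in> B \<Longrightarrow> form D x b = form D x' b"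
    have "subspace {y. form D x y = form D x' y}" by (auto simp: subspace_def form_add form_scale form_zero)
    then have "form D x y = form D x' y" for y using span_minimal[of B "{y. form D x y = form D x' y}"] B(3) e by auto
    then have "form D (x + sc (-1) x') y = 0" for y unfolding form_add_left form_scale_left by simp
    then have "x + sc (-1) x' = 0" by (rule form_nondeg)
    then show ?thesis by simp
  qed
  \<comment> \<open>Each form is encoded by its values on a basis. By nondegeneracy
    \<open>?T\<close> is invertible, and \<phi>, which is \<open>?S\<close> followed by that
    inverse, satisfies (\<phi> x | y) = Killing form of x and y.\<close>
  let ?T = "\<lambda>x. \<Sum>b\<in>B. sc (form D x b) b" and ?S = "\<lambda>x. \<Sum>b\<in>B. sc (kf UNIV x b) b"
  have T: "endo ?T"
    by (auto simp: endo_iff form_add_left form_scale_left scale_left_distrib sum.distrib scale_sum_right)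
  have coef: "(\<Sum>b\<in>B. sc (p b) b) = (\<Sum>b\<in>B. sc (q b) b) \<Longrightarrow> b \<in> B \<Longrightarrow> p b = q b" for p q b
  proof -
    assume e: "(\<Sum>b\<in>B. sc (p b) b) = (\<Sum>b\<in>B. sc (q b) b)" and b: "b \<in> B"
    have "(\<Sum>b\<in>B. sc (p b - q b) b) = 0" using e by (simp add: scale_left_diff_distrib sum_subtractf)
    then have "p b - q b = 0"
      using B(1,2) b dependent_finite[OF B(1)] by (auto dest: spec[of _ "\<lambda>b. p b - q b"])
    then show ?thesis by simp
  qed
  have "inj ?T" using coef extF by (intro injI) blast
  then have "surj ?T" using fd.linear_inj_imp_surj[OF T] by blast
  have "\<exists>y. ?T y = ?S x" for x
  proof -
    obtain y where "?S x = ?T y" using surjD[OF \<open>surj ?T\<close>, of "?S x"] by blast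
    then show ?thesis by (intro exI[of _ y]) (rule sym)
  qed
  then obtain \<phi> where p: "\<And>x. ?T (\<phi> x) = ?S x" by metis
  have fB: "form D (\<phi> x) b = kf UNIV x b" if "b \<in> B" for x b using coef[OF p that] .
  have "endo \<phi>" unfolding endo_iff
    by (auto intro!: extF simp: fB form_add_left form_scale_left kf_UNIV_add kf_UNIV_scale)
  moreover obtain x0 :: 'g where "x0 \<noteq> 0" using simpleg by (metis simple_lie_def)
  ultimately obtain l y where y: "y \<noteq> 0" "\<phi> y = sc l y"
    using eigenvector_exists[OF vector_space_axioms B(1,3)] by blast
  have fphi: "form D (\<phi> x) z = kf UNIV x z" for x z
  proof -
    have k0: "kf UNIV x 0 = 0" using kf_UNIV_zero kf_UNIV_sym by metis
    have "subspace {z. form D (\<phi> x) z = kf UNIV x z}"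
      by (auto simp: subspace_def form_add form_scale form_zero k0 kf_UNIV_add kf_UNIV_scale kf_UNIV_sym[of x] kf_UNIV_zero)
    then show ?thesis using span_minimal[of B "{z. form D (\<phi> x) z = kf UNIV x z}"] B(3) fB by auto
  qed
  \<comment> \<open>In terms of \<phi> this is the eigenspace for \<open>l\<close>; it is an ideal
    because both forms are invariant.\<close>
  let ?K = "{x. \<forall>z. kf UNIV x z = l * form D x z}"
  have "lie_ideal sc br UNIV ?K" unfolding lie_ideal_def
  proof (intro conjI ballI)
    have "form D 0 z = 0" "kf UNIV 0 z = 0" for z
      using form_scale_left[of 0 0 z] kf_UNIV_scale[of 0 0 z] by simp_all
    then show "subspace ?K"
      by (auto simp: subspace_def form_add_left form_scale_left kf_UNIV_add kf_UNIV_scale distrib_left)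
    fix x r assume r: "r \<in> ?K"
    have "br x r = sc (-1) (br r x)" using br_skew[of x r] by simp
    then have "kf UNIV (br x r) z = l * form D (br x r) z" for z
      unfolding \<open>br x r = sc (-1) (br r x)\<close> kf_UNIV_scale form_scale_left kf_UNIV_inv form_inv
      using r by simp
    then show "br x r \<in> ?K" by simp
  qed simp
  moreover have "y \<in> ?K" using fphi[of y] y(2) by (simp add: form_scale_left)
  ultimately have "?K = UNIV" using simpleg y(1) unfolding simple_lie_def by blast
  then show ?thesis by blast
qed

text \<open>For h = [x,y] invariance gives (h|h) = \<alpha>(h) (x|y), up to the symmetry of the
  form, and (h|h) = 0 would make the Killing form vanish on h as well. The pair serves to reach the
  central operators by commutators.\<close>

lemma form_pairs_root_vectors:
  "\<exists>\<alpha> x y. \<alpha> \<in> dualH \<and> \<alpha> \<noteq> zero_wt \<and> x \<in> gspace_wt D 0 0 \<alpha> \<and> y \<in> gspace_wt D 0 0 (\<lambda>h. - \<alpha> h) \<and> form D x y \<noteq> 0"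
proof -
  obtain \<alpha> x y where xy: "\<alpha> \<in> dualH" "\<alpha> \<noteq> zero_wt" "x \<in> G" "y \<in> G" "x \<in> wtv \<alpha>" "y \<in> wtv (\<lambda>h. - \<alpha> h)" "br x y \<noteq> 0"
    using opposite_root_vectors_exist by blast
  let ?h = "br x y"
  have "kf UNIV ?h ?h \<noteq> 0"
    by (rule kf_bracket_nonzero[OF subspace_UNIV UNIV_weights _ _ xy(3,5,4,6,1,7)]) (auto simp: stab_def)
  then have "form D ?h ?h \<noteq> 0" using killing_multiple by fastforce
  moreover have "br y ?h = sc (\<alpha> ?h) y"
    using br_skew[of y ?h] wtvD[OF xy(6) opposite_bracket_in_H[OF xy(3-6)]] by simp
  ultimately have "form D x y \<noteq> 0" using form_inv[of x y ?h] by (auto simp: form_scale)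
  then show ?thesis using xy by (auto simp: gspace_wt_eq)
qed

end

subsection \<open>Coordinates in type B\<close>

text \<open>With simple roots \<beta>_i = e_i - e_{i+1} and last one e_{l-1}, this is the coordinate
  at e_k of the combination of the simple roots with coefficients \<open>c\<close>.\<close>

definition orth_coord :: "(nat \<Rightarrow> int) \<Rightarrow> nat \<Rightarrow> int" where
  "orth_coord c k = c k - (if k = 0 then 0 else c (k - 1))"

lemma orth_coord_sum: "(\<Sum>k\<le>n. orth_coord c k) = c n"
  by (induction n) (auto simp: orth_coord_def)

text \<open>The coordinates up to r add up to \<open>c r\<close> and those from r + 1 to s add up to
  \<open>c s - c r\<close>; the triangle inequality is applied to the two blocks.\<close>

lemma orth_coord_abs_le: "r \<le> s \<Longrightarrow> \<bar>c r\<bar> + \<bar>c s - c r\<bar> \<le> (\<Sum>k\<le>s. \<bar>orth_coord c k\<bar>)"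
proof (induction s rule: dec_induct)
  case base
  show ?case using sum_abs[of "orth_coord c" "{..r}"] by (simp add: orth_coord_sum)
next
  case (step s)
  then show ?case by (simp add: orth_coord_def)
qed

text \<open>The coefficients are the partial sums of the coordinates. Reaching a nonzero value costs
  at least 1, and moving on to a value of the opposite sign at least 2 more.\<close>

lemma small_l1_norm_sign:
  assumes "(\<Sum>k<l. \<bar>orth_coord c k\<bar>) \<le> 2"
  shows "(\<forall>r<l. c r \<ge> 0) \<or> (\<forall>r<l. c r \<le> 0)"
proof (rule ccontr)
  assume "\<not> ?thesis"
  then obtain r s where rs: "r < l" "c r < 0" "s < l" "c s > 0" by (meson not_le)
  have le: "\<bar>c a\<bar> + \<bar>c b - c a\<bar> \<le> 2" if "a \<le> b" "b < l" for a b
  proof -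
    have "(\<Sum>k\<le>b. \<bar>orth_coord c k\<bar>) \<le> (\<Sum>k<l. \<bar>orth_coord c k\<bar>)" using that by (intro sum_mono2) auto
    then show ?thesis using orth_coord_abs_le[OF that(1), of c] assms by linarith
  qed
  show False using le[of r s] le[of s r] rs by (cases "r \<le> s") auto
qed

abbreviation int_cartan_B :: "nat \<Rightarrow> nat \<Rightarrow> nat \<Rightarrow> int" where
  "int_cartan_B l i j \<equiv>
     (if i = j then 2 else if i + 1 = j \<and> j + 1 = l then -2 else if i + 1 = j \<or> j + 1 = i then -1 else 0)"

text \<open>The pairing with the coroot of \<beta>_j, in coordinates: x_j - x_{j+1} for a long root,
  2 x_j for the short one at the end.\<close>

lemma cartan_B_row_sum:
  assumes j: "j < l"
  shows "(\<Sum>r<l. c r * int_cartan_B l r j) =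
    (if j + 1 = l then 2 * orth_coord c j else orth_coord c j - orth_coord c (j + 1))"
proof -
  have "(\<Sum>r<l. c r * int_cartan_B l r j) = (\<Sum>r<l. (if r = j then 2 * c j else 0)
      + (if r + 1 = j then (if j + 1 = l then -2 else -1) * c (j - 1) else 0) + (if r = j + 1 then - c (j + 1) else 0))"
    by (intro sum.cong) auto
  also have "\<dots> = 2 * c j + (\<Sum>r<l. if r + 1 = j then (if j + 1 = l then -2 else -1) * c (j - 1) else 0)
      + (if j + 1 < l then - c (j + 1) else 0)"
    using j by (simp add: sum.distrib sum.delta)
  also have "(\<Sum>r<l. if r + 1 = j then (if j + 1 = l then -2 else -1) * c (j - 1) else 0)
      = (if j = 0 then 0 else (if j + 1 = l then -2 else -1) * c (j - 1))"
  proof (cases j)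
    case (Suc i)
    then have "(\<Sum>r<l. if r + 1 = j then (if j + 1 = l then -2 else -1) * c (j - 1) else 0)
        = (\<Sum>r<l. if r = i then (if j + 1 = l then -2 else -1) * c (j - 1) else 0)"
      by (intro sum.cong) auto
    then show ?thesis using Suc j by (simp add: sum.delta)
  qed simp
  finally show ?thesis using j by (auto simp: orth_coord_def)
qed

text \<open>The reflection in \<beta>_j exchanges the coordinates j and j + 1, or changes the sign
  of the last coordinate if j + 1 = l.\<close>

lemma l1_norm_reflection:
  assumes j: "j < l"
  shows "(\<Sum>k<l. \<bar>orth_coord (c(j := c j - (\<Sum>r<l. c r * int_cartan_B l r j))) k\<bar>) = (\<Sum>k<l. \<bar>orth_coord c k\<bar>)"
proof -
  let ?m = "\<Sum>r<l. c r * int_cartan_B l r j" and ?X = "orth_coord c"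
  let ?c = "c(j := c j - ?m)"
  have other: "orth_coord ?c k = ?X k" if "k \<noteq> j" "k \<noteq> j + 1" for k
    using that by (auto simp: orth_coord_def)
  have Xj: "orth_coord ?c j = ?X j - ?m" and Xj1: "orth_coord ?c (j + 1) = ?X (j + 1) + ?m"
    by (auto simp: orth_coord_def)
  show ?thesis
  proof (cases "j + 1 = l")
    case True
    then have "\<bar>orth_coord ?c k\<bar> = \<bar>?X k\<bar>" if "k < l" for k
      using that other[of k] Xj cartan_B_row_sum[OF j, of c] by (cases "k = j") auto
    then show ?thesis by (intro sum.cong) auto
  next
    case False
    let ?R = "{..<l} - {j} - {j + 1}"
    have s: "(\<Sum>k<l. f k) = f j + (f (j + 1) + sum f ?R)" for f :: "nat \<Rightarrow> int"
      using j False by (subst sum.remove[of _ j], simp, simp, subst sum.remove[of _ "j + 1"]) auto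
    have "orth_coord ?c j = ?X (j + 1)" "orth_coord ?c (j + 1) = ?X j"
      using Xj Xj1 cartan_B_row_sum[OF j, of c] False by simp_all
    moreover have "(\<Sum>k\<in>?R. \<bar>orth_coord ?c k\<bar>) = (\<Sum>k\<in>?R. \<bar>?X k\<bar>)" using other by (intro sum.cong) auto
    ultimately show ?thesis unfolding s[of "\<lambda>k. \<bar>orth_coord ?c k\<bar>"] s[of "\<lambda>k. \<bar>?X k\<bar>"] by simp
  qed
qed

lemma dominant_l1_norm:
  assumes "\<And>j. j < l \<Longrightarrow> (\<Sum>r<l. c r * int_cartan_B l r j) \<ge> 0" and l: "l > 0"
  shows "(\<Sum>k<l. \<bar>orth_coord c k\<bar>) = c (l - 1)"
proof -
  obtain n where n: "l = Suc n" using l by (cases l) auto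
  have last: "orth_coord c n \<ge> 0" using assms(1)[of n] cartan_B_row_sum[of n l c] n by simp
  have "orth_coord c (j + 1) \<le> orth_coord c j" if "j < n" for j
    using assms(1)[of j] cartan_B_row_sum[of j l c] n that by simp
  then have dec: "orth_coord c (Suc j) \<le> orth_coord c j" if "j < n" for j using that by simp
  have "orth_coord c n \<le> orth_coord c k" if "k \<le> n" for k
    using that
  proof (induction k rule: inc_induct)
    case (step k) then show ?case using dec[of k] by linarith
  qed simp
  then have "\<bar>orth_coord c k\<bar> = orth_coord c k" if "k \<le> n" for k using last that by force
  then have "(\<Sum>k\<le>n. \<bar>orth_coord c k\<bar>) = (\<Sum>k\<le>n. orth_coord c k)" by (intro sum.cong) auto
  then show ?thesis by (simp add: n lessThan_Suc_atMost orth_coord_sum)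
qed

text \<open>The Gram matrix of the simple roots of type B, in terms of \<open>\<beta>\<^sub>i = e\<^sub>i - e\<^bsub>i+1\<^esub>\<close>, \<open>\<beta>\<^bsub>l-1\<^esub> = e\<^bsub>l-1\<^esub>\<close>.\<close>

lemma cartan_B_gram:
  fixes d :: real and t :: "nat \<Rightarrow> int"
  assumes l: "l > 0" and gram: "\<And>i j. i < l \<Longrightarrow> j < l \<Longrightarrow> M i j = cartan_matrix_B l i j * w j / 2"
    and sym: "\<And>i j. i < l \<Longrightarrow> j < l \<Longrightarrow> M i j = M j i"
  shows "(\<Sum>i<l. \<Sum>j<l. of_int (t i) * of_int (t j) * M i j) = w (l - 1) * of_int (\<Sum>k<l. (orth_coord t k)\<^sup>2)"
proof -
  obtain n where n: "l = Suc n" using l by (cases l) auto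
  let ?d = "w n"
  \<comment> \<open>Comparing the entries (i, i+1) and (i+1, i) of the symmetric matrix gives the
    ratio of neighbouring squared lengths: 2 at the end of the diagram and 1 elsewhere.\<close>
  have step: "w i = (if i + 2 = l then 2 else 1) * w (Suc i)" if "Suc i < l" for i
    using sym[of i "Suc i"] gram[of i "Suc i"] gram[of "Suc i" i] that by (auto simp: cartan_matrix_B_def split: if_splits)
  have w: "w i = 2 * ?d" if "i < n" for i
  proof -
    have "i \<le> n - 1" using that by simp
    then show ?thesis
    proof (induction i rule: inc_induct)
      case base
      show ?case using step[of "n - 1"] that n by simp
    next
      case (step k)
      have "w k = w (Suc k)" using \<open>\<And>i. Suc i < l \<Longrightarrow> _\<close>[of k] step(2) n by auto
      then show ?case using step by simp
    qed
  qed
  \<comment> \<open>The coordinates of \<beta>_i. For i = l - 1 the subtracted entry falls outside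
    the range of k, so this covers the short root too.\<close>
  let ?a = "\<lambda>i k. (if k = i then 1 else 0) - (if k = Suc i then 1 else (0::real))"
  have M: "M i j = ?d * (\<Sum>k<l. ?a i k * ?a j k)" if ij: "i < l" "j < l" for i j
  proof -
    have "(\<Sum>k<l. ?a i k * ?a j k) = (\<Sum>k<l. (if k = i then (if i = j then 1 else 0) - (if i = Suc j then 1 else 0) else 0))
        - (\<Sum>k<l. (if k = Suc i then (if Suc i = j then 1 else 0) - (if i = j then 1 else 0) else 0))"
      unfolding sum_subtractf[symmetric] by (intro sum.cong) auto
    also have "\<dots> = (if i = j then 1 else 0) - (if i = Suc j then 1 else 0)
        - (if Suc i < l then (if Suc i = j then 1 else 0) - (if i = j then 1 else 0) else 0)"
      using ij by (simp add: sum.delta)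
    finally have s: "(\<Sum>k<l. ?a i k * ?a j k) = (if i = j then 1 else 0) - (if i = Suc j then 1 else 0)
        - (if Suc i < l then (if Suc i = j then 1 else 0) - (if i = j then 1 else 0) else 0)" .
    have wj: "w j = (if j = n then ?d else 2 * ?d)" using w[of j] ij n by auto
    show ?thesis unfolding s gram[OF ij] wj using ij n by (auto simp: cartan_matrix_B_def)
  qed
  have X: "(\<Sum>i<l. of_int (t i) * ?a i k) = of_int (orth_coord t k)" if k: "k < l" for k
  proof -
    have "(\<Sum>i<l. of_int (t i) * ?a i k) = (\<Sum>i<l. if i = k then of_int (t k) else 0)
        - (\<Sum>i<l. if Suc i = k then real_of_int (t (k - 1)) else 0)"
      unfolding sum_subtractf[symmetric] by (intro sum.cong) (auto simp: algebra_simps)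
    also have "(\<Sum>i<l. if Suc i = k then real_of_int (t (k - 1)) else 0) = (if k = 0 then 0 else of_int (t (k - 1)))"
    proof (cases k)
      case (Suc m)
      then have "(\<Sum>i<l. if Suc i = k then real_of_int (t (k - 1)) else 0) = (\<Sum>i<l. if i = m then real_of_int (t (k - 1)) else 0)"
        by (intro sum.cong) auto
      then show ?thesis using Suc k by (simp add: sum.delta)
    qed simp
    finally show ?thesis using k by (simp add: sum.delta orth_coord_def)
  qed
  have "(\<Sum>i<l. \<Sum>j<l. of_int (t i) * of_int (t j) * M i j)
      = (\<Sum>i<l. \<Sum>j<l. \<Sum>k<l. ?d * ((of_int (t i) * ?a i k) * (of_int (t j) * ?a j k)))"
    by (intro sum.cong refl) (simp only: M lessThan_iff sum_distrib_left mult_ac)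
  also have "\<dots> = (\<Sum>k<l. \<Sum>i<l. \<Sum>j<l. ?d * ((of_int (t i) * ?a i k) * (of_int (t j) * ?a j k)))"
    by (subst (2) sum.swap, subst sum.swap) (rule refl)
  also have "\<dots> = (\<Sum>k<l. ?d * ((\<Sum>i<l. of_int (t i) * ?a i k) * (\<Sum>j<l. of_int (t j) * ?a j k)))"
    by (intro sum.cong refl) (subst sum_product, simp only: sum_distrib_left)
  also have "\<dots> = (\<Sum>k<l. ?d * (of_int (orth_coord t k))\<^sup>2)"
    by (intro sum.cong refl) (simp only: X lessThan_iff power2_eq_square)
  also have "\<dots> = ?d * of_int (\<Sum>k<l. (orth_coord t k)\<^sup>2)" by (simp add: sum_distrib_left)
  finally show ?thesis using n by simp
qed

context lie_torus_data
begin

section \<open>Inner products of roots\<close>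

abbreviation rip :: "('g \<Rightarrow> complex) \<Rightarrow> ('g \<Rightarrow> complex) \<Rightarrow> real" where "rip \<equiv> root_ip sc br G H"
abbreviation dv :: "('g \<Rightarrow> complex) \<Rightarrow> 'g" where "dv \<equiv> dual_vec sc br G H"

lemma kfG_add: "x \<in> G \<Longrightarrow> y \<in> G \<Longrightarrow> z \<in> G \<Longrightarrow> kf G (x + y) z = kf G x z + kf G y z"
  by (rule kf_add[OF subspace_G stab_G stab_G stab_G])

lemma kfG_scale: "x \<in> G \<Longrightarrow> z \<in> G \<Longrightarrow> kf G (sc c x) z = c * kf G x z"
  by (rule kf_scale[OF subspace_G stab_G stab_G])

lemma kfG_sym: "x \<in> G \<Longrightarrow> y \<in> G \<Longrightarrow> kf G x y = kf G y x"
  by (rule kf_sym[OF subspace_G stab_G stab_G])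

lemma kfG_inv: "x \<in> G \<Longrightarrow> y \<in> G \<Longrightarrow> z \<in> G \<Longrightarrow> kf G (br x y) z = kf G x (br y z)"
  by (rule kf_invariant[OF subspace_G stab_G stab_G stab_G])

lemma kfG_zero: "z \<in> G \<Longrightarrow> kf G 0 z = 0"
  using kfG_scale[of 0 z 0] subspace_0[OF subspace_G] by simp

text \<open>By invariance \<open>H\<close> is orthogonal to all nonzero weight vectors, so an
  element of \<open>H\<close> orthogonal to \<open>H\<close> is orthogonal to all of g(0,0).\<close>

lemma kf_H_nondegenerate:
  assumes t: "t \<in> H" and k: "\<And>h. h \<in> H \<Longrightarrow> kf G t h = 0"
  shows "t = 0"
proof (rule ccontr)
  assume "t \<noteq> 0"
  have tG: "t \<in> G" using t H_sub by blast
  have "subspace {y \<in> G. kf G t y = 0}" using subspace_G tG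
    by (auto simp: subspace_def kfG_sym[OF tG] kfG_add kfG_scale kfG_zero)
  moreover have "wvecs G \<subseteq> {y \<in> G. kf G t y = 0}"
  proof clarify
    fix y \<alpha> assume y: "y \<in> G" "\<alpha> \<in> dualH" "y \<in> wtv \<alpha>"
    show "kf G t y = 0"
    proof (cases "\<alpha> = zero_wt")
      case True
      then have "y \<in> H" using y by (intro H_max) (auto simp: joint_eigenspace_def)
      then show ?thesis by (rule k)
    next
      case False
      then obtain h where h: "\<alpha> h \<noteq> 0" by blast
      then have hH: "h \<in> H" using dual_outside[OF y(2)] by blast
      have hG: "h \<in> G" using hH H_sub by blast
      have "\<alpha> h * kf G t y = kf G (sc (\<alpha> h) y) t" using kfG_scale[OF y(1) tG] kfG_sym[OF tG y(1)] by simp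
      also have "\<dots> = kf G t (br h y)"
        using kfG_sym[OF subspace_scale[OF subspace_G y(1)] tG] wtvD[OF y(3) hH] by simp
      also have "\<dots> = kf G (br t h) y" using kfG_inv[OF tG hG y(1)] by simp
      also have "\<dots> = 0" using H_abelian[OF t hH] kfG_zero[OF y(1)] by simp
      finally show ?thesis using h by simp
    qed
  qed
  ultimately have "G \<subseteq> {y \<in> G. kf G t y = 0}"
    using G_weights span_minimal[of "wvecs G" "{y \<in> G. kf G t y = 0}"] by blast
  then show False using kf_G_nondegenerate[OF tG \<open>t \<noteq> 0\<close>] by blast
qed

lemma dv_eq: assumes t: "t \<in> H" "\<And>h. h \<in> H \<Longrightarrow> kf G t h = \<alpha> h" shows "dv \<alpha> = t"
  unfolding dual_vec_def
proof (rule the_equality)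
  show "t \<in> H \<and> (\<forall>h\<in>H. kf G t h = \<alpha> h)" using t by blast
  fix s assume s: "s \<in> H \<and> (\<forall>h\<in>H. kf G s h = \<alpha> h)"
  have sG: "s \<in> G" "t \<in> G" using s t H_sub by auto
  have "s + sc (-1) t = 0"
  proof (rule kf_H_nondegenerate)
    show "s + sc (-1) t \<in> H" using s t by (intro subspace_add[OF H_subspace] subspace_scale[OF H_subspace]) auto
    show "kf G (s + sc (-1) t) h = 0" if h: "h \<in> H" for h
    proof -
      have hG: "h \<in> G" using h H_sub by blast
      show ?thesis
        using s t(2)[OF h] h kfG_add[OF sG(1) subspace_scale[OF subspace_G sG(2)] hG, of "-1"]
          kfG_scale[OF sG(2) hG, of "-1"] by simp
    qed
  qed
  then show "s = t" by simp
qed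

lemma triple_weight_int: "triple \<alpha> e f \<Longrightarrow> \<mu> \<in> wts G \<Longrightarrow> \<exists>m::int. \<mu> (br e f) = of_int m"
  using string_lower[of \<alpha> e f G \<mu>] stab_G unfolding triple_def by blast

text \<open>Here \<kappa> is the Killing form of e and f. Since 2\<kappa> is the trace of the square
  of ad h for h = [e,f], which acts by integers on weight vectors, \<kappa> is a nonnegative real;
  if it were 0, then h would be orthogonal to \<open>H\<close>. Hence taking real parts in
  \<open>root_ip\<close> loses nothing.\<close>

lemma root_dv:
  assumes a: "\<alpha> \<in> g00_roots D"
  shows "\<exists>e f. \<exists>\<kappa>::real. triple \<alpha> e f \<and> \<kappa> > 0 \<and> dv \<alpha> = sc (of_real (1 / \<kappa>)) (br e f) \<and>
    (\<forall>h\<in>H. kf G (dv \<alpha>) h = \<alpha> h)"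
proof -
  obtain e f where t: "triple \<alpha> e f" and k: "\<And>h. h \<in> H \<Longrightarrow> kf G (br e f) h = \<alpha> h * kf G e f"
    using triple_exists[OF a] by blast
  let ?h = "br e f"
  have hH: "?h \<in> H" by (rule triple_H[OF t])
  have hG: "?h \<in> G" using hH H_sub by blast
  have h2: "\<alpha> ?h = 2" using t by (simp add: triple_def)
  obtain B wt where B: "finite B" "independent B" "span B = G"
    "\<And>b. b \<in> B \<Longrightarrow> wt b \<in> dualH \<and> b \<in> wtv (wt b) \<and> b \<noteq> 0"
    using weight_basis[OF subspace_G G_weights] by metis
  have "\<exists>m::int. wt b ?h = of_int m" if "b \<in> B" for b
    using triple_weight_int[OF t] wtsI[of "wt b" b G] B(3) B(4)[OF that] span_base[OF that] by blast
  then obtain m :: "'g \<Rightarrow> int" where m: "\<And>b. b \<in> B \<Longrightarrow> wt b ?h = of_int (m b)" by metis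
  define \<kappa> where "\<kappa> = (\<Sum>b\<in>B. (real_of_int (m b))\<^sup>2) / 2"
  have "2 * kf G e f = kf G ?h ?h" using k[OF hH] h2 by simp
  also have "\<dots> = (\<Sum>b\<in>B. wt b ?h * wt b ?h)"
    by (rule kf_weights[OF subspace_G B hH hH stab_G[OF hG] stab_G[OF hG]])
  also have "\<dots> = (\<Sum>b\<in>B. of_real ((real_of_int (m b))\<^sup>2))"
    by (intro sum.cong refl) (simp add: m power2_eq_square)
  also have "\<dots> = of_real (2 * \<kappa>)" unfolding \<kappa>_def by simp
  also have "\<dots> = 2 * of_real \<kappa>" by (simp only: of_real_mult of_real_numeral)
  finally have "kf G e f = of_real \<kappa>" by (simp del: of_real_sum)
  moreover have "\<kappa> \<ge> 0" by (simp add: \<kappa>_def sum_nonneg)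
  ultimately have \<kappa>: "kf G e f = of_real \<kappa>" "\<kappa> \<ge> 0" by blast+
  have "\<kappa> \<noteq> 0"
  proof
    assume "\<kappa> = 0"
    then have "?h = 0" using kf_H_nondegenerate[OF hH] k \<kappa>(1) by simp
    moreover have "\<alpha> 0 = 0" using dual_uminus[OF roots_dual[OF a], of 0] subspace_0[OF H_subspace] by (simp add: equation_minus_iff)
    ultimately show False using h2 by simp
  qed
  then have pos: "\<kappa> > 0" using \<kappa>(2) by simp
  have kd: "kf G (sc (of_real (1 / \<kappa>)) ?h) h = \<alpha> h" if h: "h \<in> H" for h
    using kfG_scale[OF hG, of h] h H_sub k[OF h] \<kappa>(1) pos by auto
  have "dv \<alpha> = sc (of_real (1 / \<kappa>)) ?h"
    by (rule dv_eq[OF subspace_scale[OF H_subspace hH] kd])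
  then show ?thesis using t pos kd by auto
qed

lemma dv_comb:
  assumes "finite A" "\<And>i. i \<in> A \<Longrightarrow> \<beta> i \<in> g00_roots D"
  shows "dv (\<lambda>h. \<Sum>i\<in>A. c i * \<beta> i h) = (\<Sum>i\<in>A. sc (c i) (dv (\<beta> i)))"
    and "dv (\<lambda>h. \<Sum>i\<in>A. c i * \<beta> i h) \<in> H"
    and "h \<in> H \<Longrightarrow> kf G (dv (\<lambda>h. \<Sum>i\<in>A. c i * \<beta> i h)) h = (\<Sum>i\<in>A. c i * \<beta> i h)"
proof -
  have d: "dv (\<beta> i) \<in> H \<and> (\<forall>h\<in>H. kf G (dv (\<beta> i)) h = \<beta> i h)" if i: "i \<in> A" for i
    using root_dv[OF assms(2)[OF i]] triple_H subspace_scale[OF H_subspace] by metis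
  have *: "(\<Sum>i\<in>A'. sc (c i) (dv (\<beta> i))) \<in> H \<and>
      (\<forall>h\<in>H. kf G (\<Sum>i\<in>A'. sc (c i) (dv (\<beta> i))) h = (\<Sum>i\<in>A'. c i * \<beta> i h))" if "A' \<subseteq> A" for A'
    using finite_subset[OF that assms(1)] that
  proof (induction A' rule: finite_induct)
    case empty
    then show ?case using subspace_0[OF H_subspace] kfG_zero H_sub by auto
  next
    case (insert i A')
    then have i: "sc (c i) (dv (\<beta> i)) \<in> H" "dv (\<beta> i) \<in> H" and
      s: "(\<Sum>i\<in>A'. sc (c i) (dv (\<beta> i))) \<in> H"
      using d subspace_scale[OF H_subspace] by auto
    have "kf G (sc (c i) (dv (\<beta> i)) + (\<Sum>i\<in>A'. sc (c i) (dv (\<beta> i)))) h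
        = c i * \<beta> i h + (\<Sum>i\<in>A'. c i * \<beta> i h)" if h: "h \<in> H" for h
    proof -
      have "kf G (sc (c i) (dv (\<beta> i)) + (\<Sum>i\<in>A'. sc (c i) (dv (\<beta> i)))) h
          = kf G (sc (c i) (dv (\<beta> i))) h + kf G (\<Sum>i\<in>A'. sc (c i) (dv (\<beta> i))) h"
        by (rule kfG_add) (use i s h H_sub in blast)+
      also have "kf G (sc (c i) (dv (\<beta> i))) h = c i * kf G (dv (\<beta> i)) h"
        by (rule kfG_scale) (use i h H_sub in blast)+
      finally show ?thesis using insert d[of i] h by simp
    qed
    then show ?case using insert.hyps subspace_add[OF H_subspace i(1) s] by simp
  qed
  show e: "dv (\<lambda>h. \<Sum>i\<in>A. c i * \<beta> i h) = (\<Sum>i\<in>A. sc (c i) (dv (\<beta> i)))"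
    using *[OF order_refl] by (intro dv_eq) auto
  show "dv (\<lambda>h. \<Sum>i\<in>A. c i * \<beta> i h) \<in> H"
    "h \<in> H \<Longrightarrow> kf G (dv (\<lambda>h. \<Sum>i\<in>A. c i * \<beta> i h)) h = (\<Sum>i\<in>A. c i * \<beta> i h)"
    unfolding e using *[OF order_refl] by auto
qed

lemma dual_H_sum:
  assumes "\<beta> \<in> dualH" "finite A" "\<And>i. i \<in> A \<Longrightarrow> x i \<in> H"
  shows "\<beta> (\<Sum>i\<in>A. sc (c i) (x i)) = (\<Sum>i\<in>A. c i * \<beta> (x i))"
  using assms(2,3)
proof (induction A rule: finite_induct)
  case empty
  have "\<beta> (sc 0 0) = 0 * \<beta> 0" using assms(1) subspace_0[OF H_subspace] unfolding dual_def by blast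
  then show ?case by simp
next
  case (insert i A)
  have "(\<Sum>i\<in>A. sc (c i) (x i)) \<in> H" "sc (c i) (x i) \<in> H"
    using insert.prems H_subspace by (auto intro!: subspace_sum subspace_scale)
  then have "\<beta> (sc (c i) (x i) + (\<Sum>i\<in>A. sc (c i) (x i))) = \<beta> (sc (c i) (x i)) + \<beta> (\<Sum>i\<in>A. sc (c i) (x i))"
    "\<beta> (sc (c i) (x i)) = c i * \<beta> (x i)"
    using assms(1) insert.prems unfolding dual_def by blast+
  then show ?case using insert by simp
qed

text \<open>\<open>root_ip\<close> is a real part, through which the integer coefficients
  pass.\<close>

lemma rip_comb:
  fixes t :: "nat \<Rightarrow> int"
  assumes r: "\<And>i. i < l \<Longrightarrow> \<beta> i \<in> g00_roots D"
  shows "rip (\<lambda>h. \<Sum>i<l. of_int (t i) * \<beta> i h) (\<lambda>h. \<Sum>i<l. of_int (t i) * \<beta> i h)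
    = (\<Sum>i<l. \<Sum>j<l. of_int (t i) * of_int (t j) * rip (\<beta> i) (\<beta> j))"
proof -
  let ?s = "\<lambda>h. \<Sum>i<l. of_int (t i) * \<beta> i h"
  have r': "\<And>i. i \<in> {..<l} \<Longrightarrow> \<beta> i \<in> g00_roots D" using r by simp
  note c = dv_comb[OF finite_lessThan r', where c = "\<lambda>i. of_int (t i)"]
  have dH: "dv (\<beta> j) \<in> H" if "j < l" for j
    using root_dv[OF r[OF that]] triple_H subspace_scale[OF H_subspace] by metis
  have kd: "kf G (dv (\<beta> i)) h = \<beta> i h" if "i < l" "h \<in> H" for i h using root_dv[OF r[OF that(1)]] that(2) by blast
  have "kf G (dv ?s) (dv ?s) = (\<Sum>i<l. of_int (t i) * \<beta> i (dv ?s))" using c(2,3) by simp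
  also have "\<dots> = (\<Sum>i<l. of_int (t i) * (\<Sum>j<l. of_int (t j) * \<beta> i (dv (\<beta> j))))"
  proof (intro sum.cong refl)
    fix i assume "i \<in> {..<l}"
    then have i: "i < l" by simp
    have "\<beta> i (dv ?s) = \<beta> i (\<Sum>j<l. sc (of_int (t j)) (dv (\<beta> j)))" by (simp only: c(1))
    also have "\<dots> = (\<Sum>j<l. of_int (t j) * \<beta> i (dv (\<beta> j)))"
      by (rule dual_H_sum[OF roots_dual[OF r[OF i]] finite_lessThan]) (simp add: dH)
    finally show "of_int (t i) * \<beta> i (dv ?s) = of_int (t i) * (\<Sum>j<l. of_int (t j) * \<beta> i (dv (\<beta> j)))"
      by (rule arg_cong)
  qed
  also have "\<dots> = (\<Sum>i<l. \<Sum>j<l. of_int (t i) * of_int (t j) * kf G (dv (\<beta> i)) (dv (\<beta> j)))"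
    using kd dH by (simp add: sum_distrib_left mult.assoc)
  finally show ?thesis unfolding root_ip_def by simp
qed

text \<open>The Cartan matrix of \<open>type_B\<close> is made of inner products; since
  \<open>dual_vec\<close> of a root is a positive multiple of its coroot, its entries are also the
  values of the simple roots on the coroots of the triples, as root strings require. The numbers
  \<open>w j\<close> are the squared lengths.\<close>

lemma type_B_coords:
  assumes "type_B sc br G H (simples D)"
  obtains l \<beta> e f w where "l > 0" "bij_betw \<beta> {..<l} (simples D)"
    "\<And>j. j < l \<Longrightarrow> triple (\<beta> j) (e j) (f j)"
    "\<And>i j. i < l \<Longrightarrow> j < l \<Longrightarrow> \<beta> i (br (e j) (f j)) = of_int (int_cartan_B l i j)"
    "\<And>i j. i < l \<Longrightarrow> j < l \<Longrightarrow> rip (\<beta> i) (\<beta> j) = cartan_matrix_B l i j * w j / 2"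
    "\<And>i j. i < l \<Longrightarrow> j < l \<Longrightarrow> rip (\<beta> i) (\<beta> j) = rip (\<beta> j) (\<beta> i)"
    "\<And>j. j < l \<Longrightarrow> w j > 0"
proof -
  obtain l \<beta> where B: "l \<ge> 1" "bij_betw \<beta> {..<l} (simples D)"
    "\<And>i j. i < l \<Longrightarrow> j < l \<Longrightarrow> 2 * rip (\<beta> i) (\<beta> j) / rip (\<beta> j) (\<beta> j) = cartan_matrix_B l i j"
    using assms unfolding type_B_def by blast
  have r: "\<beta> j \<in> g00_roots D" if "j < l" for j using B(2) that simples_root by (auto simp: bij_betw_def)
  have "\<forall>j. j < l \<longrightarrow> (\<exists>e f. \<exists>\<kappa>::real. triple (\<beta> j) e f \<and> \<kappa> > 0 \<and> dv (\<beta> j) = sc (of_real (1 / \<kappa>)) (br e f) \<and>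
    (\<forall>h\<in>H. kf G (dv (\<beta> j)) h = \<beta> j h))" using root_dv r by blast
  then obtain e f where "\<forall>j. j < l \<longrightarrow> (\<exists>\<kappa>::real. triple (\<beta> j) (e j) (f j) \<and> \<kappa> > 0 \<and>
    dv (\<beta> j) = sc (of_real (1 / \<kappa>)) (br (e j) (f j)) \<and> (\<forall>h\<in>H. kf G (dv (\<beta> j)) h = \<beta> j h))" by metis
  then obtain \<kappa> :: "nat \<Rightarrow> real" where k: "\<And>j. j < l \<Longrightarrow> triple (\<beta> j) (e j) (f j)" "\<And>j. j < l \<Longrightarrow> \<kappa> j > 0"
    "\<And>j. j < l \<Longrightarrow> dv (\<beta> j) = sc (of_real (1 / \<kappa> j)) (br (e j) (f j))"
    "\<And>j h. j < l \<Longrightarrow> h \<in> H \<Longrightarrow> kf G (dv (\<beta> j)) h = \<beta> j h" by metis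
  have dH: "dv (\<beta> j) \<in> H" if "j < l" for j using k(3)[OF that] triple_H[OF k(1)[OF that]] subspace_scale[OF H_subspace] by simp
  have kd: "kf G (dv (\<beta> i)) (dv (\<beta> j)) = of_real (1 / \<kappa> j) * \<beta> i (br (e j) (f j))" if ij: "i < l" "j < l" for i j
  proof -
    have "\<beta> i (sc (of_real (1 / \<kappa> j)) (br (e j) (f j))) = of_real (1 / \<kappa> j) * \<beta> i (br (e j) (f j))"
      using roots_dual[OF r[OF ij(1)]] triple_H[OF k(1)[OF ij(2)]] unfolding dual_def by blast
    then show ?thesis using k(4)[OF ij(1) dH[OF ij(2)]] k(3)[OF ij(2)] by simp
  qed
  have int: "\<exists>m::int. \<beta> i (br (e j) (f j)) = of_int m" if "i < l" "j < l" for i j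
    using triple_weight_int[OF k(1)[OF that(2)]] root_weight_of_G[OF r[OF that(1)]] by blast
  have rj: "rip (\<beta> j) (\<beta> j) = 2 / \<kappa> j" if "j < l" for j
    using kd[OF that that] k(1)[OF that] by (simp add: root_ip_def triple_def)
  show thesis
  proof (rule that[of l \<beta> e f "\<lambda>j. 2 / \<kappa> j"])
    show "l > 0" using B(1) by simp
    show "bij_betw \<beta> {..<l} (simples D)" by (rule B(2))
    show "triple (\<beta> j) (e j) (f j)" if "j < l" for j by (rule k(1)[OF that])
    show "2 / \<kappa> j > 0" if "j < l" for j using k(2)[OF that] by simp
    fix i j assume ij: "i < l" "j < l"
    obtain m :: int where m: "\<beta> i (br (e j) (f j)) = of_int m" using int[OF ij] by blast
    have rm: "rip (\<beta> i) (\<beta> j) = of_int m / \<kappa> j" using kd[OF ij] m by (simp add: root_ip_def)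
    have cm: "cartan_matrix_B l i j = of_int m" using B(3)[OF ij] rm rj[OF ij(2)] k(2)[OF ij(2)] by simp
    show "rip (\<beta> i) (\<beta> j) = cartan_matrix_B l i j * (2 / \<kappa> j) / 2" using rm cm by simp
    have "cartan_matrix_B l i j = real_of_int (int_cartan_B l i j)" by (auto simp: cartan_matrix_B_def)
    from trans[OF cm[symmetric] this] have "m = int_cartan_B l i j" by (simp only: of_int_eq_iff)
    then show "\<beta> i (br (e j) (f j)) = of_int (int_cartan_B l i j)" using m by simp
    show "rip (\<beta> i) (\<beta> j) = rip (\<beta> j) (\<beta> i)"
      unfolding root_ip_def by (rule arg_cong[OF kfG_sym]) (use dH ij H_sub in blast)+
  qed
qed

section \<open>Integral combinations of the simple roots\<close>

definition comb :: "nat \<Rightarrow> (nat \<Rightarrow> 'g \<Rightarrow> complex) \<Rightarrow> (nat \<Rightarrow> int) \<Rightarrow> 'g \<Rightarrow> complex" where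
  "comb l \<beta> c = (\<lambda>h. \<Sum>r<l. of_int (c r) * \<beta> r h)"

lemma comb_eq:
  assumes b: "bij_betw \<beta> {..<l} (simples D)" and e: "comb l \<beta> c = comb l \<beta> c'" and r: "r < l"
  shows "c r = c' r"
proof -
  let ?i = "inv_into {..<l} \<beta>"
  define d where "d \<gamma> = complex_of_int (c (?i \<gamma>) - c' (?i \<gamma>))" for \<gamma>
  have i: "?i (\<beta> k) = k" if "k < l" for k using bij_betw_inv_into_left[OF b, of k] that by simp
  have "(\<Sum>\<gamma>\<in>simples D. d \<gamma> * \<gamma> h) = 0" for h
  proof -
    have "(\<Sum>\<gamma>\<in>simples D. d \<gamma> * \<gamma> h) = (\<Sum>k<l. d (\<beta> k) * \<beta> k h)"
      by (rule sum.reindex_bij_betw[OF b, of "\<lambda>\<gamma>. d \<gamma> * \<gamma> h", symmetric])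
    also have "\<dots> = comb l \<beta> c h - comb l \<beta> c' h"
      unfolding comb_def sum_subtractf[symmetric] by (intro sum.cong) (simp_all add: d_def i left_diff_distrib)
    finally show ?thesis using e by simp
  qed
  moreover have "\<beta> r \<in> simples D" using b r by (auto simp: bij_betw_def)
  ultimately have "d (\<beta> r) = 0" by (rule simples_independent)
  then show ?thesis using i[OF r] by (simp add: d_def)
qed

lemma nonneg_iff_comb:
  assumes b: "bij_betw \<beta> {..<l} (simples D)"
  shows "nonneg \<alpha> \<longleftrightarrow> (\<exists>c. (\<forall>r<l. c r \<ge> 0) \<and> \<alpha> = comb l \<beta> c)"
proof
  assume "nonneg \<alpha>"
  then obtain n :: "('g \<Rightarrow> complex) \<Rightarrow> nat" where n: "\<And>h. \<alpha> h = (\<Sum>\<gamma>\<in>simples D. of_nat (n \<gamma>) * \<gamma> h)"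
    by (auto simp: nonneg_comb_def)
  have "\<alpha> = comb l \<beta> (\<lambda>r. int (n (\<beta> r)))"
    using sum.reindex_bij_betw[OF b, of "\<lambda>\<gamma>. of_nat (n \<gamma>) * \<gamma> h" for h] by (auto simp: comb_def n)
  then show "\<exists>c. (\<forall>r<l. c r \<ge> 0) \<and> \<alpha> = comb l \<beta> c" by (intro exI[of _ "\<lambda>r. int (n (\<beta> r))"]) simp
next
  assume "\<exists>c. (\<forall>r<l. c r \<ge> 0) \<and> \<alpha> = comb l \<beta> c"
  then obtain c where c: "\<forall>r<l. c r \<ge> 0" "\<alpha> = comb l \<beta> c" by blast
  let ?n = "\<lambda>\<gamma>. nat (c (inv_into {..<l} \<beta> \<gamma>))"
  have "\<alpha> h = (\<Sum>\<gamma>\<in>simples D. of_nat (?n \<gamma>) * \<gamma> h)" for h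
  proof -
    have "(\<Sum>\<gamma>\<in>simples D. of_nat (?n \<gamma>) * \<gamma> h) = (\<Sum>k<l. of_nat (?n (\<beta> k)) * \<beta> k h)"
      by (rule sum.reindex_bij_betw[OF b, of "\<lambda>\<gamma>. of_nat (?n \<gamma>) * \<gamma> h", symmetric])
    also have "\<dots> = (\<Sum>r<l. of_int (c r) * \<beta> r h)"
      using b c(1) by (intro sum.cong) (auto simp: bij_betw_def inv_into_f_f)
    finally show ?thesis by (simp add: c(2) comb_def)
  qed
  then show "nonneg \<alpha>" unfolding nonneg_comb_def by (intro exI[of _ ?n]) blast
qed

text \<open>Every weight of \<open>V\<close> has coordinate norm at most 2, by induction on its
  height below the highest weight. A weight that is not dominant is reflected to a higher one of the
  same norm. For a dominant weight the norm is the coefficient of the last simple root; it is at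
  most that of 2\<theta>, and that of \<theta> is at most 1.\<close>

lemma type_B_constituent_weights:
  assumes cV: "constituent V (\<lambda>h. 2 * \<theta> h)" and B: "type_B sc br G H (simples D)"
    and th: "\<theta> \<in> short_roots sc br G H" and m: "\<mu> \<in> wts V"
  shows "nonneg \<mu> \<or> nonneg (\<lambda>h. - \<mu> h)"
proof -
  obtain l \<beta> e f w where l: "l > 0" and b: "bij_betw \<beta> {..<l} (simples D)" and
    t: "\<And>j. j < l \<Longrightarrow> triple (\<beta> j) (e j) (f j)" and
    cm: "\<And>i j. i < l \<Longrightarrow> j < l \<Longrightarrow> \<beta> i (br (e j) (f j)) = of_int (int_cartan_B l i j)" and
    gram: "\<And>i j. i < l \<Longrightarrow> j < l \<Longrightarrow> rip (\<beta> i) (\<beta> j) = cartan_matrix_B l i j * w j / 2" and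
    sym: "\<And>i j. i < l \<Longrightarrow> j < l \<Longrightarrow> rip (\<beta> i) (\<beta> j) = rip (\<beta> j) (\<beta> i)" and
    w: "\<And>j. j < l \<Longrightarrow> w j > 0"
    by (rule type_B_coords[OF B]) blast
  have bs: "\<beta> j \<in> simples D" if "j < l" for j using b that by (auto simp: bij_betw_def)
  have br: "\<beta> j \<in> g00_roots D" if "j < l" for j using bs[OF that] by (rule simples_root)
  have th_root: "\<theta> \<in> g00_roots D" and th_min: "\<And>\<gamma>. \<gamma> \<in> g00_roots D \<Longrightarrow> rip \<theta> \<theta> \<le> rip \<gamma> \<gamma>"
    using th by (auto simp: short_roots_def g00_roots_def)
  have negc: "(\<lambda>h. - comb l \<beta> c h) = comb l \<beta> (\<lambda>r. - c r)" for c
    by (simp add: comb_def sum_negf)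
  obtain s where s: "\<theta> = comb l \<beta> s"
    using root_sign[OF th_root] unfolding nonneg_iff_comb[OF b]
  proof (elim disjE exE conjE)
    fix c assume "(\<lambda>h. - \<theta> h) = comb l \<beta> c"
    then have "\<theta> = comb l \<beta> (\<lambda>r. - c r)" unfolding negc[symmetric] by (metis minus_minus)
    then show thesis by (rule that)
  qed (rule that)
  text \<open>A short root has at most one nonzero orthogonal coordinate, and it is at most 1.\<close>
  have s1: "s (l - 1) \<le> 1"
  proof -
    have "rip \<theta> \<theta> = (\<Sum>i<l. \<Sum>j<l. of_int (s i) * of_int (s j) * rip (\<beta> i) (\<beta> j))"
      unfolding s comb_def by (rule rip_comb[OF br])
    also have "\<dots> = w (l - 1) * of_int (\<Sum>k<l. (orth_coord s k)\<^sup>2)"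
      by (rule cartan_B_gram[OF l gram sym])
    finally have "w (l - 1) * of_int (\<Sum>k<l. (orth_coord s k)\<^sup>2) \<le> rip (\<beta> (l - 1)) (\<beta> (l - 1))"
      using th_min[OF br[of "l - 1"]] l by simp
    also have "\<dots> = w (l - 1)" using gram[of "l - 1" "l - 1"] l by (simp add: cartan_matrix_B_def)
    finally have "real_of_int (\<Sum>k<l. (orth_coord s k)\<^sup>2) \<le> 1" using w[of "l - 1"] l by simp
    then have q: "(\<Sum>k<l. (orth_coord s k)\<^sup>2) \<le> 1" by linarith
    \<comment> \<open>Integers satisfy x \<le> x^2, so the bound on the sum of squares also bounds
      the sum of the coordinates, which is the last coefficient.\<close>
    have sq: "(x::int) \<le> x\<^sup>2" for x
      using mult_left_mono[of 1 x x] by (cases "x \<ge> 1") (auto simp: power2_eq_square intro: order_trans[of x 0])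
    have "s (l - 1) = (\<Sum>k<l. orth_coord s k)"
      using orth_coord_sum[of s "l - 1"] l by (cases l) (auto simp: lessThan_Suc_atMost)
    also have "\<dots> \<le> (\<Sum>k<l. (orth_coord s k)\<^sup>2)" by (intro sum_mono sq)
    finally show ?thesis using q by linarith
  qed
  have lam: "(\<lambda>h. 2 * \<theta> h) = comb l \<beta> (\<lambda>r. 2 * s r)"
    by (simp add: s comb_def sum_distrib_left mult.assoc)
  note stab = V_stab[OF cV] and le = weight_le[OF cV] and height = weight_height[OF cV]
  have main: "(\<Sum>k<l. \<bar>orth_coord c k\<bar>) \<le> 2" if "\<nu> \<in> wts V" "\<nu> = comb l \<beta> c"
    "2 * \<theta> varpi - \<nu> varpi = of_nat n" for \<nu> c n
    using that
  proof (induction n arbitrary: \<nu> c rule: less_induct)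
    case (less n)
    let ?m = "\<lambda>j. \<Sum>r<l. c r * int_cartan_B l r j"
    have val: "\<nu> (br (e j) (f j)) = of_int (?m j)" if "j < l" for j
      using cm that by (simp add: less.prems(2) comb_def)
    show ?case
    proof (cases "\<exists>j<l. ?m j < 0")
      case True
      then obtain j where j: "j < l" "?m j < 0" by blast
      have efG: "e j \<in> G" "f j \<in> G" using t[OF j(1)] by (auto simp: triple_def)
      obtain m where mm: "\<nu> (br (e j) (f j)) = of_int m"
        "\<And>i::nat. int i \<le> m \<Longrightarrow> (\<lambda>h. \<nu> h - of_nat i * \<beta> j h) \<in> wts V"
        "\<And>i::nat. int i \<le> - m \<Longrightarrow> (\<lambda>h. \<nu> h + of_nat i * \<beta> j h) \<in> wts V"
        by (rule string_full[OF t[OF j(1)] stab[OF efG(1)] stab[OF efG(2)] less.prems(1)]) blast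
      have meq: "m = ?m j" using mm(1) val[OF j(1)] by (simp only: of_int_eq_iff)
      \<comment> \<open>Reflecting \<nu> in \<beta>_j adds p copies of \<beta>_j: the weight gets
        higher, and \<open>l1_norm_reflection\<close> keeps the norm.\<close>
      define p where "p = nat (- ?m j)"
      have p: "p > 0" "int p = - ?m j" using j(2) by (auto simp: p_def)
      define c' where "c' = c(j := c j - ?m j)"
      let ?\<nu> = "\<lambda>h. \<nu> h + of_nat p * \<beta> j h"
      have nV: "?\<nu> \<in> wts V" using mm(3)[of p] p(2) meq by simp
      have c': "c' r = (if r = j then c j - ?m j else c r)" for r by (simp add: c'_def)
      have "?m j = - int p" using p(2) by linarith
      then have "complex_of_int (?m j) = of_int (- int p)" by (rule arg_cong)
      then have pm: "complex_of_int (?m j) = - of_nat p" by (simp only: of_int_minus of_int_of_nat_eq)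
      have nc: "?\<nu> = comb l \<beta> c'"
      proof
        fix h
        have "comb l \<beta> c' h = (\<Sum>r<l. of_int (c r) * \<beta> r h + (if r = j then - of_int (?m j) * \<beta> j h else 0))"
          unfolding comb_def by (intro sum.cong refl) (simp add: c' left_diff_distrib del: of_int_sum)
        also have "\<dots> = \<nu> h + - of_int (?m j) * \<beta> j h"
          using j(1) unfolding sum.distrib by (simp add: sum.delta less.prems(2) comb_def del: of_int_sum)
        finally show "?\<nu> h = comb l \<beta> c' h" unfolding pm by simp
      qed
      obtain n' :: nat where n': "2 * \<theta> varpi - ?\<nu> varpi = of_nat n'" using height[OF nV] by blast
      have "complex_of_nat (n' + p) = 2 * \<theta> varpi - ?\<nu> varpi + of_nat p" using n' by simp
      also have "\<dots> = of_nat n" using less.prems(3) varpi(2)[OF bs[OF j(1)]] by simp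
      finally have "n' + p = n" by (simp only: of_nat_eq_iff)
      then have "n' < n" using p(1) by simp
      then have "(\<Sum>k<l. \<bar>orth_coord c' k\<bar>) \<le> 2" by (rule less.IH[OF _ nV nc n'])
      then show ?thesis unfolding c'_def l1_norm_reflection[OF j(1)] .
    next
      case False
      have "(\<Sum>k<l. \<bar>orth_coord c k\<bar>) = c (l - 1)"
      proof (rule dominant_l1_norm[OF _ l])
        show "?m j \<ge> 0" if "j < l" for j using False that by (meson not_le)
      qed
      moreover have "c (l - 1) \<le> 2"
      proof -
        obtain d where d: "\<forall>r<l. d r \<ge> 0" "(\<lambda>h. 2 * \<theta> h - \<nu> h) = comb l \<beta> d"
          using le[OF less.prems(1)] unfolding nonneg_iff_comb[OF b] by blast
        have "comb l \<beta> d = comb l \<beta> (\<lambda>r. 2 * s r - c r)"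
        proof
          fix h
          have "comb l \<beta> d h = 2 * \<theta> h - \<nu> h" using d(2) by (metis (no_types))
          also have "\<dots> = comb l \<beta> (\<lambda>r. 2 * s r) h - comb l \<beta> c h" using lam less.prems(2) by metis
          also have "\<dots> = comb l \<beta> (\<lambda>r. 2 * s r - c r) h"
            unfolding comb_def sum_subtractf[symmetric] by (intro sum.cong refl) (simp add: algebra_simps)
          finally show "comb l \<beta> d h = comb l \<beta> (\<lambda>r. 2 * s r - c r) h" .
        qed
        then have "d (l - 1) = 2 * s (l - 1) - c (l - 1)" by (rule comb_eq[OF b]) (use l in simp)
        moreover have "d (l - 1) \<ge> 0" using d(1) l by simp
        ultimately show ?thesis using s1 by linarith
      qed
      ultimately show ?thesis by simp
    qed
  qed
  obtain d where d: "(\<lambda>h. 2 * \<theta> h - \<mu> h) = comb l \<beta> d"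
    using le[OF m] unfolding nonneg_iff_comb[OF b] by blast
  have mc: "\<mu> = comb l \<beta> (\<lambda>r. 2 * s r - d r)"
  proof
    fix h
    have "\<mu> h = comb l \<beta> (\<lambda>r. 2 * s r) h - comb l \<beta> d h" using lam d by (metis diff_diff_eq2 add_diff_cancel_left')
    also have "\<dots> = comb l \<beta> (\<lambda>r. 2 * s r - d r) h"
      unfolding comb_def sum_subtractf[symmetric] by (intro sum.cong refl) (simp add: algebra_simps)
    finally show "\<mu> h = comb l \<beta> (\<lambda>r. 2 * s r - d r) h" .
  qed
  let ?c = "\<lambda>r. 2 * s r - d r"
  obtain n :: nat where "2 * \<theta> varpi - \<mu> varpi = of_nat n" using height[OF m] by blast
  then have "(\<Sum>k<l. \<bar>orth_coord ?c k\<bar>) \<le> 2" by (rule main[OF m mc])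
  then consider "\<forall>r<l. ?c r \<ge> 0" | "\<forall>r<l. ?c r \<le> 0" using small_l1_norm_sign by blast
  then show ?thesis
  proof cases
    case 1
    then have "nonneg \<mu>" unfolding nonneg_iff_comb[OF b] by (intro exI[of _ ?c] conjI mc)
    then show ?thesis ..
  next
    case 2
    then have "nonneg (\<lambda>h. - \<mu> h)"
      unfolding nonneg_iff_comb[OF b] mc negc by (intro exI[of _ "\<lambda>r. - ?c r"]) auto
    then show ?thesis ..
  qed
qed

text \<open>A nonzero weight cannot come from the trivial summand, so \<mu> is a weight of the
  constituent. The highest root and the highest short root are both roots; only twice the highest
  short root needs the coordinates of type B.\<close>

lemma weight_sign:
  assumes x: "x \<in> gspace_wt D k0 k \<mu>" "x \<noteq> 0" and m: "\<mu> \<in> dualH" "\<mu> \<noteq> zero_wt"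
  shows "pos \<mu> \<or> pos (\<lambda>h. - \<mu> h)"
proof -
  have xg: "x \<in> gspace D k0 k" "x \<in> wtv \<mu>" using x by (auto simp: gspace_wt_eq)
  obtain U V where "subspace U" "subspace V" "U \<subseteq> gspace D k0 k" "V \<subseteq> gspace D k0 k" and UV:
    "\<And>x. x \<in> gspace D k0 k \<Longrightarrow> \<exists>u\<in>U. \<exists>v\<in>V. x = u + v"
    "\<And>x u. x \<in> G \<Longrightarrow> u \<in> U \<Longrightarrow> br x u = 0" "V = {0} \<or> (\<exists>lam. constituent V lam)"
    by (rule gspace_constituent[of k0 k]) blast
  obtain u v where uv: "u \<in> U" "v \<in> V" "x = u + v" using UV(1)[OF xg(1)] by blast
  have U0: "u \<in> wtv zero_wt" if "u \<in> U" for u using UV(2)[OF _ that] H_sub by (auto simp: joint_eigenspace_def)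
  have "v \<in> span (wvecs V)" using UV(3) constituent_weights uv(2) by (auto simp: span_zero)
  then have "x \<in> span (insert u (wvecs V))"
    unfolding uv(3) using span_mono[of "wvecs V" "insert u (wvecs V)"] by (intro span_add) (auto intro: span_base)
  then have "x \<in> span (insert u (wvecs V) \<inter> wtv \<mu>)"
    by (rule weight_part[rotated, OF _ xg(2) m(1)]) (use U0[OF uv(1)] dual_zero in blast)
  then have "\<not> insert u (wvecs V) \<inter> wtv \<mu> \<subseteq> {0}"
    using span_mono[of "insert u (wvecs V) \<inter> wtv \<mu>" "{0}"] x(2) by auto
  then obtain s where s: "s \<in> insert u (wvecs V)" "s \<in> wtv \<mu>" "s \<noteq> 0" by blast
  have "s \<noteq> u" using wtv_unique[OF s(3,2) _ m(1) dual_zero] U0[OF uv(1)] m(2) by blast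
  then have sV: "s \<in> V" using s(1) by blast
  then obtain lam where cV: "constituent V lam" using UV(3) s(3) by blast
  have mw: "\<mu> \<in> wts V" by (rule wtsI[OF m(1) sV s(3,2)])
  have "lam \<in> torus_weights D" by (rule lam_torus[OF cV])
  then consider "lam \<in> g00_roots D" | \<theta> where "lam = (\<lambda>h. 2 * \<theta> h)" "type_B sc br G H (simples D)" "\<theta> \<in> short_roots sc br G H"
    unfolding torus_weights_def Let_def is_highest_def by (auto simp: short_roots_def g00_roots_def)
  then have "nonneg \<mu> \<or> nonneg (\<lambda>h. - \<mu> h)"
  proof cases
    case 1
    have "\<mu> \<in> wts G" by (rule root_constituent_weights[OF cV 1 mw])
    then show ?thesis using weight_of_G_root[OF _ m(2)] root_sign by blast
  next
    case 2
    show ?thesis by (rule type_B_constituent_weights[OF cV[unfolded 2(1)] 2(2,3) mw])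
  qed
  moreover have "(\<lambda>h. - \<mu> h) \<noteq> zero_wt" using m(2) by (auto simp: fun_eq_iff)
  ultimately show ?thesis using m(2) by (simp add: positive_wt_def)
qed

end

section \<open>The radical of the annihilator\<close>

lemma poly_mapping_sum_single:
  "f = (\<Sum>k\<in>Poly_Mapping.keys f. Poly_Mapping.single k (Poly_Mapping.lookup f k))"
proof (rule poly_mapping_eqI)
  fix k
  have "(\<Sum>i\<in>Poly_Mapping.keys f. Poly_Mapping.lookup (Poly_Mapping.single i (Poly_Mapping.lookup f i)) k)
      = (\<Sum>i\<in>Poly_Mapping.keys f. if i = k then Poly_Mapping.lookup f k else 0)"
    by (intro sum.cong refl) (simp add: lookup_single when_def)
  also have "\<dots> = Poly_Mapping.lookup f k" using in_keys_iff[of k f] by (simp add: sum.delta)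
  finally show "Poly_Mapping.lookup f k = Poly_Mapping.lookup
      (\<Sum>k\<in>Poly_Mapping.keys f. Poly_Mapping.single k (Poly_Mapping.lookup f k)) k"
    by (simp add: lookup_sum)
qed

text \<open>The properties of \<open>V(N)\<close> from which the argument proceeds, detached from
  its construction: \<open>e X k0 k\<close>, \<open>cK \<gamma>\<close> and \<open>d\<close> are the
  actions of X t_0^{k0} t^k, of K t^\<gamma> and of d_0, \<open>V0\<close> is the module and
  \<open>N0\<close> its top. The operators act on a whole type and their commutation relations hold
  on all of it, so membership in \<open>V0\<close> need not be carried through computations.\<close>

locale toroidal_module = lie_torus_data D + M: complex_vector_space sM
  for D :: "('g::ab_group_add, 'n::finite) multiloop"
    and sM :: "complex \<Rightarrow> 'v::ab_group_add \<Rightarrow> 'v" +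
  fixes e :: "'g \<Rightarrow> int \<Rightarrow> int^'n \<Rightarrow> 'v \<Rightarrow> 'v"
    and cK :: "int^'n \<Rightarrow> 'v \<Rightarrow> 'v" and d :: "'v \<Rightarrow> 'v"
    and V0 N0 :: "'v set"
  assumes e_endo: "X \<in> gspace D k0 k \<Longrightarrow> M.endo (e X k0 k)"
    and cK_endo: "M.endo (cK \<gamma>)" and d_endo: "M.endo d"
    and e_add: "X \<in> gspace D k0 k \<Longrightarrow> Y \<in> gspace D k0 k \<Longrightarrow> e (X + Y) k0 k v = e X k0 k v + e Y k0 k v"
    and e_scale: "X \<in> gspace D k0 k \<Longrightarrow> e (scal D r X) k0 k v = sM r (e X k0 k v)"
    and e_comm: "X \<in> gspace D k0 k \<Longrightarrow> Y \<in> gspace D l0 l \<Longrightarrow>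
      e X k0 k (e Y l0 l v) = e Y l0 l (e X k0 k v) + e (brac D X Y) (k0 + l0) (k + l) v
        + (if k0 + l0 = 0 then sM (of_int k0 * form D X Y) (cK (k + l) v) else 0)"
    and form_lattice: "X \<in> gspace D k0 k \<Longrightarrow> Y \<in> gspace D (- k0) l \<Longrightarrow> form D X Y \<noteq> 0 \<Longrightarrow>
      \<forall>i. int (ord D (Some i)) dvd (k + l) $ i"
    and cK_e: "X \<in> gspace D k0 k \<Longrightarrow> \<forall>i. int (ord D (Some i)) dvd \<gamma> $ i \<Longrightarrow>
      cK \<gamma> (e X k0 k v) = e X k0 k (cK \<gamma> v)"
    and cK_cK: "\<forall>i. int (ord D (Some i)) dvd \<gamma> $ i \<Longrightarrow> \<forall>i. int (ord D (Some i)) dvd \<gamma>' $ i \<Longrightarrow>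
      cK \<gamma> (cK \<gamma>' v) = cK \<gamma>' (cK \<gamma> v)"
    and d_e: "X \<in> gspace D k0 k \<Longrightarrow> d (e X k0 k v) = e X k0 k (d v) + sM (of_int k0) (e X k0 k v)"
    and d_cK: "\<forall>i. int (ord D (Some i)) dvd \<gamma> $ i \<Longrightarrow> d (cK \<gamma> v) = cK \<gamma> (d v)"
    and V0: "M.subspace V0"
    and e_V0: "X \<in> gspace D k0 k \<Longrightarrow> v \<in> V0 \<Longrightarrow> e X k0 k v \<in> V0"
    and cK_V0: "\<forall>i. int (ord D (Some i)) dvd \<gamma> $ i \<Longrightarrow> v \<in> V0 \<Longrightarrow> cK \<gamma> v \<in> V0"
    and d_V0: "v \<in> V0 \<Longrightarrow> d v \<in> V0"
    and V0_irr: "M.subspace W \<Longrightarrow> W \<subseteq> V0 \<Longrightarrow>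
      (\<And>X k0 k v. X \<in> gspace D k0 k \<Longrightarrow> v \<in> W \<Longrightarrow> e X k0 k v \<in> W) \<Longrightarrow>
      (\<And>\<gamma> v. \<forall>i. int (ord D (Some i)) dvd \<gamma> $ i \<Longrightarrow> v \<in> W \<Longrightarrow> cK \<gamma> v \<in> W) \<Longrightarrow>
      (\<And>v. v \<in> W \<Longrightarrow> d v \<in> W) \<Longrightarrow> W = {0} \<or> W = V0"
    and N0: "M.subspace N0" "N0 \<subseteq> V0" "\<exists>n\<in>N0. n \<noteq> 0" "\<exists>B. finite B \<and> N0 \<subseteq> M.span B"
    and e_N0: "X \<in> gspace_wt D 0 k (\<lambda>_. 0) \<Longrightarrow> n \<in> N0 \<Longrightarrow> e X 0 k n \<in> N0"
    and cK_N0: "\<forall>i. int (ord D (Some i)) dvd \<gamma> $ i \<Longrightarrow> n \<in> N0 \<Longrightarrow> cK \<gamma> n \<in> N0"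
    and N0_irr: "M.subspace W \<Longrightarrow> W \<subseteq> N0 \<Longrightarrow>
      (\<And>X k v. X \<in> gspace_wt D 0 k (\<lambda>_. 0) \<Longrightarrow> v \<in> W \<Longrightarrow> e X 0 k v \<in> W) \<Longrightarrow>
      (\<And>\<gamma> v. \<forall>i. int (ord D (Some i)) dvd \<gamma> $ i \<Longrightarrow> v \<in> W \<Longrightarrow> cK \<gamma> v \<in> W) \<Longrightarrow>
      (\<And>v. v \<in> W \<Longrightarrow> d v \<in> W) \<Longrightarrow> W = {0} \<or> W = N0"
    and e_pos_N0: "X \<in> gspace_wt D k0 k \<alpha> \<Longrightarrow> \<alpha> \<in> dual (scal D) (csub D) \<Longrightarrow>
      k0 > 0 \<or> k0 = 0 \<and> positive_wt (simples D) \<alpha> \<Longrightarrow> n \<in> N0 \<Longrightarrow> e X k0 k n = 0"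
    and N0_wt: "\<And>h. h \<in> csub D \<Longrightarrow> \<exists>r. \<forall>n\<in>N0. e h 0 0 n = sM r n" "\<exists>r. \<forall>n\<in>N0. d n = sM r n"
    and real_nilpotent: "X \<in> gspace_wt D k0 k \<alpha> \<Longrightarrow> \<alpha> \<in> dual (scal D) (csub D) \<Longrightarrow> \<alpha> \<noteq> (\<lambda>_. 0) \<Longrightarrow>
      f \<in> Am D \<Longrightarrow> v \<in> V0 \<Longrightarrow>
      \<exists>r. ((\<lambda>v. \<Sum>s\<in>Poly_Mapping.keys f. sM (Poly_Mapping.lookup f s) (e X k0 (k + s) v)) ^^ r) v = 0"
begin

section \<open>Operators with Laurent polynomial coefficients\<close>

abbreviation lat :: "int^'n \<Rightarrow> bool" where
  "lat \<gamma> \<equiv> \<forall>i. int (ord D (Some i)) dvd \<gamma> $ i"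

definition psum :: "'n laurent \<Rightarrow> (int^'n \<Rightarrow> 'v) \<Rightarrow> 'v" where
  "psum f \<phi> = (\<Sum>s\<in>Poly_Mapping.keys f. sM (Poly_Mapping.lookup f s) (\<phi> s))"

lemma psum_superset: "finite A \<Longrightarrow> Poly_Mapping.keys f \<subseteq> A \<Longrightarrow> psum f \<phi> = (\<Sum>s\<in>A. sM (Poly_Mapping.lookup f s) (\<phi> s))"
  unfolding psum_def
proof (rule sum.mono_neutral_left)
  show "\<forall>i\<in>A - Poly_Mapping.keys f. sM (Poly_Mapping.lookup f i) (\<phi> i) = 0"
  proof
    fix i assume "i \<in> A - Poly_Mapping.keys f"
    then have "Poly_Mapping.lookup f i = 0" using in_keys_iff[of i f] by blast
    then show "sM (Poly_Mapping.lookup f i) (\<phi> i) = 0" by simp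
  qed
qed

lemma psum_add: "psum (f + g) \<phi> = psum f \<phi> + psum g \<phi>"
proof -
  let ?A = "Poly_Mapping.keys f \<union> Poly_Mapping.keys g"
  have "psum (f + g) \<phi> = (\<Sum>s\<in>?A. sM (Poly_Mapping.lookup (f + g) s) (\<phi> s))"
    by (rule psum_superset[OF _ keys_add]) simp
  also have "\<dots> = psum f \<phi> + psum g \<phi>"
    by (simp add: lookup_add M.scale_left_distrib sum.distrib psum_superset[of ?A f] psum_superset[of ?A g])
  finally show ?thesis .
qed

lemma psum_zero: "psum 0 \<phi> = 0" by (simp add: psum_def)

lemma psum_single: "psum (Poly_Mapping.single s c) \<phi> = sM c (\<phi> s)"
  by (simp add: psum_def)

lemma psum_sum: "finite A \<Longrightarrow> psum (\<Sum>a\<in>A. f a) \<phi> = (\<Sum>a\<in>A. psum (f a) \<phi>)"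
  by (induction A rule: finite_induct) (auto simp: psum_zero psum_add)

lemma psum_cong: "(\<And>s. s \<in> Poly_Mapping.keys f \<Longrightarrow> \<phi> s = \<psi> s) \<Longrightarrow> psum f \<phi> = psum f \<psi>"
  unfolding psum_def by (intro sum.cong) auto

lemma psum_plus: "psum f (\<lambda>s. \<phi> s + \<psi> s) = psum f \<phi> + psum f \<psi>"
  by (simp add: psum_def M.scale_right_distrib sum.distrib)

lemma psum_scale: "psum f (\<lambda>s. sM c (\<phi> s)) = sM c (psum f \<phi>)"
  by (simp add: psum_def M.scale_sum_right mult.commute)

lemma psum_endo: "M.endo T \<Longrightarrow> T (psum f \<phi>) = psum f (\<lambda>s. T (\<phi> s))"
  by (simp add: psum_def M.endo_sum M.endo_scale)

lemma psum_in: "M.subspace W \<Longrightarrow> (\<And>s. s \<in> Poly_Mapping.keys f \<Longrightarrow> \<phi> s \<in> W) \<Longrightarrow> psum f \<phi> \<in> W"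
  unfolding psum_def by (intro M.subspace_sum M.subspace_scale) auto

lemma psum_endo_family: "(\<And>s. s \<in> Poly_Mapping.keys f \<Longrightarrow> M.endo (T s)) \<Longrightarrow> M.endo (\<lambda>v. psum f (\<lambda>s. T s v))"
  unfolding M.endo_iff
  by (auto simp: psum_def M.scale_right_distrib sum.distrib M.scale_sum_right mult.commute intro!: sum.cong)

lemma psum_mult: "psum (f * g) \<phi> = psum f (\<lambda>s. psum g (\<lambda>u. \<phi> (s + u)))"
proof -
  have "f * g = (\<Sum>s\<in>Poly_Mapping.keys f. Poly_Mapping.single s (Poly_Mapping.lookup f s)) *
      (\<Sum>u\<in>Poly_Mapping.keys g. Poly_Mapping.single u (Poly_Mapping.lookup g u))"
    by (rule arg_cong2[where f = "(*)", OF poly_mapping_sum_single poly_mapping_sum_single])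
  also have "\<dots> = (\<Sum>s\<in>Poly_Mapping.keys f. \<Sum>u\<in>Poly_Mapping.keys g.
      Poly_Mapping.single (s + u) (Poly_Mapping.lookup f s * Poly_Mapping.lookup g u))"
    by (simp add: sum_product mult_single)
  finally have "psum (f * g) \<phi> = (\<Sum>s\<in>Poly_Mapping.keys f. \<Sum>u\<in>Poly_Mapping.keys g.
      sM (Poly_Mapping.lookup f s * Poly_Mapping.lookup g u) (\<phi> (s + u)))"
    by (simp add: psum_sum psum_single)
  then show ?thesis by (simp add: psum_def M.scale_sum_right)
qed

text \<open>The action of X t_0^{k0} t^k f; \<open>Kf\<close> is that of K t^\<gamma> f. For f in
  A(m) every shifted degree k + s belongs to the same graded piece as k.\<close>

definition E :: "'g \<Rightarrow> int \<Rightarrow> int^'n \<Rightarrow> 'n laurent \<Rightarrow> 'v \<Rightarrow> 'v" where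
  "E X k0 k f v = psum f (\<lambda>s. e X k0 (k + s) v)"

definition Kf :: "int^'n \<Rightarrow> 'n laurent \<Rightarrow> 'v \<Rightarrow> 'v" where
  "Kf \<gamma> f v = psum f (\<lambda>s. cK (\<gamma> + s) v)"

lemma Am_lat: "f \<in> Am D \<Longrightarrow> s \<in> Poly_Mapping.keys f \<Longrightarrow> lat s"
  by (auto simp: Am_def)

lemma lat_add: "lat \<gamma> \<Longrightarrow> lat \<gamma>' \<Longrightarrow> lat (\<gamma> + \<gamma>')" by simp

lemma lat_gspace: "lat s \<Longrightarrow> gspace D k0 (k + s) = gspace D k0 k"
  by (rule gspace_periodic) auto

lemma lat_gspace_wt: "lat s \<Longrightarrow> gspace_wt D k0 (k + s) \<alpha> = gspace_wt D k0 k \<alpha>"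
  by (simp add: gspace_wt_eq lat_gspace)

lemma E_endo: "X \<in> gspace D k0 k \<Longrightarrow> f \<in> Am D \<Longrightarrow> M.endo (E X k0 k f)"
  unfolding E_def by (rule psum_endo_family) (simp add: e_endo lat_gspace Am_lat)

lemma Kf_endo: "M.endo (Kf \<gamma> f)"
  unfolding Kf_def by (rule psum_endo_family) (rule cK_endo)

lemma E_add: "X \<in> gspace D k0 k \<Longrightarrow> Y \<in> gspace D k0 k \<Longrightarrow> f \<in> Am D \<Longrightarrow>
    E (X + Y) k0 k f v = E X k0 k f v + E Y k0 k f v"
  unfolding E_def psum_plus[symmetric] by (intro psum_cong e_add) (simp_all add: lat_gspace Am_lat)

lemma E_scale: "X \<in> gspace D k0 k \<Longrightarrow> f \<in> Am D \<Longrightarrow> E (sc r X) k0 k f v = sM r (E X k0 k f v)"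
  unfolding E_def psum_scale[symmetric] by (intro psum_cong e_scale) (simp add: lat_gspace Am_lat)

lemma E_zero: "f \<in> Am D \<Longrightarrow> E 0 k0 k f v = 0"
  using E_scale[of 0 k0 k f 0 v] subspace_0[OF subspace_gspace] by simp

lemma E_V0: "X \<in> gspace D k0 k \<Longrightarrow> f \<in> Am D \<Longrightarrow> v \<in> V0 \<Longrightarrow> E X k0 k f v \<in> V0"
  unfolding E_def by (intro psum_in[OF V0] e_V0) (simp_all add: lat_gspace Am_lat)

lemma e_E:
  assumes Y: "Y \<in> gspace D l0 l" and X: "X \<in> gspace D k0 k" and f: "f \<in> Am D"
  shows "e Y l0 l (E X k0 k f v) = E X k0 k f (e Y l0 l v) + E (br Y X) (l0 + k0) (l + k) f v
    + (if l0 + k0 = 0 then sM (of_int l0 * form D Y X) (Kf (l + k) f v) else 0)"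
proof -
  have "e Y l0 l (E X k0 k f v) = psum f (\<lambda>s. e Y l0 l (e X k0 (k + s) v))"
    unfolding E_def by (rule psum_endo[OF e_endo[OF Y]])
  also have "\<dots> = psum f (\<lambda>s. e X k0 (k + s) (e Y l0 l v) + (e (br Y X) (l0 + k0) (l + k + s) v
      + sM (if l0 + k0 = 0 then of_int l0 * form D Y X else 0) (cK (l + k + s) v)))"
    using X by (intro psum_cong) (auto simp: e_comm[OF Y] lat_gspace Am_lat[OF f] add.assoc)
  also have "\<dots> = E X k0 k f (e Y l0 l v) + (E (br Y X) (l0 + k0) (l + k) f v
      + sM (if l0 + k0 = 0 then of_int l0 * form D Y X else 0) (Kf (l + k) f v))"
    by (simp only: psum_plus psum_scale E_def Kf_def)
  finally show ?thesis by (simp add: add.assoc)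
qed

text \<open>The polynomials get multiplied in the commutator, which is how f in both factors leads
  to f^2.\<close>

lemma E_E:
  assumes Y: "Y \<in> gspace D l0 l" and X: "X \<in> gspace D k0 k" and f: "f \<in> Am D" and g: "g \<in> Am D"
  shows "E Y l0 l g (E X k0 k f v) = E X k0 k f (E Y l0 l g v) + E (br Y X) (l0 + k0) (l + k) (g * f) v
    + (if l0 + k0 = 0 then sM (of_int l0 * form D Y X) (Kf (l + k) (g * f) v) else 0)"
proof -
  have "E Y l0 l g (E X k0 k f v) = psum g (\<lambda>s. e Y l0 (l + s) (E X k0 k f v))" by (simp add: E_def)
  also have "\<dots> = psum g (\<lambda>s. E X k0 k f (e Y l0 (l + s) v) + (E (br Y X) (l0 + k0) (l + s + k) f v
      + sM (if l0 + k0 = 0 then of_int l0 * form D Y X else 0) (Kf (l + s + k) f v)))"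
    using Y by (intro psum_cong) (auto simp: e_E[OF _ X f] lat_gspace Am_lat[OF g] add.assoc)
  also have "\<dots> = E X k0 k f (E Y l0 l g v) + (psum g (\<lambda>s. E (br Y X) (l0 + k0) (l + s + k) f v)
      + sM (if l0 + k0 = 0 then of_int l0 * form D Y X else 0) (psum g (\<lambda>s. Kf (l + s + k) f v)))"
    unfolding psum_plus psum_scale psum_endo[OF E_endo[OF X f], symmetric] by (simp add: E_def[of Y])
  also have "psum g (\<lambda>s. E (br Y X) (l0 + k0) (l + s + k) f v) = E (br Y X) (l0 + k0) (l + k) (g * f) v"
    by (simp add: E_def psum_mult add_ac)
  also have "psum g (\<lambda>s. Kf (l + s + k) f v) = Kf (l + k) (g * f) v"
    by (simp add: Kf_def psum_mult add_ac)
  finally show ?thesis by (simp add: add.assoc)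
qed

lemma cK_E: "lat \<gamma> \<Longrightarrow> X \<in> gspace D k0 k \<Longrightarrow> f \<in> Am D \<Longrightarrow> cK \<gamma> (E X k0 k f v) = E X k0 k f (cK \<gamma> v)"
  unfolding E_def psum_endo[OF cK_endo] by (intro psum_cong cK_e) (simp_all add: lat_gspace Am_lat)

lemma e_Kf: "X \<in> gspace D k0 k \<Longrightarrow> lat \<gamma> \<Longrightarrow> f \<in> Am D \<Longrightarrow> e X k0 k (Kf \<gamma> f v) = Kf \<gamma> f (e X k0 k v)"
  unfolding Kf_def by (subst psum_endo[OF e_endo]) (auto intro!: psum_cong cK_e[symmetric] simp: Am_lat)

lemma E_Kf: "X \<in> gspace D k0 k \<Longrightarrow> lat \<gamma> \<Longrightarrow> f \<in> Am D \<Longrightarrow> g \<in> Am D \<Longrightarrow>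
    E X k0 k g (Kf \<gamma> f v) = Kf \<gamma> f (E X k0 k g v)"
  unfolding E_def psum_endo[OF Kf_endo] by (intro psum_cong e_Kf) (simp_all add: lat_gspace Am_lat)

lemma cK_Kf: "lat \<gamma>' \<Longrightarrow> lat \<gamma> \<Longrightarrow> f \<in> Am D \<Longrightarrow> cK \<gamma>' (Kf \<gamma> f v) = Kf \<gamma> f (cK \<gamma>' v)"
  unfolding Kf_def psum_endo[OF cK_endo] by (intro psum_cong cK_cK) (simp_all add: Am_lat)

lemma Kf_Kf: "lat \<gamma>' \<Longrightarrow> lat \<gamma> \<Longrightarrow> f \<in> Am D \<Longrightarrow> g \<in> Am D \<Longrightarrow> Kf \<gamma>' g (Kf \<gamma> f v) = Kf \<gamma> f (Kf \<gamma>' g v)"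
  unfolding Kf_def[of \<gamma>' g] psum_endo[OF Kf_endo] by (intro psum_cong cK_Kf) (simp_all add: Am_lat)

lemma d_E: "X \<in> gspace D k0 k \<Longrightarrow> f \<in> Am D \<Longrightarrow> d (E X k0 k f v) = E X k0 k f (d v) + sM (of_int k0) (E X k0 k f v)"
  unfolding E_def psum_endo[OF d_endo] psum_scale[symmetric] psum_plus[symmetric]
  by (intro psum_cong d_e) (simp add: lat_gspace Am_lat)

lemma d_Kf: "lat \<gamma> \<Longrightarrow> f \<in> Am D \<Longrightarrow> d (Kf \<gamma> f v) = Kf \<gamma> f (d v)"
  unfolding Kf_def psum_endo[OF d_endo] by (intro psum_cong d_cK) (simp add: Am_lat)

lemma E_pos_N0: "X \<in> gspace_wt D k0 k \<alpha> \<Longrightarrow> \<alpha> \<in> dualH \<Longrightarrow> k0 > 0 \<or> k0 = 0 \<and> pos \<alpha> \<Longrightarrow> f \<in> Am D \<Longrightarrow>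
    n \<in> N0 \<Longrightarrow> E X k0 k f n = 0"
  unfolding E_def psum_def by (intro sum.neutral ballI) (simp add: e_pos_N0 lat_gspace_wt Am_lat)

lemma E_N0: "X \<in> gspace_wt D 0 k zero_wt \<Longrightarrow> f \<in> Am D \<Longrightarrow> n \<in> N0 \<Longrightarrow> E X 0 k f n \<in> N0"
  unfolding E_def by (intro psum_in[OF N0(1)] e_N0) (simp_all add: lat_gspace_wt Am_lat)

lemma Kf_N0: "lat \<gamma> \<Longrightarrow> f \<in> Am D \<Longrightarrow> n \<in> N0 \<Longrightarrow> Kf \<gamma> f n \<in> N0"
  unfolding Kf_def by (intro psum_in[OF N0(1)] cK_N0) (simp_all add: Am_lat)

lemma d_N0: "n \<in> N0 \<Longrightarrow> d n \<in> N0"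
  using N0_wt(2) M.subspace_scale[OF N0(1)] by auto

definition kills :: "'n laurent \<Rightarrow> bool" where
  "kills f \<longleftrightarrow> (\<forall>v\<in>V0. (\<forall>X k0 k. X \<in> gspace D k0 k \<longrightarrow> E X k0 k f v = 0) \<and> (\<forall>\<gamma>. lat \<gamma> \<longrightarrow> Kf \<gamma> f v = 0))"

definition kills_top :: "'n laurent \<Rightarrow> 'v \<Rightarrow> bool" where
  "kills_top f n \<longleftrightarrow> (\<forall>X k. X \<in> gspace_wt D 0 k zero_wt \<longrightarrow> E X 0 k f n = 0) \<and> (\<forall>\<gamma>. lat \<gamma> \<longrightarrow> Kf \<gamma> f n = 0)"

definition lowering :: "('v \<Rightarrow> 'v) set" where
  "lowering = {e X k0 k | X k0 k \<alpha>. X \<in> gspace_wt D k0 k \<alpha> \<and> \<alpha> \<in> dualH \<and> (k0 < 0 \<or> k0 = 0 \<and> pos (\<lambda>h. - \<alpha> h))}"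

text \<open>The part of degree and weight zero, the centre and \<open>d\<close> are included: these
  operators come from the whole of L^+ + L^0.\<close>

definition raising :: "('v \<Rightarrow> 'v) set" where
  "raising = {e X k0 k | X k0 k \<alpha>. X \<in> gspace_wt D k0 k \<alpha> \<and> \<alpha> \<in> dualH \<and> (k0 > 0 \<or> k0 = 0 \<and> (pos \<alpha> \<or> \<alpha> = zero_wt))}
     \<union> {cK \<gamma> | \<gamma>. lat \<gamma>} \<union> {d}"

text \<open>The point where the dichotomy of weights enters: in t_0-degree zero a nonzero vector of
  nonzero weight is either raising or lowering.\<close>

lemma root_operator_cases:
  assumes X: "X \<in> gspace_wt D k0 k \<alpha>" "\<alpha> \<in> dualH"
  obtains "X = 0" | "k0 > 0 \<or> k0 = 0 \<and> pos \<alpha>" | "k0 = 0" "\<alpha> = zero_wt" | "k0 < 0 \<or> k0 = 0 \<and> pos (\<lambda>h. - \<alpha> h)"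
proof -
  consider "k0 > 0" | "k0 < 0" | "k0 = 0" by linarith
  then show thesis using that weight_sign[OF X(1) _ X(2)] by cases blast+
qed

lemma e_zero: "e 0 k0 k v = 0"
  using e_scale[of 0 k0 k 0 v] subspace_0[OF subspace_gspace] by simp

lemma e_in_span: assumes X: "X \<in> gspace D k0 k" shows "e X k0 k v \<in> M.span {T v | T. T \<in> lowering \<union> raising}"
proof -
  let ?S = "M.span {T v | T. T \<in> lowering \<union> raising}"
  have "M.subspace ?S" by (rule M.subspace_span)
  then have "subspace {X \<in> gspace D k0 k. e X k0 k v \<in> ?S}"
    using subspace_gspace e_zero
    by (auto simp: subspace_def M.subspace_def e_add e_scale)
  moreover have "wvecs (gspace D k0 k) \<subseteq> {X \<in> gspace D k0 k. e X k0 k v \<in> ?S}"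
  proof clarify
    fix X \<alpha> assume X: "X \<in> gspace D k0 k" "\<alpha> \<in> dualH" "X \<in> wtv \<alpha>"
    then have Xw: "X \<in> gspace_wt D k0 k \<alpha>" by (simp add: gspace_wt_eq)
    show "e X k0 k v \<in> ?S"
    proof (cases "X = 0")
      case True then show ?thesis by (simp add: e_zero M.span_zero)
    next
      case False
      have "e X k0 k \<in> lowering \<union> raising"
        using root_operator_cases[OF Xw X(2)] False Xw X(2) unfolding lowering_def raising_def by blast
      then show ?thesis by (intro M.span_base) blast
    qed
  qed
  ultimately have "gspace D k0 k \<subseteq> {X \<in> gspace D k0 k. e X k0 k v \<in> ?S}"
    using gspace_weights span_minimal by blast
  then show ?thesis using X by blast
qed

lemma cK_in_span: "lat \<gamma> \<Longrightarrow> cK \<gamma> v \<in> M.span {T v | T. T \<in> lowering \<union> raising}"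
  by (intro M.span_base) (auto simp: raising_def)

lemma operators_endo: "T \<in> lowering \<union> raising \<Longrightarrow> M.endo T"
  unfolding lowering_def raising_def using e_endo cK_endo d_endo by (auto simp: gspace_wt_eq)

lemma raise_lower_in_span:
  assumes "R \<in> raising" "L \<in> lowering"
  shows "R (L v) - L (R v) \<in> M.span {T v | T. T \<in> lowering \<union> raising}"
proof -
  let ?S = "M.span {T v | T. T \<in> lowering \<union> raising}"
  obtain X k0 k \<alpha> where L: "L = e X k0 k" "X \<in> gspace D k0 k"
    using assms(2) by (auto simp: lowering_def gspace_wt_eq)
  consider Y l0 l where "R = e Y l0 l" "Y \<in> gspace D l0 l" | \<gamma> where "R = cK \<gamma>" "lat \<gamma>" | "R = d"
    using assms(1) by (auto simp: raising_def gspace_wt_eq)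
  then show ?thesis
  proof cases
    case (1 Y l0 l)
    have "sM (of_int l0 * form D Y X) (cK (l + k) v) \<in> ?S" if "l0 + k0 = 0"
    proof (cases "form D Y X = 0")
      case True then show ?thesis by (simp add: M.span_zero)
    next
      case False
      have "k0 = - l0" using that by simp
      then have "lat (l + k)" using form_lattice[OF 1(2) _ False] L(2) by simp
      then show ?thesis by (intro M.span_scale cK_in_span)
    qed
    moreover have "e (br Y X) (l0 + k0) (l + k) v \<in> ?S" by (rule e_in_span[OF br_gspace[OF 1(2) L(2)]])
    ultimately show ?thesis using e_comm[OF 1(2) L(2), of v] by (auto simp: L 1 M.span_add)
  next
    case 2 then show ?thesis using cK_e[OF L(2)] by (simp add: L M.span_zero)
  next
    case 3 then show ?thesis using d_e[OF L(2)] e_in_span[OF L(2)] by (simp add: L M.span_scale)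
  qed
qed

text \<open>The lowering operators applied to \<open>L(f)\<^sup>- N0\<close> generate a submodule all of whose weights differ
  from that of \<open>N0\<close>.\<close>

lemma kills_of_kills_top:
  assumes f: "f \<in> Am D" and top: "\<And>n. n \<in> N0 \<Longrightarrow> kills_top f n"
  shows "kills f"
proof -
  define T where "T = {E X k0 k f n | X k0 k \<alpha> n. n \<in> N0 \<and> X \<in> gspace_wt D k0 k \<alpha> \<and> \<alpha> \<in> dualH \<and>
    (k0 < 0 \<or> k0 = 0 \<and> pos (\<lambda>h. - \<alpha> h))}"
  define M' where "M' = M.lowering_closure (\<lambda>t. t) lowering T"
  have sM': "M.subspace M'" unfolding M'_def by (rule M.subspace_lowering_closure)
  \<comment> \<open>Raising elements kill \<open>N0\<close>, those of degree and weight zero vanish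
    with f by hypothesis, and the remaining ones are the generators in \<open>T\<close>.\<close>
  have EN: "E X k0 k f n \<in> M'" if X: "X \<in> gspace_wt D k0 k \<alpha>" "\<alpha> \<in> dualH" and n: "n \<in> N0" for X k0 k \<alpha> n
    using X
  proof (cases rule: root_operator_cases)
    case 1 then show ?thesis using E_zero[OF f] M.subspace_0[OF sM'] by simp
  next
    case 2 then show ?thesis using E_pos_N0[OF X _ f n] M.subspace_0[OF sM'] by simp
  next
    case 3 then show ?thesis using top[OF n] X M.subspace_0[OF sM'] by (simp add: kills_top_def)
  next
    case 4
    then have "E X k0 k f n \<in> T" using X n unfolding T_def by blast
    then show ?thesis unfolding M'_def by (rule M.lowering_closure_base)
  qed
  have RN: "R n \<in> N0" if "R \<in> raising" "n \<in> N0" for R n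
    using that e_N0 cK_N0 d_N0 e_pos_N0 M.subspace_0[OF N0(1)] unfolding raising_def by auto
  have raise: "R v \<in> M'" if R: "R \<in> raising" and v: "v \<in> M'" for R v
    unfolding M'_def
  proof (rule M.lowering_closure_stable[where act = "\<lambda>t. t" and Nm = lowering and Bp = raising
        and T = T and x = R and v = v])
    show "M.endo x" if "x \<in> lowering \<union> raising" for x using that by (rule operators_endo)
    show "x (y w) - y (x w) \<in> M.span {z w | z. z \<in> lowering \<union> raising}"
      if "x \<in> raising" "y \<in> lowering" for x y w using that by (rule raise_lower_in_span)
    show "R \<in> raising" "v \<in> M.lowering_closure (\<lambda>t. t) lowering T" using R v unfolding M'_def .
  next
    fix R t assume R: "R \<in> raising" and "t \<in> T"
    then obtain X k0 k \<alpha> n where t: "t = E X k0 k f n" "n \<in> N0" "X \<in> gspace_wt D k0 k \<alpha>" "\<alpha> \<in> dualH"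
      unfolding T_def by blast
    have X: "X \<in> gspace D k0 k" using t(3) by (simp add: gspace_wt_eq)
    have m: "E X k0 k f (R n) \<in> M'" by (rule EN[OF t(3,4) RN[OF R t(2)]])
    consider Y l0 l \<beta> where "R = e Y l0 l" "Y \<in> gspace_wt D l0 l \<beta>" "\<beta> \<in> dualH" | \<gamma> where "R = cK \<gamma>" "lat \<gamma>" | "R = d"
      using R unfolding raising_def by blast
    then have "R t \<in> M'"
    proof cases
      case (1 Y l0 l \<beta>)
      have Y: "Y \<in> gspace D l0 l" using 1(2) by (simp add: gspace_wt_eq)
      have b: "E (br Y X) (l0 + k0) (l + k) f n \<in> M'"
        by (rule EN[OF br_gspace_wt[OF 1(2) t(3)] dual_add[OF 1(3) t(4)] t(2)])
      \<comment> \<open>A nonzero central coefficient puts l + k into the lattice, where the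
        hypothesis on the top makes the central operator vanish.\<close>
      have "sM (of_int l0 * form D Y X) (Kf (l + k) f n) = 0" if "l0 + k0 = 0"
      proof (cases "form D Y X = 0")
        case False
        have "k0 = - l0" using that by simp
        then have "lat (l + k)" using form_lattice[OF Y _ False] X by simp
        then show ?thesis using top[OF t(2)] by (simp add: kills_top_def)
      qed simp
      then have "R t = E X k0 k f (R n) + E (br Y X) (l0 + k0) (l + k) f n"
        unfolding t(1) 1(1) e_E[OF Y X f] by simp
      then show ?thesis using M.subspace_add[OF sM' m b] by simp
    next
      case 2 then show ?thesis using m cK_E[OF _ X f] by (simp add: t(1))
    next
      case 3
      have "E X k0 k f n \<in> M'" by (rule EN[OF t(3,4,2)])
      then show ?thesis using m d_E[OF X f] 3 M.subspace_add[OF sM'] M.subspace_scale[OF sM'] by (simp add: t(1))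
    qed
    then show "R t \<in> M.lowering_closure (\<lambda>t. t) lowering T" unfolding M'_def .
  qed
  have lower: "L v \<in> M'" if "L \<in> lowering" "v \<in> M'" for L v
    using M.lowering_closure_act[of L lowering v "\<lambda>t. t" T] that unfolding M'_def by simp
  have span_M': "w \<in> M'" if "v \<in> M'" "w \<in> M.span {T v | T. T \<in> lowering \<union> raising}" for v w
  proof -
    have "{T v | T. T \<in> lowering \<union> raising} \<subseteq> M'" using lower raise that(1) by blast
    then show ?thesis using M.span_minimal[OF _ sM'] that(2) by blast
  qed
  have M'V0: "M' \<subseteq> V0" unfolding M'_def
  proof (rule M.lowering_closure_minimal[OF V0])
    show "T \<subseteq> V0" using E_V0 f N0(2) unfolding T_def by (auto simp: gspace_wt_eq)
    show "L v \<in> V0" if "L \<in> lowering" "v \<in> V0" for L v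
      using that e_V0 unfolding lowering_def by (auto simp: gspace_wt_eq)
  qed
  obtain r1 r2 where r: "\<And>n. n \<in> N0 \<Longrightarrow> e varpi 0 0 n = sM r1 n" "\<And>n. n \<in> N0 \<Longrightarrow> d n = sM r2 n"
    using N0_wt(1)[OF varpi(1)] N0_wt(2) by blast
  have vG: "varpi \<in> gspace D 0 0" using varpi(1) H_sub by blast
  \<comment> \<open>Joint eigenvectors of \<open>d\<close> and \<open>varpi\<close> whose
    eigenvalues differ from those on \<open>N0\<close> by a pair (k, p) that is negative
    lexicographically. Every lowering operator adds such a pair.\<close>
  define S where "S = {v. \<exists>(k::int) p. d v = sM (r2 + of_int k) v \<and> e varpi 0 0 v = sM (r1 + p) v \<and>
    (k < 0 \<or> k = 0 \<and> (\<exists>m::nat. m > 0 \<and> p = - complex_of_nat m))}"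
  let ?neg = "\<lambda>(k::int) p. k < 0 \<or> k = 0 \<and> (\<exists>m::nat. m > 0 \<and> p = - complex_of_nat m)"
  have neg_add: "?neg (k + k') (p + p')" if "?neg k p" "?neg k' p'" for k k' p p'
    using that by (auto intro: add_neg_neg)
  have neg_root: "?neg k0 (\<alpha> varpi)" if "k0 < 0 \<or> k0 = 0 \<and> pos (\<lambda>h. - \<alpha> h)" for k0 \<alpha>
  proof (cases "k0 < 0")
    case False
    then have k0: "k0 = 0" "pos (\<lambda>h. - \<alpha> h)" using that by auto
    obtain n :: nat where n: "n > 0" "- \<alpha> varpi = of_nat n" using pos_height[OF k0(2)] by blast
    have "\<alpha> varpi = - of_nat n" using n(2) by (metis minus_minus)
    then show ?thesis using k0(1) n(1) by auto
  qed simp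
  have SI: "v \<in> S" if "d v = sM (r2 + of_int k) v" "e varpi 0 0 v = sM (r1 + p) v" "?neg k p" for v k p
    using that unfolding S_def by blast
  have brw: "br varpi X = sc (\<alpha> varpi) X" if "X \<in> gspace_wt D k0 k \<alpha>" for X k0 k \<alpha>
    using wtvD[OF _ varpi(1)] that by (simp add: gspace_wt_eq)
  have "M' \<subseteq> M.span S" unfolding M'_def
  proof (rule M.lowering_closure_minimal[OF M.subspace_span])
    show "T \<subseteq> M.span S"
    proof
      fix t assume "t \<in> T"
      then obtain X k0 k \<alpha> n where t: "t = E X k0 k f n" "n \<in> N0" "X \<in> gspace_wt D k0 k \<alpha>" "\<alpha> \<in> dualH"
        "k0 < 0 \<or> k0 = 0 \<and> pos (\<lambda>h. - \<alpha> h)" unfolding T_def by blast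
      have X: "X \<in> gspace D k0 k" using t(3) by (simp add: gspace_wt_eq)
      have 1: "d t = sM (r2 + of_int k0) t"
        unfolding t(1) d_E[OF X f] r(2)[OF t(2)] by (simp add: M.endo_add[OF E_endo[OF X f]] M.endo_scale[OF E_endo[OF X f]] M.scale_left_distrib)
      have 2: "e varpi 0 0 t = sM (r1 + \<alpha> varpi) t"
        unfolding t(1) e_E[OF vG X f] r(1)[OF t(2)] brw[OF t(3)]
        by (simp add: M.endo_add[OF E_endo[OF X f]] M.endo_scale[OF E_endo[OF X f]] M.scale_left_distrib E_scale[OF X f])
      show "t \<in> M.span S" by (rule M.span_base[OF SI[OF 1 2 neg_root[OF t(5)]]])
    qed
    fix L v assume L: "L \<in> lowering" and v: "v \<in> M.span S"
    obtain X k0 k \<alpha> where X: "L = e X k0 k" "X \<in> gspace_wt D k0 k \<alpha>" "\<alpha> \<in> dualH" "k0 < 0 \<or> k0 = 0 \<and> pos (\<lambda>h. - \<alpha> h)"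
      using L unfolding lowering_def by blast
    have Xg: "X \<in> gspace D k0 k" using X(2) by (simp add: gspace_wt_eq)
    show "L v \<in> M.span S"
    proof (rule M.endo_span[OF operators_endo M.subspace_span _ v])
      show "L \<in> lowering \<union> raising" using L by blast
      fix u assume "u \<in> S"
      then obtain q p where u: "d u = sM (r2 + of_int q) u" "e varpi 0 0 u = sM (r1 + p) u" "?neg q p"
        unfolding S_def by blast
      have 1: "d (L u) = sM (r2 + of_int (q + k0)) (L u)"
        unfolding X(1) d_e[OF Xg] u(1) by (simp add: M.endo_add[OF e_endo[OF Xg]] M.endo_scale[OF e_endo[OF Xg]] M.scale_left_distrib algebra_simps)
      have 2: "e varpi 0 0 (L u) = sM (r1 + (p + \<alpha> varpi)) (L u)"
        unfolding X(1) e_comm[OF vG Xg] u(2) brw[OF X(2)]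
        by (simp add: M.endo_add[OF e_endo[OF Xg]] M.endo_scale[OF e_endo[OF Xg]] M.scale_left_distrib e_scale[OF Xg] algebra_simps)
      show "L u \<in> M.span S" by (rule M.span_base[OF SI[OF 1 2 neg_add[OF u(3) neg_root[OF X(4)]]]])
    qed
  qed
  \<comment> \<open>On \<open>N0\<close> the difference is (0, 0), and an element of
    \<open>S\<close> with that difference is zero. So \<open>M'\<close> meets \<open>N0\<close>
    trivially and cannot be all of \<open>V0\<close>.\<close>
  moreover have "n = 0" if n: "n \<in> N0" "n \<in> M.span S" for n
  proof -
    let ?T = "\<lambda>b. if b then d else e varpi 0 0" and ?r = "\<lambda>b. if b then r2 else r1"
    have "n \<in> M.span (S \<inter> M.joint_eigenspace UNIV ?T ?r)"
    proof (rule M.eigen_vector_span[OF _ _ n(2)])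
      fix x assume "x \<in> S"
      then obtain k p where "d x = sM (r2 + of_int k) x" "e varpi 0 0 x = sM (r1 + p) x" unfolding S_def by blast
      then have "x \<in> M.joint_eigenspace UNIV ?T (\<lambda>b. if b then r2 + of_int k else r1 + p)"
        by (auto simp: M.joint_eigenspace_def)
      then show "\<exists>ev. (\<forall>i. i \<notin> UNIV \<longrightarrow> ev i = 0) \<and> x \<in> M.joint_eigenspace UNIV ?T ev" by blast
    next
      show "n \<in> M.joint_eigenspace UNIV ?T ?r" using r n(1) by (auto simp: M.joint_eigenspace_def)
    qed (use d_endo e_endo[OF vG] in auto)
    moreover have "S \<inter> M.joint_eigenspace UNIV ?T ?r \<subseteq> {0}"
    proof
      fix x assume x: "x \<in> S \<inter> M.joint_eigenspace UNIV ?T ?r"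
      then obtain k p where kp: "d x = sM (r2 + of_int k) x" "e varpi 0 0 x = sM (r1 + p) x" "?neg k p"
        unfolding S_def by blast
      moreover have "d x = sM r2 x" "e varpi 0 0 x = sM r1 x"
        using x by (auto simp: M.joint_eigenspace_def split: if_splits)
      ultimately have "sM (of_int k) x = 0" "sM p x = 0" by (simp_all add: M.scale_left_distrib)
      then show "x \<in> {0}" using kp(3) by auto
    qed
    ultimately show ?thesis using M.span_mono[of "S \<inter> M.joint_eigenspace UNIV ?T ?r" "{0}"] by auto
  qed
  ultimately have "M' \<noteq> V0" using N0(2,3) by blast
  moreover have "M' = {0} \<or> M' = V0"
  proof (rule V0_irr[OF sM' M'V0])
    show "e X k0 k v \<in> M'" if "X \<in> gspace D k0 k" "v \<in> M'" for X k0 k v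
      by (rule span_M'[OF that(2) e_in_span[OF that(1)]])
    show "cK \<gamma> v \<in> M'" if "lat \<gamma>" "v \<in> M'" for \<gamma> v by (rule span_M'[OF that(2) cK_in_span[OF that(1)]])
    show "d v \<in> M'" if "v \<in> M'" for v using raise[of d v] that by (simp add: raising_def)
  qed
  ultimately have M'0: "M' = {0}" by blast
  \<comment> \<open>As \<open>M'\<close> vanishes, \<open>EN\<close> now says that f annihilates
    \<open>N0\<close> in every degree and weight.\<close>
  have EN0: "E X k0 k f n = 0" if X: "X \<in> gspace D k0 k" and n: "n \<in> N0" for X k0 k n
  proof -
    have "subspace {X \<in> gspace D k0 k. E X k0 k f n = 0}"
      using subspace_gspace by (auto simp: subspace_def E_zero[OF f] E_add[OF _ _ f] E_scale[OF _ f])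
    moreover have "wvecs (gspace D k0 k) \<subseteq> {X \<in> gspace D k0 k. E X k0 k f n = 0}"
      using EN[OF _ _ n] M'0 by (auto simp: gspace_wt_eq)
    ultimately have "gspace D k0 k \<subseteq> {X \<in> gspace D k0 k. E X k0 k f n = 0}"
      using gspace_weights span_minimal by blast
    then show ?thesis using X by blast
  qed
  \<comment> \<open>The vectors annihilated by f form a submodule of \<open>V0\<close>, which
    contains the top.\<close>
  let ?W = "{v \<in> V0. (\<forall>X k0 k. X \<in> gspace D k0 k \<longrightarrow> E X k0 k f v = 0) \<and> (\<forall>\<gamma>. lat \<gamma> \<longrightarrow> Kf \<gamma> f v = 0)}"
  have "?W = {0} \<or> ?W = V0"
  proof (rule V0_irr)
    show "M.subspace ?W" using V0
      by (auto simp: M.subspace_def M.endo_zero[OF E_endo[OF _ f]] M.endo_add[OF E_endo[OF _ f]]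
          M.endo_scale[OF E_endo[OF _ f]] M.endo_zero[OF Kf_endo] M.endo_add[OF Kf_endo] M.endo_scale[OF Kf_endo])
    show "e Y l0 l v \<in> ?W" if Y: "Y \<in> gspace D l0 l" and v: "v \<in> ?W" for Y l0 l v
    proof -
      have "E X k0 k f (e Y l0 l v) = 0" if X: "X \<in> gspace D k0 k" for X k0 k
      proof -
        have "(if l0 + k0 = 0 then sM (of_int l0 * form D Y X) (Kf (l + k) f v) else 0) = 0"
        proof (cases "l0 + k0 = 0 \<and> form D Y X \<noteq> 0")
          case True
          then have "k0 = - l0" by simp
          then have "lat (l + k)" using form_lattice[OF Y] X True by blast
          then show ?thesis using v by simp
        qed auto
        moreover have "E (br Y X) (l0 + k0) (l + k) f v = 0" using br_gspace[OF Y X] v by blast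
        moreover have "e Y l0 l (E X k0 k f v) = 0" using v X M.endo_zero[OF e_endo[OF Y]] by simp
        ultimately show ?thesis using e_E[OF Y X f, of v] by simp
      qed
      moreover have "Kf \<gamma> f (e Y l0 l v) = 0" if "lat \<gamma>" for \<gamma>
        using e_Kf[OF Y that f, of v] v that M.endo_zero[OF e_endo[OF Y]] by simp
      ultimately show ?thesis using e_V0[OF Y] v by blast
    qed
    show "cK \<gamma> v \<in> ?W" if "lat \<gamma>" "v \<in> ?W" for \<gamma> v
      using that cK_V0 cK_E[OF that(1) _ f, symmetric] cK_Kf[OF that(1) _ f, symmetric] M.endo_zero[OF cK_endo] by simp
    show "d v \<in> ?W" if v: "v \<in> ?W" for v
    proof -
      have "E X k0 k f (d v) = 0" if "X \<in> gspace D k0 k" for X k0 k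
        using d_E[OF that f, of v] v that M.endo_zero[OF d_endo] by simp
      moreover have "Kf \<gamma> f (d v) = 0" if "lat \<gamma>" for \<gamma>
        using d_Kf[OF that f, of v] v that M.endo_zero[OF d_endo] by simp
      ultimately show ?thesis using v d_V0 by blast
    qed
  qed blast
  moreover have "N0 \<subseteq> ?W" using N0(2) EN0 top by (auto simp: kills_top_def)
  ultimately have "?W = V0" using N0(3) by blast
  then show ?thesis unfolding kills_def by blast
qed

end

section \<open>The ring A(m)\<close>

lemma Am_mult: assumes "f \<in> Am D" "g \<in> Am D" shows "f * g \<in> Am D"
  unfolding Am_def
proof (intro CollectI ballI allI)
  fix k i assume "k \<in> Poly_Mapping.keys (f * g)"
  then obtain s u where "s \<in> Poly_Mapping.keys f" "u \<in> Poly_Mapping.keys g" "k = s + u"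
    using keys_mult[of f g] by blast
  then show "int (ord D (Some i)) dvd k $ i" using assms by (auto simp: Am_def)
qed

lemma Am_add: "f \<in> Am D \<Longrightarrow> g \<in> Am D \<Longrightarrow> f + g \<in> Am D"
  using keys_add[of f g] by (auto simp: Am_def)

lemma Am_zero: "0 \<in> Am D" by (simp add: Am_def)

lemma Am_single: "(\<And>i. int (ord D (Some i)) dvd k $ i) \<Longrightarrow> Poly_Mapping.single k c \<in> Am D"
  by (auto simp: Am_def)

lemma Am_one: "1 \<in> Am D" unfolding single_one[symmetric] by (rule Am_single) simp

lemma Am_diff: "f \<in> Am D \<Longrightarrow> g \<in> Am D \<Longrightarrow> f - g \<in> Am D"
  using keys_diff[of f g] by (auto simp: Am_def)

lemma Am_power: "f \<in> Am D \<Longrightarrow> f ^ n \<in> Am D"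
  by (induction n) (auto simp: Am_one Am_mult)

lemma Am_prod: "(\<And>j. j \<in> A \<Longrightarrow> f j \<in> Am D) \<Longrightarrow> prod f A \<in> Am D"
  by (induction A rule: infinite_finite_induct) (auto simp: Am_one Am_mult)

context toroidal_module
begin

text \<open>The positive degree \<open>l0\<close> makes x kill \<open>N0\<close> whatever the sign
  of \<alpha>. Only y carries f, so that h contains f once while [y,h] contains it twice and
  vanishes.\<close>

lemma top_bracket_nilpotent:
  assumes f: "f \<in> Am D" and sq: "kills (f * f)"
    and X: "X \<in> gspace_wt D l0 l \<alpha>" and Y: "Y \<in> gspace_wt D (- l0) l' (\<lambda>h. - \<alpha> h)"
    and a: "\<alpha> \<in> dualH" "\<alpha> \<noteq> zero_wt" and l0: "l0 > 0"
    and h: "\<And>v. h v = E (br X Y) 0 (l + l') f v + sM (of_int l0 * form D X Y) (Kf (l + l') f v)"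
    and hN: "\<And>n. n \<in> N0 \<Longrightarrow> h n \<in> N0"
    and n: "n \<in> N0"
  shows "\<exists>r. (h ^^ r) n = 0"
proof -
  have Xg: "X \<in> gspace D l0 l" and Yg: "Y \<in> gspace D (- l0) l'" using X Y by (simp_all add: gspace_wt_eq)
  have Zg: "br X Y \<in> gspace D 0 (l + l')" using br_gspace[OF Xg Yg] by simp
  define x y where "x = e X l0 l" and "y = E Y (- l0) l' f"
  have y_endo: "M.endo y" unfolding y_def by (rule E_endo[OF Yg f])
  have xy: "x (y v) = y (x v) + h v" for v
    unfolding x_def y_def h e_E[OF Xg Yg f] by (simp add: add.assoc)
  have yV: "y v \<in> V0" if "v \<in> V0" for v unfolding y_def by (rule E_V0[OF Yg f that])
  have yh: "y (h v) = h (y v)" if v: "v \<in> V0" for v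
  proof -
    have 1: "y (E (br X Y) 0 (l + l') f v) = E (br X Y) 0 (l + l') f (y v)"
    proof -
      have "br Y (br X Y) \<in> gspace D (- l0) (l' + (l + l'))" using br_gspace[OF Yg Zg] by simp
      then have "E (br Y (br X Y)) (- l0 + 0) (l' + (l + l')) (f * f) v = 0"
        using sq v by (simp add: kills_def)
      then show ?thesis unfolding y_def E_E[OF Yg Zg f f] using l0 by simp
    qed
    have 2: "sM (of_int l0 * form D X Y) (y (Kf (l + l') f v)) = sM (of_int l0 * form D X Y) (Kf (l + l') f (y v))"
    proof (cases "form D X Y = 0")
      case False
      then have "lat (l + l')" by (rule form_lattice[OF Xg Yg])
      then show ?thesis unfolding y_def using E_Kf[OF Yg _ f f] by simp
    qed simp
    show ?thesis unfolding h by (simp add: M.endo_add[OF y_endo] M.endo_scale[OF y_endo] 1 2)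
  qed
  have yhpow: "(y ^^ i) (h v) = h ((y ^^ i) v)" "(y ^^ i) v \<in> V0" if "v \<in> V0" for i v
  proof -
    show "(y ^^ i) v \<in> V0" using that yV by (induction i) auto
    show "(y ^^ i) (h v) = h ((y ^^ i) v)" using that
    proof (induction i)
      case (Suc i)
      have "(y ^^ i) v \<in> V0" using Suc.prems yV by (induction i) auto
      then show ?case using Suc yh by simp
    qed simp
  qed
  have xN: "x m = 0" if "m \<in> N0" for m
    unfolding x_def using e_pos_N0[OF X a(1) _ that] l0 by simp
  \<comment> \<open>Moving x through i + 1 factors y yields i + 1 copies of h, which commutes with
    y, and then x kills m.\<close>
  have step: "x ((y ^^ Suc i) m) = sM (of_nat (Suc i)) ((y ^^ i) (h m))" if m: "m \<in> N0" for i m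
  proof -
    have mV: "m \<in> V0" using m N0(2) by blast
    show ?thesis
    proof (induction i)
      case 0
      show ?case using xN[OF m] xy[of m] M.endo_zero[OF y_endo] by simp
    next
      case (Suc i)
      have "x ((y ^^ Suc (Suc i)) m) = y (x ((y ^^ Suc i) m)) + h ((y ^^ Suc i) m)"
        using xy[of "(y ^^ Suc i) m"] by simp
      also have "y (x ((y ^^ Suc i) m)) = sM (of_nat (Suc i)) ((y ^^ Suc i) (h m))"
        unfolding Suc by (simp add: M.endo_scale[OF y_endo])
      also have "h ((y ^^ Suc i) m) = (y ^^ Suc i) (h m)" using yhpow(1)[OF mV, of "Suc i"] by simp
      finally have "x ((y ^^ Suc (Suc i)) m) = sM (of_nat (Suc i)) ((y ^^ Suc i) (h m)) + (y ^^ Suc i) (h m)" .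
      moreover have n: "complex_of_nat (Suc (Suc i)) = of_nat (Suc i) + 1" by simp
      ultimately show ?case unfolding n M.scale_left_distrib M.scale_one by simp
    qed
  qed
  have x_endo: "M.endo x" unfolding x_def by (rule e_endo[OF Xg])
  \<comment> \<open>The induction passes from \<open>m\<close> to \<open>h m\<close>, for which h
    has to preserve \<open>N0\<close>.\<close>
  have xr: "(x ^^ r) ((y ^^ r) m) = sM (fact r) ((h ^^ r) m)" if "m \<in> N0" for r m
    using that
  proof (induction r arbitrary: m)
    case (Suc r)
    have "(x ^^ Suc r) ((y ^^ Suc r) m) = (x ^^ r) (x ((y ^^ Suc r) m))" by (simp only: funpow_Suc_right o_def)
    also have "\<dots> = sM (of_nat (Suc r)) ((x ^^ r) ((y ^^ r) (h m)))"
      unfolding step[OF Suc.prems] by (rule M.endo_scale[OF M.endo_funpow[OF x_endo]])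
    also have "\<dots> = sM (of_nat (Suc r)) (sM (fact r) ((h ^^ r) (h m)))"
      by (simp only: Suc.IH[OF hN[OF Suc.prems]])
    also have "\<dots> = sM (fact (Suc r)) ((h ^^ Suc r) m)" by (simp add: funpow_swap1)
    finally show ?case .
  qed simp
  have "(\<lambda>h. - \<alpha> h) \<noteq> zero_wt" using a(2) by (auto simp: fun_eq_iff)
  then obtain r where "(y ^^ r) n = 0"
    using real_nilpotent[OF Y dual_neg[OF a(1)] _ f, of n] n N0(2) unfolding y_def E_def psum_def by blast
  then have "sM (fact r) ((h ^^ r) n) = 0"
    using xr[OF n, of r] M.endo_zero[OF M.endo_funpow[OF x_endo]] by simp
  then have "(h ^^ r) n = 0" by simp
  then show ?thesis by blast
qed

text \<open>The commutator of X t_0^{l0} t^l with Y t_0^{-l0} t^{l'} f, where k = l + l'.\<close>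

definition top_bracket :: "'n laurent \<Rightarrow> 'g \<Rightarrow> 'g \<Rightarrow> int \<Rightarrow> int^'n \<Rightarrow> 'v \<Rightarrow> 'v" where
  "top_bracket f X Y l0 k v = E (br X Y) 0 k f v + sM (of_int l0 * form D X Y) (Kf k f v)"

definition top_brackets :: "'n laurent \<Rightarrow> ('v \<Rightarrow> 'v) set" where
  "top_brackets f = {top_bracket f X Y l0 (l + l') | X Y \<alpha> l0 l l'. \<alpha> \<in> dualH \<and> \<alpha> \<noteq> zero_wt \<and> l0 > 0 \<and>
     X \<in> gspace_wt D l0 l \<alpha> \<and> Y \<in> gspace_wt D (- l0) l' (\<lambda>h. - \<alpha> h)}"

text \<open>A bracket only controls the sum of its loop term and its central term. For root vectors
  with (x|y) \<noteq> 0, placed in the t_0-degrees m_0 and 2 m_0 and their opposites, the loop terms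
  coincide while the central coefficients differ, so the central operators vanish. Then all loop
  terms vanish, and \<open>zero_weight_span\<close> gives the rest of L^0.\<close>

lemma kills_top_of_brackets:
  assumes f: "f \<in> Am D" and n: "\<And>h. h \<in> top_brackets f \<Longrightarrow> h n = 0"
  shows "kills_top f n"
proof -
  let ?m = "int (ord D None)"
  have Kf0: "Kf \<gamma> f n = 0" if g: "lat \<gamma>" for \<gamma>
  proof -
    obtain \<alpha> x y where xy: "\<alpha> \<in> dualH" "\<alpha> \<noteq> zero_wt" "x \<in> gspace_wt D 0 0 \<alpha>" "y \<in> gspace_wt D 0 0 (\<lambda>h. - \<alpha> h)"
      "form D x y \<noteq> 0" using form_pairs_root_vectors by blast
    have m0: "?m > 0" using ord_pos[of None] by simp
    have "gspace D 0 0 = gspace D (?m * q) 0" "gspace D 0 0 = gspace D (- (?m * q)) \<gamma>" for q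
      using g by (auto intro!: gspace_periodic)
    then have "x \<in> gspace_wt D (?m * q) 0 \<alpha>" "y \<in> gspace_wt D (- (?m * q)) \<gamma> (\<lambda>h. - \<alpha> h)" for q
      using xy(3,4) unfolding gspace_wt_eq by blast+
    then have "top_bracket f x y (?m * q) (0 + \<gamma>) \<in> top_brackets f" if "q > 0" for q
      unfolding top_brackets_def using xy(1,2) mult_pos_pos[OF m0 that] by blast
    then have t: "top_bracket f x y (?m * q) (0 + \<gamma>) n = 0" if "q > 0" for q by (rule n[OF _]) (rule that)
    have "sM (of_int (?m * q) * form D x y) (Kf \<gamma> f n) = - E (br x y) 0 \<gamma> f n" if "q > 0" for q
      using t[OF that] unfolding top_bracket_def by (simp add: eq_neg_iff_add_eq_0 add.commute)
    \<comment> \<open>The right-hand side does not involve q, so the central terms for q = 1 and q =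
      2 agree although their coefficients are different.\<close>
    from this[of 1] this[of 2]
    have "sM (of_int (?m * 1) * form D x y) (Kf \<gamma> f n) = sM (of_int (?m * 2) * form D x y) (Kf \<gamma> f n)" by simp
    then show ?thesis using xy(5) m0 by (simp only: M.scale_cancel_right) simp
  qed
  have "E X 0 k f n = 0" if X: "X \<in> gspace_wt D 0 k zero_wt" for X k
  proof -
    let ?R = "{br X Y | X Y \<alpha> l0 l l'. \<alpha> \<in> dualH \<and> \<alpha> \<noteq> zero_wt \<and> l0 > 0 \<and>
     X \<in> gspace_wt D l0 l \<alpha> \<and> Y \<in> gspace_wt D (- l0) l' (\<lambda>h. - \<alpha> h) \<and> l + l' = k}"
    have "subspace {Z \<in> gspace D 0 k. E Z 0 k f n = 0}"
      using subspace_gspace by (auto simp: subspace_def E_zero[OF f] E_add[OF _ _ f] E_scale[OF _ f])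
    moreover have "?R \<subseteq> {Z \<in> gspace D 0 k. E Z 0 k f n = 0}"
    proof clarify
      fix X Y \<alpha> l0 l l'
      assume r: "\<alpha> \<in> dualH" "\<alpha> \<noteq> zero_wt" "(0::int) < l0" "X \<in> gspace_wt D l0 l \<alpha>"
        "Y \<in> gspace_wt D (- l0) l' (\<lambda>h. - \<alpha> h)" "k = l + l'"
      have g: "X \<in> gspace D l0 l" "Y \<in> gspace D (- l0) l'" using r by (simp_all add: gspace_wt_eq)
      have "top_bracket f X Y l0 (l + l') \<in> top_brackets f" unfolding top_brackets_def using r by blast
      then have "top_bracket f X Y l0 (l + l') n = 0" by (rule n)
      moreover have "sM (of_int l0 * form D X Y) (Kf (l + l') f n) = 0"
        using form_lattice[OF g] Kf0 by (cases "form D X Y = 0") auto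
      ultimately have "E (br X Y) 0 (l + l') f n = 0" by (simp add: top_bracket_def)
      then show "br X Y \<in> gspace D 0 (l + l') \<and> E (br X Y) 0 (l + l') f n = 0"
        using br_gspace[OF g] by simp
    qed
    ultimately have "span ?R \<subseteq> {Z \<in> gspace D 0 k. E Z 0 k f n = 0}" by (rule span_minimal[rotated])
    then show ?thesis using zero_weight_span[OF X] by blast
  qed
  then show ?thesis using Kf0 by (simp add: kills_top_def)
qed

lemma top_brackets_N0:
  assumes f: "f \<in> Am D" and h: "h \<in> top_brackets f" and n: "n \<in> N0"
  shows "h n \<in> N0"
proof -
  obtain X Y \<alpha> l0 l l' where r: "h = top_bracket f X Y l0 (l + l')" "X \<in> gspace_wt D l0 l \<alpha>"
    "Y \<in> gspace_wt D (- l0) l' (\<lambda>h. - \<alpha> h)" using h unfolding top_brackets_def by blast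
  have g: "X \<in> gspace D l0 l" "Y \<in> gspace D (- l0) l'" using r by (simp_all add: gspace_wt_eq)
  have "br X Y \<in> gspace_wt D 0 (l + l') zero_wt" using br_gspace_wt[OF r(2,3)] by simp
  then have 1: "E (br X Y) 0 (l + l') f n \<in> N0" by (rule E_N0[OF _ f n])
  have 2: "sM (of_int l0 * form D X Y) (Kf (l + l') f n) \<in> N0"
  proof (cases "form D X Y = 0")
    case True then show ?thesis using M.subspace_0[OF N0(1)] by simp
  next
    case False
    then have "lat (l + l')" by (rule form_lattice[OF g])
    then show ?thesis by (intro M.subspace_scale[OF N0(1)] Kf_N0[OF _ f n])
  qed
  show ?thesis unfolding r(1) top_bracket_def by (rule M.subspace_add[OF N0(1) 1 2])
qed

text \<open>The loop terms have t_0-degree 0, so their commutator has no central part and consists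
  of one operator with f^2, which vanishes on \<open>V0\<close>. The central terms commute with
  everything.\<close>

lemma top_brackets_commute:
  assumes f: "f \<in> Am D" and sq: "kills (f * f)" and h: "h \<in> top_brackets f" "h' \<in> top_brackets f" and n: "n \<in> N0"
  shows "h (h' n) = h' (h n)"
proof -
  have nV: "n \<in> V0" using n N0(2) by blast
  have form: "\<exists>Z k c. h = (\<lambda>v. E Z 0 k f v + sM c (Kf k f v)) \<and> Z \<in> gspace D 0 k \<and> (c \<noteq> 0 \<longrightarrow> lat k)"
    if hh: "h \<in> top_brackets f" for h
  proof -
    obtain X Y \<alpha> l0 l l' where r: "h = top_bracket f X Y l0 (l + l')" "X \<in> gspace_wt D l0 l \<alpha>"
      "Y \<in> gspace_wt D (- l0) l' (\<lambda>h. - \<alpha> h)" using hh unfolding top_brackets_def by blast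
    have g: "X \<in> gspace D l0 l" "Y \<in> gspace D (- l0) l'" using r by (simp_all add: gspace_wt_eq)
    have "of_int l0 * form D X Y \<noteq> 0 \<longrightarrow> lat (l + l')" using form_lattice[OF g] by auto
    moreover have "br X Y \<in> gspace D 0 (l + l')" using br_gspace[OF g] by simp
    moreover have "h = (\<lambda>v. E (br X Y) 0 (l + l') f v + sM (of_int l0 * form D X Y) (Kf (l + l') f v))"
      unfolding r(1) by (rule ext) (rule top_bracket_def)
    ultimately show ?thesis by blast
  qed
  obtain Z k c where h1: "h = (\<lambda>v. E Z 0 k f v + sM c (Kf k f v))" "Z \<in> gspace D 0 k" "c \<noteq> 0 \<longrightarrow> lat k"
    using form[OF h(1)] by blast
  obtain Z' k' c' where h2: "h' = (\<lambda>v. E Z' 0 k' f v + sM c' (Kf k' f v))" "Z' \<in> gspace D 0 k'" "c' \<noteq> 0 \<longrightarrow> lat k'"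
    using form[OF h(2)] by blast
  note lin = M.endo_add[OF E_endo[OF h1(2) f]] M.endo_scale[OF E_endo[OF h1(2) f]]
    M.endo_add[OF E_endo[OF h2(2) f]] M.endo_scale[OF E_endo[OF h2(2) f]] M.endo_add[OF Kf_endo] M.endo_scale[OF Kf_endo]
  have "br Z Z' \<in> gspace D (0 + 0) (k + k')" by (rule br_gspace[OF h1(2) h2(2)])
  then have EE: "E Z 0 k f (E Z' 0 k' f n) = E Z' 0 k' f (E Z 0 k f n)"
    unfolding E_E[OF h1(2) h2(2) f f] using sq nV by (simp add: kills_def)
  have EK: "sM c' (E Z 0 k f (Kf k' f n)) = sM c' (Kf k' f (E Z 0 k f n))"
    using E_Kf[OF h1(2) _ f f] h2(3) by (cases "c' = 0") auto
  have KE: "sM c (Kf k f (E Z' 0 k' f n)) = sM c (E Z' 0 k' f (Kf k f n))"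
    using E_Kf[OF h2(2) _ f f] h1(3) by (cases "c = 0") auto
  have KK: "sM c (sM c' (Kf k f (Kf k' f n))) = sM c' (sM c (Kf k' f (Kf k f n)))"
    using Kf_Kf[OF _ _ f f] h1(3) h2(3) by (cases "c = 0 \<or> c' = 0") (auto simp: mult.commute)
  have "h (h' n) = E Z 0 k f (E Z' 0 k' f n) + sM c' (E Z 0 k f (Kf k' f n))
      + (sM c (Kf k f (E Z' 0 k' f n)) + sM c (sM c' (Kf k f (Kf k' f n))))"
    unfolding h1(1) h2(1) lin M.scale_right_distrib ..
  also have "\<dots> = E Z' 0 k' f (E Z 0 k f n) + sM c (E Z' 0 k' f (Kf k f n))
      + (sM c' (Kf k' f (E Z 0 k f n)) + sM c' (sM c (Kf k' f (Kf k f n))))"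
    unfolding EE EK KE KK by (simp add: add_ac)
  also have "\<dots> = h' (h n)" unfolding h1(1) h2(1) lin M.scale_right_distrib ..
  finally show ?thesis .
qed

lemma kills_of_square:
  assumes f: "f \<in> Am D" and sq: "kills (f * f)"
  shows "kills f"
proof -
  obtain B n0 where B: "finite B" "N0 \<subseteq> M.span B" and n0: "n0 \<in> N0" "n0 \<noteq> 0" using N0(3,4) by blast
  have "\<exists>n\<in>N0. n \<noteq> 0 \<and> (\<forall>h\<in>top_brackets f. h n = 0)"
  proof (rule M.commuting_nilpotents_common_kernel[OF N0(1) B(2,1) n0])
    fix h assume h: "h \<in> top_brackets f"
    then obtain X Y \<alpha> l0 l l' where r: "h = top_bracket f X Y l0 (l + l')" "X \<in> gspace_wt D l0 l \<alpha>"
      "Y \<in> gspace_wt D (- l0) l' (\<lambda>h. - \<alpha> h)" "\<alpha> \<in> dualH" "\<alpha> \<noteq> zero_wt" "l0 > 0"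
      unfolding top_brackets_def by blast
    have g: "X \<in> gspace D l0 l" "Y \<in> gspace D (- l0) l'" using r by (simp_all add: gspace_wt_eq)
    have Z: "br X Y \<in> gspace D 0 (l + l')" using br_gspace[OF g] by simp
    show "M.endo h" unfolding r(1) M.endo_iff top_bracket_def
      by (auto simp: M.endo_add[OF E_endo[OF Z f]] M.endo_scale[OF E_endo[OF Z f]] M.endo_add[OF Kf_endo]
          M.endo_scale[OF Kf_endo] M.scale_right_distrib mult.commute)
    show "\<exists>r. (h ^^ r) n = 0" if "n \<in> N0" for n
      by (rule top_bracket_nilpotent[OF f sq r(2,3,4,5,6) _ top_brackets_N0[OF f h] that])
        (simp add: r(1) top_bracket_def)
  qed (use top_brackets_N0[OF f] top_brackets_commute[OF f sq] in auto)
  then obtain n1 where n1: "n1 \<in> N0" "n1 \<noteq> 0" "kills_top f n1" using kills_top_of_brackets[OF f] by blast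
  let ?W = "{n \<in> N0. kills_top f n}"
  have zw: "X \<in> gspace D 0 k" if "X \<in> gspace_wt D 0 k zero_wt" for X k using that by (simp add: gspace_wt_eq)
  have "?W = {0} \<or> ?W = N0"
  proof (rule N0_irr)
    show "M.subspace ?W" using N0(1) zw
      by (auto simp: kills_top_def M.subspace_def M.endo_zero[OF E_endo[OF _ f]] M.endo_add[OF E_endo[OF _ f]]
          M.endo_scale[OF E_endo[OF _ f]] M.endo_zero[OF Kf_endo] M.endo_add[OF Kf_endo] M.endo_scale[OF Kf_endo])
    show "e Y 0 l n \<in> ?W" if Y: "Y \<in> gspace_wt D 0 l zero_wt" and n: "n \<in> ?W" for Y l n
    proof -
      have Yg: "Y \<in> gspace D 0 l" by (rule zw[OF Y])
      have "E X 0 k f (e Y 0 l n) = 0" if X: "X \<in> gspace_wt D 0 k zero_wt" for X k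
      proof -
        have "br Y X \<in> gspace_wt D 0 (l + k) zero_wt" using br_gspace_wt[OF Y X] by simp
        then have "E (br Y X) 0 (l + k) f n = 0" using n by (simp add: kills_top_def)
        moreover have "e Y 0 l (E X 0 k f n) = 0" using n X M.endo_zero[OF e_endo[OF Yg]] by (simp add: kills_top_def)
        ultimately show ?thesis using e_E[OF Yg zw[OF X] f, of n] by simp
      qed
      moreover have "Kf \<gamma> f (e Y 0 l n) = 0" if "lat \<gamma>" for \<gamma>
        using e_Kf[OF Yg that f, of n] n that M.endo_zero[OF e_endo[OF Yg]] by (simp add: kills_top_def)
      ultimately show ?thesis using e_N0[OF Y] n by (simp add: kills_top_def)
    qed
    show "cK \<gamma> n \<in> ?W" if g: "lat \<gamma>" and n: "n \<in> ?W" for \<gamma> n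
    proof -
      have "E X 0 k f (cK \<gamma> n) = 0" if X: "X \<in> gspace_wt D 0 k zero_wt" for X k
        using cK_E[OF g zw[OF X] f, of n] n X M.endo_zero[OF cK_endo] by (simp add: kills_top_def)
      moreover have "Kf \<gamma>' f (cK \<gamma> n) = 0" if "lat \<gamma>'" for \<gamma>'
        using cK_Kf[OF g that f, of n] n that M.endo_zero[OF cK_endo] by (simp add: kills_top_def)
      ultimately show ?thesis using cK_N0[OF g] n by (simp add: kills_top_def)
    qed
    show "d n \<in> ?W" if n: "n \<in> ?W" for n
    proof -
      have "E X 0 k f (d n) = 0" if X: "X \<in> gspace_wt D 0 k zero_wt" for X k
        using d_E[OF zw[OF X] f, of n] n X M.endo_zero[OF d_endo] by (simp add: kills_top_def)
      moreover have "Kf \<gamma> f (d n) = 0" if "lat \<gamma>" for \<gamma>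
        using d_Kf[OF that f, of n] n that M.endo_zero[OF d_endo] by (simp add: kills_top_def)
      ultimately show ?thesis using d_N0 n by (simp add: kills_top_def)
    qed
  qed blast
  moreover have "?W \<noteq> {0}" using n1 by blast
  ultimately have "?W = N0" by blast
  then show ?thesis using kills_of_kills_top[OF f] by blast
qed

section \<open>The annihilating polynomials as an ideal\<close>

lemma kills_zero: "kills 0"
  by (simp add: kills_def E_def Kf_def psum_zero)

lemma kills_add: "kills f \<Longrightarrow> kills g \<Longrightarrow> kills (f + g)"
  by (simp add: kills_def E_def Kf_def psum_add)

lemma kills_mult:
  assumes g: "g \<in> Am D" and f: "kills f" shows "kills (g * f)"
  unfolding kills_def
proof (intro ballI conjI allI impI)
  fix v X k0 k assume v: "v \<in> V0" and X: "X \<in> gspace D k0 k"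
  have "E X k0 k (g * f) v = psum g (\<lambda>s. E X k0 (k + s) f v)" by (simp add: E_def psum_mult add.assoc)
  also have "\<dots> = 0" unfolding psum_def
    using f v X by (intro sum.neutral ballI) (simp add: kills_def lat_gspace Am_lat[OF g])
  finally show "E X k0 k (g * f) v = 0" .
next
  fix v \<gamma> assume v: "v \<in> V0" and g': "lat \<gamma>"
  have "Kf \<gamma> (g * f) v = psum g (\<lambda>s. Kf (\<gamma> + s) f v)" by (simp add: Kf_def psum_mult add.assoc)
  also have "\<dots> = 0" unfolding psum_def
  proof (intro sum.neutral ballI)
    fix s assume "s \<in> Poly_Mapping.keys g"
    then have "lat (\<gamma> + s)" by (intro lat_add g' Am_lat[OF g])
    then show "sM (Poly_Mapping.lookup g s) (Kf (\<gamma> + s) f v) = 0" using f v by (simp add: kills_def)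
  qed
  finally show "Kf \<gamma> (g * f) v = 0" .
qed

text \<open>The exponent m is enlarged to 2^m, which is then halved repeatedly by
  \<open>kills_of_square\<close>.\<close>

lemma kills_of_power:
  assumes f: "f \<in> Am D" and p: "kills (f ^ m)"
  shows "kills f"
proof -
  have "kills (f ^ (2 ^ j)) \<Longrightarrow> kills f" for j
  proof (induction j)
    case (Suc j)
    have "f ^ (2 ^ Suc j) = f ^ (2 ^ j) * f ^ (2 ^ j)" by (simp add: mult_2 power_add)
    then have "kills (f ^ (2 ^ j))" using kills_of_square[OF Am_power[OF f]] Suc.prems by simp
    then show ?case by (rule Suc.IH)
  qed simp
  moreover have "kills (f ^ (2 ^ m))"
  proof -
    have "m \<le> 2 ^ m" by (simp add: less_imp_le)
    then have "f ^ (2 ^ m) = f ^ (2 ^ m - m) * f ^ m" by (simp flip: power_add)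
    then show ?thesis using kills_mult[OF Am_power[OF f] p] by simp
  qed
  ultimately show ?thesis by blast
qed

lemma laurent_prod_Am: "laurent_prod D i q a b \<in> Am D"
  unfolding laurent_prod_def
  by (intro Am_prod Am_power Am_diff Am_single) (auto simp: axis_def)

lemma radical_kills:
  assumes top: "\<And>n. n \<in> N0 \<Longrightarrow> kills_top (laurent_prod D i q a b) n"
  shows "kills (laurent_prod D i q a (\<lambda>_. 1))"
proof -
  let ?P = "laurent_prod D i q a (\<lambda>_. 1)"
  \<comment> \<open>A common bound of the multiplicities, needed so that the power of the reduced
    polynomial is divisible by the given one.\<close>
  let ?m = "\<Sum>j\<in>{1..q}. b j"
  let ?c = "\<lambda>j. ?m - b j"
  have le: "b j \<le> ?m" if "j \<in> {1..q}" for j using that by (intro member_le_sum) auto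
  have "?P ^ ?m = laurent_prod D i q a ?c * laurent_prod D i q a b"
    unfolding laurent_prod_def prod.distrib[symmetric] prod_power_distrib
    using le by (intro prod.cong refl) (simp flip: power_add)
  moreover have "kills (laurent_prod D i q a b)" by (rule kills_of_kills_top[OF laurent_prod_Am top])
  ultimately have "kills (?P ^ ?m)" using kills_mult[OF laurent_prod_Am] by simp
  then show ?thesis by (rule kills_of_power[OF laurent_prod_Am])
qed

lemma ideal_kills:
  assumes "\<And>f. f \<in> F \<Longrightarrow> f \<in> Am D \<and> kills f" and f: "f \<in> ideal_generated (Am D) F"
  shows "f \<in> Am D" "kills f"
proof -
  have "ideal_of (Am D) {f \<in> Am D. kills f}"
    unfolding ideal_of_def
    by (auto simp: Am_zero kills_zero intro: Am_add Am_mult kills_add kills_mult)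
  then have "f \<in> {f \<in> Am D. kills f}" using assms unfolding ideal_generated_def by blast
  then show "f \<in> Am D" "kills f" by auto
qed

end

section \<open>Quotient modules as subspaces\<close>

lemma lookup_pscale: "s c 0 = 0 \<Longrightarrow> Poly_Mapping.lookup (pscale s c f) k = s c (Poly_Mapping.lookup f k)"
  by (simp add: pscale_def Poly_Mapping.map.rep_eq when_def)

lemma vector_space_pscale:
  assumes "vector_space (s :: complex \<Rightarrow> 'b::ab_group_add \<Rightarrow> 'b)"
  shows "vector_space (pscale s :: complex \<Rightarrow> ('a \<Rightarrow>\<^sub>0 'b) \<Rightarrow> _)"
proof -
  interpret vector_space s by (rule assms)
  show ?thesis
    by unfold_locales (auto intro!: poly_mapping_eqI simp: lookup_pscale lookup_add
        scale_right_distrib scale_left_distrib)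
qed

lemma vector_space_complex: "vector_space ((*) :: complex \<Rightarrow> complex \<Rightarrow> complex)"
  by unfold_locales (auto simp: algebra_simps)

interpretation free_vs: complex_vector_space "pscale (*)"
  by (simp add: complex_vector_space_def vector_space_pscale[OF vector_space_complex])

lemma pscale_single: "pscale (*) c (Poly_Mapping.single k d) = Poly_Mapping.single k (c * d)"
  by (rule poly_mapping_eqI) (simp add: lookup_pscale lookup_single when_def)

context complex_vector_space
begin

lemma subspace_projection:
  assumes "subspace W"
  obtains P where "endo P" "\<And>w. w \<in> W \<Longrightarrow> P w = w" "\<And>v. P v \<in> W"
proof -
  interpret vp: vector_space_pair scale scale by unfold_locales
  have "endo (\<lambda>x. x)" by (simp add: endo_iff)
  from vp.linear_exists_left_inverse_on[OF this assms] show thesis using that by (auto simp: inj_on_def)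
qed

text \<open>\<open>M\<close> is a quotient of the subspace \<open>F0\<close>, on which \<open>L\<close> acts linearly (not necessarily as a Lie algebra).\<close>

definition mod_cover :: "'b set \<Rightarrow> ('l \<Rightarrow> 'b \<Rightarrow> 'b) \<Rightarrow> 'l set \<Rightarrow> ('l, 'v) lie_mod \<Rightarrow> ('b \<Rightarrow> 'v) \<Rightarrow> bool" where
  "mod_cover F0 act L M \<pi> \<longleftrightarrow> subspace F0 \<and> (\<forall>l\<in>L. endo (act l) \<and> (\<forall>f\<in>F0. act l f \<in> F0)) \<and> \<pi> ` F0 = mcar M \<and>
     (\<forall>f\<in>F0. \<forall>g\<in>F0. \<pi> (f + g) = madd M (\<pi> f) (\<pi> g)) \<and> (\<forall>c. \<forall>f\<in>F0. \<pi> (scale c f) = mscale M c (\<pi> f)) \<and>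
     \<pi> 0 = mzero M \<and> (\<forall>l\<in>L. \<forall>f\<in>F0. \<pi> (act l f) = mact M l (\<pi> f))"

text \<open>Elements of a quotient module are sets, possibly of sets, so computations are carried
  out on representatives in \<open>F0\<close>. It is applied twice: to the tensor relations, and
  then to the submodule whose quotient is irreducible.\<close>

lemma quotient_cover:
  assumes c: "mod_cover F0 act L M \<pi>" and S: "submodule L M S"
  defines "R \<equiv> {r \<in> F0. \<pi> r \<in> S}"
  defines "q \<equiv> \<lambda>f. (\<lambda>r. \<pi> (f + r)) ` R"
  shows "mod_cover F0 act L (quotient_module M S) q"
    and "f \<in> F0 \<Longrightarrow> q f = mzero (quotient_module M S) \<longleftrightarrow> \<pi> f \<in> S"
proof -
  have F0: "subspace F0" and img: "\<pi> ` F0 = mcar M" and p0: "\<pi> 0 = mzero M"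
    and act: "\<And>l. l \<in> L \<Longrightarrow> endo (act l)" "\<And>l f. l \<in> L \<Longrightarrow> f \<in> F0 \<Longrightarrow> act l f \<in> F0"
    and padd: "\<And>f g. f \<in> F0 \<Longrightarrow> g \<in> F0 \<Longrightarrow> madd M (\<pi> f) (\<pi> g) = \<pi> (f + g)"
    and pscl: "\<And>c f. f \<in> F0 \<Longrightarrow> mscale M c (\<pi> f) = \<pi> (scale c f)"
    and pact: "\<And>l f. l \<in> L \<Longrightarrow> f \<in> F0 \<Longrightarrow> mact M l (\<pi> f) = \<pi> (act l f)"
    using c by (auto simp: mod_cover_def)
  have SR: "S = \<pi> ` R" using S img by (auto simp: R_def submodule_def msubspace_def)
  have S0: "mzero M \<in> S" and Sadd: "\<And>u v. u \<in> S \<Longrightarrow> v \<in> S \<Longrightarrow> madd M u v \<in> S"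
    and Sscl: "\<And>c v. v \<in> S \<Longrightarrow> mscale M c v \<in> S" and Sact: "\<And>l v. l \<in> L \<Longrightarrow> v \<in> S \<Longrightarrow> mact M l v \<in> S"
    using S by (auto simp: submodule_def msubspace_def)
  have RF: "R \<subseteq> F0" by (auto simp: R_def)
  have sR: "subspace R"
  proof (rule subspaceI)
    show "0 \<in> R" using S0 p0 subspace_0[OF F0] by (simp add: R_def)
    show "x + y \<in> R" if "x \<in> R" "y \<in> R" for x y
      using that Sadd[of "\<pi> x" "\<pi> y"] padd[of x y] subspace_add[OF F0] by (simp add: R_def)
    show "scale c x \<in> R" if "x \<in> R" for c x
      using that Sscl[of "\<pi> x" c] pscl[of x c] subspace_scale[OF F0] by (simp add: R_def)
  qed
  have Ract: "act l r \<in> R" if "l \<in> L" "r \<in> R" for l r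
    using that Sact[of l "\<pi> r"] pact[of l r] act(2) by (simp add: R_def)
  have q_in: "x \<in> q f \<longleftrightarrow> (\<exists>r\<in>R. x = \<pi> (f + r))" for x f by (auto simp: q_def)
  have qI: "\<pi> g \<in> q f" if "g - f \<in> R" for f g
    unfolding q_in using that by (intro bexI[of _ "g - f"]) simp_all
  have F: "f + r \<in> F0" if "f \<in> F0" "r \<in> R" for f r using that RF subspace_add[OF F0] by blast
  have q_coset: "{madd M (\<pi> f) s | s. s \<in> S} = q f" if f: "f \<in> F0" for f
  proof -
    have "madd M (\<pi> f) (\<pi> r) = \<pi> (f + r)" if "r \<in> R" for r using padd[OF f] that RF by blast
    then show ?thesis unfolding q_def SR by (auto simp: image_iff) metis+
  qed
  have coset: "{madd M (\<pi> g) s | s. s \<in> S} = q g" if "g \<in> F0" for g by (rule q_coset[OF that])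
  have car: "q ` F0 = mcar (quotient_module M S)"
    unfolding quotient_module_def using q_coset by (auto simp: img[symmetric] image_image image_iff)
  have qadd: "q (f + g) = madd (quotient_module M S) (q f) (q g)" if fg: "f \<in> F0" "g \<in> F0" for f g
  proof (rule set_eqI)
    fix x
    have "x \<in> madd (quotient_module M S) (q f) (q g) \<longleftrightarrow> (\<exists>r\<in>R. \<exists>r'\<in>R. x = madd M (\<pi> (f + r)) (\<pi> (g + r')))"
      by (auto simp: quotient_module_def q_in)
    also have "\<dots> \<longleftrightarrow> (\<exists>r\<in>R. \<exists>r'\<in>R. x = \<pi> (f + g + (r + r')))"
    proof (intro bex_cong refl)
      fix r r' assume r: "r \<in> R" "r' \<in> R"
      have e: "f + r + (g + r') = f + g + (r + r')" by (simp add: add_ac)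
      show "(x = madd M (\<pi> (f + r)) (\<pi> (g + r'))) = (x = \<pi> (f + g + (r + r')))"
        unfolding padd[OF F[OF fg(1) r(1)] F[OF fg(2) r(2)]] e ..
    qed
    also have "\<dots> \<longleftrightarrow> x \<in> q (f + g)"
      unfolding q_in using subspace_add[OF sR] subspace_0[OF sR] by (metis add.right_neutral)
    finally show "x \<in> q (f + g) \<longleftrightarrow> x \<in> madd (quotient_module M S) (q f) (q g)" by blast
  qed
  have qscl: "q (scale k f) = mscale (quotient_module M S) k (q f)" if f: "f \<in> F0" for k f
  proof (rule set_eqI)
    fix x
    have kf: "scale k (f + r) \<in> F0" if "r \<in> R" for r using F[OF f that] subspace_scale[OF F0] by blast
    have "x \<in> mscale (quotient_module M S) k (q f) \<longleftrightarrow> (\<exists>r\<in>R. \<exists>r'\<in>R. x = madd M (mscale M k (\<pi> (f + r))) (\<pi> r'))"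
      by (auto simp: quotient_module_def q_in SR)
    also have "\<dots> \<longleftrightarrow> (\<exists>r\<in>R. \<exists>r'\<in>R. x = \<pi> (scale k f + (scale k r + r')))"
    proof (intro bex_cong refl)
      fix r r' assume r: "r \<in> R" "r' \<in> R"
      have e: "scale k (f + r) + r' = scale k f + (scale k r + r')" by (simp add: scale_right_distrib add_ac)
      have "r' \<in> F0" using r(2) RF by blast
      show "(x = madd M (mscale M k (\<pi> (f + r))) (\<pi> r')) = (x = \<pi> (scale k f + (scale k r + r')))"
        unfolding pscl[OF F[OF f r(1)]] padd[OF kf[OF r(1)] \<open>r' \<in> F0\<close>] e ..
    qed
    also have "\<dots> \<longleftrightarrow> x \<in> q (scale k f)"
      unfolding q_in using subspace_add[OF sR] subspace_scale[OF sR] subspace_0[OF sR]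
      by (metis add.left_neutral scale_zero_right)
    finally show "x \<in> q (scale k f) \<longleftrightarrow> x \<in> mscale (quotient_module M S) k (q f)" by blast
  qed
  have qact: "q (act l f) = mact (quotient_module M S) l (q f)" if l: "l \<in> L" and f: "f \<in> F0" for l f
  proof (rule set_eqI)
    fix x
    have lf: "act l (f + r) \<in> F0" if "r \<in> R" for r using F[OF f that] act(2)[OF l] by blast
    have "x \<in> mact (quotient_module M S) l (q f) \<longleftrightarrow> (\<exists>r\<in>R. \<exists>r'\<in>R. x = madd M (mact M l (\<pi> (f + r))) (\<pi> r'))"
      by (auto simp: quotient_module_def q_in SR)
    also have "\<dots> \<longleftrightarrow> (\<exists>r\<in>R. \<exists>r'\<in>R. x = \<pi> (act l f + (act l r + r')))"
    proof (intro bex_cong refl)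
      fix r r' assume r: "r \<in> R" "r' \<in> R"
      have e: "act l (f + r) + r' = act l f + (act l r + r')" by (simp add: endo_add[OF act(1)[OF l]] add_ac)
      have "r' \<in> F0" using r(2) RF by blast
      show "(x = madd M (mact M l (\<pi> (f + r))) (\<pi> r')) = (x = \<pi> (act l f + (act l r + r')))"
        unfolding pact[OF l F[OF f r(1)]] padd[OF lf[OF r(1)] \<open>r' \<in> F0\<close>] e ..
    qed
    also have "\<dots> \<longleftrightarrow> x \<in> q (act l f)"
      unfolding q_in using subspace_add[OF sR] Ract[OF l] subspace_0[OF sR]
      by (metis add.left_neutral endo_zero[OF act(1)[OF l]])
    finally show "x \<in> q (act l f) \<longleftrightarrow> x \<in> mact (quotient_module M S) l (q f)" by blast
  qed
  have q0: "q 0 = mzero (quotient_module M S)" by (simp add: quotient_module_def q_def SR)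
  show "mod_cover F0 act L (quotient_module M S) q"
    unfolding mod_cover_def by (simp add: F0 act car qadd qscl q0 qact)
  assume f: "f \<in> F0"
  show "q f = mzero (quotient_module M S) \<longleftrightarrow> \<pi> f \<in> S"
  proof
    assume "q f = mzero (quotient_module M S)"
    moreover have "\<pi> f \<in> q f" using qI[of f f] subspace_0[OF sR] by simp
    ultimately show "\<pi> f \<in> S" by (simp add: quotient_module_def)
  next
    assume "\<pi> f \<in> S"
    then have fR: "f \<in> R" using f by (simp add: R_def)
    have "q f = q 0"
    proof (intro set_eqI iffI)
      fix x assume "x \<in> q f"
      then obtain r where "r \<in> R" "x = \<pi> (f + r)" unfolding q_in by blast
      then show "x \<in> q 0" using subspace_add[OF sR fR] qI[of "f + r" 0] by simp
    next
      fix x assume "x \<in> q 0"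
      then obtain r where "r \<in> R" "x = \<pi> r" unfolding q_in by auto
      then show "x \<in> q f" using subspace_diff[OF sR _ fR] qI[of r f] by simp
    qed
    then show "q f = mzero (quotient_module M S)" using q0 by simp
  qed
qed

end

section \<open>The induced module\<close>

text \<open>Words form a monoid under concatenation, so that the product of the free algebra is the
  convolution product of the library.\<close>

instantiation list :: (type) monoid_add
begin
definition plus_list :: "'a list \<Rightarrow> 'a list \<Rightarrow> 'a list" where "plus_list = (@)"
definition zero_list :: "'a list" where "zero_list = []"
instance by standard (auto simp: plus_list_def zero_list_def)
end

lemma fmul_eq: "fmul a b = a * b"
proof -
  have "a * b = (\<Sum>u\<in>Poly_Mapping.keys a. Poly_Mapping.single u (Poly_Mapping.lookup a u)) *
      (\<Sum>v\<in>Poly_Mapping.keys b. Poly_Mapping.single v (Poly_Mapping.lookup b v))"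
    by (rule arg_cong2[where f = "(*)", OF poly_mapping_sum_single poly_mapping_sum_single])
  also have "\<dots> = fmul a b" by (simp add: sum_product mult_single fmul_def plus_list_def)
  finally show ?thesis by simp
qed

text \<open>The linear extension of a map between bases. Left multiplication by a word and the
  action on pairs are both of this form.\<close>

definition push :: "('a \<Rightarrow> 'b) \<Rightarrow> ('a \<Rightarrow>\<^sub>0 complex) \<Rightarrow> ('b \<Rightarrow>\<^sub>0 complex)" where
  "push g f = (\<Sum>p\<in>Poly_Mapping.keys f. Poly_Mapping.single (g p) (Poly_Mapping.lookup f p))"

lemma push_superset: "finite A \<Longrightarrow> Poly_Mapping.keys f \<subseteq> A \<Longrightarrow>
    push g f = (\<Sum>p\<in>A. Poly_Mapping.single (g p) (Poly_Mapping.lookup f p))"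
  unfolding push_def
proof (rule sum.mono_neutral_left)
  show "\<forall>i\<in>A - Poly_Mapping.keys f. Poly_Mapping.single (g i) (Poly_Mapping.lookup f i) = 0"
  proof
    fix i assume "i \<in> A - Poly_Mapping.keys f"
    then have "Poly_Mapping.lookup f i = 0" using in_keys_iff[of i f] by blast
    then show "Poly_Mapping.single (g i) (Poly_Mapping.lookup f i) = 0" by simp
  qed
qed

lemma push_endo: "free_vs.endo (push g)"
  unfolding free_vs.endo_iff
proof (intro conjI allI)
  fix f h :: "'a \<Rightarrow>\<^sub>0 complex" and c
  let ?A = "Poly_Mapping.keys f \<union> Poly_Mapping.keys h"
  have "push g (f + h) = (\<Sum>p\<in>?A. Poly_Mapping.single (g p) (Poly_Mapping.lookup (f + h) p))"
    by (rule push_superset[OF _ keys_add]) simp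
  also have "\<dots> = push g f + push g h"
    by (simp add: lookup_add single_add sum.distrib push_superset[of ?A f] push_superset[of ?A h])
  finally show "push g (f + h) = push g f + push g h" .
  have "Poly_Mapping.keys (pscale (*) c f) \<subseteq> Poly_Mapping.keys f" by (auto simp: in_keys_iff lookup_pscale)
  then have "push g (pscale (*) c f) = (\<Sum>p\<in>Poly_Mapping.keys f. Poly_Mapping.single (g p) (Poly_Mapping.lookup (pscale (*) c f) p))"
    by (intro push_superset) auto
  also have "\<dots> = pscale (*) c (push g f)"
    unfolding push_def free_vs.scale_sum_right by (simp add: lookup_pscale pscale_single)
  finally show "push g (pscale (*) c f) = pscale (*) c (push g f)" .
qed

lemma push_single: "push g (Poly_Mapping.single p c) = Poly_Mapping.single (g p) c"
  by (simp add: push_def)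

lemma mult_pscale: "word v * pscale (*) c a = pscale (*) c (word v * (a :: 'l free_alg))"
proof -
  have "free_vs.endo (\<lambda>a. word v * (a :: 'l free_alg))"
  proof -
    have "push ((@) v) a = word v * a" for a :: "'l free_alg"
    proof -
      have "word v * a = word v * (\<Sum>k\<in>Poly_Mapping.keys a. Poly_Mapping.single k (Poly_Mapping.lookup a k))"
        by (rule arg_cong[OF poly_mapping_sum_single])
      then show ?thesis by (simp add: push_def sum_distrib_left mult_single plus_list_def)
    qed
    then have "push ((@) v) = (\<lambda>a. word v * (a :: 'l free_alg))" by (rule ext)
    then show ?thesis using push_endo[of "(@) v"] by simp
  qed
  then show ?thesis by (rule free_vs.endo_scale)
qed

lemma single_in_span: "p \<in> S \<Longrightarrow> Poly_Mapping.single p (c::complex) \<in> free_vs.span {Poly_Mapping.single p 1 | p. p \<in> S}"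
proof -
  assume "p \<in> S"
  then have "pscale (*) c (Poly_Mapping.single p 1) \<in> free_vs.span {Poly_Mapping.single p 1 | p. p \<in> S}"
    by (intro free_vs.span_scale free_vs.span_base) blast
  then show ?thesis by (simp add: pscale_single)
qed

lemma keys_span: "Poly_Mapping.keys (f :: _ \<Rightarrow>\<^sub>0 complex) \<subseteq> S \<Longrightarrow> f \<in> free_vs.span {Poly_Mapping.single p 1 | p. p \<in> S}"
  by (subst poly_mapping_sum_single) (intro free_vs.span_sum single_in_span, blast)

lemma keys_subspace: "free_vs.subspace {f. Poly_Mapping.keys f \<subseteq> S}"
proof (rule free_vs.subspaceI)
  show "f + g \<in> {f. Poly_Mapping.keys f \<subseteq> S}" if "f \<in> {f. Poly_Mapping.keys f \<subseteq> S}" "g \<in> {f. Poly_Mapping.keys f \<subseteq> S}" for f g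
    using that keys_add[of f g] by auto
  show "pscale (*) c f \<in> {f. Poly_Mapping.keys f \<subseteq> S}" if "f \<in> {f. Poly_Mapping.keys f \<subseteq> S}" for c and f :: "'a \<Rightarrow>\<^sub>0 complex"
    using that by (auto simp: in_keys_iff lookup_pscale subset_iff)
qed simp

text \<open>When \<open>L\<close> is not closed under the bracket, no ideal of the free algebra on \<open>L\<close> contains the relations;
  the enveloping algebra degenerates, and with it the induced module.\<close>

lemma induced_module_degenerate:
  assumes xy: "x \<in> L" "y \<in> L" "br x y \<notin> L"
  shows "\<not> irreducible_quotient L (induced_module sc br L B N) V"
proof
  assume "irreducible_quotient L (induced_module sc br L B N) V"
  then obtain S where S: "submodule L (induced_module sc br L B N) S"
    "V = quotient_module (induced_module sc br L B N) S" "irreducible_module L V"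
    by (auto simp: irreducible_quotient_def)
  have "\<not> (free_alg_ideal L J \<and> env_relations sc br L \<subseteq> J)" for J
  proof
    assume J: "free_alg_ideal L J \<and> env_relations sc br L \<subseteq> J"
    let ?r = "word [x, y] - word [y, x] - word [br x y]"
    have "?r \<in> free_alg L" using J xy unfolding free_alg_ideal_def env_relations_def by blast
    moreover have "[br x y] \<in> Poly_Mapping.keys ?r"
      by (simp add: in_keys_iff lookup_minus lookup_single when_def)
    ultimately show False using xy(3) by (auto simp: free_alg_def)
  qed
  \<comment> \<open>The intersection of an empty family of ideals is everything, so there is only
    one class.\<close>
  then have J: "env_ideal sc br L = UNIV" unfolding env_ideal_def by blast
  have cls: "env_class sc br L a = UNIV" for a
  proof -
    have "b \<in> env_class sc br L a" for b
      unfolding env_class_def J by (intro CollectI exI[of _ "b - a"]) simp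
    then show ?thesis by blast
  qed
  have "free_alg L \<noteq> {}" by (auto simp: free_alg_def intro: exI[of _ 0])
  then have alg: "env_alg sc br L = {UNIV}" unfolding env_alg_def using cls by auto
  have add: "env_add UNIV UNIV = (UNIV :: 'a free_alg set)"
  proof -
    have "b \<in> env_add UNIV UNIV" for b :: "'a free_alg"
      unfolding env_add_def by (intro CollectI exI[of _ b] exI[of _ 0]) simp
    then show ?thesis by blast
  qed
  define R where "R = free_vs.span (tensor_relations sc br L B N)"
  let ?F = "{f :: ('a, 'b) tensor_free. Poly_Mapping.keys f \<subseteq> env_alg sc br L \<times> mcar N}"
  \<comment> \<open>The single class is its own double, so additivity in the first factor makes each
    pair vanish modulo the relations.\<close>
  have "pair UNIV n \<in> R" if n: "n \<in> mcar N" for n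
  proof -
    have "pair (env_add UNIV UNIV) n - pair UNIV n - pair UNIV n \<in> tensor_relations sc br L B N"
      unfolding tensor_relations_def alg using n by blast
    then have "- pair UNIV n \<in> R" unfolding add R_def by (auto intro: free_vs.span_base)
    then show ?thesis using free_vs.span_neg[of "- pair UNIV n"] by (simp add: R_def)
  qed
  then have "{Poly_Mapping.single p 1 | p. p \<in> env_alg sc br L \<times> mcar N} \<subseteq> R" unfolding alg by auto
  then have "free_vs.span {Poly_Mapping.single p 1 | p. p \<in> env_alg sc br L \<times> mcar N} \<subseteq> R"
    unfolding R_def by (rule free_vs.span_minimal[OF _ free_vs.subspace_span])
  then have FR: "?F \<subseteq> R" using keys_span by blast
  have sR: "free_vs.subspace R" unfolding R_def by (rule free_vs.subspace_span)
  have co: "{f + s | s. s \<in> R} = R" if f: "f \<in> R" for f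
  proof -
    have "r \<in> {f + s | s. s \<in> R}" if "r \<in> R" for r
      using free_vs.subspace_diff[OF sR that f] by (intro CollectI exI[of _ "r - f"]) simp
    then show ?thesis using free_vs.subspace_add[OF sR f] by blast
  qed
  have Mcar: "mcar (induced_module sc br L B N) = {R}"
  proof -
    have "0 \<in> ?F" by simp
    then have "(\<lambda>v. {v + s | s. s \<in> R}) ` ?F = {R}" using co FR by blast
    then show ?thesis by (simp add: induced_module_def quotient_module_def tensor_free_module_def R_def)
  qed
  have Mz: "mzero (induced_module sc br L B N) = R" by (simp add: induced_module_def quotient_module_def R_def)
  have "S = {R}" using S(1) Mcar Mz by (auto simp: submodule_def msubspace_def)
  moreover have "madd (induced_module sc br L B N) R R = R"
  proof -
    have "{a + b | a b. a \<in> R \<and> b \<in> R} = R"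
      using free_vs.subspace_add[OF sR] free_vs.subspace_0[OF sR] by (auto, metis add.right_neutral)
    then show ?thesis by (simp add: induced_module_def quotient_module_def tensor_free_module_def)
  qed
  ultimately have "mcar V = {mzero V}"
    unfolding S(2) by (subst (1 2) quotient_module_def) (simp add: Mcar)
  then show False using S(3) by (simp add: irreducible_module_def)
qed

locale induced_setup =
  fixes sc :: "complex \<Rightarrow> 'l::ab_group_add \<Rightarrow> 'l" and br :: "'l \<Rightarrow> 'l \<Rightarrow> 'l" and L B :: "'l set"
    and N :: "('l, 'w) lie_mod"
  assumes L_add: "x \<in> L \<Longrightarrow> y \<in> L \<Longrightarrow> x + y \<in> L" and L_scale: "x \<in> L \<Longrightarrow> sc c x \<in> L"
    and L_br: "x \<in> L \<Longrightarrow> y \<in> L \<Longrightarrow> br x y \<in> L" and B_sub: "B \<subseteq> L"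
    and N_space: "complex_space N" and B_N: "b \<in> B \<Longrightarrow> n \<in> mcar N \<Longrightarrow> mact N b n \<in> mcar N"
begin

section \<open>Classes in the enveloping algebra\<close>

abbreviation FA :: "'l free_alg set" where "FA \<equiv> free_alg L"
abbreviation J :: "'l free_alg set" where "J \<equiv> env_ideal sc br L"
abbreviation cls :: "'l free_alg \<Rightarrow> 'l free_alg set" where "cls \<equiv> env_class sc br L"
abbreviation U :: "'l free_alg set set" where "U \<equiv> env_alg sc br L"

lemma FA_eq: "FA = {a. Poly_Mapping.keys a \<subseteq> {w. set w \<subseteq> L}}" by (auto simp: free_alg_def)

lemma FA_subspace: "free_vs.subspace FA" unfolding FA_eq by (rule keys_subspace)

lemma FA_word: "set w \<subseteq> L \<Longrightarrow> word w \<in> FA" by (simp add: free_alg_def)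

lemma FA_mult: "a \<in> FA \<Longrightarrow> b \<in> FA \<Longrightarrow> a * b \<in> FA"
  using keys_mult[of a b] by (fastforce simp: free_alg_def plus_list_def)

lemma J_ideal: "free_alg_ideal L J" and J_relations: "env_relations sc br L \<subseteq> J"
proof -
  note sub = free_vs.subspace_diff[OF FA_subspace]
  have rel: "env_relations sc br L \<subseteq> FA"
    unfolding env_relations_def
    by (auto intro!: sub free_vs.subspace_scale[OF FA_subspace] FA_word simp: L_add L_scale L_br)
  have FAi: "free_alg_ideal L FA" using FA_subspace FA_mult by (auto simp: free_alg_ideal_def fmul_eq)
  show "env_relations sc br L \<subseteq> J" unfolding env_ideal_def by blast
  have "J \<subseteq> FA" unfolding env_ideal_def using FAi rel by blast
  moreover have "free_vs.subspace J" unfolding env_ideal_def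
    by (rule free_vs.subspace_Inter) (auto simp: free_alg_ideal_def)
  moreover have "fmul a j \<in> J \<and> fmul j a \<in> J" if "a \<in> FA" "j \<in> J" for a j
    using that unfolding env_ideal_def by (auto simp: free_alg_ideal_def)
  ultimately show "free_alg_ideal L J" by (simp add: free_alg_ideal_def)
qed

lemma J_subspace: "free_vs.subspace J" and J_FA: "J \<subseteq> FA"
  and J_mult: "a \<in> FA \<Longrightarrow> j \<in> J \<Longrightarrow> a * j \<in> J" "a \<in> FA \<Longrightarrow> j \<in> J \<Longrightarrow> j * a \<in> J"
  using J_ideal by (auto simp: free_alg_ideal_def fmul_eq)

lemmas J_add = free_vs.subspace_add[OF J_subspace] and J_zero = free_vs.subspace_0[OF J_subspace]
  and J_diff = free_vs.subspace_diff[OF J_subspace] and J_scale = free_vs.subspace_scale[OF J_subspace]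

lemma in_cls: "x \<in> cls a \<longleftrightarrow> x - a \<in> J"
proof
  assume "x - a \<in> J"
  then show "x \<in> cls a" unfolding env_class_def by (intro CollectI exI[of _ "x - a"]) simp
qed (auto simp: env_class_def)

lemma cls_eqI: "a - b \<in> J \<Longrightarrow> cls a = cls b"
proof (intro set_eqI)
  fix x assume ab: "a - b \<in> J"
  have "x - b \<in> J \<longleftrightarrow> x - a \<in> J" using J_add[OF ab, of "x - a"] J_diff[OF _ ab, of "x - b"] by auto
  then show "x \<in> cls a \<longleftrightarrow> x \<in> cls b" by (simp add: in_cls)
qed

lemma U_E: "u \<in> U \<Longrightarrow> (\<And>a. a \<in> FA \<Longrightarrow> u = cls a \<Longrightarrow> thesis) \<Longrightarrow> thesis" and cls_U: "a \<in> FA \<Longrightarrow> cls a \<in> U"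
  by (auto simp: env_alg_def)

lemma env_add_cls: "env_add (cls a) (cls b) = cls (a + b)"
proof (intro set_eqI iffI)
  fix x assume "x \<in> env_add (cls a) (cls b)"
  then obtain u v where "x = u + v" "u - a \<in> J" "v - b \<in> J" by (auto simp: env_add_def in_cls)
  then show "x \<in> cls (a + b)" using J_add[of "u - a" "v - b"] by (simp add: in_cls algebra_simps)
next
  fix x assume "x \<in> cls (a + b)"
  then have "x - b \<in> cls a" "b \<in> cls b" using J_zero by (auto simp: in_cls algebra_simps)
  then show "x \<in> env_add (cls a) (cls b)" unfolding env_add_def by (intro CollectI exI[of _ "x - b"] exI[of _ b]) simp
qed

lemma env_scale_cls: "env_scale sc br L c (cls a) = cls (pscale (*) c a)"
proof (intro set_eqI iffI)
  fix x assume "x \<in> env_scale sc br L c (cls a)"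
  then obtain u j where u: "x = pscale (*) c u + j" "u - a \<in> J" "j \<in> J" by (auto simp: env_scale_def in_cls)
  then have "pscale (*) c (u - a) + j \<in> J" by (intro J_add J_scale)
  then show "x \<in> cls (pscale (*) c a)" unfolding in_cls u(1) free_vs.scale_right_diff_distrib by (simp add: algebra_simps)
next
  fix x assume "x \<in> cls (pscale (*) c a)"
  then have "x - pscale (*) c a \<in> J" "a \<in> cls a" using J_zero by (auto simp: in_cls)
  then show "x \<in> env_scale sc br L c (cls a)"
    unfolding env_scale_def by (intro CollectI exI[of _ a] exI[of _ "x - pscale (*) c a"]) simp
qed

lemma env_mul_cls: assumes "a \<in> FA" "b \<in> FA" shows "env_mul sc br L (cls a) (cls b) = cls (a * b)"
proof (intro set_eqI iffI)
  fix x assume "x \<in> env_mul sc br L (cls a) (cls b)"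
  then obtain u v j where u: "x = u * v + j" "u - a \<in> J" "v - b \<in> J" "j \<in> J"
    by (auto simp: env_mul_def in_cls fmul_eq)
  have "v \<in> FA" using free_vs.subspace_add[OF FA_subspace, of "v - b" b] J_FA u(3) assms(2) by auto
  then have "(u - a) * v + a * (v - b) + j \<in> J" using u assms by (intro J_add J_mult)
  then show "x \<in> cls (a * b)" unfolding in_cls u(1) by (simp add: algebra_simps)
next
  fix x assume "x \<in> cls (a * b)"
  then show "x \<in> env_mul sc br L (cls a) (cls b)"
    unfolding env_mul_def using J_zero
    by (intro CollectI exI[of _ a] exI[of _ b] exI[of _ "x - a * b"]) (auto simp: in_cls fmul_eq)
qed

section \<open>The action on the free space of pairs\<close>

abbreviation TF :: "('l, ('l, 'w) tensor_free) lie_mod" where "TF \<equiv> tensor_free_module sc br L N"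
abbreviation F0 :: "('l, 'w) tensor_free set" where "F0 \<equiv> {f. Poly_Mapping.keys f \<subseteq> U \<times> mcar N}"
abbreviation Rel :: "('l, 'w) tensor_free set" where "Rel \<equiv> free_vs.span (tensor_relations sc br L B N)"

definition act :: "'l \<Rightarrow> ('l, 'w) tensor_free \<Rightarrow> ('l, 'w) tensor_free" where
  "act x = push (\<lambda>(u, n). (env_mul sc br L (cls (word [x])) u, n))"

lemma TF_act: "mact TF x f = act x f"
  by (simp add: tensor_free_module_def act_def push_def case_prod_beta)

lemma act_endo: "free_vs.endo (act x)" unfolding act_def by (rule push_endo)

lemma act_pair: "act x (pair u n) = pair (env_mul sc br L (cls (word [x])) u) n"
  by (simp add: act_def push_single)

lemma act_pair_cls: "x \<in> L \<Longrightarrow> a \<in> FA \<Longrightarrow> act x (pair (cls a) n) = pair (cls (word [x] * a)) n"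
  by (simp add: act_pair env_mul_cls FA_word)

abbreviation pairs :: "('l, 'w) tensor_free set" where "pairs \<equiv> {Poly_Mapping.single p 1 | p. p \<in> U \<times> mcar N}"

lemma F0_span: "f \<in> F0 \<Longrightarrow> f \<in> free_vs.span pairs" using keys_span by blast

lemma F0_subspace: "free_vs.subspace F0" by (rule keys_subspace)

lemma pair_F0: "a \<in> FA \<Longrightarrow> n \<in> mcar N \<Longrightarrow> pair (cls a) n \<in> F0" by (simp add: cls_U)

lemma F0_induct:
  assumes f: "f \<in> F0" and T: "free_vs.endo T" and W: "free_vs.subspace W"
    and p: "\<And>a n. a \<in> FA \<Longrightarrow> n \<in> mcar N \<Longrightarrow> T (pair (cls a) n) \<in> W"
  shows "T f \<in> W"
proof (rule free_vs.endo_span[OF T W _ F0_span[OF f]])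
  fix x assume "x \<in> pairs"
  then obtain u n where "x = pair u n" "u \<in> U" "n \<in> mcar N" by auto
  then show "T x \<in> W" using p U_E by metis
qed

lemma act_F0: "x \<in> L \<Longrightarrow> f \<in> F0 \<Longrightarrow> act x f \<in> F0"
  by (rule F0_induct[OF _ act_endo F0_subspace]) (auto simp: act_pair_cls FA_mult FA_word cls_U)

lemma TF_cover: "free_vs.mod_cover F0 act L TF (\<lambda>f. f)"
  unfolding free_vs.mod_cover_def
  using F0_subspace act_endo act_F0 by (simp add: TF_act) (simp add: tensor_free_module_def)

lemma rel_add: "a \<in> FA \<Longrightarrow> b \<in> FA \<Longrightarrow> n \<in> mcar N \<Longrightarrow>
    pair (cls (a + b)) n - pair (cls a) n - pair (cls b) n \<in> tensor_relations sc br L B N"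
  unfolding tensor_relations_def env_add_cls[symmetric] using cls_U by blast

lemma rel_add_right: "a \<in> FA \<Longrightarrow> n \<in> mcar N \<Longrightarrow> n' \<in> mcar N \<Longrightarrow>
    pair (cls a) (madd N n n') - pair (cls a) n - pair (cls a) n' \<in> tensor_relations sc br L B N"
  unfolding tensor_relations_def using cls_U by blast

lemma rel_scale: "a \<in> FA \<Longrightarrow> n \<in> mcar N \<Longrightarrow>
    pair (cls (pscale (*) c a)) n - pscale (*) c (pair (cls a) n) \<in> tensor_relations sc br L B N"
  unfolding tensor_relations_def env_scale_cls[symmetric] using cls_U by blast

lemma rel_scale_right: "a \<in> FA \<Longrightarrow> n \<in> mcar N \<Longrightarrow>
    pair (cls a) (mscale N c n) - pscale (*) c (pair (cls a) n) \<in> tensor_relations sc br L B N"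
  unfolding tensor_relations_def using cls_U by blast

lemma rel_borel: "a \<in> FA \<Longrightarrow> set bs \<subseteq> B \<Longrightarrow> n \<in> mcar N \<Longrightarrow>
    pair (cls (a * word bs)) n - pair (cls a) (foldr (mact N) bs n) \<in> tensor_relations sc br L B N"
proof -
  assume a: "a \<in> FA" "set bs \<subseteq> B" "n \<in> mcar N"
  then have "pair (env_mul sc br L (cls a) (cls (word bs))) n - pair (cls a) (foldr (mact N) bs n)
      \<in> tensor_relations sc br L B N"
    unfolding tensor_relations_def using cls_U by blast
  moreover have "set bs \<subseteq> L" using a(2) B_sub by blast
  ultimately show ?thesis using a by (simp add: env_mul_cls FA_word)
qed

lemma relE:
  assumes "r \<in> tensor_relations sc br L B N"
  obtains a b n where "a \<in> FA" "b \<in> FA" "n \<in> mcar N" "r = pair (cls (a + b)) n - pair (cls a) n - pair (cls b) n"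
  | a n n' where "a \<in> FA" "n \<in> mcar N" "n' \<in> mcar N" "r = pair (cls a) (madd N n n') - pair (cls a) n - pair (cls a) n'"
  | a c n where "a \<in> FA" "n \<in> mcar N" "r = pair (cls (pscale (*) c a)) n - pscale (*) c (pair (cls a) n)"
  | a c n where "a \<in> FA" "n \<in> mcar N" "r = pair (cls a) (mscale N c n) - pscale (*) c (pair (cls a) n)"
  | a bs n where "a \<in> FA" "set bs \<subseteq> B" "n \<in> mcar N" "r = pair (cls (a * word bs)) n - pair (cls a) (foldr (mact N) bs n)"
proof -
  have bsL: "word bs \<in> FA" if "set bs \<subseteq> B" for bs using that B_sub FA_word[of bs] by blast
  show thesis
    using assms unfolding tensor_relations_def
  proof (elim UnE)
    assume "r \<in> {pair (env_add u u') n - pair u n - pair u' n | u u' n. u \<in> U \<and> u' \<in> U \<and> n \<in> mcar N}"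
    then obtain u u' n where u: "r = pair (env_add u u') n - pair u n - pair u' n" "u \<in> U" "u' \<in> U" "n \<in> mcar N" by blast
    obtain a b where "a \<in> FA" "u = cls a" "b \<in> FA" "u' = cls b" using u(2,3) U_E by metis
    then show thesis using u that(1) by (simp add: env_add_cls)
  next
    assume "r \<in> {pair u (madd N n n') - pair u n - pair u n' | u n n'. u \<in> U \<and> n \<in> mcar N \<and> n' \<in> mcar N}"
    then show thesis using that(2) U_E by (smt (verit) mem_Collect_eq)
  next
    assume "r \<in> {pair (env_scale sc br L c u) n - pscale (*) c (pair u n) | c u n. u \<in> U \<and> n \<in> mcar N}"
    then obtain u c n where u: "r = pair (env_scale sc br L c u) n - pscale (*) c (pair u n)" "u \<in> U" "n \<in> mcar N" by blast
    obtain a where "a \<in> FA" "u = cls a" using u(2) U_E by metis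
    then show thesis using u that(3) by (simp add: env_scale_cls)
  next
    assume "r \<in> {pair u (mscale N c n) - pscale (*) c (pair u n) | c u n. u \<in> U \<and> n \<in> mcar N}"
    then obtain u c n where u: "r = pair u (mscale N c n) - pscale (*) c (pair u n)" "u \<in> U" "n \<in> mcar N" by blast
    obtain a where "a \<in> FA" "u = cls a" using u(2) U_E by metis
    then show thesis using u that(4) by simp
  next
    assume "r \<in> {pair (env_mul sc br L u (cls (word bs))) n - pair u (foldr (mact N) bs n)
        | u bs n. u \<in> U \<and> set bs \<subseteq> B \<and> n \<in> mcar N}"
    then obtain u bs n where u: "r = pair (env_mul sc br L u (cls (word bs))) n - pair u (foldr (mact N) bs n)"
      "u \<in> U" "set bs \<subseteq> B" "n \<in> mcar N" by blast
    obtain a where "a \<in> FA" "u = cls a" using u(2) U_E by metis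
    then show thesis using u that(5) by (simp add: env_mul_cls bsL)
  qed
qed

lemma N_closed: "n \<in> mcar N \<Longrightarrow> n' \<in> mcar N \<Longrightarrow> madd N n n' \<in> mcar N" "n \<in> mcar N \<Longrightarrow> mscale N c n \<in> mcar N"
  using N_space by (auto simp: complex_space_def)

lemma foldr_N: "set bs \<subseteq> B \<Longrightarrow> n \<in> mcar N \<Longrightarrow> foldr (mact N) bs n \<in> mcar N"
  by (induction bs) (auto simp: B_N)

lemma relations_F0: "r \<in> tensor_relations sc br L B N \<Longrightarrow> r \<in> F0"
proof (erule relE)
  note sub = free_vs.subspace_diff[OF F0_subspace] and scl = free_vs.subspace_scale[OF F0_subspace]
    and add = free_vs.subspace_add[OF FA_subspace] and fscl = free_vs.subspace_scale[OF FA_subspace]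
  have bsL: "word bs \<in> FA" if "set bs \<subseteq> B" for bs using that B_sub FA_word[of bs] by blast
  show "r \<in> F0" if "a \<in> FA" "b \<in> FA" "n \<in> mcar N" "r = pair (cls (a + b)) n - pair (cls a) n - pair (cls b) n" for a b n
    unfolding that(4) using that(1-3) by (intro sub pair_F0 add)
  show "r \<in> F0" if "a \<in> FA" "n \<in> mcar N" "n' \<in> mcar N" "r = pair (cls a) (madd N n n') - pair (cls a) n - pair (cls a) n'" for a n n'
    unfolding that(4) using that(1-3) by (intro sub pair_F0 N_closed)
  show "r \<in> F0" if "a \<in> FA" "n \<in> mcar N" "r = pair (cls (pscale (*) c a)) n - pscale (*) c (pair (cls a) n)" for a c n
    unfolding that(3) using that(1-2) by (intro sub scl pair_F0 fscl)
  show "r \<in> F0" if "a \<in> FA" "n \<in> mcar N" "r = pair (cls a) (mscale N c n) - pscale (*) c (pair (cls a) n)" for a c n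
    unfolding that(3) using that(1-2) by (intro sub scl pair_F0 N_closed)
  show "r \<in> F0" if "a \<in> FA" "set bs \<subseteq> B" "n \<in> mcar N" "r = pair (cls (a * word bs)) n - pair (cls a) (foldr (mact N) bs n)" for a bs n
    unfolding that(4) using that(1-3) by (intro sub pair_F0 FA_mult foldr_N bsL)
qed

text \<open>Left multiplication commutes with sums, scalars and right multiplication by words, so
  each kind of relation goes to one of the same kind.\<close>

lemma act_relations: assumes x: "x \<in> L" and r: "r \<in> tensor_relations sc br L B N"
  shows "act x r \<in> tensor_relations sc br L B N"
  using r
proof (cases rule: relE)
  note lin = free_vs.endo_diff[OF act_endo] free_vs.endo_scale[OF act_endo] and ap = act_pair_cls[OF x]
  have X: "word [x] \<in> FA" using x by (simp add: FA_word)
  note XM = FA_mult[OF X] and add = free_vs.subspace_add[OF FA_subspace] and fscl = free_vs.subspace_scale[OF FA_subspace]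
  {
    case (1 a b n)
    then show ?thesis using rel_add[OF XM[OF 1(1)] XM[OF 1(2)] 1(3)] by (simp add: lin ap add distrib_left)
  next
    case (2 a n n')
    then show ?thesis using rel_add_right[OF XM[OF 2(1)] 2(2,3)] by (simp add: lin ap)
  next
    case (3 a c n)
    have "word [x] * pscale (*) c a = pscale (*) c (word [x] * a)"
      by (rule mult_pscale)
    then show ?thesis using rel_scale[OF XM[OF 3(1)] 3(2), of c] 3 by (simp add: lin ap fscl)
  next
    case (4 a c n)
    then show ?thesis using rel_scale_right[OF XM[OF 4(1)] 4(2)] by (simp add: lin ap)
  next
    case (5 a bs n)
    have "word bs \<in> FA" using 5(2) B_sub FA_word[of bs] by blast
    then show ?thesis using rel_borel[OF XM[OF 5(1)] 5(2,3)] 5 by (simp add: lin ap FA_mult mult.assoc)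
  }
qed

end

lemma pscale_eq_mult: "pscale (*) c a = Poly_Mapping.single 0 c * (a :: 'l free_alg)"
proof -
  have "pscale (*) c a = pscale (*) c (\<Sum>k\<in>Poly_Mapping.keys a. Poly_Mapping.single k (Poly_Mapping.lookup a k))"
    by (rule arg_cong[OF poly_mapping_sum_single])
  also have "\<dots> = Poly_Mapping.single 0 c * (\<Sum>k\<in>Poly_Mapping.keys a. Poly_Mapping.single k (Poly_Mapping.lookup a k))"
    by (simp add: free_vs.scale_sum_right pscale_single sum_distrib_left mult_single)
  also have "\<dots> = Poly_Mapping.single 0 c * a" by (rule arg_cong[OF poly_mapping_sum_single[symmetric]])
  finally show ?thesis .
qed

context induced_setup
begin

section \<open>The action modulo the tensor relations\<close>

lemma Rel_subspace: "free_vs.subspace Rel" by (rule free_vs.subspace_span)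

lemma Rel_F0: "Rel \<subseteq> F0"
  by (rule free_vs.span_minimal[OF _ F0_subspace]) (rule subsetI, rule relations_F0)

lemma Rel_act: "x \<in> L \<Longrightarrow> r \<in> Rel \<Longrightarrow> act x r \<in> Rel"
  by (rule free_vs.endo_span[OF act_endo Rel_subspace]) (auto intro: free_vs.span_base act_relations)

lemma Rel_submodule: "submodule L TF Rel"
proof -
  have "mcar TF = F0" "madd TF = (+)" "mzero TF = 0" "mscale TF = pscale (*)" by (simp_all add: tensor_free_module_def)
  then show ?thesis
    using Rel_F0 free_vs.subspace_0[OF Rel_subspace] free_vs.subspace_add[OF Rel_subspace]
      free_vs.subspace_scale[OF Rel_subspace] Rel_act
    unfolding submodule_def msubspace_def TF_act by auto
qed

lemma Rel_base: "r \<in> tensor_relations sc br L B N \<Longrightarrow> r \<in> Rel" by (rule free_vs.span_base)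

lemma cls_mult_J: "j \<in> J \<Longrightarrow> a \<in> FA \<Longrightarrow> b - c = j * a \<Longrightarrow> cls b = cls c"
  using J_mult(2) by (intro cls_eqI) simp

lemma env_rel_add: "x \<in> L \<Longrightarrow> y \<in> L \<Longrightarrow> word [x + y] - word [x] - word [y] \<in> J"
  by (rule subsetD[OF J_relations], unfold env_relations_def, rule UnI1, rule UnI1) blast

lemma env_rel_scale: "x \<in> L \<Longrightarrow> word [sc c x] - pscale (*) c (word [x]) \<in> J"
  by (rule subsetD[OF J_relations], unfold env_relations_def, rule UnI1, rule UnI2) blast

lemma env_rel_br: "x \<in> L \<Longrightarrow> y \<in> L \<Longrightarrow> word [x, y] - word [y, x] - word [br x y] \<in> J"
  by (rule subsetD[OF J_relations], unfold env_relations_def, rule UnI2) blast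

lemma act_add_rel:
  assumes xy: "x \<in> L" "y \<in> L" and f: "f \<in> F0" shows "act (x + y) f - act x f - act y f \<in> Rel"
proof (rule F0_induct[OF f _ Rel_subspace])
  show "free_vs.endo (\<lambda>f. act (x + y) f - act x f - act y f)"
    unfolding free_vs.endo_iff
    by (simp add: free_vs.endo_add[OF act_endo] free_vs.endo_scale[OF act_endo] free_vs.scale_right_diff_distrib)
  fix a n assume a: "a \<in> FA" "n \<in> mcar N"
  have "word [x + y] * a - (word [x] * a + word [y] * a) = (word [x + y] - word [x] - word [y]) * a"
    by (simp add: algebra_simps)
  from cls_mult_J[OF env_rel_add[OF xy] a(1) this]
  show "act (x + y) (pair (cls a) n) - act x (pair (cls a) n) - act y (pair (cls a) n) \<in> Rel"
    using Rel_base[OF rel_add[of "word [x] * a" "word [y] * a" n]] xy a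
    by (simp add: act_pair_cls L_add FA_mult FA_word)
qed

lemma act_scale_rel:
  assumes x: "x \<in> L" and f: "f \<in> F0" shows "act (sc c x) f - pscale (*) c (act x f) \<in> Rel"
proof (rule F0_induct[OF f _ Rel_subspace])
  show "free_vs.endo (\<lambda>f. act (sc c x) f - pscale (*) c (act x f))"
    unfolding free_vs.endo_iff
    by (simp add: free_vs.endo_add[OF act_endo] free_vs.endo_scale[OF act_endo] free_vs.scale_right_diff_distrib
        free_vs.scale_right_distrib mult.commute)
  fix a n assume a: "a \<in> FA" "n \<in> mcar N"
  have "word [sc c x] * a - pscale (*) c (word [x] * a) = (word [sc c x] - pscale (*) c (word [x])) * a"
    by (simp only: pscale_eq_mult left_diff_distrib mult.assoc)
  from cls_mult_J[OF env_rel_scale[OF x] a(1) this]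
  show "act (sc c x) (pair (cls a) n) - pscale (*) c (act x (pair (cls a) n)) \<in> Rel"
    using Rel_base[OF rel_scale[of "word [x] * a" n c]] x a
    by (simp add: act_pair_cls L_scale FA_mult FA_word)
qed

lemma act_br_rel:
  assumes xy: "x \<in> L" "y \<in> L" and f: "f \<in> F0"
  shows "act (br x y) f - (act x (act y f) - act y (act x f)) \<in> Rel"
proof (rule F0_induct[OF f _ Rel_subspace])
  show "free_vs.endo (\<lambda>f. act (br x y) f - (act x (act y f) - act y (act x f)))"
    unfolding free_vs.endo_iff
    by (simp add: free_vs.endo_add[OF act_endo] free_vs.endo_scale[OF act_endo] free_vs.scale_right_diff_distrib)
  fix a n assume a: "a \<in> FA" "n \<in> mcar N"
  let ?A = "word [x] * (word [y] * a)" and ?C = "word [y] * (word [x] * a)"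
  \<comment> \<open>The tensor relations speak of sums and scalar multiples only, so the difference
    is written with the multiple by -1.\<close>
  let ?C' = "pscale (*) (-1) ?C"
  have FAA: "?A \<in> FA" "?C \<in> FA" using xy a(1) by (simp_all add: FA_mult FA_word)
  have FAC: "?C' \<in> FA" by (rule free_vs.subspace_scale[OF FA_subspace FAA(2)])
  have m: "?C' = - ?C" by simp
  have w: "word [x, y] = word [x] * word [y]" "word [y, x] = word [y] * word [x]"
    by (simp_all add: mult_single plus_list_def)
  have "(?A + ?C') - word [br x y] * a = (word [x, y] - word [y, x] - word [br x y]) * a"
    unfolding m w by (simp add: algebra_simps)
  from cls_mult_J[OF env_rel_br[OF xy] a(1) this] have c: "cls (word [br x y] * a) = cls (?A + ?C')" by (rule sym)
  have "(pair (cls (?A + ?C')) n - pair (cls ?A) n - pair (cls ?C') n) + (pair (cls ?C') n - pscale (*) (-1) (pair (cls ?C) n)) \<in> Rel"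
    by (intro free_vs.subspace_add[OF Rel_subspace] Rel_base rel_add rel_scale FAA FAC a(2))
  also have "(pair (cls (?A + ?C')) n - pair (cls ?A) n - pair (cls ?C') n) + (pair (cls ?C') n - pscale (*) (-1) (pair (cls ?C) n))
      = pair (cls (word [br x y] * a)) n - (pair (cls ?A) n - pair (cls ?C) n)"
    unfolding c by simp
  finally show "act (br x y) (pair (cls a) n) - (act x (act y (pair (cls a) n)) - act y (act x (pair (cls a) n))) \<in> Rel"
    using xy a(1) by (simp add: act_pair_cls L_br FA_mult FA_word)
qed

text \<open>The vector 1 \<otimes> n, as the empty word is the unit of the free algebra.\<close>

abbreviation top :: "'w \<Rightarrow> ('l, 'w) tensor_free" where "top n \<equiv> pair (cls (word [])) n"

lemma FA_unit: "word [] \<in> FA" by (rule FA_word) simp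

lemma word_Nil_mult: "word [] * a = a" "a * word [] = (a :: 'l free_alg)"
  by (simp_all flip: zero_list_def)

lemma act_top_rel: "b \<in> B \<Longrightarrow> n \<in> mcar N \<Longrightarrow> act b (top n) - top (mact N b n) \<in> Rel"
  using Rel_base[OF rel_borel[OF FA_unit, of "[b]" n]] B_sub
  by (auto simp: act_pair_cls FA_unit word_Nil_mult)

text \<open>Words arise from the unit letter by letter through the action, and additivity and
  homogeneity in the first factor extend this to their combinations.\<close>

lemma top_generates:
  assumes W: "free_vs.subspace W" "Rel \<subseteq> W" and st: "\<And>l w. l \<in> L \<Longrightarrow> w \<in> W \<Longrightarrow> act l w \<in> W"
    and top: "\<And>n. n \<in> mcar N \<Longrightarrow> top n \<in> W"
  shows "F0 \<subseteq> W"
proof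
  fix f assume f: "f \<in> F0"
  have words: "pair (cls (word w)) n \<in> W" if "set w \<subseteq> L" "n \<in> mcar N" for w n
    using that
  proof (induction w)
    case (Cons x w)
    then have "act x (pair (cls (word w)) n) \<in> W" by (intro st) auto
    then show ?case using Cons.prems by (simp add: act_pair_cls FA_word mult_single plus_list_def)
  qed (rule top)
  have "pair (cls a) n \<in> W" if a: "a \<in> FA" and n: "n \<in> mcar N" for a n
  proof -
    let ?P = "{a \<in> FA. pair (cls a) n \<in> W}"
    have "free_vs.subspace ?P"
    proof (rule free_vs.subspaceI)
      show s: "pscale (*) c a \<in> ?P" if "a \<in> ?P" for c a
      proof -
        have "pair (cls (pscale (*) c a)) n - pscale (*) c (pair (cls a) n) \<in> W"
          using Rel_base[OF rel_scale, of a n c] that n W(2) by blast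
        moreover have "pscale (*) c (pair (cls a) n) \<in> W" using that free_vs.subspace_scale[OF W(1)] by blast
        ultimately have "pair (cls (pscale (*) c a)) n \<in> W" using free_vs.subspace_add[OF W(1)] by fastforce
        then show ?thesis using that free_vs.subspace_scale[OF FA_subspace] by blast
      qed
      have "word [] \<in> ?P" using words[of "[]"] n FA_unit by simp
      from s[OF this, of 0] show "0 \<in> ?P" by (simp add: free_vs.scale_zero_left)
      show "a + b \<in> ?P" if "a \<in> ?P" "b \<in> ?P" for a b
      proof -
        have "pair (cls (a + b)) n - pair (cls a) n - pair (cls b) n \<in> W"
          using Rel_base[OF rel_add, of a b n] that n W(2) by blast
        moreover have "pair (cls a) n + pair (cls b) n \<in> W" using that free_vs.subspace_add[OF W(1)] by blast
        ultimately have "(pair (cls (a + b)) n - pair (cls a) n - pair (cls b) n) + (pair (cls a) n + pair (cls b) n) \<in> W"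
          by (rule free_vs.subspace_add[OF W(1)])
        then show ?thesis using that free_vs.subspace_add[OF FA_subspace] by simp
      qed
    qed
    moreover have "{Poly_Mapping.single w 1 | w. w \<in> {w. set w \<subseteq> L}} \<subseteq> ?P" using words n FA_word by blast
    ultimately have "free_vs.span {Poly_Mapping.single w 1 | w. w \<in> {w. set w \<subseteq> L}} \<subseteq> ?P"
      by (rule free_vs.span_minimal[rotated])
    moreover have "a \<in> free_vs.span {Poly_Mapping.single w 1 | w. w \<in> {w. set w \<subseteq> L}}"
      using a unfolding FA_eq by (intro keys_span) simp
    ultimately show ?thesis by blast
  qed
  moreover have "free_vs.endo (\<lambda>f. f :: ('l, 'w) tensor_free)" by (simp add: free_vs.endo_iff)
  ultimately show "f \<in> W" using F0_induct[OF f _ W(1), of "\<lambda>f. f"] by blast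
qed

text \<open>Choosing complements turns the quotient into a space of vectors on which \<open>L\<close> acts by genuine
  linear operators, with equalities instead of congruences.\<close>

lemma typed_irreducible_quotient:
  assumes V: "irreducible_quotient L (induced_module sc br L B N) V"
  obtains V0 :: "('l, 'w) tensor_free set" and \<rho> \<phi> j where "free_vs.subspace V0"
    "\<And>l. l \<in> L \<Longrightarrow> free_vs.endo (\<rho> l)" "\<And>l v. l \<in> L \<Longrightarrow> \<rho> l v \<in> V0"
    "\<And>x y v. x \<in> L \<Longrightarrow> y \<in> L \<Longrightarrow> \<rho> (x + y) v = \<rho> x v + \<rho> y v"
    "\<And>c x v. x \<in> L \<Longrightarrow> \<rho> (sc c x) v = pscale (*) c (\<rho> x v)"
    "\<And>x y v. x \<in> L \<Longrightarrow> y \<in> L \<Longrightarrow> \<rho> (br x y) v = \<rho> x (\<rho> y v) - \<rho> y (\<rho> x v)"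
    "\<And>W. free_vs.subspace W \<Longrightarrow> W \<subseteq> V0 \<Longrightarrow> (\<And>l w. l \<in> L \<Longrightarrow> w \<in> W \<Longrightarrow> \<rho> l w \<in> W) \<Longrightarrow> W = {0} \<or> W = V0"
    "\<And>n. n \<in> mcar N \<Longrightarrow> j n \<in> V0"
    "\<And>n n'. n \<in> mcar N \<Longrightarrow> n' \<in> mcar N \<Longrightarrow> j (madd N n n') = j n + j n'"
    "\<And>c n. n \<in> mcar N \<Longrightarrow> j (mscale N c n) = pscale (*) c (j n)"
    "\<And>b n. b \<in> B \<Longrightarrow> n \<in> mcar N \<Longrightarrow> \<rho> b (j n) = j (mact N b n)"
    "\<exists>n\<in>mcar N. j n \<noteq> 0"
    "inj_on \<phi> V0" "\<phi> ` V0 = mcar V" "\<And>u v. u \<in> V0 \<Longrightarrow> v \<in> V0 \<Longrightarrow> \<phi> (u + v) = madd V (\<phi> u) (\<phi> v)"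
    "\<And>c v. v \<in> V0 \<Longrightarrow> \<phi> (pscale (*) c v) = mscale V c (\<phi> v)" "\<phi> 0 = mzero V"
    "\<And>l v. l \<in> L \<Longrightarrow> v \<in> V0 \<Longrightarrow> \<phi> (\<rho> l v) = mact V l (\<phi> v)"
proof -
  let ?M = "induced_module sc br L B N"
  obtain S where S: "submodule L ?M S" "V = quotient_module ?M S" "irreducible_module L V"
    using V by (auto simp: irreducible_quotient_def)
  have Meq: "?M = quotient_module TF Rel" by (simp add: induced_module_def)
  define \<pi>1 where "\<pi>1 = (\<lambda>f. (\<lambda>r. f + r) ` {r \<in> F0. r \<in> Rel})"
  have q1: "free_vs.mod_cover F0 act L ?M \<pi>1"
    unfolding \<pi>1_def Meq by (rule free_vs.quotient_cover(1)[OF TF_cover Rel_submodule])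
  have q1z: "\<pi>1 f = mzero ?M \<longleftrightarrow> f \<in> Rel" if "f \<in> F0" for f
    unfolding \<pi>1_def Meq by (rule free_vs.quotient_cover(2)[OF TF_cover Rel_submodule that])
  define \<phi> where "\<phi> = (\<lambda>f. (\<lambda>r. \<pi>1 (f + r)) ` {r \<in> F0. \<pi>1 r \<in> S})"
  have q2: "free_vs.mod_cover F0 act L V \<phi>"
    unfolding \<phi>_def S(2) by (rule free_vs.quotient_cover(1)[OF q1 S(1)])
  have z: "\<phi> f = mzero V \<longleftrightarrow> \<pi>1 f \<in> S" if "f \<in> F0" for f
    unfolding \<phi>_def S(2) by (rule free_vs.quotient_cover(2)[OF q1 S(1) that])
  \<comment> \<open>The kernel of the passage from free vectors to \<open>V\<close>, which is the
    preimage of \<open>S\<close> and contains the tensor relations.\<close>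
  define R where "R = {f \<in> F0. \<phi> f = mzero V}"
  have img: "\<phi> ` F0 = mcar V" and p0: "\<phi> 0 = mzero V"
    and padd: "\<And>f g. f \<in> F0 \<Longrightarrow> g \<in> F0 \<Longrightarrow> \<phi> (f + g) = madd V (\<phi> f) (\<phi> g)"
    and pscl: "\<And>c f. f \<in> F0 \<Longrightarrow> \<phi> (pscale (*) c f) = mscale V c (\<phi> f)"
    and pact: "\<And>l f. l \<in> L \<Longrightarrow> f \<in> F0 \<Longrightarrow> \<phi> (act l f) = mact V l (\<phi> f)"
    using q2 unfolding free_vs.mod_cover_def by auto
  have Sm: "mzero ?M \<in> S" "\<And>u v. u \<in> S \<Longrightarrow> v \<in> S \<Longrightarrow> madd ?M u v \<in> S" "\<And>c v. v \<in> S \<Longrightarrow> mscale ?M c v \<in> S"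
    "\<And>l v. l \<in> L \<Longrightarrow> v \<in> S \<Longrightarrow> mact ?M l v \<in> S"
    using S(1) by (auto simp: submodule_def msubspace_def)
  have p1: "\<And>f g. f \<in> F0 \<Longrightarrow> g \<in> F0 \<Longrightarrow> \<pi>1 (f + g) = madd ?M (\<pi>1 f) (\<pi>1 g)"
    "\<And>c f. f \<in> F0 \<Longrightarrow> \<pi>1 (pscale (*) c f) = mscale ?M c (\<pi>1 f)" "\<pi>1 0 = mzero ?M"
    "\<And>l f. l \<in> L \<Longrightarrow> f \<in> F0 \<Longrightarrow> \<pi>1 (act l f) = mact ?M l (\<pi>1 f)"
    using q1 unfolding free_vs.mod_cover_def by auto
  have R_iff: "f \<in> R \<longleftrightarrow> f \<in> F0 \<and> \<pi>1 f \<in> S" for f using z[of f] by (auto simp: R_def)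
  note Fadd = free_vs.subspace_add[OF F0_subspace] and Fscl = free_vs.subspace_scale[OF F0_subspace]
    and Fdiff = free_vs.subspace_diff[OF F0_subspace]
  have sR: "free_vs.subspace R"
  proof (rule free_vs.subspaceI)
    show "0 \<in> R" using free_vs.subspace_0[OF F0_subspace] p0 by (simp add: R_def)
    show "x + y \<in> R" if "x \<in> R" "y \<in> R" for x y
      using that Fadd[of x y] p1(1)[of x y] Sm(2) unfolding R_iff by simp
    show "pscale (*) c x \<in> R" if "x \<in> R" for c x
      using that Fscl[of x c] p1(2)[of x c] Sm(3) unfolding R_iff by simp
  qed
  have R_act: "act l r \<in> R" if "l \<in> L" "r \<in> R" for l r
    using that act_F0[of l r] p1(4)[of l r] Sm(4) unfolding R_iff by simp
  have Rel_R: "Rel \<subseteq> R"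
  proof
    fix r assume r: "r \<in> Rel"
    then have rF: "r \<in> F0" using Rel_F0 by blast
    then have "\<pi>1 r = mzero ?M" using q1z[OF rF] r by simp
    then show "r \<in> R" using rF Sm(1) unfolding R_iff by simp
  qed
  \<comment> \<open>With \<open>P\<close> a projection onto \<open>R\<close>, the map
    \<open>p = 1 - P\<close> has kernel \<open>R\<close>, and the image of \<open>F0\<close> under
    it is a copy of \<open>V\<close>.\<close>
  obtain P where P: "free_vs.endo P" "\<And>w. w \<in> R \<Longrightarrow> P w = w" "\<And>v. P v \<in> R"
    by (rule free_vs.subspace_projection[OF sR]) (rule that)
  define p where "p f = f - P f" for f
  have p_endo: "free_vs.endo p"
    unfolding free_vs.endo_iff p_def
    by (simp add: free_vs.endo_add[OF P(1)] free_vs.endo_scale[OF P(1)] free_vs.scale_right_diff_distrib)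
  note plin = free_vs.endo_add[OF p_endo] free_vs.endo_scale[OF p_endo] free_vs.endo_diff[OF p_endo]
  have pR: "p r = 0" if "r \<in> R" for r using P(2)[OF that] by (simp add: p_def)
  have p_diff: "f - p f \<in> R" for f using P(3) by (simp add: p_def)
  have pp: "p (p f) = p f" for f using pR[OF p_diff[of f]] plin(3)[of f "p f"] by simp
  have p_eq: "p f = p g" if "f - g \<in> R" for f g using pR[OF that] plin(3)[of f g] by simp
  have pF: "p f \<in> F0" if "f \<in> F0" for f using Fdiff[OF that] P(3)[of f] R_iff unfolding p_def by blast
  \<comment> \<open>\<open>R\<close> is stable under the action, so the class of
    \<open>act l f\<close> depends only on the class of \<open>f\<close>.\<close>
  have p_act: "p (act l (p f)) = p (act l f)" if "l \<in> L" for l f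
  proof (rule p_eq)
    have "act l (f - p f) \<in> R" by (rule R_act[OF that p_diff])
    then have "act l f - act l (p f) \<in> R" by (simp only: free_vs.endo_diff[OF act_endo])
    then show "act l (p f) - act l f \<in> R" using free_vs.subspace_neg[OF sR] by fastforce
  qed
  define V0 where "V0 = p ` F0"
  have V0F: "V0 \<subseteq> F0" using pF by (auto simp: V0_def)
  have pV: "p v = v" if "v \<in> V0" for v using that pp by (auto simp: V0_def)
  have sV0: "free_vs.subspace V0"
  proof (rule free_vs.subspaceI)
    show "0 \<in> V0" using free_vs.endo_zero[OF p_endo] free_vs.subspace_0[OF F0_subspace] by (force simp: V0_def)
    show "x + y \<in> V0" if xy: "x \<in> V0" "y \<in> V0" for x y
    proof -
      have "x + y = p (x + y)" using pV[OF xy(1)] pV[OF xy(2)] plin(1)[of x y] by simp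
      moreover have "x + y \<in> F0" using xy V0F Fadd by blast
      ultimately show ?thesis unfolding V0_def by (rule image_eqI)
    qed
    show "pscale (*) c x \<in> V0" if x: "x \<in> V0" for c x
    proof -
      have "pscale (*) c x = p (pscale (*) c x)" using pV[OF x] plin(2)[of c x] by simp
      moreover have "pscale (*) c x \<in> F0" using x V0F Fscl by blast
      ultimately show ?thesis unfolding V0_def by (rule image_eqI)
    qed
  qed
  \<comment> \<open>Composing with a projection onto \<open>V0\<close> makes the operators linear on
    the whole type, with values in \<open>V0\<close>.\<close>
  obtain Q where Q: "free_vs.endo Q" "\<And>w. w \<in> V0 \<Longrightarrow> Q w = w" "\<And>v. Q v \<in> V0"
    by (rule free_vs.subspace_projection[OF sV0]) (rule that)
  define \<rho> where "\<rho> l v = p (act l (Q v))" for l v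
  have QF: "Q v \<in> F0" for v using Q(3) V0F by blast
  have \<rho>V: "\<rho> l v \<in> V0" if "l \<in> L" for l v
    unfolding \<rho>_def V0_def by (rule imageI[OF act_F0[OF that QF]])
  have \<rho>_p: "\<rho> l (p f) = p (act l f)" if "l \<in> L" "f \<in> F0" for l f
    using Q(2)[of "p f"] that p_act[OF that(1)] by (simp add: \<rho>_def V0_def)
  define j where "j n = p (top n)" for n
  have topF: "top n \<in> F0" if "n \<in> mcar N" for n by (rule pair_F0[OF FA_unit that])
  have \<phi>p: "\<phi> (p f) = \<phi> f" if f: "f \<in> F0" for f
  proof -
    have r: "f - p f \<in> R" by (rule p_diff)
    have rF: "f - p f \<in> F0" using r by (simp add: R_def)
    have "\<phi> f = \<phi> (p f + (f - p f))" by simp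
    also have "\<dots> = madd V (\<phi> (p f)) (\<phi> 0)" using padd[OF pF[OF f] rF] r p0 by (simp add: R_def)
    also have "\<dots> = \<phi> (p f)" using padd[OF pF[OF f], of 0] free_vs.subspace_0[OF F0_subspace] by simp
    finally show ?thesis by simp
  qed
  have \<phi>img: "\<phi> ` V0 = mcar V" unfolding V0_def img[symmetric] image_image using \<phi>p by simp
  have inj: "inj_on \<phi> V0"
  proof (rule inj_onI)
    fix u v assume uv: "u \<in> V0" "v \<in> V0" "\<phi> u = \<phi> v"
    have F: "u \<in> F0" "pscale (*) (-1) v \<in> F0" "v \<in> F0" using uv V0F Fscl by blast+
    have "\<phi> (u + pscale (*) (-1) v) = madd V (\<phi> v) (\<phi> (pscale (*) (-1) v))" using padd[OF F(1,2)] uv(3) by simp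
    also have "\<dots> = \<phi> (v + pscale (*) (-1) v)" using padd[OF F(3,2)] by simp
    also have "\<dots> = mzero V" using p0 by simp
    finally have "u + pscale (*) (-1) v \<in> R" using Fadd[OF F(1,2)] by (simp add: R_def)
    then have "u - v \<in> R" by simp
    then have "p u = p v" by (rule p_eq)
    then show "u = v" using pV uv by simp
  qed
  have \<phi>\<rho>: "\<phi> (\<rho> l v) = mact V l (\<phi> v)" if "l \<in> L" "v \<in> V0" for l v
  proof -
    have vF: "v \<in> F0" using that(2) V0F by blast
    have "\<phi> (\<rho> l v) = \<phi> (act l v)" using \<phi>p[OF act_F0[OF that(1) vF]] Q(2)[OF that(2)] by (simp add: \<rho>_def)
    then show ?thesis using pact[OF that(1) vF] by simp
  qed
  have V0n: "V0 \<noteq> {0}" using S(3) \<phi>img p0 by (auto simp: irreducible_module_def)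
  have irr: "W = {0} \<or> W = V0" if W: "free_vs.subspace W" "W \<subseteq> V0" "\<And>l w. l \<in> L \<Longrightarrow> w \<in> W \<Longrightarrow> \<rho> l w \<in> W" for W
  proof -
    have WF: "W \<subseteq> F0" using W(2) V0F by blast
    have "submodule L V (\<phi> ` W)"
      unfolding submodule_def msubspace_def
    proof (intro conjI ballI allI)
      show "\<phi> ` W \<subseteq> mcar V" using W(2) \<phi>img by blast
      show "mzero V \<in> \<phi> ` W" using p0 free_vs.subspace_0[OF W(1)] by (metis image_eqI)
      fix u assume "u \<in> \<phi> ` W"
      then obtain a where a: "a \<in> W" "u = \<phi> a" by blast
      show "madd V u v \<in> \<phi> ` W" if v: "v \<in> \<phi> ` W" for v
      proof -
        obtain b where b: "b \<in> W" "v = \<phi> b" using v by blast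
        have "madd V u v = \<phi> (a + b)" using padd[of a b] a b WF by auto
        then show ?thesis using free_vs.subspace_add[OF W(1) a(1) b(1)] by blast
      qed
      show "mscale V c u \<in> \<phi> ` W" for c
      proof -
        have "mscale V c u = \<phi> (pscale (*) c a)" using pscl[of a c] a WF by auto
        then show ?thesis using free_vs.subspace_scale[OF W(1) a(1)] by blast
      qed
      show "mact V l u \<in> \<phi> ` W" if "l \<in> L" for l
        using \<phi>\<rho>[OF that, of a] a W(2) W(3)[OF that a(1)] by (metis image_eqI subsetD)
    qed
    then have "\<phi> ` W = {mzero V} \<or> \<phi> ` W = mcar V" using S(3) by (simp add: irreducible_module_def)
    then show ?thesis
    proof
      assume w: "\<phi> ` W = {mzero V}"
      have "w = 0" if "w \<in> W" for w
        using inj_onD[OF inj, of w 0] w that p0 W(2) free_vs.subspace_0[OF sV0] by blast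
      then show ?thesis using free_vs.subspace_0[OF W(1)] by blast
    next
      assume "\<phi> ` W = mcar V"
      then show ?thesis using inj_on_image_eq_iff[OF inj W(2) order_refl] \<phi>img by simp
    qed
  qed
  \<comment> \<open>If all vectors 1 \<otimes> n were in \<open>R\<close>, then so would be
    \<open>F0\<close>, which they generate, and \<open>V\<close> would be zero.\<close>
  have g0: "\<exists>n\<in>mcar N. j n \<noteq> 0"
  proof (rule ccontr)
    assume no: "\<not> ?thesis"
    have "top n \<in> R" if "n \<in> mcar N" for n
    proof -
      have "p (top n) = 0" using no that by (simp add: j_def)
      then show ?thesis using p_diff[of "top n"] by simp
    qed
    then have "F0 \<subseteq> R" using top_generates[OF sR Rel_R R_act] by blast
    then have "V0 \<subseteq> {0}" using pR by (auto simp: V0_def)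
    then show False using V0n free_vs.subspace_0[OF sV0] by blast
  qed
  have g1: "j (madd N n n') = j n + j n'" if "n \<in> mcar N" "n' \<in> mcar N" for n n'
  proof -
    have "top (madd N n n') - (top n + top n') \<in> R"
      using Rel_base[OF rel_add_right[OF FA_unit that]] Rel_R by (auto simp: diff_diff_eq)
    then show ?thesis unfolding j_def plin(1)[symmetric] by (rule p_eq)
  qed
  have g2: "j (mscale N c n) = pscale (*) c (j n)" if "n \<in> mcar N" for c n
  proof -
    have "top (mscale N c n) - pscale (*) c (top n) \<in> R"
      using Rel_base[OF rel_scale_right[OF FA_unit that]] Rel_R by blast
    then show ?thesis unfolding j_def plin(2)[symmetric] by (rule p_eq)
  qed
  have g3: "\<rho> b (j n) = j (mact N b n)" if b: "b \<in> B" "n \<in> mcar N" for b n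
  proof -
    have bL: "b \<in> L" using b(1) B_sub by blast
    have "act b (top n) - top (mact N b n) \<in> R" using act_top_rel[OF b] Rel_R by blast
    then show ?thesis unfolding j_def \<rho>_p[OF bL topF[OF b(2)]] by (rule p_eq)
  qed
  have g4: "\<rho> (x + y) v = \<rho> x v + \<rho> y v" if "x \<in> L" "y \<in> L" for x y v
  proof -
    have "act (x + y) (Q v) - (act x (Q v) + act y (Q v)) \<in> R"
      using act_add_rel[OF that QF] Rel_R by (auto simp: diff_diff_eq)
    then show ?thesis unfolding \<rho>_def plin(1)[symmetric] by (rule p_eq)
  qed
  have g5: "\<rho> (sc c x) v = pscale (*) c (\<rho> x v)" if "x \<in> L" for c x v
  proof -
    have "act (sc c x) (Q v) - pscale (*) c (act x (Q v)) \<in> R" using act_scale_rel[OF that QF] Rel_R by blast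
    then show ?thesis unfolding \<rho>_def plin(2)[symmetric] by (rule p_eq)
  qed
  have g6: "\<rho> (br x y) v = \<rho> x (\<rho> y v) - \<rho> y (\<rho> x v)" if xy: "x \<in> L" "y \<in> L" for x y v
  proof -
    have "act (br x y) (Q v) - (act x (act y (Q v)) - act y (act x (Q v))) \<in> R"
      using act_br_rel[OF xy QF] Rel_R by blast
    then have "\<rho> (br x y) v = p (act x (act y (Q v))) - p (act y (act x (Q v)))"
      unfolding \<rho>_def plin(3)[symmetric] by (rule p_eq)
    then show ?thesis
      using \<rho>_p[OF xy(1) act_F0[OF xy(2) QF[of v]]] \<rho>_p[OF xy(2) act_F0[OF xy(1) QF[of v]]] by (simp add: \<rho>_def[of _ v])
  qed
  have g7: "free_vs.endo (\<rho> l)" for l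
    unfolding free_vs.endo_iff \<rho>_def
    by (simp add: plin free_vs.endo_add[OF Q(1)] free_vs.endo_scale[OF Q(1)] free_vs.endo_add[OF act_endo] free_vs.endo_scale[OF act_endo])
  have g8: "j n \<in> V0" if "n \<in> mcar N" for n unfolding j_def V0_def by (rule imageI[OF topF[OF that]])
  have g9: "\<phi> (u + v) = madd V (\<phi> u) (\<phi> v)" if "u \<in> V0" "v \<in> V0" for u v using that V0F by (intro padd) auto
  have g10: "\<phi> (pscale (*) c v) = mscale V c (\<phi> v)" if "v \<in> V0" for c v using that V0F by (intro pscl) auto
  show thesis
  proof (rule that[of V0 \<rho> j \<phi>])
    show "W = {0} \<or> W = V0"
      if "free_vs.subspace W" "W \<subseteq> V0" "\<And>l w. l \<in> L \<Longrightarrow> w \<in> W \<Longrightarrow> \<rho> l w \<in> W" for W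
      using that(1,2) by (rule irr) (rule that(3))
  qed (simp_all add: sV0 g7 \<rho>V g4 g5 g6 g8 g1 g2 g3 inj \<phi>img p0 \<phi>\<rho> g9 g10 g0)
qed

end

section \<open>The toroidal algebra\<close>

lemma lie_module_facts:
  assumes "lie_module sc br L M"
  shows "complex_space M" "\<And>x v. x \<in> L \<Longrightarrow> v \<in> mcar M \<Longrightarrow> mact M x v \<in> mcar M"
    "\<And>c x v. x \<in> L \<Longrightarrow> v \<in> mcar M \<Longrightarrow> mact M (sc c x) v = mscale M c (mact M x v)"
  using assms unfolding lie_module_def by blast+

lemma K_elt_sum: "(\<Sum>s\<in>A. (0, g s, 0)) = (0, \<Sum>s\<in>A. g s, 0)"
  by (induction A rule: infinite_finite_induct) (auto simp: zero_prod_def)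

context lie_torus_data
begin

lemma vector_space_tscale: "vector_space (tscale D)"
proof -
  interpret P: vector_space "pscale sc :: complex \<Rightarrow> ((int \<times> (int^'n)) \<Rightarrow>\<^sub>0 'g) \<Rightarrow> _"
    by (rule vector_space_pscale[OF vector_space_axioms])
  show ?thesis
    by unfold_locales (auto simp: tscale_def P.scale_right_distrib P.scale_left_distrib
        free_vs.scale_right_distrib free_vs.scale_left_distrib algebra_simps split: prod.splits)
qed

interpretation T: complex_vector_space "tscale D"
  by (simp add: complex_vector_space_def vector_space_tscale)

lemma pscale_sc_zero: "pscale sc 0 (x :: 'a \<Rightarrow>\<^sub>0 'g) = 0" "pscale sc c (0 :: 'a \<Rightarrow>\<^sub>0 'g) = 0"
  by (auto intro!: poly_mapping_eqI simp: lookup_pscale)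

lemma pscale_sc_single: "pscale sc c (Poly_Mapping.single p X) = Poly_Mapping.single p (sc c X)"
  by (rule poly_mapping_eqI) (simp add: lookup_pscale lookup_single when_def)

lemma pscale_sc_one: "pscale sc 1 (x :: 'a \<Rightarrow>\<^sub>0 'g) = x"
  by (rule poly_mapping_eqI) (simp add: lookup_pscale)

lemma degree_deriv_single: "degree_deriv D (Poly_Mapping.single p X) = Poly_Mapping.single p (sc (of_int (fst p)) X)"
  by (simp add: degree_deriv_def)

lemma degree_deriv_zero: "degree_deriv D 0 = 0" by (simp add: degree_deriv_def)

lemma form_zero_left: "form D 0 y = 0" using form_scale_left[of 0 0 y] by simp

lemma tbracket_loop: "tbracket D (loop_elt X k0 k) (loop_elt Y l0 l) = loop_elt (br X Y) (k0 + l0) (k + l)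
    + (if k0 + l0 = 0 then K_elt (Poly_Mapping.single (k + l) (of_int k0 * form D X Y)) else 0)"
  by (simp add: tbracket_def pscale_sc_zero form_zero form_zero_left zero_prod_def)

lemma tbracket_K: "tbracket D (K_elt f) z = 0" "tbracket D z (K_elt f) = 0"
  by (simp_all add: tbracket_def pscale_sc_zero degree_deriv_zero zero_prod_def split: prod.splits)

lemma tbracket_d_loop: "tbracket D d0_elt (loop_elt X k0 k) = loop_elt (sc (of_int k0) X) k0 k"
  by (simp add: tbracket_def pscale_sc_zero pscale_sc_one degree_deriv_single degree_deriv_zero)

lemma loop_add: "loop_elt (X + Y) k0 k = (loop_elt X k0 k + loop_elt Y k0 k :: ('g, 'n) toroidal)"
  by (simp add: single_add)

lemma loop_scale: "loop_elt (sc c X) k0 k = tscale D c (loop_elt X k0 k)"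
  by (simp add: tscale_def pscale_sc_single pscale_sc_zero)

lemma K_scale: "K_elt (Poly_Mapping.single \<gamma> c) = tscale D c (K_elt (Poly_Mapping.single \<gamma> 1))"
  by (simp add: tscale_def pscale_single pscale_sc_zero)

lemma K_elt_decomp: "K_elt f = (\<Sum>s\<in>Poly_Mapping.keys f. tscale D (Poly_Mapping.lookup f s) (K_elt (Poly_Mapping.single s 1)))"
proof -
  have "K_elt f = (0, \<Sum>s\<in>Poly_Mapping.keys f. Poly_Mapping.single s (Poly_Mapping.lookup f s), 0)"
    using arg_cong[OF poly_mapping_sum_single, of "\<lambda>f. (0, f, 0)" f] .
  then show ?thesis unfolding K_scale[symmetric] K_elt_sum .
qed

lemma loop_mult_decomp: "loop_mult D X k0 k f =
    (\<Sum>s\<in>Poly_Mapping.keys f. tscale D (Poly_Mapping.lookup f s) (loop_elt X k0 (k + s)))"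
  by (simp only: loop_mult_def loop_scale)

section \<open>The triangular pieces of the toroidal algebra\<close>

lemma Lalg_subspace: "T.subspace (Lalg D)" unfolding Lalg_def by (rule T.subspace_span)

lemma loop_L: "X \<in> gspace D k0 k \<Longrightarrow> loop_elt X k0 k \<in> Lalg D"
  unfolding Lalg_def by (intro T.span_base) blast

lemma K_L: "f \<in> Am D \<Longrightarrow> K_elt f \<in> Lalg D"
  unfolding Lalg_def by (intro T.span_base) blast

lemma d_L: "d0_elt \<in> Lalg D"
  unfolding Lalg_def by (intro T.span_base) blast

lemma Lzero_eq: "Lzero D = T.span ({loop_elt X 0 k | X k. X \<in> gspace_wt D 0 k zero_wt} \<union> {K_elt f | f. f \<in> Am D} \<union> {d0_elt})"
  by (simp add: Lzero_def root_space_def Un_assoc)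

lemma Lzero_subspace: "T.subspace (Lzero D)" unfolding Lzero_eq by (rule T.subspace_span)

lemma loop_Lzero: "X \<in> gspace_wt D 0 k zero_wt \<Longrightarrow> loop_elt X 0 k \<in> Lzero D"
  and K_Lzero: "f \<in> Am D \<Longrightarrow> K_elt f \<in> Lzero D" and d_Lzero: "d0_elt \<in> Lzero D"
  unfolding Lzero_eq by (auto intro!: T.span_base)

lemma root_space_Lalg: "root_space D \<alpha> k0 \<subseteq> Lalg D"
  unfolding root_space_def
  by (rule T.span_minimal[OF _ Lalg_subspace]) (auto simp: gspace_wt_eq loop_L K_L d_L split: if_splits)

lemma Lzero_Lalg: "Lzero D \<subseteq> Lalg D" unfolding Lzero_def by (rule root_space_Lalg)

lemma Lplus_subspace: "T.subspace (Lplus D)" unfolding Lplus_def by (rule T.subspace_span)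

lemma Lplus_Lalg: "Lplus D \<subseteq> Lalg D"
  unfolding Lplus_def by (rule T.span_minimal[OF _ Lalg_subspace]) (use root_space_Lalg in blast)

lemma loop_Lplus:
  assumes "X \<in> gspace_wt D k0 k \<alpha>" "\<alpha> \<in> dualH" "k0 > 0 \<or> k0 = 0 \<and> pos \<alpha>"
  shows "loop_elt X k0 k \<in> Lplus D"
proof -
  have "loop_elt X k0 k \<in> root_space D \<alpha> k0"
    unfolding root_space_def using assms(1) by (intro T.span_base) blast
  then show ?thesis unfolding Lplus_def using assms(2,3) by (intro T.span_base) blast
qed

lemma Lborel_Lalg: "Lborel D \<subseteq> Lalg D"
  unfolding Lborel_def using Lplus_Lalg Lzero_Lalg T.subspace_add[OF Lalg_subspace] by blast

lemma Lplus_coeff: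
  assumes "z \<in> Lplus D"
  shows "fst (snd z) = 0 \<and> snd (snd z) = 0 \<and> (\<forall>k. Poly_Mapping.lookup (fst z) (0, k) \<in> span {x. \<exists>\<alpha>\<in>dualH. pos \<alpha> \<and> x \<in> wtv \<alpha>})"
proof -
  let ?S = "span {x. \<exists>\<alpha>\<in>dualH. pos \<alpha> \<and> x \<in> wtv \<alpha>}"
  let ?P = "{z :: ('g, 'n) toroidal. fst (snd z) = 0 \<and> snd (snd z) = 0 \<and> (\<forall>k. Poly_Mapping.lookup (fst z) (0, k) \<in> ?S)}"
  have P: "T.subspace ?P"
    by (rule T.subspaceI)
      (auto simp: tscale_def lookup_add lookup_pscale span_zero span_add span_scale split: prod.splits)
  have "root_space D \<alpha> k0 \<subseteq> ?P" if a: "\<alpha> \<in> dualH" "k0 > 0 \<or> k0 = 0 \<and> pos \<alpha>" for \<alpha> k0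
    unfolding root_space_def
  proof (rule T.span_minimal[OF _ P], rule subsetI)
    have "\<not> (\<alpha> = zero_wt \<and> k0 = 0)" using a(2) by (auto simp: positive_wt_def)
    moreover fix z assume "z \<in> {loop_elt X k0 k | X k. X \<in> gspace_wt D k0 k \<alpha>} \<union>
      (if \<alpha> = zero_wt \<and> k0 = 0 then {K_elt f | f. f \<in> Am D} \<union> {d0_elt} else {})"
    ultimately obtain X k where z: "z = loop_elt X k0 k" "X \<in> gspace_wt D k0 k \<alpha>" by (auto split: if_splits)
    have "X \<in> ?S" if "k0 = 0" using z(2) a that by (intro span_base) (auto simp: gspace_wt_eq)
    then show "z \<in> ?P" unfolding z(1) by (auto simp: lookup_single when_def span_zero)
  qed
  then have "Lplus D \<subseteq> ?P" unfolding Lplus_def by (intro T.span_minimal[OF _ P]) blast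
  then show ?thesis using assms by blast
qed

lemma Lplus_degree: "z \<in> Lzero D \<Longrightarrow> k0 \<noteq> 0 \<Longrightarrow> Poly_Mapping.lookup (fst z) (k0, k) = 0"
  and Lzero_coeff: "z \<in> Lzero D \<Longrightarrow> Poly_Mapping.lookup (fst z) (0, k) \<in> wtv zero_wt"
proof -
  let ?P = "{z :: ('g, 'n) toroidal. \<forall>k0 k. (k0 \<noteq> 0 \<longrightarrow> Poly_Mapping.lookup (fst z) (k0, k) = 0)
    \<and> Poly_Mapping.lookup (fst z) (0, k) \<in> wtv zero_wt}"
  have P: "T.subspace ?P"
    by (rule T.subspaceI) (auto simp: tscale_def lookup_add lookup_pscale subspace_0[OF subspace_wtv]
        subspace_add[OF subspace_wtv] subspace_scale[OF subspace_wtv] split: prod.splits)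
  have "Lzero D \<subseteq> ?P" unfolding Lzero_eq
  proof (rule T.span_minimal[OF _ P], rule subsetI)
    fix z assume "z \<in> {loop_elt X 0 k | X k. X \<in> gspace_wt D 0 k zero_wt} \<union> {K_elt f | f. f \<in> Am D} \<union> {d0_elt}"
    then consider X k where "z = loop_elt X 0 k" "X \<in> wtv zero_wt" | "fst z = 0" by (auto simp: gspace_wt_eq)
    then show "z \<in> ?P"
      by cases (auto simp: lookup_single when_def subspace_0[OF subspace_wtv])
  qed
  then show "z \<in> Lzero D \<Longrightarrow> k0 \<noteq> 0 \<Longrightarrow> Poly_Mapping.lookup (fst z) (k0, k) = 0"
    "z \<in> Lzero D \<Longrightarrow> Poly_Mapping.lookup (fst z) (0, k) \<in> wtv zero_wt" by auto
qed

text \<open>This gives the uniqueness on which the description operator in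
  \<open>extend_by_zero\<close> depends. \<open>Lzero\<close> has t_0-degree and weight zero, while
  the coefficients of t_0-degree zero in \<open>Lplus\<close> are sums of vectors of positive
  weight.\<close>

lemma Lplus_Lzero: assumes "z \<in> Lplus D" "z \<in> Lzero D" shows "z = 0"
proof -
  have "Poly_Mapping.lookup (fst z) p = 0" for p
  proof (cases "fst p = 0")
    case True
    let ?x = "Poly_Mapping.lookup (fst z) p" and ?S = "{x. \<exists>\<alpha>\<in>dualH. pos \<alpha> \<and> x \<in> wtv \<alpha>}"
    obtain k where p: "p = (0, k)" using True by (cases p) auto
    have "?x \<in> span ?S" unfolding p using Lplus_coeff[OF assms(1)] by blast
    moreover have w: "?x \<in> wtv zero_wt" unfolding p by (rule Lzero_coeff[OF assms(2)])
    ultimately have "?x \<in> span (?S \<inter> wtv zero_wt)" by (intro weight_part[OF _ _ w dual_zero]) blast+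
    moreover have "?S \<inter> wtv zero_wt \<subseteq> {0}"
    proof
      fix x assume "x \<in> ?S \<inter> wtv zero_wt"
      then obtain \<alpha> where "\<alpha> \<in> dualH" "pos \<alpha>" "x \<in> wtv \<alpha>" "x \<in> wtv zero_wt" by blast
      then show "x \<in> {0}" using wtv_unique[of x \<alpha> zero_wt] dual_zero by (auto simp: positive_wt_def)
    qed
    ultimately show ?thesis using span_mono[of "?S \<inter> wtv zero_wt" "{0}"] by auto
  next
    case False
    then show ?thesis using Lplus_degree[OF assms(2), of "fst p" "snd p"] by simp
  qed
  then have "fst z = 0" by (intro poly_mapping_eqI) simp
  then show ?thesis using Lplus_coeff[OF assms(1)] by (simp add: prod_eq_iff)
qed

lemma borel_component:
  assumes "x \<in> Lplus D" "y \<in> Lzero D"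
  shows "mact (extend_by_zero D N) (x + y) = mact N y"
proof -
  have "(THE y'. y' \<in> Lzero D \<and> x + y - y' \<in> Lplus D) = y"
  proof (rule the_equality)
    fix y' assume y': "y' \<in> Lzero D \<and> x + y - y' \<in> Lplus D"
    then have "(x + y - y') - x \<in> Lplus D" using assms(1) T.subspace_diff[OF Lplus_subspace] by blast
    then have "y - y' \<in> Lplus D" by (simp add: algebra_simps)
    moreover have "y - y' \<in> Lzero D" using assms(2) y' T.subspace_diff[OF Lzero_subspace] by blast
    ultimately have "y - y' = 0" by (rule Lplus_Lzero)
    then show "y' = y" by simp
  qed (use assms in simp)
  then show ?thesis by (simp add: extend_by_zero_def)
qed

lemma borel_zero_component: "y \<in> Lzero D \<Longrightarrow> mact (extend_by_zero D N) y = mact N y"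
  using borel_component[OF T.subspace_0[OF Lplus_subspace], of y N] by simp

lemma borel_plus_component: "x \<in> Lplus D \<Longrightarrow> mact (extend_by_zero D N) x = mact N 0"
  using borel_component[OF _ T.subspace_0[OF Lzero_subspace], of x N] by simp

lemma Lzero_Lborel: "Lzero D \<subseteq> Lborel D" and Lplus_Lborel: "Lplus D \<subseteq> Lborel D"
proof -
  show "Lzero D \<subseteq> Lborel D"
  proof
    fix y assume "y \<in> Lzero D"
    then show "y \<in> Lborel D" unfolding Lborel_def
      using T.subspace_0[OF Lplus_subspace] by (intro CollectI exI[of _ 0] exI[of _ y]) simp
  qed
  show "Lplus D \<subseteq> Lborel D"
  proof
    fix x assume "x \<in> Lplus D"
    then show "x \<in> Lborel D" unfolding Lborel_def
      using T.subspace_0[OF Lzero_subspace] by (intro CollectI exI[of _ x] exI[of _ 0]) simp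
  qed
qed

lemma Lalg_center_Am: assumes "z \<in> Lalg D" shows "fst (snd z) \<in> Am D"
proof -
  have "T.subspace {z. fst (snd z) \<in> Am D}"
  proof (rule T.subspaceI)
    show "tscale D c x \<in> {z. fst (snd z) \<in> Am D}" if "x \<in> {z. fst (snd z) \<in> Am D}" for c x
      using that by (auto simp: tscale_def Am_def in_keys_iff lookup_pscale split: prod.splits)
  qed (auto simp: Am_zero Am_add)
  then have "Lalg D \<subseteq> {z. fst (snd z) \<in> Am D}"
    unfolding Lalg_def by (intro T.span_minimal) (auto simp: Am_zero)
  then show ?thesis using assms by blast
qed

text \<open>Closure under the bracket forces the form to be compatible with the grading. The central term
  vanishes in degree \<open>k\<^sub>0 = 0\<close>, so the degrees are first shifted by the order of \<open>\<sigma>\<^sub>0\<close>.\<close>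

lemma closed_form_lattice:
  assumes cl: "\<And>x y. x \<in> Lalg D \<Longrightarrow> y \<in> Lalg D \<Longrightarrow> tbracket D x y \<in> Lalg D"
    and X: "X \<in> gspace D k0 k" and Y: "Y \<in> gspace D (- k0) l" and n: "form D X Y \<noteq> 0"
  shows "int (ord D (Some i)) dvd (k + l) $ i"
proof -
  define k1 where "k1 = (if k0 = 0 then int (ord D None) else k0)"
  have k1: "k1 \<noteq> 0" using ord_pos[of None] by (simp add: k1_def)
  have "gspace D k0 k = gspace D k1 k" "gspace D (- k0) l = gspace D (- k1) l"
    by (auto intro!: gspace_periodic simp: k1_def)
  then have "loop_elt X k1 k \<in> Lalg D" "loop_elt Y (- k1) l \<in> Lalg D" using X Y loop_L by blast+
  from Lalg_center_Am[OF cl[OF this]] have "Poly_Mapping.single (k + l) (of_int k1 * form D X Y) \<in> Am D"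
    by (simp add: tbracket_loop)
  then show ?thesis using k1 n by (auto simp: Am_def)
qed

end

section \<open>The highest weight module\<close>

text \<open>The output of \<open>typed_irreducible_quotient\<close> together with the hypotheses on
  \<open>N\<close> and \<open>V\<close>: \<phi> identifies \<open>V0\<close> with \<open>V\<close>,
  \<rho> is the action transported to \<open>V0\<close>, and \<open>j\<close> sends n to the class
  of 1 \<otimes> n.\<close>

locale highest_weight_quotient = lie_torus_data D + M: complex_vector_space sM
  for D :: "('g::ab_group_add, 'n::finite) multiloop" and sM :: "complex \<Rightarrow> 'v::ab_group_add \<Rightarrow> 'v" +
  fixes N :: "(('g, 'n) toroidal, 'w) lie_mod" and V :: "(('g, 'n) toroidal, 'x) lie_mod"
    and V0 :: "'v set" and \<rho> :: "('g, 'n) toroidal \<Rightarrow> 'v \<Rightarrow> 'v" and \<phi> :: "'v \<Rightarrow> 'x" and j :: "'w \<Rightarrow> 'v"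
  assumes closed: "x \<in> Lalg D \<Longrightarrow> y \<in> Lalg D \<Longrightarrow> tbracket D x y \<in> Lalg D"
    and N_module: "lie_module (tscale D) (tbracket D) (Lzero D) N"
    and N_fin: "mfin_dim N (mcar N)" and N_irr: "irreducible_module (Lzero D) N"
    and integrable: "integrable_module D V"
    and V0_subspace: "M.subspace V0" and \<rho>_endo: "x \<in> Lalg D \<Longrightarrow> M.endo (\<rho> x)"
    and \<rho>_V0: "x \<in> Lalg D \<Longrightarrow> \<rho> x v \<in> V0"
    and \<rho>_add: "x \<in> Lalg D \<Longrightarrow> y \<in> Lalg D \<Longrightarrow> \<rho> (x + y) v = \<rho> x v + \<rho> y v"
    and \<rho>_scale: "x \<in> Lalg D \<Longrightarrow> \<rho> (tscale D c x) v = sM c (\<rho> x v)"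
    and \<rho>_br: "x \<in> Lalg D \<Longrightarrow> y \<in> Lalg D \<Longrightarrow> \<rho> (tbracket D x y) v = \<rho> x (\<rho> y v) - \<rho> y (\<rho> x v)"
    and \<rho>_irr: "M.subspace W \<Longrightarrow> W \<subseteq> V0 \<Longrightarrow> (\<And>x w. x \<in> Lalg D \<Longrightarrow> w \<in> W \<Longrightarrow> \<rho> x w \<in> W) \<Longrightarrow> W = {0} \<or> W = V0"
    and j_V0: "n \<in> mcar N \<Longrightarrow> j n \<in> V0"
    and j_add: "n \<in> mcar N \<Longrightarrow> n' \<in> mcar N \<Longrightarrow> j (madd N n n') = j n + j n'"
    and j_scale: "n \<in> mcar N \<Longrightarrow> j (mscale N c n) = sM c (j n)"
    and \<rho>_j: "x \<in> Lborel D \<Longrightarrow> n \<in> mcar N \<Longrightarrow> \<rho> x (j n) = j (mact (extend_by_zero D N) x n)"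
    and j_nonzero: "\<exists>n\<in>mcar N. j n \<noteq> 0"
    and \<phi>_inj: "inj_on \<phi> V0" and \<phi>_image: "\<phi> ` V0 = mcar V"
    and \<phi>_add: "u \<in> V0 \<Longrightarrow> v \<in> V0 \<Longrightarrow> \<phi> (u + v) = madd V (\<phi> u) (\<phi> v)"
    and \<phi>_scale: "v \<in> V0 \<Longrightarrow> \<phi> (sM c v) = mscale V c (\<phi> v)" and \<phi>_zero: "\<phi> 0 = mzero V"
    and \<phi>_\<rho>: "x \<in> Lalg D \<Longrightarrow> v \<in> V0 \<Longrightarrow> \<phi> (\<rho> x v) = mact V x (\<phi> v)"
begin

interpretation T: complex_vector_space "tscale D"
  by (simp add: complex_vector_space_def vector_space_tscale)

text \<open>Zero outside the lattice, where K t^\<gamma> does not belong to the algebra. The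
  commutator formula stays uniform, because a nonzero value of the form in opposite t_0-degrees
  forces the sum of the degrees into the lattice.\<close>

definition cK :: "int^'n \<Rightarrow> 'v \<Rightarrow> 'v" where
  "cK \<gamma> v = (if \<forall>i. int (ord D (Some i)) dvd \<gamma> $ i then \<rho> (K_elt (Poly_Mapping.single \<gamma> 1)) v else 0)"

lemma N_act: "x \<in> Lzero D \<Longrightarrow> n \<in> mcar N \<Longrightarrow> mact N x n \<in> mcar N"
  by (rule lie_module_facts(2)[OF N_module])

lemma N_space: "mzero N \<in> mcar N" "u \<in> mcar N \<Longrightarrow> v \<in> mcar N \<Longrightarrow> madd N u v \<in> mcar N"
  "v \<in> mcar N \<Longrightarrow> mscale N c v \<in> mcar N" "v \<in> mcar N \<Longrightarrow> madd N (mzero N) v = v"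
  using lie_module_facts(1)[OF N_module] unfolding complex_space_def by blast+

lemma j_zero: "j (mzero N) = 0"
  using j_add[OF N_space(1) N_space(1)] N_space(4)[OF N_space(1)] by simp

lemma K_single_L: "\<forall>i. int (ord D (Some i)) dvd \<gamma> $ i \<Longrightarrow> K_elt (Poly_Mapping.single \<gamma> c) \<in> Lalg D"
  by (intro K_L Am_single) simp

lemma \<rho>_zero: "\<rho> 0 v = 0"
  using \<rho>_scale[OF T.subspace_0[OF Lalg_subspace], of 0 v] by simp

lemma \<rho>_span:
  assumes x: "x \<in> T.span S" and S: "S \<subseteq> Lalg D" and W: "M.subspace W" and gen: "\<And>y. y \<in> S \<Longrightarrow> \<rho> y v \<in> W"
  shows "\<rho> x v \<in> W"
proof -
  have "T.subspace {x \<in> Lalg D. \<rho> x v \<in> W}"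
    by (rule T.subspaceI)
      (auto simp: \<rho>_zero \<rho>_add \<rho>_scale intro: M.subspace_0[OF W] M.subspace_add[OF W] M.subspace_scale[OF W]
        T.subspace_0[OF Lalg_subspace] T.subspace_add[OF Lalg_subspace] T.subspace_scale[OF Lalg_subspace])
  then have "T.span S \<subseteq> {x \<in> Lalg D. \<rho> x v \<in> W}" using S gen by (intro T.span_minimal) auto
  then show ?thesis using x by blast
qed

lemma \<rho>_sum:
  assumes "\<And>s. s \<in> A \<Longrightarrow> g s \<in> Lalg D"
  shows "\<rho> (\<Sum>s\<in>A. tscale D (c s) (g s)) v = (\<Sum>s\<in>A. sM (c s) (\<rho> (g s) v))"
  using assms
proof (induction A rule: infinite_finite_induct)
  case (insert a A)
  have "tscale D (c a) (g a) \<in> Lalg D" by (rule T.subspace_scale[OF Lalg_subspace]) (simp add: insert.prems)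
  moreover have "(\<Sum>s\<in>A. tscale D (c s) (g s)) \<in> Lalg D"
    by (intro T.subspace_sum[OF Lalg_subspace] T.subspace_scale[OF Lalg_subspace]) (simp add: insert.prems)
  ultimately show ?case using insert by (simp add: \<rho>_add \<rho>_scale)
qed (simp_all add: \<rho>_zero)

lemma \<rho>_K_elt:
  assumes f: "f \<in> Am D"
  shows "\<rho> (K_elt f) v = (\<Sum>s\<in>Poly_Mapping.keys f. sM (Poly_Mapping.lookup f s) (cK s v))"
proof -
  have l: "\<forall>i. int (ord D (Some i)) dvd s $ i" if "s \<in> Poly_Mapping.keys f" for s using f that by (auto simp: Am_def)
  have "\<rho> (K_elt f) v = (\<Sum>s\<in>Poly_Mapping.keys f. sM (Poly_Mapping.lookup f s) (\<rho> (K_elt (Poly_Mapping.single s 1)) v))"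
    by (subst K_elt_decomp) (rule \<rho>_sum[OF K_single_L[OF l]])
  then show ?thesis using l by (auto simp: cK_def intro!: sum.cong)
qed

lemma gspace_shift: "f \<in> Am D \<Longrightarrow> s \<in> Poly_Mapping.keys f \<Longrightarrow> gspace D k0 (k + s) = gspace D k0 k"
  by (rule gspace_periodic) (auto simp: Am_def)

lemma loop_mult_L:
  assumes "X \<in> gspace D k0 k" and "f \<in> Am D"
  shows "loop_mult D X k0 k f \<in> Lalg D"
  unfolding loop_mult_decomp
  by (intro T.subspace_sum[OF Lalg_subspace] T.subspace_scale[OF Lalg_subspace] loop_L) (simp add: assms(1) gspace_shift[OF assms(2)])

lemma \<rho>_loop_mult:
  assumes "X \<in> gspace D k0 k" and "f \<in> Am D"
  shows "\<rho> (loop_mult D X k0 k f) v =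
    (\<Sum>s\<in>Poly_Mapping.keys f. sM (Poly_Mapping.lookup f s) (\<rho> (loop_elt X k0 (k + s)) v))"
  unfolding loop_mult_decomp by (rule \<rho>_sum[OF loop_L]) (simp add: assms(1) gspace_shift[OF assms(2)])

lemma \<rho>_comm:
  assumes X: "X \<in> gspace D k0 k" and Y: "Y \<in> gspace D l0 l"
  shows "\<rho> (loop_elt X k0 k) (\<rho> (loop_elt Y l0 l) v) = \<rho> (loop_elt Y l0 l) (\<rho> (loop_elt X k0 k) v)
    + \<rho> (loop_elt (br X Y) (k0 + l0) (k + l)) v
    + (if k0 + l0 = 0 then sM (of_int k0 * form D X Y) (cK (k + l) v) else 0)"
proof -
  let ?c = "of_int k0 * form D X Y"
  let ?K = "if k0 + l0 = 0 then K_elt (Poly_Mapping.single (k + l) ?c) else (0 :: ('g, 'n) toroidal)"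
  have "?K \<in> Lalg D \<and> \<rho> ?K v = (if k0 + l0 = 0 then sM ?c (cK (k + l) v) else 0)"
  proof (cases "k0 + l0 = 0 \<and> form D X Y \<noteq> 0")
    case True
    then have "l0 = - k0" by simp
    then have "Y \<in> gspace D (- k0) l" using Y by simp
    then have l: "\<forall>i. int (ord D (Some i)) dvd (k + l) $ i"
      using closed_form_lattice[OF closed X] True by blast
    have "\<rho> (K_elt (Poly_Mapping.single (k + l) ?c)) v = sM ?c (cK (k + l) v)"
      using l unfolding K_scale[of _ ?c] by (subst \<rho>_scale[OF K_single_L[OF l]]) (simp add: cK_def)
    then show ?thesis using K_single_L[OF l] True by simp
  next
    case False
    then have "?K = 0" by (auto simp: zero_prod_def)
    then show ?thesis using False by (auto simp: \<rho>_zero T.subspace_0[OF Lalg_subspace])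
  qed
  moreover have "\<rho> (loop_elt (br X Y) (k0 + l0) (k + l) + ?K) v =
      \<rho> (loop_elt X k0 k) (\<rho> (loop_elt Y l0 l) v) - \<rho> (loop_elt Y l0 l) (\<rho> (loop_elt X k0 k) v)"
    unfolding tbracket_loop[symmetric] by (rule \<rho>_br[OF loop_L[OF X] loop_L[OF Y]])
  ultimately show ?thesis
    using \<rho>_add[OF loop_L[OF br_gspace[OF X Y]], of ?K v] by (simp add: algebra_simps)
qed

lemma \<rho>_central: "x \<in> Lalg D \<Longrightarrow> f \<in> Am D \<Longrightarrow> \<rho> (K_elt f) (\<rho> x v) = \<rho> x (\<rho> (K_elt f) v)"
  using \<rho>_br[OF K_L, of f x v] by (simp add: tbracket_K \<rho>_zero)

lemma cK_central: "x \<in> Lalg D \<Longrightarrow> cK \<gamma> (\<rho> x v) = \<rho> x (cK \<gamma> v)"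
  by (simp add: cK_def \<rho>_central Am_single M.endo_zero[OF \<rho>_endo])

lemma \<rho>_d:
  assumes X: "X \<in> gspace D k0 k"
  shows "\<rho> d0_elt (\<rho> (loop_elt X k0 k) v) = \<rho> (loop_elt X k0 k) (\<rho> d0_elt v) + sM (of_int k0) (\<rho> (loop_elt X k0 k) v)"
  using \<rho>_br[OF d_L loop_L[OF X], of v]
  unfolding tbracket_d_loop loop_scale \<rho>_scale[OF loop_L[OF X]] by (simp add: algebra_simps)

lemma \<rho>_stable:
  assumes W: "M.subspace W"
    and "\<And>X k0 k v. X \<in> gspace D k0 k \<Longrightarrow> v \<in> W \<Longrightarrow> \<rho> (loop_elt X k0 k) v \<in> W"
    and "\<And>\<gamma> v. \<forall>i. int (ord D (Some i)) dvd \<gamma> $ i \<Longrightarrow> v \<in> W \<Longrightarrow> cK \<gamma> v \<in> W"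
    and "\<And>v. v \<in> W \<Longrightarrow> \<rho> d0_elt v \<in> W"
    and x: "x \<in> Lalg D" and v: "v \<in> W"
  shows "\<rho> x v \<in> W"
  using x unfolding Lalg_def
proof (rule \<rho>_span[OF _ _ W])
  have "\<rho> (K_elt f) v \<in> W" if f: "f \<in> Am D" for f
    unfolding \<rho>_K_elt[OF f] using f v assms(3) by (intro M.subspace_sum[OF W] M.subspace_scale[OF W]) (auto simp: Am_def)
  then show "\<rho> y v \<in> W" if "y \<in> {loop_elt X k0 k | X k0 k. X \<in> gspace D k0 k} \<union> {K_elt f | f. f \<in> Am D} \<union> {d0_elt}" for y
    using that assms(2,4) v by auto
qed (auto simp: loop_L K_L d_L)

lemma \<rho>_zero_stable:
  assumes W: "M.subspace W"
    and "\<And>X k v. X \<in> gspace_wt D 0 k zero_wt \<Longrightarrow> v \<in> W \<Longrightarrow> \<rho> (loop_elt X 0 k) v \<in> W"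
    and "\<And>\<gamma> v. \<forall>i. int (ord D (Some i)) dvd \<gamma> $ i \<Longrightarrow> v \<in> W \<Longrightarrow> cK \<gamma> v \<in> W"
    and "\<And>v. v \<in> W \<Longrightarrow> \<rho> d0_elt v \<in> W"
    and x: "x \<in> Lzero D" and v: "v \<in> W"
  shows "\<rho> x v \<in> W"
  using x unfolding Lzero_eq
proof (rule \<rho>_span[OF _ _ W])
  have "\<rho> (K_elt f) v \<in> W" if f: "f \<in> Am D" for f
    unfolding \<rho>_K_elt[OF f] using f v assms(3) by (intro M.subspace_sum[OF W] M.subspace_scale[OF W]) (auto simp: Am_def)
  then show "\<rho> y v \<in> W" if "y \<in> {loop_elt X 0 k | X k. X \<in> gspace_wt D 0 k zero_wt} \<union> {K_elt f | f. f \<in> Am D} \<union> {d0_elt}" for y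
    using that assms(2,4) v by auto
qed (auto simp: loop_L K_L d_L gspace_wt_eq)

lemma \<rho>_Lzero_j: "x \<in> Lzero D \<Longrightarrow> n \<in> mcar N \<Longrightarrow> \<rho> x (j n) = j (mact N x n)"
  using \<rho>_j[of x n] Lzero_Lborel by (auto simp: borel_zero_component)

lemma \<rho>_Lplus_j:
  assumes x: "x \<in> Lplus D" and n: "n \<in> mcar N" shows "\<rho> x (j n) = 0"
proof -
  \<comment> \<open>\<open>extend_by_zero\<close> lets \<open>Lplus\<close> act like the element 0
    of \<open>Lzero\<close>, and \<rho> turns this into the zero operator.\<close>
  have "\<rho> x (j n) = j (mact N 0 n)" using \<rho>_j[of x n] x n Lplus_Lborel by (auto simp: borel_plus_component)
  also have "\<dots> = 0" using \<rho>_Lzero_j[OF T.subspace_0[OF Lzero_subspace] n] by (simp add: \<rho>_zero)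
  finally show ?thesis .
qed

section \<open>The top of the module\<close>

abbreviation N0 :: "'v set" where "N0 \<equiv> j ` mcar N"

lemma N0_subspace: "M.subspace N0"
proof (rule M.subspaceI)
  show "0 \<in> N0" using j_zero N_space(1) by (metis image_eqI)
  show "x + y \<in> N0" if "x \<in> N0" "y \<in> N0" for x y
    using that j_add N_space(2) by (auto simp: image_iff) metis
  show "sM c x \<in> N0" if "x \<in> N0" for c x
    using that j_scale N_space(3) by (auto simp: image_iff) metis
qed

lemma N0_fin: "\<exists>B. finite B \<and> N0 \<subseteq> M.span B"
proof -
  obtain B where B: "finite B" "B \<subseteq> mcar N" "mspan N B = mcar N" using N_fin by (auto simp: mfin_dim_def)
  have "msubspace N {n \<in> mcar N. j n \<in> M.span (j ` B)}"
    by (auto simp: msubspace_def N_space j_zero j_add j_scale M.span_zero M.span_add M.span_scale)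
  then have "mspan N B \<subseteq> {n \<in> mcar N. j n \<in> M.span (j ` B)}"
    unfolding mspan_def using B(2) by (intro Inter_lower) (auto intro: M.span_base)
  then have "N0 \<subseteq> M.span (j ` B)" unfolding B(3) by blast
  then show ?thesis using B(1) by blast
qed

lemma N0_stable: "x \<in> Lzero D \<Longrightarrow> n \<in> N0 \<Longrightarrow> \<rho> x n \<in> N0"
  using \<rho>_Lzero_j[of x] N_act[of x] by auto

lemma cK_N0: "\<forall>i. int (ord D (Some i)) dvd \<gamma> $ i \<Longrightarrow> n \<in> N0 \<Longrightarrow> cK \<gamma> n \<in> N0"
  using N0_stable[OF K_Lzero[OF Am_single]] by (simp add: cK_def)

lemma N0_irreducible:
  assumes W: "M.subspace W" "W \<subseteq> N0" and st: "\<And>x v. x \<in> Lzero D \<Longrightarrow> v \<in> W \<Longrightarrow> \<rho> x v \<in> W"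
  shows "W = {0} \<or> W = N0"
proof -
  let ?S = "{n \<in> mcar N. j n \<in> W}"
  have "submodule (Lzero D) N ?S"
    using M.subspace_0[OF W(1)] M.subspace_add[OF W(1)] M.subspace_scale[OF W(1)] st
    by (auto simp: submodule_def msubspace_def N_space j_zero j_add j_scale N_act simp flip: \<rho>_Lzero_j)
  then have "?S = {mzero N} \<or> ?S = mcar N" using N_irr by (simp add: irreducible_module_def)
  then show ?thesis
  proof
    assume S: "?S = {mzero N}"
    have "w = 0" if w: "w \<in> W" for w
    proof -
      obtain n where n: "n \<in> mcar N" "w = j n" using w W(2) by blast
      then have "n \<in> ?S" using w by simp
      then show ?thesis unfolding S using n(2) j_zero by simp
    qed
    then show ?thesis using M.subspace_0[OF W(1)] by blast
  qed (use W(2) in blast)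
qed

text \<open>The elements of \<open>htilde\<close> whose eigenvalues tell the top from the lower
  vectors; together with K they span \<open>htilde\<close>.\<close>

definition cartan_elements :: "('g, 'n) toroidal set" where
  "cartan_elements = {loop_elt h 0 0 | h. h \<in> H} \<union> {d0_elt}"

lemma H_zero_wt: "h \<in> H \<Longrightarrow> h \<in> gspace_wt D 0 0 zero_wt"
  using H_sub H_abelian by (auto simp: gspace_wt_eq joint_eigenspace_def)

lemma cartan_elements_Lzero: "cartan_elements \<subseteq> Lzero D"
  unfolding cartan_elements_def using loop_Lzero[OF H_zero_wt] d_Lzero by auto

lemma cartan_elements_htilde: "cartan_elements \<subseteq> htilde D"
proof
  fix x assume "x \<in> cartan_elements"
  then consider h where "h \<in> H" "x = loop_elt h 0 0" | "x = d0_elt" by (auto simp: cartan_elements_def)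
  then show "x \<in> htilde D"
  proof cases
    case 1
    then have "x = (Poly_Mapping.single 0 h, Poly_Mapping.single 0 0, 0)" by (simp add: zero_prod_def)
    then show ?thesis using 1(1) unfolding htilde_def by blast
  next
    case 2
    then have "x = (Poly_Mapping.single 0 0, Poly_Mapping.single 0 0, 1)" by (simp add: zero_prod_def)
    then show ?thesis using subspace_0[OF H_subspace] unfolding htilde_def by blast
  qed
qed

text \<open>The image in \<open>V\<close> of the span of the eigenvectors contains all weight
  spaces, hence is \<open>V\<close>; injectivity of \<phi> carries this back to
  \<open>V0\<close>.\<close>

lemma V0_weights:
  "V0 \<subseteq> M.span {v \<in> V0. \<exists>ev. (\<forall>x. x \<notin> cartan_elements \<longrightarrow> ev x = 0) \<and> v \<in> M.joint_eigenspace cartan_elements \<rho> ev}"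
    (is "_ \<subseteq> M.span ?S")
proof -
  have sV: "M.span ?S \<subseteq> V0" by (rule M.span_minimal[OF _ V0_subspace]) blast
  have "msubspace V (\<phi> ` M.span ?S)"
    unfolding msubspace_def
  proof (intro conjI ballI allI)
    show "\<phi> ` M.span ?S \<subseteq> mcar V" using sV \<phi>_image by blast
    show "mzero V \<in> \<phi> ` M.span ?S" unfolding \<phi>_zero[symmetric] by (rule imageI[OF M.span_zero])
    fix u assume "u \<in> \<phi> ` M.span ?S"
    then obtain a where a: "a \<in> M.span ?S" "u = \<phi> a" by blast
    show "madd V u v \<in> \<phi> ` M.span ?S" if "v \<in> \<phi> ` M.span ?S" for v
    proof -
      obtain b where b: "b \<in> M.span ?S" "v = \<phi> b" using \<open>v \<in> \<phi> ` M.span ?S\<close> by blast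
      have "a \<in> V0" "b \<in> V0" using a(1) b(1) sV by blast+
      then have "madd V u v = \<phi> (a + b)" by (simp only: a(2) b(2) \<phi>_add)
      then show ?thesis using M.span_add[OF a(1) b(1)] by blast
    qed
    show "mscale V c u \<in> \<phi> ` M.span ?S" for c
    proof -
      have "a \<in> V0" using a(1) sV by blast
      then have "mscale V c u = \<phi> (sM c a)" by (simp only: a(2) \<phi>_scale)
      then show ?thesis using M.span_scale[OF a(1)] by blast
    qed
  qed
  moreover have "mweight_space (htilde D) V lam \<subseteq> \<phi> ` M.span ?S" for lam
  proof
    fix u assume u: "u \<in> mweight_space (htilde D) V lam"
    then obtain v where v: "v \<in> V0" "u = \<phi> v" using \<phi>_image by (auto simp: mweight_space_def)
    have "\<rho> x v = sM (lam x) v" if x: "x \<in> cartan_elements" for x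
    proof -
      have xL: "x \<in> Lalg D" using x cartan_elements_Lzero Lzero_Lalg by blast
      have "x \<in> htilde D" using x cartan_elements_htilde by blast
      then have "\<phi> (\<rho> x v) = \<phi> (sM (lam x) v)"
        using u v by (simp add: \<phi>_\<rho>[OF xL] \<phi>_scale mweight_space_def)
      then show ?thesis by (rule inj_onD[OF \<phi>_inj _ \<rho>_V0[OF xL] M.subspace_scale[OF V0_subspace v(1)]])
    qed
    then have "v \<in> ?S"
      using v(1) by (intro CollectI conjI exI[of _ "\<lambda>x. if x \<in> cartan_elements then lam x else 0"])
        (auto simp: M.joint_eigenspace_def)
    then show "u \<in> \<phi> ` M.span ?S" unfolding v(2) by (intro imageI M.span_base)
  qed
  ultimately have "mspan V (\<Union>lam\<in>dual (tscale D) (htilde D). mweight_space (htilde D) V lam) \<subseteq> \<phi> ` M.span ?S"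
    unfolding mspan_def by (intro Inter_lower) blast
  then have "\<phi> ` V0 \<subseteq> \<phi> ` M.span ?S"
    using integrable \<phi>_image unfolding integrable_module_def weight_module_def by simp
  then show ?thesis using inj_on_image_subset_iff[OF \<phi>_inj order_refl sV] by blast
qed

text \<open>For two loop elements the bracket vanishes because of the weight zero and the central
  term because of the t_0-degree zero; d_0 acts there by zero.\<close>

lemma cartan_central:
  assumes h: "h \<in> cartan_elements" and x: "x \<in> cartan_elements \<union> {loop_elt X 0 k | X k. X \<in> gspace_wt D 0 k zero_wt}"
  shows "\<rho> h (\<rho> x v) = \<rho> x (\<rho> h v)"
proof -
  have L: "h' \<in> gspace D 0 0" if "h' \<in> H" for h' using that H_sub by blast
  have main: "\<rho> (loop_elt h' 0 0) (\<rho> (loop_elt X 0 k) v) = \<rho> (loop_elt X 0 k) (\<rho> (loop_elt h' 0 0) v)"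
    if "h' \<in> H" "X \<in> gspace_wt D 0 k zero_wt" for h' X k
  proof -
    have "X \<in> gspace D 0 k" "br h' X = 0" using that by (auto simp: gspace_wt_eq joint_eigenspace_def)
    then show ?thesis using \<rho>_comm[OF L[OF that(1)], of X 0 k v] by (simp add: \<rho>_zero flip: zero_prod_def)
  qed
  have dm: "\<rho> d0_elt (\<rho> (loop_elt X 0 k) v) = \<rho> (loop_elt X 0 k) (\<rho> d0_elt v)" if "X \<in> gspace_wt D 0 k zero_wt" for X k
    using \<rho>_d[of X 0 k v] that by (simp add: gspace_wt_eq)
  consider h' where "h' \<in> H" "h = loop_elt h' 0 0" | "h = d0_elt" using h by (auto simp: cartan_elements_def)
  moreover have "x = d0_elt \<or> (\<exists>X k. X \<in> gspace_wt D 0 k zero_wt \<and> x = loop_elt X 0 k)"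
    using x H_zero_wt by (auto simp: cartan_elements_def)
  ultimately show ?thesis using main dm H_zero_wt by cases auto
qed

text \<open>\<open>V0\<close> is spanned by joint eigenvectors, so a nonzero vector of the stable
  subspace \<open>N0\<close> has a nonzero eigenvector among its components. Its eigenspace in
  \<open>N0\<close> is stable under \<open>Lzero\<close> by \<open>cartan_central\<close>, and
  irreducibility makes it all of \<open>N0\<close>.\<close>

lemma N0_weight:
  obtains ev where "\<And>x n. x \<in> cartan_elements \<Longrightarrow> n \<in> N0 \<Longrightarrow> \<rho> x n = sM (ev x) n"
proof -
  let ?J = "M.joint_eigenspace cartan_elements \<rho>"
  let ?S = "{v \<in> V0. \<exists>ev. (\<forall>x. x \<notin> cartan_elements \<longrightarrow> ev x = 0) \<and> v \<in> ?J ev}"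
  obtain z where z: "z \<in> N0" "z \<noteq> 0" using j_nonzero by blast
  have zs: "z \<in> M.span ?S" using z(1) j_V0 V0_weights by blast
  have lin: "M.endo (\<rho> x)" if "x \<in> cartan_elements" for x
    using that cartan_elements_Lzero Lzero_Lalg by (intro \<rho>_endo) blast
  have "z \<in> M.span {w \<in> N0. \<exists>ev. (\<forall>x. x \<notin> cartan_elements \<longrightarrow> ev x = 0) \<and> w \<in> ?J ev \<and> w \<in> M.span (?S \<inter> ?J ev)}"
  proof (rule M.eigen_vectors_in_invariant[OF _ lin N0_subspace _ zs z(1)])
    show "\<rho> x n \<in> N0" if "x \<in> cartan_elements" "n \<in> N0" for x n
      using that cartan_elements_Lzero by (intro N0_stable) auto
  qed auto
  moreover have "M.span {0 :: 'v} = {0}" by simp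
  ultimately have "\<not> {w \<in> N0. \<exists>ev. (\<forall>x. x \<notin> cartan_elements \<longrightarrow> ev x = 0) \<and> w \<in> ?J ev \<and> w \<in> M.span (?S \<inter> ?J ev)} \<subseteq> {0}"
    using z(2) M.span_mono by blast
  then obtain w ev where w: "w \<in> N0" "w \<noteq> 0" "w \<in> ?J ev" by blast
  let ?W = "N0 \<inter> ?J ev"
  have "?W = {0} \<or> ?W = N0"
  proof (rule N0_irreducible)
    have sW: "M.subspace ?W" by (intro M.subspace_inter N0_subspace M.subspace_joint_eigenspace lin)
    then show "M.subspace ?W" .
    show "\<rho> x v \<in> ?W" if xv: "x \<in> Lzero D" "v \<in> ?W" for x v
    proof (rule \<rho>_zero_stable[OF sW _ _ _ xv])
      show "\<rho> (loop_elt X 0 k) v \<in> ?W" if X: "X \<in> gspace_wt D 0 k zero_wt" and v: "v \<in> ?W" for X k v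
      proof -
        have "\<rho> x (\<rho> (loop_elt X 0 k) v) = sM (ev x) (\<rho> (loop_elt X 0 k) v)" if x: "x \<in> cartan_elements" for x
          using cartan_central[OF x, of "loop_elt X 0 k" v] X v x M.endo_scale[OF \<rho>_endo[OF loop_L[of X 0 k]]]
          by (auto simp: M.joint_eigenspace_def gspace_wt_eq)
        then show ?thesis using N0_stable[OF loop_Lzero[OF X]] v by (auto simp: M.joint_eigenspace_def)
      qed
      show "cK \<gamma> v \<in> ?W" if g: "\<forall>i. int (ord D (Some i)) dvd \<gamma> $ i" and v: "v \<in> ?W" for \<gamma> v
      proof -
        have "\<rho> x (cK \<gamma> v) = sM (ev x) (cK \<gamma> v)" if x: "x \<in> cartan_elements" for x
        proof -
          have "\<rho> x (cK \<gamma> v) = cK \<gamma> (\<rho> x v)" using x cartan_elements_Lzero Lzero_Lalg by (intro cK_central[symmetric]) blast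
          also have "\<dots> = cK \<gamma> (sM (ev x) v)" using v x by (simp add: M.joint_eigenspace_def)
          also have "\<dots> = sM (ev x) (cK \<gamma> v)" using g M.endo_scale[OF \<rho>_endo[OF K_single_L[OF g]]] by (simp add: cK_def)
          finally show ?thesis .
        qed
        then show ?thesis using cK_N0[OF g] v by (auto simp: M.joint_eigenspace_def)
      qed
      show "\<rho> d0_elt v \<in> ?W" if v: "v \<in> ?W" for v
      proof -
        have d: "d0_elt \<in> cartan_elements" by (simp add: cartan_elements_def)
        have "\<rho> x (\<rho> d0_elt v) = sM (ev x) (\<rho> d0_elt v)" if x: "x \<in> cartan_elements" for x
          using cartan_central[OF x, of d0_elt v] d v x M.endo_scale[OF \<rho>_endo[OF d_L]]
          by (simp add: M.joint_eigenspace_def)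
        then show ?thesis using N0_stable[OF d_Lzero] v by (auto simp: M.joint_eigenspace_def)
      qed
    qed
  qed blast
  then have "?W = N0" using w by blast
  then have "\<rho> x n = sM (ev x) n" if "x \<in> cartan_elements" "n \<in> N0" for x n
    using that by (auto simp: M.joint_eigenspace_def)
  then show thesis by (rule that)
qed

lemma loop_mult_root_space:
  assumes X: "X \<in> gspace_wt D k0 k \<alpha>" and f: "f \<in> Am D"
  shows "loop_mult D X k0 k f \<in> root_space D \<alpha> k0"
  unfolding loop_mult_decomp root_space_def
proof (intro T.span_sum T.span_scale T.span_base UnI1)
  fix s assume "s \<in> Poly_Mapping.keys f"
  then have "X \<in> gspace_wt D k0 (k + s) \<alpha>" using X by (simp add: gspace_wt_eq gspace_shift[OF f])
  then show "loop_elt X k0 (k + s) \<in> {loop_elt X k0 k | X k. X \<in> gspace_wt D k0 k \<alpha>}" by blast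
qed

lemma real_root_nilpotent:
  assumes X: "X \<in> gspace_wt D k0 k \<alpha>" and \<alpha>: "\<alpha> \<in> dualH" "\<alpha> \<noteq> zero_wt" and f: "f \<in> Am D" and v: "v \<in> V0"
  shows "\<exists>r. (\<rho> (loop_mult D X k0 k f) ^^ r) v = 0"
proof -
  let ?x = "loop_mult D X k0 k f"
  have xL: "?x \<in> Lalg D" using X f by (intro loop_mult_L) (simp_all add: gspace_wt_eq)
  have "?x \<in> root_space D \<alpha> k0" by (rule loop_mult_root_space[OF X f])
  moreover have "\<phi> v \<in> mcar V" using v \<phi>_image by blast
  ultimately obtain r where r: "(mact V ?x ^^ r) (\<phi> v) = mzero V"
    using integrable \<alpha> unfolding integrable_module_def by blast
  have *: "(\<rho> ?x ^^ r) v \<in> V0 \<and> \<phi> ((\<rho> ?x ^^ r) v) = (mact V ?x ^^ r) (\<phi> v)" for r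
    by (induction r) (simp_all add: v \<rho>_V0[OF xL] \<phi>_\<rho>[OF xL])
  have "\<phi> ((\<rho> ?x ^^ r) v) = \<phi> 0" using * r \<phi>_zero by simp
  then have "(\<rho> ?x ^^ r) v = 0" using inj_onD[OF \<phi>_inj] * M.subspace_0[OF V0_subspace] by blast
  then show ?thesis by blast
qed

sublocale toroidal_module D sM "\<lambda>X k0 k. \<rho> (loop_elt X k0 k)" cK "\<rho> d0_elt" V0 N0
proof (rule toroidal_module.intro, rule lie_torus_data_axioms, rule M.complex_vector_space_axioms, rule toroidal_module_axioms.intro)
  show "M.endo (cK \<gamma>)" for \<gamma>
  proof (cases "\<forall>i. int (ord D (Some i)) dvd \<gamma> $ i")
    case True
    then have "cK \<gamma> = \<rho> (K_elt (Poly_Mapping.single \<gamma> 1))" by (auto simp: cK_def)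
    then show ?thesis using \<rho>_endo[OF K_single_L[OF True]] by simp
  next
    case False
    then have "cK \<gamma> = (\<lambda>_. 0)" by (intro ext) (simp only: cK_def if_False)
    then show ?thesis by (simp add: M.endo_iff)
  qed
  show "\<rho> (loop_elt (X + Y) k0 k) v = \<rho> (loop_elt X k0 k) v + \<rho> (loop_elt Y k0 k) v"
    if "X \<in> gspace D k0 k" "Y \<in> gspace D k0 k" for X Y k0 k v
    unfolding loop_add using that by (intro \<rho>_add loop_L)
  show "\<rho> (loop_elt (sc r X) k0 k) v = sM r (\<rho> (loop_elt X k0 k) v)" if "X \<in> gspace D k0 k" for X r k0 k v
    unfolding loop_scale using that by (intro \<rho>_scale loop_L)
  show "cK \<gamma> (cK \<gamma>' v) = cK \<gamma>' (cK \<gamma> v)"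
    if "\<forall>i. int (ord D (Some i)) dvd \<gamma> $ i" and g': "\<forall>i. int (ord D (Some i)) dvd \<gamma>' $ i" for \<gamma> \<gamma>' v
    using cK_central[OF K_single_L[OF g'], of \<gamma> 1 v] g' by (simp add: cK_def[of \<gamma>'])
  show "cK \<gamma> v \<in> V0" if "\<forall>i. int (ord D (Some i)) dvd \<gamma> $ i" for \<gamma> v
    using \<rho>_V0[OF K_single_L[OF that]] that by (simp add: cK_def)
  show "W = {0} \<or> W = V0"
    if "M.subspace W" "W \<subseteq> V0" "\<And>X k0 k v. X \<in> gspace D k0 k \<Longrightarrow> v \<in> W \<Longrightarrow> \<rho> (loop_elt X k0 k) v \<in> W"
      "\<And>\<gamma> v. \<forall>i. int (ord D (Some i)) dvd \<gamma> $ i \<Longrightarrow> v \<in> W \<Longrightarrow> cK \<gamma> v \<in> W" "\<And>v. v \<in> W \<Longrightarrow> \<rho> d0_elt v \<in> W" for W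
    using that(1,2) by (rule \<rho>_irr) (rule \<rho>_stable[OF that(1) that(3) that(4) that(5)])
  show "W = {0} \<or> W = N0"
    if "M.subspace W" "W \<subseteq> N0" "\<And>X k v. X \<in> gspace_wt D 0 k zero_wt \<Longrightarrow> v \<in> W \<Longrightarrow> \<rho> (loop_elt X 0 k) v \<in> W"
      "\<And>\<gamma> v. \<forall>i. int (ord D (Some i)) dvd \<gamma> $ i \<Longrightarrow> v \<in> W \<Longrightarrow> cK \<gamma> v \<in> W" "\<And>v. v \<in> W \<Longrightarrow> \<rho> d0_elt v \<in> W" for W
    using that(1,2) by (rule N0_irreducible) (rule \<rho>_zero_stable[OF that(1) that(3) that(4) that(5)])
  obtain ev where ev: "\<And>x n. x \<in> cartan_elements \<Longrightarrow> n \<in> N0 \<Longrightarrow> \<rho> x n = sM (ev x) n" by (rule N0_weight) (rule that)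
  show "\<exists>r. \<forall>n\<in>N0. \<rho> (loop_elt h 0 0) n = sM r n" if "h \<in> H" for h
  proof -
    have "loop_elt h 0 0 \<in> cartan_elements" using \<open>h \<in> H\<close> unfolding cartan_elements_def by blast
    then show ?thesis using ev by blast
  qed
  show "\<exists>r. \<forall>n\<in>N0. \<rho> d0_elt n = sM r n"
  proof -
    have "d0_elt \<in> cartan_elements" unfolding cartan_elements_def by blast
    then show ?thesis using ev by blast
  qed
  show "\<exists>r. ((\<lambda>v. \<Sum>s\<in>Poly_Mapping.keys f. sM (Poly_Mapping.lookup f s) (\<rho> (loop_elt X k0 (k + s)) v)) ^^ r) v = 0"
    if X: "X \<in> gspace_wt D k0 k \<alpha>" and a: "\<alpha> \<in> dualH" "\<alpha> \<noteq> zero_wt" and f: "f \<in> Am D" and v: "v \<in> V0" for X k0 k \<alpha> f v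
  proof -
    have "X \<in> gspace D k0 k" using X by (simp add: gspace_wt_eq)
    from \<rho>_loop_mult[OF this f] have "\<rho> (loop_mult D X k0 k f) =
        (\<lambda>v. \<Sum>s\<in>Poly_Mapping.keys f. sM (Poly_Mapping.lookup f s) (\<rho> (loop_elt X k0 (k + s)) v))" by (intro ext)
    then show ?thesis using real_root_nilpotent[OF X a f v] by simp
  qed
  show "\<rho> (loop_elt X k0 k) n = 0"
    if "X \<in> gspace_wt D k0 k \<alpha>" "\<alpha> \<in> dualH" "k0 > 0 \<or> k0 = 0 \<and> pos \<alpha>" "n \<in> N0" for X k0 k \<alpha> n
    using \<rho>_Lplus_j[OF loop_Lplus[OF that(1-3)]] that(4) by blast
  show "\<rho> (loop_elt X 0 k) n \<in> N0" if "X \<in> gspace_wt D 0 k zero_wt" "n \<in> N0" for X k n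
    by (rule N0_stable[OF loop_Lzero[OF that(1)] that(2)])
  show "\<exists>n\<in>N0. n \<noteq> 0" using j_nonzero by blast
  show "\<forall>i. int (ord D (Some i)) dvd (k + l) $ i"
    if "X \<in> gspace D k0 k" "Y \<in> gspace D (- k0) l" "form D X Y \<noteq> 0" for X Y k0 k l
    using closed_form_lattice[OF closed that] by blast
  show "\<rho> d0_elt (cK \<gamma> v) = cK \<gamma> (\<rho> d0_elt v)" for \<gamma> v by (rule cK_central[OF d_L, symmetric])
  show "N0 \<subseteq> V0" using j_V0 by blast
qed (rule \<rho>_endo[OF loop_L] \<rho>_endo[OF d_L] \<rho>_comm cK_central[OF loop_L] \<rho>_d V0_subspace
      \<rho>_V0[OF loop_L] \<rho>_V0[OF d_L] N0_subspace N0_fin cK_N0; assumption?)+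

section \<open>From ideals of A(m) to the toroidal algebra\<close>

lemma top_kills:
  assumes ideal: "ideal_of (Am D) I" and kN: "\<forall>x\<in>Lzero_ideal D I. \<forall>v\<in>mcar N. mact N x v = mzero N"
    and f: "f \<in> I" and n: "n \<in> N0"
  shows "kills_top f n"
proof -
  obtain n' where n': "n' \<in> mcar N" "n = j n'" using n by blast
  have I_Am: "g \<in> Am D" if "g \<in> I" for g using ideal that by (auto simp: ideal_of_def)
  have zero: "\<rho> x n = 0" if "x \<in> Lzero_ideal D I" "x \<in> Lzero D" for x
    using that kN n' j_zero by (simp add: \<rho>_Lzero_j)
  have "E X 0 k f n = 0" if X: "X \<in> gspace_wt D 0 k zero_wt" for X k
  proof -
    have "loop_mult D X 0 k f \<in> Lzero_ideal D I"
      unfolding Lzero_ideal_def using X f by (intro T.span_base) blast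
    moreover have "loop_mult D X 0 k f \<in> Lzero D" unfolding Lzero_def by (rule loop_mult_root_space[OF X I_Am[OF f]])
    ultimately have "\<rho> (loop_mult D X 0 k f) n = 0" by (rule zero)
    then show ?thesis using \<rho>_loop_mult[of X 0 k f n] X I_Am[OF f] by (simp add: E_def psum_def gspace_wt_eq)
  qed
  moreover have "Kf \<gamma> f n = 0" if g: "lat \<gamma>" for \<gamma>
  proof -
    \<comment> \<open>As an ideal, \<open>I\<close> contains t^\<gamma> f as well, and the central
      operator of this product is \<open>Kf \<gamma> f\<close>.\<close>
    let ?f = "Poly_Mapping.single \<gamma> 1 * f"
    have fI: "?f \<in> I" using ideal f g by (simp add: ideal_of_def Am_single)
    then have "K_elt ?f \<in> Lzero_ideal D I" unfolding Lzero_ideal_def by (intro T.span_base) blast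
    then have "\<rho> (K_elt ?f) n = 0" using zero[OF _ K_Lzero[OF I_Am[OF fI]]] by blast
    then have "psum ?f (\<lambda>s. cK s n) = 0" using \<rho>_K_elt[OF I_Am[OF fI], of n] by (simp add: psum_def)
    then show ?thesis by (simp add: psum_mult psum_single Kf_def)
  qed
  ultimately show ?thesis by (simp add: kills_top_def)
qed

lemma Lalg_ideal_kills:
  assumes kills: "\<And>f. f \<in> I' \<Longrightarrow> f \<in> Am D \<and> kills f" and x: "x \<in> Lalg_ideal D I'" and v: "v \<in> mcar V"
  shows "mact V x v = mzero V"
proof -
  let ?G = "{loop_mult D X k0 k f | X k0 k f. X \<in> gspace D k0 k \<and> f \<in> I'} \<union> {K_elt f | f. f \<in> I'}"
  obtain v' where v': "v' \<in> V0" "v = \<phi> v'" using v \<phi>_image by blast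
  have G: "?G \<subseteq> Lalg D" using kills loop_mult_L K_L by blast
  have xG: "x \<in> T.span ?G" using x by (simp add: Lalg_ideal_def)
  have xL: "x \<in> Lalg D" using T.span_minimal[OF G Lalg_subspace] xG by blast
  have l: "\<rho> (loop_mult D X k0 k f) v' = 0" if "X \<in> gspace D k0 k" "f \<in> I'" for X k0 k f
    using kills[OF that(2)] that(1) v'(1) \<rho>_loop_mult[OF that(1)] by (auto simp: kills_def E_def psum_def)
  have "\<rho> (K_elt f) v' = 0" if "f \<in> I'" for f
  proof -
    have "Kf 0 f v' = 0" using kills[OF that] v'(1) by (simp add: kills_def)
    then show ?thesis using kills[OF that] \<rho>_K_elt[of f v'] by (simp add: Kf_def psum_def)
  qed
  then have "\<rho> x v' \<in> {0}" using l by (intro \<rho>_span[OF xG G M.subspace_single_0]) auto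
  then show ?thesis using \<phi>_\<rho>[OF xL v'(1)] v'(2) \<phi>_zero by simp
qed

end

theorem proposition4p3:
  fixes D :: "('g::ab_group_add, 'n::finite) multiloop"
    and N :: "(('g, 'n) toroidal, 'w) lie_mod"
    and V :: "(('g, 'n) toroidal, (('g, 'n) toroidal, 'w) tensor_free set set) lie_mod"
    and q :: "'n \<Rightarrow> nat" and a :: "'n \<Rightarrow> nat \<Rightarrow> complex" and b :: "'n \<Rightarrow> nat \<Rightarrow> nat"
    and I I' :: "'n laurent set"
  assumes "lie_torus D"
    and "lie_module (tscale D) (tbracket D) (Lzero D) N"
    and "mfin_dim N (mcar N)"
    and "irreducible_module (Lzero D) N"
    and "irreducible_quotient (Lalg D) (MN D N) V"
    and "integrable_module D V"
    and "\<And>i. q i > 0"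
    and "\<And>i j. j \<in> {1..q i} \<Longrightarrow> b i j > 0"
    and "\<And>i j. j \<in> {1..q i} \<Longrightarrow> a i j \<noteq> 0"
    and "\<And>i j j'. j \<in> {1..q i} \<Longrightarrow> j' \<in> {1..q i} \<Longrightarrow> j \<noteq> j' \<Longrightarrow>
           a i j ^ ord D (Some i) \<noteq> a i j' ^ ord D (Some i)"
    and "I = ideal_generated (Am D) (range (\<lambda>i. laurent_prod D i (q i) (a i) (b i)))"
    and "\<forall>x\<in>Lzero_ideal D I. \<forall>v\<in>mcar N. mact N x v = mzero N"
    and "I' = ideal_generated (Am D) (range (\<lambda>i. laurent_prod D i (q i) (a i) (\<lambda>_. 1)))"
  shows "\<forall>x\<in>Lalg_ideal D I'. \<forall>v\<in>mcar V. mact V x v = mzero V"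
proof -
  interpret lie_torus_data D by unfold_locales (rule assms(1))
  interpret T: complex_vector_space "tscale D"
    by (simp add: complex_vector_space_def vector_space_tscale)
  let ?N = "extend_by_zero D N"
  have V: "irreducible_quotient (Lalg D) (induced_module (tscale D) (tbracket D) (Lalg D) (Lborel D) ?N) V"
    using assms(5) by (simp add: MN_def)
  \<comment> \<open>The existence of an irreducible quotient rules out the degenerate case in which
    \<open>Lalg D\<close> is not closed.\<close>
  have closed: "tbracket D x y \<in> Lalg D" if "x \<in> Lalg D" "y \<in> Lalg D" for x y
    using induced_module_degenerate[OF that] V by blast
  have N': "mcar ?N = mcar N" "madd ?N = madd N" "mscale ?N = mscale N" "mzero ?N = mzero N"
    by (simp_all add: extend_by_zero_def)
  have act: "mact ?N x n \<in> mcar N" if x: "x \<in> Lborel D" and n: "n \<in> mcar N" for x n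
  proof -
    obtain y z where "x = y + z" "y \<in> Lplus D" "z \<in> Lzero D" using x unfolding Lborel_def by blast
    then show ?thesis using lie_module_facts(2)[OF assms(2), of z n] n by (simp add: borel_component)
  qed
  interpret U: induced_setup "tscale D" "tbracket D" "Lalg D" "Lborel D" ?N
  proof
    show "complex_space ?N" using lie_module_facts(1)[OF assms(2)] unfolding complex_space_def N' .
  qed (use closed Lborel_Lalg act in \<open>auto simp: N' T.subspace_add[OF Lalg_subspace] T.subspace_scale[OF Lalg_subspace]\<close>)
  obtain V0 :: "((('g, 'n) toroidal, 'w) tensor_free) set" and \<rho> \<phi> j
    where m: "highest_weight_quotient D (pscale (*)) N V V0 \<rho> \<phi> j"
  proof (rule U.typed_irreducible_quotient[OF V])
    fix V0 :: "((('g, 'n) toroidal, 'w) tensor_free) set" and \<rho> \<phi> j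
    assume typed: "free_vs.subspace V0"
    "\<And>l. l \<in> Lalg D \<Longrightarrow> free_vs.endo (\<rho> l)" "\<And>l v. l \<in> Lalg D \<Longrightarrow> \<rho> l v \<in> V0"
    "\<And>x y v. x \<in> Lalg D \<Longrightarrow> y \<in> Lalg D \<Longrightarrow> \<rho> (x + y) v = \<rho> x v + \<rho> y v"
    "\<And>c x v. x \<in> Lalg D \<Longrightarrow> \<rho> (tscale D c x) v = pscale (*) c (\<rho> x v)"
    "\<And>x y v. x \<in> Lalg D \<Longrightarrow> y \<in> Lalg D \<Longrightarrow> \<rho> (tbracket D x y) v = \<rho> x (\<rho> y v) - \<rho> y (\<rho> x v)"
    "\<And>W. free_vs.subspace W \<Longrightarrow> W \<subseteq> V0 \<Longrightarrow> (\<And>l w. l \<in> Lalg D \<Longrightarrow> w \<in> W \<Longrightarrow> \<rho> l w \<in> W) \<Longrightarrow> W = {0} \<or> W = V0"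
    "\<And>n. n \<in> mcar ?N \<Longrightarrow> j n \<in> V0"
    "\<And>n n'. n \<in> mcar ?N \<Longrightarrow> n' \<in> mcar ?N \<Longrightarrow> j (madd ?N n n') = j n + j n'"
    "\<And>c n. n \<in> mcar ?N \<Longrightarrow> j (mscale ?N c n) = pscale (*) c (j n)"
    "\<And>b n. b \<in> Lborel D \<Longrightarrow> n \<in> mcar ?N \<Longrightarrow> \<rho> b (j n) = j (mact ?N b n)"
    "\<exists>n\<in>mcar ?N. j n \<noteq> 0"
    "inj_on \<phi> V0" "\<phi> ` V0 = mcar V" "\<And>u v. u \<in> V0 \<Longrightarrow> v \<in> V0 \<Longrightarrow> \<phi> (u + v) = madd V (\<phi> u) (\<phi> v)"
    "\<And>c v. v \<in> V0 \<Longrightarrow> \<phi> (pscale (*) c v) = mscale V c (\<phi> v)" "\<phi> 0 = mzero V"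
    "\<And>l v. l \<in> Lalg D \<Longrightarrow> v \<in> V0 \<Longrightarrow> \<phi> (\<rho> l v) = mact V l (\<phi> v)"
    show thesis
      by (rule that[of V0 \<rho> \<phi> j], intro highest_weight_quotient.intro highest_weight_quotient_axioms.intro
            lie_torus_data_axioms free_vs.complex_vector_space_axioms)
        (rule closed typed[unfolded N'] assms(2,3,4,6); assumption?)+
  qed
  interpret highest_weight_quotient D "pscale (*)" N V V0 \<rho> \<phi> j by (rule m)
  have P: "laurent_prod D i (q i) (a i) (b i) \<in> I" for i
    unfolding assms(11) ideal_generated_def by blast
  have ideal: "ideal_of (Am D) I"
  proof -
    have "ideal_of (Am D) (Am D)" by (simp add: ideal_of_def Am_zero Am_add Am_mult)
    then have "I \<subseteq> Am D" using laurent_prod_Am unfolding assms(11) ideal_generated_def by blast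
    then show ?thesis unfolding ideal_of_def assms(11) ideal_generated_def by auto
  qed
  have "f \<in> Am D \<and> kills f" if "f \<in> range (\<lambda>i. laurent_prod D i (q i) (a i) (\<lambda>_. 1))" for f
    using that radical_kills[OF top_kills[OF ideal assms(12) P]] laurent_prod_Am by blast
  then have "f \<in> Am D \<and> kills f" if "f \<in> I'" for f
    using ideal_kills[of "range (\<lambda>i. laurent_prod D i (q i) (a i) (\<lambda>_. 1))" f] that unfolding assms(13) by blast
  then show ?thesis using Lalg_ideal_kills by blast
qed

end
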